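(* Let $u^\epsilon\in H^1(\Omega^\epsilon)$ be the solution of $$-\Delta u^\epsilon=0\ \text{in }\Omega^\epsilon,\quad u^\epsilon=\overline U\ \text{on }\Gamma^1,\quad u^\epsilon=0\ \text{on }\Gamma^\epsilon,\quad \frac{\partial u^\epsilon}{\partial n}=0\ \text{on }\Gamma_{\rm in}\cup\Gamma_{\rm out},$$ and let $u^1$ be the first order wall law, i.e. the solution of $$\Delta u^1=0\ \text{in }\Omega^0,\quad u^1=\overline U\ \text{on }\Gamma^1,\quad u^1=\epsilon\,\overline\beta\,\frac{\partial u^1}{\partial x_2}\ \text{on }\Gamma^0,\quad \frac{\partial u^1}{\partial n}=0\ \text{on }\Gamma_{\rm in}'\cup\Gamma_{\rm out}'.$$ Then $$\|u^\epsilon-u^1\|_{L^2(\Omega^0)}\le k\,\epsilon^{3/2},$$ where the constant $k$ is independent of $\epsilon$.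
   Context: $f:\mathbb R\to\mathbb R$ is Lipschitz continuous, $1$-periodic, bounded and negative: there is $\delta>0$ with $-1+\delta<f(y_1)<-\delta$ for all $y_1$. For $\epsilon\in(0,1]$, $\Omega^\epsilon=\{x\in\mathbb R^2:x_1\in(0,1),\ \epsilon f(x_1/\epsilon)<x_2<1\}$; $\Gamma^\epsilon$ is its rough bottom $\{x_1\in(0,1),\ x_2=\epsilon f(x_1/\epsilon)\}$, $\Gamma^1=(0,1)\times\{1\}$, and $\Gamma_{\rm in},\Gamma_{\rm out}$ are its vertical sides on $x_1=0$ and $x_1=1$. $\Omega^0=(0,1)^2$, with bottom $\Gamma^0=(0,1)\times\{0\}$ and vertical sides $\Gamma'_{\rm in}=\{0\}\times(0,1)$, $\Gamma'_{\rm out}=\{1\}\times(0,1)$. $\overline U$ is a given real constant and $\partial/\partial n$ the outward normal derivative. $\beta$ is the unique $y_1$-periodic (period 1) function with finite Dirichlet norm on the cell $\{y:y_1\in(0,1),\ y_2>f(y_1)\}$ that is harmonic there and equals $-y_2$ on $\{y_1\in(0,1),\ y_2=f(y_1)\}$, and $\overline\beta=\int_0^1\beta(y_1,0)\,dy_1$. *)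

theory Defs
  imports "HOL-Analysis.Analysis"
begin

section \<open>Functions of two real variables\<close>

definition grad :: "(real \<times> real \<Rightarrow> real) \<Rightarrow> real \<times> real \<Rightarrow> real \<times> real" where
  "grad u x = (frechet_derivative u (at x) (1, 0), frechet_derivative u (at x) (0, 1))"

definition laplacian :: "(real \<times> real \<Rightarrow> real) \<Rightarrow> real \<times> real \<Rightarrow> real" where
  "laplacian u x = fst (grad (\<lambda>y. fst (grad u y)) x) + snd (grad (\<lambda>y. snd (grad u y)) x)"

text \<open>The next three notions are meant for open sets, on which the derivative relative to
  the set and the one used in \<^const>\<open>grad\<close> agree.\<close>

definition C1_on :: "(real \<times> real) set \<Rightarrow> (real \<times> real \<Rightarrow> real) \<Rightarrow> bool" where
  "C1_on S u \<longleftrightarrow> u differentiable_on S \<and> continuous_on S (grad u)"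

definition C2_on :: "(real \<times> real) set \<Rightarrow> (real \<times> real \<Rightarrow> real) \<Rightarrow> bool" where
  "C2_on S u \<longleftrightarrow>
     C1_on S u \<and> C1_on S (\<lambda>y. fst (grad u y)) \<and> C1_on S (\<lambda>y. snd (grad u y))"

definition harmonic_on :: "(real \<times> real) set \<Rightarrow> (real \<times> real \<Rightarrow> real) \<Rightarrow> bool" where
  "harmonic_on S u \<longleftrightarrow> C2_on S u \<and> (\<forall>x\<in>S. laplacian u x = 0)"

section \<open>Square integrable functions, weak gradients and traces\<close>

text \<open>Functions are total; only their values on the domain in question matter, and elements of
  \<open>L\<^sup>2\<close> are given by Borel representatives.\<close>

definition L2 :: "'a::euclidean_space set \<Rightarrow> ('a \<Rightarrow> 'b::euclidean_space) \<Rightarrow> bool" where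
  "L2 S u \<longleftrightarrow>
     set_borel_measurable lborel S u \<and> set_integrable lborel S (\<lambda>x. (norm (u x))\<^sup>2)"

definition L2_norm :: "'a::euclidean_space set \<Rightarrow> ('a \<Rightarrow> 'b::euclidean_space) \<Rightarrow> real" where
  "L2_norm S u = sqrt (LINT x:S|lborel. (norm (u x))\<^sup>2)"

definition tendsto_L2 ::
    "'a::euclidean_space set \<Rightarrow> (nat \<Rightarrow> 'a \<Rightarrow> 'b::euclidean_space) \<Rightarrow> ('a \<Rightarrow> 'b) \<Rightarrow> bool" where
  "tendsto_L2 S w u \<longleftrightarrow>
     (\<forall>n. L2 S (w n)) \<and> L2 S u \<and> (\<lambda>n. L2_norm S (\<lambda>x. w n x - u x)) \<longlonglongrightarrow> 0"

text \<open>Testing with \<open>C\<^sup>1\<close> instead of \<open>C\<^sup>\<infinity>\<close> functions of compact support gives the same notion, by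
  mollification.\<close>

definition test_function :: "(real \<times> real) set \<Rightarrow> (real \<times> real \<Rightarrow> real) \<Rightarrow> bool" where
  "test_function \<Omega> \<phi> \<longleftrightarrow>
     C1_on UNIV \<phi> \<and> compact (closure {x. \<phi> x \<noteq> 0}) \<and> closure {x. \<phi> x \<noteq> 0} \<subseteq> \<Omega>"

definition weak_gradient ::
    "(real \<times> real) set \<Rightarrow> (real \<times> real \<Rightarrow> real) \<Rightarrow> (real \<times> real \<Rightarrow> real \<times> real) \<Rightarrow> bool" where
  "weak_gradient \<Omega> u g \<longleftrightarrow>
     (\<forall>\<phi>. test_function \<Omega> \<phi> \<longrightarrow>
        (LINT x:\<Omega>|lborel. u x *\<^sub>R grad \<phi> x) = - (LINT x:\<Omega>|lborel. \<phi> x *\<^sub>R g x))"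

text \<open>\<open>u \<in> H\<^sup>1(\<Omega>)\<close> with \<open>\<nabla>u = g\<close>.\<close>

definition H1_grad ::
    "(real \<times> real) set \<Rightarrow> (real \<times> real \<Rightarrow> real) \<Rightarrow> (real \<times> real \<Rightarrow> real \<times> real) \<Rightarrow> bool" where
  "H1_grad \<Omega> u g \<longleftrightarrow> L2 \<Omega> u \<and> L2 \<Omega> g \<and> weak_gradient \<Omega> u g"

text \<open>\<open>u \<in> H\<^sup>1(\<Omega>)\<close> has trace \<open>h\<close> on the boundary piece \<open>{(s, b s) | 0 < s < 1}\<close>: the trace operator
  is the continuous extension from \<open>H\<^sup>1(\<Omega>)\<close> to \<open>L\<^sup>2\<close> of the boundary piece of the restriction map
  on functions that are \<open>C\<^sup>1\<close> up to the boundary (these are dense, \<open>\<Omega>\<close> being a bounded Lipschitz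
  domain). The piece is parametrised by its abscissa; as \<open>b\<close> is Lipschitz, arc length gives the
  same space \<open>L\<^sup>2\<close> with an equivalent norm.\<close>

definition has_trace ::
    "(real \<times> real) set \<Rightarrow> (real \<Rightarrow> real) \<Rightarrow> (real \<times> real \<Rightarrow> real) \<Rightarrow> (real \<Rightarrow> real) \<Rightarrow> bool" where
  "has_trace \<Omega> b u h \<longleftrightarrow>
     (\<exists>g \<phi>. H1_grad \<Omega> u g \<and> (\<forall>n. C1_on UNIV (\<phi> n)) \<and>
        tendsto_L2 \<Omega> \<phi> u \<and> tendsto_L2 \<Omega> (\<lambda>n. grad (\<phi> n)) g \<and>
        tendsto_L2 {0<..<1} (\<lambda>n s. \<phi> n (s, b s)) h)"

section \<open>The rough problem\<close>

definition rough_bottom :: "(real \<Rightarrow> real) \<Rightarrow> real \<Rightarrow> real \<Rightarrow> real" where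
  "rough_bottom f \<epsilon> s = \<epsilon> * f (s / \<epsilon>)"

definition rough_domain :: "(real \<Rightarrow> real) \<Rightarrow> real \<Rightarrow> (real \<times> real) set" where
  "rough_domain f \<epsilon> = {(x1, x2). 0 < x1 \<and> x1 < 1 \<and> rough_bottom f \<epsilon> x1 < x2 \<and> x2 < 1}"

text \<open>Weak formulation: the Dirichlet conditions hold in the sense of traces, while
  \<open>-\<Delta>u = 0\<close> and the homogeneous Neumann condition on the vertical sides are expressed by
  Green's formula against all \<open>H\<^sup>1\<close> functions vanishing on the Dirichlet part.\<close>

definition rough_solution :: "(real \<Rightarrow> real) \<Rightarrow> real \<Rightarrow> real \<Rightarrow> (real \<times> real \<Rightarrow> real) \<Rightarrow> bool" where
  "rough_solution f U \<epsilon> u \<longleftrightarrow>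
     has_trace (rough_domain f \<epsilon>) (\<lambda>_. 1) u (\<lambda>_. U) \<and>
     has_trace (rough_domain f \<epsilon>) (rough_bottom f \<epsilon>) u (\<lambda>_. 0) \<and>
     (\<exists>g. H1_grad (rough_domain f \<epsilon>) u g \<and>
       (\<forall>v h. H1_grad (rough_domain f \<epsilon>) v h \<and>
          has_trace (rough_domain f \<epsilon>) (\<lambda>_. 1) v (\<lambda>_. 0) \<and>
          has_trace (rough_domain f \<epsilon>) (rough_bottom f \<epsilon>) v (\<lambda>_. 0) \<longrightarrow>
          (LINT x:rough_domain f \<epsilon>|lborel. g x \<bullet> h x) = 0))"

section \<open>The cell problem\<close>

text \<open>The periodic extension of the cell. Harmonicity of the periodic function is required on all
  of it, i.e. also across the vertical lines bounding the cell; without this the cell problem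
  would not have a unique solution.\<close>

definition cell_strip :: "(real \<Rightarrow> real) \<Rightarrow> (real \<times> real) set" where
  "cell_strip f = {(y1, y2). f y1 < y2}"

definition cell :: "(real \<Rightarrow> real) \<Rightarrow> (real \<times> real) set" where
  "cell f = {(y1, y2). 0 < y1 \<and> y1 < 1 \<and> f y1 < y2}"

text \<open>Traces being local, the boundary condition is expressed on the bounded part of the cell
  below height \<open>1\<close>.\<close>

definition cell_solution :: "(real \<Rightarrow> real) \<Rightarrow> (real \<times> real \<Rightarrow> real) \<Rightarrow> bool" where
  "cell_solution f \<beta> \<longleftrightarrow>
     (\<forall>y1 y2. f y1 < y2 \<longrightarrow> \<beta> (y1 + 1, y2) = \<beta> (y1, y2)) \<and>
     harmonic_on (cell_strip f) \<beta> \<and>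
     L2 (cell f) (grad \<beta>) \<and>
     has_trace (cell f \<inter> {y. snd y < 1}) f \<beta> (\<lambda>y1. - f y1)"

definition beta_bar :: "(real \<times> real \<Rightarrow> real) \<Rightarrow> real" where
  "beta_bar \<beta> = (LINT y1:{0<..<1}|lborel. \<beta> (y1, 0))"

section \<open>The first order wall law\<close>

definition smooth_domain :: "(real \<times> real) set" where
  "smooth_domain = {0<..<1} \<times> {0<..<1}"

text \<open>Weak formulation with the wall law coefficient \<open>b\<close>. The function \<open>q\<close> is
  \<open>\<partial>u/\<partial>x\<^sub>2\<close> on the bottom \<open>x\<^sub>2 = 0\<close>: there the outward normal derivative is \<open>-\<partial>u/\<partial>x\<^sub>2\<close>, so Green's
  formula for a harmonic \<open>u\<close> with vanishing normal derivative on the vertical sides reads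
  \<open>\<integral> \<nabla>u \<cdot> \<nabla>v = - \<integral> q v\<close> for all \<open>v \<in> H\<^sup>1\<close> vanishing on the top (the last integral being over
  the bottom).\<close>

definition wall_law_solution :: "real \<Rightarrow> real \<Rightarrow> real \<Rightarrow> (real \<times> real \<Rightarrow> real) \<Rightarrow> bool" where
  "wall_law_solution b U \<epsilon> u \<longleftrightarrow>
     has_trace smooth_domain (\<lambda>_. 1) u (\<lambda>_. U) \<and>
     (\<exists>g q. H1_grad smooth_domain u g \<and> L2 {0<..<1} q \<and>
       has_trace smooth_domain (\<lambda>_. 0) u (\<lambda>s. \<epsilon> * b * q s) \<and>
       (\<forall>v h t. H1_grad smooth_domain v h \<and>
          has_trace smooth_domain (\<lambda>_. 1) v (\<lambda>_. 0) \<and>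
          has_trace smooth_domain (\<lambda>_. 0) v t \<longrightarrow>
          (LINT x:smooth_domain|lborel. g x \<bullet> h x) = - (LINT s:{0<..<1}|lborel. q s * t s)))"

end

theory Submission imports Defs
begin

text \<open>Write \<open>B x = \<epsilon> \<beta>(x/\<epsilon>)\<close>, \<open>c = U / (1 + \<epsilon> B\<^sub>0)\<close> with \<open>B\<^sub>0\<close> the mean of \<open>\<beta>\<close>, and let \<open>\<zeta>\<close> be a smooth
  step from \<open>1\<close> at \<open>x\<^sub>2 \<le> 0\<close> to \<open>0\<close>. The solution of the wall law is the affine function \<open>c (x\<^sub>2 + \<epsilon> B\<^sub>0)\<close>; here
  \<open>B\<^sub>0 \<ge> 0\<close>, by the energy identity for \<open>\<beta> + y\<^sub>2\<close>. Compare \<open>u\<close> with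
  \<open>c (x\<^sub>2 + \<epsilon> B\<^sub>0 + \<zeta>(x\<^sub>2) (B - \<epsilon> B\<^sub>0))\<close>, which has the same traces on top and bottom.

  On horizontal lines, \<open>J = \<integral> \<beta> \<partial>\<^sub>2\<beta>\<close> satisfies \<open>J' = E = \<integral> |\<nabla>\<beta>|\<^sup>2\<close> and \<open>2 |J| \<le> E\<close> by Poincare's
  inequality, so that \<open>J\<close>, hence \<open>\<nabla>\<beta>\<close> and \<open>\<beta> - B\<^sub>0\<close>, decay exponentially. The corrector violates the Neumann
  condition only at the two lateral cells, whose area is of order \<open>\<epsilon>\<^sup>2\<close>. Together with the Hardy inequality
  for functions vanishing on the rough bottom this bounds the gradient of the error \<open>w\<close> by a multiple of \<open>\<epsilon>\<close>.
  The \<open>L\<^sup>2\<close> bound comes from the test function \<open>\<theta>(x\<^sub>2) w\<close> with \<open>\<theta>(t) = t\<^sup>2 (1 / sqrt (t\<^sup>2 + \<epsilon>\<^sup>2) - 1 / 2)\<close>: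
  it is of order \<open>\<epsilon>\<close> where the corrector lives, and \<open>\<theta>''\<close> is close to \<open>-1\<close> away from the bottom.\<close>

section \<open>Square integrable functions\<close>

text \<open>Two difficulties shape the proof. Nothing is known about the regularity of \<beta> or of
  the solutions at the bottom: boundary values exist only as L2 limits of restrictions of C1
  functions. So estimates near the graph are made for approximants and passed to the limit, and a
  zero trace is exploited in the form that the L2 norm over a layer of thickness r is o(r), a
  property that survives scaling and periodic repetition. Moreover \<epsilon> need not be the
  inverse of an integer, nor the lateral derivative of \<beta> vanish on the sides of a cell, so the
  corrector has a true defect of order \<epsilon> in energy; the multiplier \<theta> plays the part
  of a regular adjoint solution. For this the decay of the corrector is spent as a weight
  \<open>wt ^ 3\<close>: two powers are returned by the Hardy inequality for the error, the third by
  \<theta> \<le> \<epsilon> wt. Tested with \<theta> w, the defect is \<epsilon>^2 times the energy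
  norm of the error, which is itself of order \<epsilon>; this gives \<epsilon>^3 for the square of
  the L2 norm.\<close>

lemma Cauchy_Schwarz_integral:
  fixes f g :: "'a \<Rightarrow> real"
  assumes [measurable]: "f \<in> borel_measurable M" "g \<in> borel_measurable M"
    and f2: "integrable M (\<lambda>x. (f x)\<^sup>2)" and g2: "integrable M (\<lambda>x. (g x)\<^sup>2)"
  shows "integrable M (\<lambda>x. f x * g x)"
    and "\<bar>\<integral>x. f x * g x \<partial>M\<bar> \<le> sqrt (\<integral>x. (f x)\<^sup>2 \<partial>M) * sqrt (\<integral>x. (g x)\<^sup>2 \<partial>M)"
proof -
  have ineq: "\<bar>a * b\<bar> \<le> a\<^sup>2 + b\<^sup>2" for a b :: real
    using sum_squares_bound[of "\<bar>a\<bar>" "\<bar>b\<bar>"] mult_nonneg_nonneg[OF abs_ge_zero abs_ge_zero, of a b]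
    unfolding abs_mult power2_abs by linarith
  show int: "integrable M (\<lambda>x. f x * g x)"
    by (rule Bochner_Integration.integrable_bound[OF Bochner_Integration.integrable_add[OF f2 g2]])
       (use ineq in \<open>auto intro!: AE_I2\<close>)
  define A B C where "A = (\<integral>x. (f x)\<^sup>2 \<partial>M)" and "B = (\<integral>x. f x * g x \<partial>M)" and "C = (\<integral>x. (g x)\<^sup>2 \<partial>M)"
  have pos: "0 \<le> A - 2 * t * B + t\<^sup>2 * C" for t
  proof -
    have "0 \<le> (\<integral>x. (f x - t * g x)\<^sup>2 \<partial>M)" by simp
    also have "\<dots> = (\<integral>x. (f x)\<^sup>2 - (2 * t) * (f x * g x) + t\<^sup>2 * (g x)\<^sup>2 \<partial>M)"
      by (intro Bochner_Integration.integral_cong) (auto simp: power2_eq_square algebra_simps)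
    also have "\<dots> = A - 2 * t * B + t\<^sup>2 * C"
      unfolding A_def B_def C_def using int f2 g2 by simp
    finally show ?thesis .
  qed
  have AC: "0 \<le> A" "0 \<le> C" unfolding A_def C_def by simp_all
  have "B\<^sup>2 \<le> A * C"
  proof (cases "C = 0")
    case True
    have "B = 0"
    proof (rule ccontr)
      assume "B \<noteq> 0"
      \<comment> \<open>For \<open>C = 0\<close> the quadratic is affine in \<open>t\<close>, and at
        this \<open>t\<close> it equals -1.\<close>
      with pos[of "(A + 1) / (2 * B)"] True show False by (simp add: field_simps)
    qed
    with AC show ?thesis by simp
  next
    case False
    with AC have "C > 0" by simp
    with pos[of "B / C"] show ?thesis by (simp add: field_simps power2_eq_square)
  qed
  then have "sqrt (B\<^sup>2) \<le> sqrt (A * C)" by (rule real_sqrt_le_mono)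
  then show "\<bar>\<integral>x. f x * g x \<partial>M\<bar> \<le> sqrt (\<integral>x. (f x)\<^sup>2 \<partial>M) * sqrt (\<integral>x. (g x)\<^sup>2 \<partial>M)"
    unfolding A_def B_def C_def by (simp add: real_sqrt_mult)
qed

abbreviation lebesgue_restr :: "'a::euclidean_space set \<Rightarrow> 'a measure" where
  "lebesgue_restr S \<equiv> restrict_space lborel S"

text \<open>Set integrals become plain integrals over the restricted measure, so that the rules for
  integrals over a measure space apply without carrying indicators along.\<close>

lemma set_lint_restr:
  fixes f :: "'a::euclidean_space \<Rightarrow> 'b::euclidean_space"
  assumes "S \<in> sets borel"
  shows "(LINT x:S|lborel. f x) = (\<integral>x. f x \<partial>lebesgue_restr S)"
    and "set_integrable lborel S f \<longleftrightarrow> integrable (lebesgue_restr S) f"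
    and "set_borel_measurable lborel S f \<longleftrightarrow> f \<in> borel_measurable (lebesgue_restr S)"
  using assms
  by (simp_all add: set_lebesgue_integral_def set_integrable_def set_borel_measurable_def
      integral_restrict_space integrable_restrict_space borel_measurable_restrict_space_iff)

lemma borel_measurable_restr:
  fixes f :: "'a::euclidean_space \<Rightarrow> 'b::euclidean_space"
  assumes "f \<in> borel_measurable borel"
  shows "f \<in> borel_measurable (lebesgue_restr S)"
  using assms by (metis measurable_lborel2 measurable_restrict_space1)

lemma L2_iff:
  assumes "S \<in> sets borel"
  shows "L2 S u \<longleftrightarrow> u \<in> borel_measurable (lebesgue_restr S) \<and>
    integrable (lebesgue_restr S) (\<lambda>x. (norm (u x))\<^sup>2)"
  using assms by (simp add: L2_def set_lint_restr)

lemma L2_norm_power2: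
  assumes "S \<in> sets borel"
  shows "(L2_norm S u)\<^sup>2 = (\<integral>x. (norm (u x))\<^sup>2 \<partial>lebesgue_restr S)"
  using assms by (simp add: L2_norm_def set_lint_restr)

lemma L2_norm_nonneg [simp]: "0 \<le> L2_norm S u"
  by (simp add: L2_norm_def set_lebesgue_integral_def)

lemma L2_measurable: "S \<in> sets borel \<Longrightarrow> L2 S u \<Longrightarrow> u \<in> borel_measurable (lebesgue_restr S)"
  by (simp add: L2_iff)

text \<open>Nonnegative integrals can be bounded before anything is known to be integrable. Square
  integrability and the norm bound then come out of a single estimate, usually obtained by Tonelli's
  theorem or a change of variables.\<close>

lemma L2_I_nn:
  fixes u :: "'a::euclidean_space \<Rightarrow> 'b::euclidean_space"
  assumes S: "S \<in> sets borel" and m: "u \<in> borel_measurable (lebesgue_restr S)"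
    and le: "(\<integral>\<^sup>+x. ennreal ((norm (u x))\<^sup>2) * indicator S x \<partial>lborel) \<le> ennreal c" and "0 \<le> c"
  shows "L2 S u" and "(L2_norm S u)\<^sup>2 \<le> c"
proof -
  have *: "(\<integral>\<^sup>+x. ennreal ((norm (u x))\<^sup>2) \<partial>lebesgue_restr S) \<le> ennreal c"
    using le S by (simp add: nn_integral_restrict_space)
  then have int: "integrable (lebesgue_restr S) (\<lambda>x. (norm (u x))\<^sup>2)"
    using m by (intro integrableI_bounded) (auto simp: less_top[symmetric] top_unique)
  then show "L2 S u" using m S by (simp add: L2_iff)
  have "ennreal (\<integral>x. (norm (u x))\<^sup>2 \<partial>lebesgue_restr S) \<le> ennreal c"
    using * int by (subst nn_integral_eq_integral[symmetric]) auto
  then show "(L2_norm S u)\<^sup>2 \<le> c"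
    using S \<open>0 \<le> c\<close> by (simp add: L2_norm_power2)
qed

lemma L2_nn:
  fixes u :: "'a::euclidean_space \<Rightarrow> 'b::euclidean_space"
  assumes S: "S \<in> sets borel" and "L2 S u"
  shows "(\<integral>\<^sup>+x. ennreal ((norm (u x))\<^sup>2) * indicator S x \<partial>lborel) = ennreal ((L2_norm S u)\<^sup>2)"
proof -
  have "(\<integral>\<^sup>+x. ennreal ((norm (u x))\<^sup>2) * indicator S x \<partial>lborel) =
     (\<integral>\<^sup>+x. ennreal ((norm (u x))\<^sup>2) \<partial>lebesgue_restr S)"
    using S by (simp add: nn_integral_restrict_space)
  also have "\<dots> = ennreal (\<integral>x. (norm (u x))\<^sup>2 \<partial>lebesgue_restr S)"
    using assms by (intro nn_integral_eq_integral) (auto simp: L2_iff)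
  finally show ?thesis using S by (simp add: L2_norm_power2)
qed

lemma L2_bound:
  fixes u :: "'a::euclidean_space \<Rightarrow> 'b::euclidean_space" and v :: "'a \<Rightarrow> 'c::euclidean_space"
  assumes S: "S \<in> sets borel" and m: "u \<in> borel_measurable (lebesgue_restr S)"
    and v: "L2 S v" and le: "\<And>x. x \<in> S \<Longrightarrow> norm (u x) \<le> C * norm (v x)" and "0 \<le> C"
  shows "L2 S u" and "L2_norm S u \<le> C * L2_norm S v"
proof -
  have ae: "AE x in lebesgue_restr S. (norm (u x))\<^sup>2 \<le> C\<^sup>2 * (norm (v x))\<^sup>2"
    using S le by (intro AE_I2) (auto simp: space_restrict_space power_mult_distrib[symmetric] intro!: power_mono)
  have iv: "integrable (lebesgue_restr S) (\<lambda>x. C\<^sup>2 * (norm (v x))\<^sup>2)"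
    using v S by (simp add: L2_iff)
  have iu: "integrable (lebesgue_restr S) (\<lambda>x. (norm (u x))\<^sup>2)"
    by (rule Bochner_Integration.integrable_bound[OF iv]) (use m ae in auto)
  then show "L2 S u" using m S by (simp add: L2_iff)
  have "(\<integral>x. (norm (u x))\<^sup>2 \<partial>lebesgue_restr S) \<le> (\<integral>x. C\<^sup>2 * (norm (v x))\<^sup>2 \<partial>lebesgue_restr S)"
    by (rule integral_mono_AE[OF iu iv ae])
  then have "(L2_norm S u)\<^sup>2 \<le> (C * L2_norm S v)\<^sup>2"
    using S by (simp add: L2_norm_power2 power_mult_distrib)
  then show "L2_norm S u \<le> C * L2_norm S v"
    by (rule power2_le_imp_le) (use \<open>0 \<le> C\<close> in simp)
qed

text \<open>Only a pointwise bound by the product of the norms is asked of \<open>F\<close>, so that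
  inner products, scalar multiples and products with bounded factors are covered at once.\<close>

lemma L2_product:
  fixes u :: "'a::euclidean_space \<Rightarrow> 'b::euclidean_space" and v :: "'a \<Rightarrow> 'c::euclidean_space"
    and F :: "'a \<Rightarrow> 'd::euclidean_space"
  assumes S: "S \<in> sets borel" and u: "L2 S u" and v: "L2 S v"
    and m: "F \<in> borel_measurable (lebesgue_restr S)"
    and le: "\<And>x. x \<in> S \<Longrightarrow> norm (F x) \<le> C * (norm (u x) * norm (v x))" and "0 \<le> C"
  shows "integrable (lebesgue_restr S) F"
    and "norm (\<integral>x. F x \<partial>lebesgue_restr S) \<le> C * (L2_norm S u * L2_norm S v)"
proof -
  have mu: "(\<lambda>x. norm (u x)) \<in> borel_measurable (lebesgue_restr S)"
   and mv: "(\<lambda>x. norm (v x)) \<in> borel_measurable (lebesgue_restr S)"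
    using u v S by (auto simp: L2_iff)
  note cs = Cauchy_Schwarz_integral[OF mu mv]
  have i: "integrable (lebesgue_restr S) (\<lambda>x. norm (u x) * norm (v x))"
    using cs(1) u v S by (simp add: L2_iff)
  have iC: "integrable (lebesgue_restr S) (\<lambda>x. C * (norm (u x) * norm (v x)))"
    using i by simp
  have ae: "AE x in lebesgue_restr S. norm (F x) \<le> C * (norm (u x) * norm (v x))"
    using le S by (intro AE_I2) (auto simp: space_restrict_space)
  show "integrable (lebesgue_restr S) F"
    by (rule Bochner_Integration.integrable_bound[OF iC m]) (use ae in eventually_elim, use \<open>0 \<le> C\<close> in simp)
  have "norm (\<integral>x. F x \<partial>lebesgue_restr S) \<le> (\<integral>x. C * (norm (u x) * norm (v x)) \<partial>lebesgue_restr S)"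
    by (rule Bochner_Integration.integral_norm_bound_integral[OF \<open>integrable _ F\<close> iC])
       (use le S in \<open>auto simp: space_restrict_space\<close>)
  also have "\<dots> = C * (\<integral>x. norm (u x) * norm (v x) \<partial>lebesgue_restr S)" by simp
  also have "\<dots> \<le> C * (L2_norm S u * L2_norm S v)"
    using cs(2) u v S \<open>0 \<le> C\<close>
    by (intro mult_left_mono) (auto simp: L2_iff L2_norm_def set_lint_restr)
  finally show "norm (\<integral>x. F x \<partial>lebesgue_restr S) \<le> C * (L2_norm S u * L2_norm S v)" .
qed

lemma L2_add:
  fixes u v :: "'a::euclidean_space \<Rightarrow> 'b::euclidean_space"
  assumes S: "S \<in> sets borel" and u: "L2 S u" and v: "L2 S v"
  shows "L2 S (\<lambda>x. u x + v x)" and "L2_norm S (\<lambda>x. u x + v x) \<le> L2_norm S u + L2_norm S v"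
proof -
  have mu [measurable]: "u \<in> borel_measurable (lebesgue_restr S)"
   and mv [measurable]: "v \<in> borel_measurable (lebesgue_restr S)"
    using u v S by (simp_all add: L2_iff)
  note p = L2_product[OF S u v, of "\<lambda>x. u x \<bullet> v x" 1]
  have i: "integrable (lebesgue_restr S) (\<lambda>x. u x \<bullet> v x)"
    by (rule p(1)) (auto simp: Cauchy_Schwarz_ineq2)
  have b: "\<bar>\<integral>x. u x \<bullet> v x \<partial>lebesgue_restr S\<bar> \<le> L2_norm S u * L2_norm S v"
    using p(2) by (auto simp: Cauchy_Schwarz_ineq2)
  have eq: "(norm (u x + v x))\<^sup>2 = (norm (u x))\<^sup>2 + 2 * (u x \<bullet> v x) + (norm (v x))\<^sup>2" for x
    by (simp add: power2_norm_eq_inner algebra_simps inner_commute)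
  have iu: "integrable (lebesgue_restr S) (\<lambda>x. (norm (u x))\<^sup>2)"
   and iv: "integrable (lebesgue_restr S) (\<lambda>x. (norm (v x))\<^sup>2)"
    using u v S by (simp_all add: L2_iff)
  show "L2 S (\<lambda>x. u x + v x)"
    using S iu iv i by (simp add: L2_iff eq)
  have "(L2_norm S (\<lambda>x. u x + v x))\<^sup>2 =
     (L2_norm S u)\<^sup>2 + 2 * (\<integral>x. u x \<bullet> v x \<partial>lebesgue_restr S) + (L2_norm S v)\<^sup>2"
    using S iu iv i by (simp add: L2_norm_power2 eq)
  also have "\<dots> \<le> (L2_norm S u + L2_norm S v)\<^sup>2"
    using b by (simp add: power2_sum)
  finally show "L2_norm S (\<lambda>x. u x + v x) \<le> L2_norm S u + L2_norm S v"
    by (rule power2_le_imp_le) simp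
qed

lemma L2_uminus:
  fixes u :: "'a::euclidean_space \<Rightarrow> 'b::euclidean_space"
  shows "L2 S (\<lambda>x. - u x) \<longleftrightarrow> L2 S u" and "L2_norm S (\<lambda>x. - u x) = L2_norm S u"
  by (auto simp: L2_def L2_norm_def set_borel_measurable_def)

lemma L2_diff:
  fixes u v :: "'a::euclidean_space \<Rightarrow> 'b::euclidean_space"
  assumes S: "S \<in> sets borel" and u: "L2 S u" and v: "L2 S v"
  shows "L2 S (\<lambda>x. u x - v x)" and "L2_norm S (\<lambda>x. u x - v x) \<le> L2_norm S u + L2_norm S v"
  using L2_add[OF S u, of "\<lambda>x. - v x"] v by (simp_all add: L2_uminus)

lemma L2_norm_triangle:
  fixes u v w :: "'a::euclidean_space \<Rightarrow> 'b::euclidean_space"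
  assumes S: "S \<in> sets borel" and u: "L2 S u" and v: "L2 S v" and w: "L2 S w"
  shows "L2_norm S (\<lambda>x. u x - w x) \<le> L2_norm S (\<lambda>x. u x - v x) + L2_norm S (\<lambda>x. v x - w x)"
  using L2_add(2)[OF S L2_diff(1)[OF S u v] L2_diff(1)[OF S v w]] by simp

lemma L2_mult:
  fixes u :: "'a::euclidean_space \<Rightarrow> 'b::euclidean_space" and k :: "'a \<Rightarrow> real"
  assumes S: "S \<in> sets borel" and u: "L2 S u" and k: "k \<in> borel_measurable (lebesgue_restr S)"
    and le: "\<And>x. x \<in> S \<Longrightarrow> \<bar>k x\<bar> \<le> C"
  shows "L2 S (\<lambda>x. k x *\<^sub>R u x)"
    and "0 \<le> C \<Longrightarrow> L2_norm S (\<lambda>x. k x *\<^sub>R u x) \<le> C * L2_norm S u"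
proof -
  have m: "(\<lambda>x. k x *\<^sub>R u x) \<in> borel_measurable (lebesgue_restr S)"
    using k u S by (auto simp: L2_iff)
  show "L2 S (\<lambda>x. k x *\<^sub>R u x)"
  proof (rule L2_bound(1)[OF S m u, of "max C 0"])
    fix x assume "x \<in> S"
    then have "\<bar>k x\<bar> \<le> max C 0" using le[of x] by simp
    then show "norm (k x *\<^sub>R u x) \<le> max C 0 * norm (u x)"
      by (simp add: mult_right_mono)
  qed simp
  show "0 \<le> C \<Longrightarrow> L2_norm S (\<lambda>x. k x *\<^sub>R u x) \<le> C * L2_norm S u"
    by (rule L2_bound(2)[OF S m u]) (use le in \<open>auto intro!: mult_right_mono\<close>)
qed

lemma L2_cmult:
  fixes u :: "'a::euclidean_space \<Rightarrow> 'b::euclidean_space"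
  assumes "S \<in> sets borel" "L2 S u"
  shows "L2 S (\<lambda>x. c *\<^sub>R u x)" and "L2_norm S (\<lambda>x. c *\<^sub>R u x) = \<bar>c\<bar> * L2_norm S u"
proof -
  show "L2 S (\<lambda>x. c *\<^sub>R u x)" using L2_mult(1)[OF assms, of "\<lambda>_. c" "\<bar>c\<bar>"] by simp
  show "L2_norm S (\<lambda>x. c *\<^sub>R u x) = \<bar>c\<bar> * L2_norm S u"
    using assms by (simp add: L2_norm_def set_lint_restr power_mult_distrib real_sqrt_mult)
qed

lemma L2_linear:
  fixes u :: "'a::euclidean_space \<Rightarrow> 'b::euclidean_space" and T :: "'b \<Rightarrow> 'c::euclidean_space"
  assumes S: "S \<in> sets borel" and u: "L2 S u" and T: "bounded_linear T"
  shows "L2 S (\<lambda>x. T (u x))" and "L2_norm S (\<lambda>x. T (u x)) \<le> onorm T * L2_norm S u"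
proof -
  have m: "(\<lambda>x. T (u x)) \<in> borel_measurable (lebesgue_restr S)"
    by (rule borel_measurable_continuous_on[OF linear_continuous_on[OF T] L2_measurable[OF S u]])
  note * = L2_bound[OF S m u, of "onorm T"]
  show "L2 S (\<lambda>x. T (u x))" by (rule *(1)) (auto simp: onorm[OF T] onorm_pos_le[OF T])
  show "L2_norm S (\<lambda>x. T (u x)) \<le> onorm T * L2_norm S u"
    by (rule *(2)) (auto simp: onorm[OF T] onorm_pos_le[OF T])
qed

lemma L2_subset:
  fixes u :: "'a::euclidean_space \<Rightarrow> 'b::euclidean_space"
  assumes S: "S \<in> sets borel" and T: "T \<in> sets borel" and sub: "T \<subseteq> S" and u: "L2 S u"
  shows "L2 T u" and "L2_norm T u \<le> L2_norm S u"
proof -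
  have "restrict_space (lebesgue_restr S) T = lebesgue_restr (S \<inter> T)"
    by (rule restrict_restrict_space) (simp_all add: S T)
  also have "S \<inter> T = T" using sub by blast
  finally have m: "u \<in> borel_measurable (lebesgue_restr T)"
    using measurable_restrict_space1[OF L2_measurable[OF S u], of T] by metis
  have "(\<integral>\<^sup>+x. ennreal ((norm (u x))\<^sup>2) * indicator T x \<partial>lborel)
     \<le> (\<integral>\<^sup>+x. ennreal ((norm (u x))\<^sup>2) * indicator S x \<partial>lborel)"
    using sub by (intro nn_integral_mono) (auto simp: indicator_def)
  also have "\<dots> = ennreal ((L2_norm S u)\<^sup>2)" by (rule L2_nn[OF S u])
  finally have *: "(\<integral>\<^sup>+x. ennreal ((norm (u x))\<^sup>2) * indicator T x \<partial>lborel) \<le> ennreal ((L2_norm S u)\<^sup>2)" .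
  show "L2 T u" by (rule L2_I_nn(1)[OF T m *]) simp
  have "(L2_norm T u)\<^sup>2 \<le> (L2_norm S u)\<^sup>2" by (rule L2_I_nn(2)[OF T m *]) simp
  then show "L2_norm T u \<le> L2_norm S u" by (rule power2_le_imp_le) simp
qed

lemma L2_const:
  fixes u :: "'a::euclidean_space \<Rightarrow> 'b::euclidean_space"
  assumes S: "S \<in> sets borel" and fin: "emeasure lborel S < \<infinity>"
    and m: "u \<in> borel_measurable (lebesgue_restr S)" and le: "\<And>x. x \<in> S \<Longrightarrow> norm (u x) \<le> C"
  shows "L2 S u"
proof -
  have "finite_measure (lebesgue_restr S)"
    using S fin by (intro finite_measureI) (simp add: emeasure_restrict_space space_restrict_space less_top)
  then interpret finite_measure "lebesgue_restr S" .
  have "integrable (lebesgue_restr S) (\<lambda>x. (norm (u x))\<^sup>2)"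
    by (rule integrable_const_bound[where B="C\<^sup>2"])
       (use m le S in \<open>auto simp: space_restrict_space intro!: power_mono AE_I2\<close>)
  then show ?thesis using m S by (simp add: L2_iff)
qed

text \<open>Weak gradients are determined only up to null sets; this allows one representative to be
  exchanged for another inside limits.\<close>

lemma L2_cong_AE:
  fixes u v :: "'a::euclidean_space \<Rightarrow> 'b::euclidean_space"
  assumes S: "S \<in> sets borel" and v: "v \<in> borel_measurable (lebesgue_restr S)"
    and u: "L2 S u" and ae: "AE x in lebesgue_restr S. u x = v x"
  shows "L2 S v"
    and "w \<in> borel_measurable (lebesgue_restr S) \<Longrightarrow>
      L2_norm S (\<lambda>x. w x - v x) = L2_norm S (\<lambda>x. w x - u x)"
proof -
  have mu: "u \<in> borel_measurable (lebesgue_restr S)" and iu: "integrable (lebesgue_restr S) (\<lambda>x. (norm (u x))\<^sup>2)"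
    using u S by (simp_all add: L2_iff)
  have "integrable (lebesgue_restr S) (\<lambda>x. (norm (v x))\<^sup>2)"
    by (rule integrable_cong_AE_imp[OF iu]) (use v ae in auto)
  then show "L2 S v" using v S by (simp add: L2_iff)
  assume w: "w \<in> borel_measurable (lebesgue_restr S)"
  have "(\<integral>x. (norm (w x - v x))\<^sup>2 \<partial>lebesgue_restr S) = (\<integral>x. (norm (w x - u x))\<^sup>2 \<partial>lebesgue_restr S)"
    by (rule integral_cong_AE) (use v mu w ae in auto)
  then show "L2_norm S (\<lambda>x. w x - v x) = L2_norm S (\<lambda>x. w x - u x)"
    using S by (simp add: L2_norm_def set_lint_restr)
qed

subsection \<open>Convergence\<close>

lemma tendsto_L2D:
  assumes "tendsto_L2 S w u"
  shows "L2 S (w n)" "L2 S u" "(\<lambda>n. L2_norm S (\<lambda>x. w n x - u x)) \<longlonglongrightarrow> 0"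
  using assms by (auto simp: tendsto_L2_def)

lemma tendsto_L2I:
  assumes "\<And>n. L2 S (w n)" "L2 S u" "\<And>n. L2_norm S (\<lambda>x. w n x - u x) \<le> a n" "a \<longlonglongrightarrow> 0"
  shows "tendsto_L2 S w u"
  unfolding tendsto_L2_def using assms tendsto_sandwich[of "\<lambda>_. 0" _ _ a 0] by auto

lemma tendsto_L2_const: "L2 S u \<Longrightarrow> tendsto_L2 S (\<lambda>_. u) u"
  by (auto simp: tendsto_L2_def L2_norm_def set_lebesgue_integral_def)

lemma tendsto_L2_add:
  assumes S: "S \<in> sets borel" and w: "tendsto_L2 S w u" and z: "tendsto_L2 S z v"
  shows "tendsto_L2 S (\<lambda>n x. w n x + z n x) (\<lambda>x. u x + v x)"
proof (rule tendsto_L2I)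
  show "L2_norm S (\<lambda>x. (w n x + z n x) - (u x + v x)) \<le>
     L2_norm S (\<lambda>x. w n x - u x) + L2_norm S (\<lambda>x. z n x - v x)" for n
    using L2_add(2)[OF S L2_diff(1)[OF S tendsto_L2D(1,2)[OF w]] L2_diff(1)[OF S tendsto_L2D(1,2)[OF z]], of n n]
    by (simp add: algebra_simps)
qed (use tendsto_add[OF tendsto_L2D(3)[OF w] tendsto_L2D(3)[OF z]] tendsto_L2D[OF w] tendsto_L2D[OF z]
   in \<open>auto intro!: L2_add(1) S\<close>)

lemma tendsto_L2_mult:
  fixes k :: "'a::euclidean_space \<Rightarrow> real"
  assumes S: "S \<in> sets borel" and w: "tendsto_L2 S w u"
    and k: "k \<in> borel_measurable (lebesgue_restr S)" "\<And>x. x \<in> S \<Longrightarrow> \<bar>k x\<bar> \<le> C"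
  shows "tendsto_L2 S (\<lambda>n x. k x *\<^sub>R w n x) (\<lambda>x. k x *\<^sub>R u x)"
proof (rule tendsto_L2I)
  have k': "\<bar>k x\<bar> \<le> max C 0" if "x \<in> S" for x using k(2)[OF that] by simp
  show "L2_norm S (\<lambda>x. k x *\<^sub>R w n x - k x *\<^sub>R u x) \<le> max C 0 * L2_norm S (\<lambda>x. w n x - u x)" for n
    using L2_mult(2)[OF S L2_diff(1)[OF S tendsto_L2D(1)[OF w, of n] tendsto_L2D(2)[OF w]] k(1) k']
    by (simp add: scaleR_diff_right)
  show "(\<lambda>n. max C 0 * L2_norm S (\<lambda>x. w n x - u x)) \<longlonglongrightarrow> 0"
    using tendsto_mult_left[OF tendsto_L2D(3)[OF w], of "max C 0"] by simp
qed (use k tendsto_L2D[OF w] in \<open>auto intro!: L2_mult(1) S\<close>)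

lemma tendsto_L2_linear:
  fixes u :: "'a::euclidean_space \<Rightarrow> 'b::euclidean_space" and T :: "'b \<Rightarrow> 'c::euclidean_space"
  assumes S: "S \<in> sets borel" and w: "tendsto_L2 S w u" and T: "bounded_linear T"
  shows "tendsto_L2 S (\<lambda>n x. T (w n x)) (\<lambda>x. T (u x))"
proof (rule tendsto_L2I)
  show "L2_norm S (\<lambda>x. T (w n x) - T (u x)) \<le> onorm T * L2_norm S (\<lambda>x. w n x - u x)" for n
    using L2_linear(2)[OF S L2_diff(1)[OF S tendsto_L2D(1)[OF w, of n] tendsto_L2D(2)[OF w]] T]
    by (simp add: linear_diff[OF bounded_linear.linear[OF T]])
  show "(\<lambda>n. onorm T * L2_norm S (\<lambda>x. w n x - u x)) \<longlonglongrightarrow> 0"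
    using tendsto_mult_left[OF tendsto_L2D(3)[OF w], of "onorm T"] by simp
qed (rule L2_linear(1)[OF S _ T], rule tendsto_L2D[OF w])+

lemma tendsto_L2_diff:
  assumes S: "S \<in> sets borel" and w: "tendsto_L2 S w u" and z: "tendsto_L2 S z v"
  shows "tendsto_L2 S (\<lambda>n x. w n x - z n x) (\<lambda>x. u x - v x)"
  using tendsto_L2_add[OF S w tendsto_L2_linear[OF S z, of uminus]] by (simp add: bounded_linear_minus bounded_linear_ident)

lemma tendsto_L2_cong_AE:
  fixes u v :: "'a::euclidean_space \<Rightarrow> 'b::euclidean_space"
  assumes S: "S \<in> sets borel" and w: "tendsto_L2 S w u"
    and v: "v \<in> borel_measurable (lebesgue_restr S)" and ae: "AE x in lebesgue_restr S. u x = v x"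
  shows "tendsto_L2 S w v"
proof -
  have "w n \<in> borel_measurable (lebesgue_restr S)" for n
    using tendsto_L2D(1)[OF w] S by (simp add: L2_iff)
  then show ?thesis
    using w L2_cong_AE[OF S v tendsto_L2D(2)[OF w] ae] by (simp add: tendsto_L2_def)
qed

lemma tendsto_L2_subset:
  assumes S: "S \<in> sets borel" and T: "T \<in> sets borel" and sub: "T \<subseteq> S" and w: "tendsto_L2 S w u"
  shows "tendsto_L2 T w u"
proof (rule tendsto_L2I[OF _ _ _ tendsto_L2D(3)[OF w]])
  show "L2_norm T (\<lambda>x. w n x - u x) \<le> L2_norm S (\<lambda>x. w n x - u x)" for n
    by (rule L2_subset(2)[OF S T sub L2_diff(1)[OF S tendsto_L2D(1,2)[OF w]]])
qed (use tendsto_L2D[OF w] in \<open>auto intro!: L2_subset(1)[OF S T sub]\<close>)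

text \<open>All passages to the limit in weak identities are instances of this rule, with
  \<open>prod\<close> an inner product, a scalar multiple or a product of reals.\<close>

lemma tendsto_L2_bilinear:
  fixes u :: "'a::euclidean_space \<Rightarrow> 'b::euclidean_space" and v :: "'a \<Rightarrow> 'c::euclidean_space"
    and prod :: "'b \<Rightarrow> 'c \<Rightarrow> 'd::euclidean_space"
  assumes S: "S \<in> sets borel" and w: "tendsto_L2 S w u" and z: "tendsto_L2 S z v"
    and bil: "bounded_bilinear prod"
  shows "(\<lambda>n. \<integral>x. prod (w n x) (z n x) \<partial>lebesgue_restr S) \<longlonglongrightarrow> (\<integral>x. prod (u x) (v x) \<partial>lebesgue_restr S)"
proof -
  interpret bounded_bilinear prod by (rule bil)
  obtain K where K: "0 \<le> K" "\<And>a b. norm (prod a b) \<le> norm a * norm b * K"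
    using nonneg_bounded by blast
  have meas: "(\<lambda>x. prod (f x) (g x)) \<in> borel_measurable (lebesgue_restr S)" if "L2 S f" "L2 S g" for f g
  proof -
    have "continuous_on UNIV (\<lambda>p. prod (fst p) (snd p))"
      by (intro continuous_on continuous_intros)
    then show ?thesis
      using borel_measurable_continuous_on[of "\<lambda>p. prod (fst p) (snd p)" "\<lambda>x. (f x, g x)" "lebesgue_restr S"]
        borel_measurable_Pair[OF L2_measurable[OF S that(1)] L2_measurable[OF S that(2)]]
      by simp
  qed
  have int: "integrable (lebesgue_restr S) (\<lambda>x. prod (f x) (g x))"
   and bd: "norm (\<integral>x. prod (f x) (g x) \<partial>lebesgue_restr S) \<le> K * (L2_norm S f * L2_norm S g)"
    if "L2 S f" "L2 S g" for f g
    using L2_product[OF S that meas[OF that], of K] K by (simp_all add: mult.commute)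
  let ?a = "\<lambda>n. L2_norm S (\<lambda>x. w n x - u x)" and ?b = "\<lambda>n. L2_norm S (\<lambda>x. z n x - v x)"
  note L = tendsto_L2D[OF w] tendsto_L2D[OF z]
  have "norm ((\<integral>x. prod (w n x) (z n x) \<partial>lebesgue_restr S) - (\<integral>x. prod (u x) (v x) \<partial>lebesgue_restr S))
      \<le> K * (?a n * ?b n) + K * (?a n * L2_norm S v) + K * (L2_norm S u * ?b n)" for n
  proof -
    \<comment> \<open>Expanding around the limits leaves one term quadratic and two linear in the
      errors, each of which Cauchy-Schwarz sends to 0.\<close>
    have "prod (w n x) (z n x) = prod (u x) (v x) + (prod (w n x - u x) (z n x - v x) + prod (w n x - u x) (v x) + prod (u x) (z n x - v x))" for x
      by (simp add: diff_left diff_right)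
    then have E: "(\<integral>x. prod (w n x) (z n x) \<partial>lebesgue_restr S) - (\<integral>x. prod (u x) (v x) \<partial>lebesgue_restr S) =
      (\<integral>x. prod (w n x - u x) (z n x - v x) \<partial>lebesgue_restr S) + (\<integral>x. prod (w n x - u x) (v x) \<partial>lebesgue_restr S)
       + (\<integral>x. prod (u x) (z n x - v x) \<partial>lebesgue_restr S)"
      using int[OF L(2) L(5)] int[OF L2_diff(1)[OF S L(1,2)] L2_diff(1)[OF S L(4,5)], of n n]
        int[OF L2_diff(1)[OF S L(1,2)] L(5), of n] int[OF L(2) L2_diff(1)[OF S L(4,5)], of n]
      by simp
    show ?thesis
      unfolding E
      using norm_triangle_ineq[of "(\<integral>x. prod (w n x - u x) (z n x - v x) \<partial>lebesgue_restr S) + (\<integral>x. prod (w n x - u x) (v x) \<partial>lebesgue_restr S)"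
          "\<integral>x. prod (u x) (z n x - v x) \<partial>lebesgue_restr S"]
        norm_triangle_ineq[of "\<integral>x. prod (w n x - u x) (z n x - v x) \<partial>lebesgue_restr S" "\<integral>x. prod (w n x - u x) (v x) \<partial>lebesgue_restr S"]
        bd[OF L2_diff(1)[OF S L(1,2)] L2_diff(1)[OF S L(4,5)], of n n]
        bd[OF L2_diff(1)[OF S L(1,2)] L(5), of n] bd[OF L(2) L2_diff(1)[OF S L(4,5)], of n]
      by linarith
  qed
  moreover have "(\<lambda>n. K * (?a n * ?b n) + K * (?a n * L2_norm S v) + K * (L2_norm S u * ?b n)) \<longlonglongrightarrow> 0"
    using tendsto_add[OF tendsto_add[OF tendsto_mult_left[OF tendsto_mult[OF L(3) L(6)], of K]
        tendsto_mult_left[OF tendsto_mult_right[OF L(3), of "L2_norm S v"], of K]]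
        tendsto_mult_left[OF tendsto_mult_left[OF L(6), of "L2_norm S u"], of K]] by simp
  ultimately have "(\<lambda>n. (\<integral>x. prod (w n x) (z n x) \<partial>lebesgue_restr S) - (\<integral>x. prod (u x) (v x) \<partial>lebesgue_restr S)) \<longlonglongrightarrow> 0"
    by (rule Lim_null_comparison[OF always_eventually[OF allI]])
  then show ?thesis by (rule LIM_zero_cancel)
qed

lemma tendsto_L2_norm:
  fixes w :: "nat \<Rightarrow> 'a::euclidean_space \<Rightarrow> 'b::euclidean_space"
  assumes S: "S \<in> sets borel" and w: "tendsto_L2 S w u"
  shows "(\<lambda>n. (L2_norm S (w n))\<^sup>2) \<longlonglongrightarrow> (L2_norm S u)\<^sup>2"
  using tendsto_L2_bilinear[OF S w w bounded_bilinear_inner] S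
  by (simp add: L2_norm_power2 power2_norm_eq_inner)

section \<open>Continuously differentiable functions\<close>

lemma C1_onD:
  assumes "open S" "C1_on S u" "x \<in> S"
  shows "(u has_derivative (\<lambda>d. grad u x \<bullet> d)) (at x)"
proof -
  have "u differentiable (at x)"
    using assms by (auto simp: C1_on_def differentiable_on_eq_differentiable_at)
  then have D: "(u has_derivative frechet_derivative u (at x)) (at x)"
    by (simp add: frechet_derivative_works)
  then interpret bounded_linear "frechet_derivative u (at x)" by (rule has_derivative_bounded_linear)
  have "frechet_derivative u (at x) d = grad u x \<bullet> d" for d
  proof -
    have "d = fst d *\<^sub>R (1, 0) + snd d *\<^sub>R (0, 1)" by (simp add: prod_eq_iff)
    then have "frechet_derivative u (at x) d =
        fst d *\<^sub>R frechet_derivative u (at x) (1, 0) + snd d *\<^sub>R frechet_derivative u (at x) (0, 1)"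
      by (metis add scaleR)
    then show ?thesis by (simp add: grad_def inner_prod_def)
  qed
  then have "frechet_derivative u (at x) = (\<lambda>d. grad u x \<bullet> d)" by auto
  with D show ?thesis by simp
qed

lemma grad_eqI:
  assumes "(u has_derivative (\<lambda>d. G \<bullet> d)) (at x)"
  shows "grad u x = G"
proof -
  have "frechet_derivative u (at x) = (\<lambda>d. G \<bullet> d)" by (rule frechet_derivative_at[OF assms, symmetric])
  then show ?thesis by (simp add: grad_def inner_prod_def)
qed

lemma C1_onI:
  assumes "open S" "\<And>x. x \<in> S \<Longrightarrow> (u has_derivative (\<lambda>d. G x \<bullet> d)) (at x)" "continuous_on S G"
  shows "C1_on S u" and "\<And>x. x \<in> S \<Longrightarrow> grad u x = G x"
proof -
  show g: "grad u x = G x" if "x \<in> S" for x using assms(2)[OF that] by (rule grad_eqI)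
  have "continuous_on S (grad u)" using assms(3) g by (simp cong: continuous_on_cong)
  then show "C1_on S u"
    using assms(1,2) by (auto simp: C1_on_def differentiable_on_eq_differentiable_at differentiable_def)
qed

lemma C1_on_continuous: "C1_on S u \<Longrightarrow> continuous_on S u" "C1_on S u \<Longrightarrow> continuous_on S (grad u)"
  by (auto simp: C1_on_def differentiable_imp_continuous_on)

lemma C1_on_subset: "C1_on S u \<Longrightarrow> T \<subseteq> S \<Longrightarrow> C1_on T u"
  by (auto simp: C1_on_def intro: differentiable_on_subset continuous_on_subset)

lemma C1_on_add:
  assumes S: "open S" and u: "C1_on S u" and v: "C1_on S v"
  shows "C1_on S (\<lambda>x. u x + v x)" and "\<And>x. x \<in> S \<Longrightarrow> grad (\<lambda>x. u x + v x) x = grad u x + grad v x"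
proof -
  have D: "((\<lambda>x. u x + v x) has_derivative (\<lambda>d. (grad u x + grad v x) \<bullet> d)) (at x)" if "x \<in> S" for x
    unfolding inner_add_left by (intro has_derivative_add C1_onD[OF S u that] C1_onD[OF S v that])
  have "continuous_on S (\<lambda>x. grad u x + grad v x)"
    by (intro continuous_intros C1_on_continuous u v)
  from C1_onI[OF S D this]
  show "C1_on S (\<lambda>x. u x + v x)" and "\<And>x. x \<in> S \<Longrightarrow> grad (\<lambda>x. u x + v x) x = grad u x + grad v x"
    by auto
qed

lemma C1_on_mult:
  assumes S: "open S" and u: "C1_on S u" and v: "C1_on S v"
  shows "C1_on S (\<lambda>x. u x * v x)"
    and "\<And>x. x \<in> S \<Longrightarrow> grad (\<lambda>x. u x * v x) x = u x *\<^sub>R grad v x + v x *\<^sub>R grad u x"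
proof -
  have D: "((\<lambda>x. u x * v x) has_derivative (\<lambda>d. (u x *\<^sub>R grad v x + v x *\<^sub>R grad u x) \<bullet> d)) (at x)" if "x \<in> S" for x
    by (rule has_derivative_eq_rhs[OF has_derivative_mult[OF C1_onD[OF S u that] C1_onD[OF S v that]]])
       (auto simp: inner_add_left)
  have "continuous_on S (\<lambda>x. u x *\<^sub>R grad v x + v x *\<^sub>R grad u x)"
    by (intro continuous_intros C1_on_continuous u v)
  from C1_onI[OF S D this]
  show "C1_on S (\<lambda>x. u x * v x)"
   and "\<And>x. x \<in> S \<Longrightarrow> grad (\<lambda>x. u x * v x) x = u x *\<^sub>R grad v x + v x *\<^sub>R grad u x"
    by auto
qed

lemma C1_const: "C1_on UNIV (\<lambda>_. c)" and grad_const [simp]: "grad (\<lambda>_. c) x = 0"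
  using C1_onI[of UNIV "\<lambda>_. c" "\<lambda>_. 0"] by auto

lemma C1_on_cmult:
  assumes S: "open S" and u: "C1_on S u"
  shows "C1_on S (\<lambda>x. c * u x)" and "\<And>x. x \<in> S \<Longrightarrow> grad (\<lambda>x. c * u x) x = c *\<^sub>R grad u x"
  using C1_on_mult[OF S C1_on_subset[OF C1_const[of c] subset_UNIV] u] by auto

lemma C1_on_diff:
  assumes S: "open S" and u: "C1_on S u" and v: "C1_on S v"
  shows "C1_on S (\<lambda>x. u x - v x)" and "\<And>x. x \<in> S \<Longrightarrow> grad (\<lambda>x. u x - v x) x = grad u x - grad v x"
  using C1_on_add[OF S u C1_on_cmult(1)[OF S v, of "-1"]] C1_on_cmult(2)[OF S v, of _ "-1"] by auto

lemma C1_compose_real: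
  fixes h :: "real \<Rightarrow> real"
  assumes S: "open S" and u: "C1_on S u" and h: "\<And>t. (h has_real_derivative h' t) (at t)"
    and h': "continuous_on UNIV h'"
  shows "C1_on S (\<lambda>x. h (u x))" and "\<And>x. x \<in> S \<Longrightarrow> grad (\<lambda>x. h (u x)) x = h' (u x) *\<^sub>R grad u x"
proof -
  have D: "((\<lambda>x. h (u x)) has_derivative (\<lambda>d. (h' (u x) *\<^sub>R grad u x) \<bullet> d)) (at x)" if "x \<in> S" for x
    using has_derivative_compose[OF C1_onD[OF S u that] h[unfolded has_field_derivative_def]]
    by (simp add: mult.commute)
  have "continuous_on S (\<lambda>x. h' (u x) *\<^sub>R grad u x)"
    by (intro continuous_intros continuous_on_compose2[OF h'] C1_on_continuous u) auto
  from C1_onI[OF S D this] show "C1_on S (\<lambda>x. h (u x))"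
   and "\<And>x. x \<in> S \<Longrightarrow> grad (\<lambda>x. h (u x)) x = h' (u x) *\<^sub>R grad u x" by auto
qed

lemma C1_fst: "C1_on UNIV fst" and grad_fst [simp]: "grad fst x = (1, 0)"
proof -
  have D: "(fst has_derivative (\<lambda>d. (1, 0) \<bullet> d)) (at x)" for x :: "real \<times> real"
    using has_derivative_fst[OF has_derivative_ident] by (simp add: inner_prod_def)
  show "C1_on UNIV fst" by (rule C1_onI(1)[OF open_UNIV D]) simp
  show "grad fst x = (1, 0)" by (rule grad_eqI[OF D])
qed

lemma C1_snd: "C1_on UNIV snd" and grad_snd [simp]: "grad snd x = (0, 1)"
proof -
  have D: "(snd has_derivative (\<lambda>d. (0, 1) \<bullet> d)) (at x)" for x :: "real \<times> real"
    using has_derivative_snd[OF has_derivative_ident] by (simp add: inner_prod_def)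
  show "C1_on UNIV snd" by (rule C1_onI(1)[OF open_UNIV D]) simp
  show "grad snd x = (0, 1)" by (rule grad_eqI[OF D])
qed

lemma has_derivative_local_cong:
  assumes "open S" "x \<in> S" "\<And>y. y \<in> S \<Longrightarrow> u y = v y"
  shows "grad u x = grad v x"
proof -
  have "frechet_derivative u (at x) = frechet_derivative v (at x)"
  proof -
    have "(u has_derivative D) (at x) \<longleftrightarrow> (v has_derivative D) (at x)" for D
      using has_derivative_transform_within_open[of u D x UNIV S v] has_derivative_transform_within_open[of v D x UNIV S u] assms
      by auto
    then show ?thesis by (simp add: frechet_derivative_def)
  qed
  then show ?thesis by (simp add: grad_def)
qed

lemma grad_zero_open:
  assumes "open V" "\<And>y. y \<in> V \<Longrightarrow> u y = 0" "x \<in> V"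
  shows "grad u x = 0"
  using has_derivative_local_cong[OF assms(1,3), of u "\<lambda>_. 0"] assms(2) by simp

text \<open>A cut-off that vanishes on an open set \<open>V\<close> makes the product C1 on the
  whole plane although \<open>u\<close> is smooth only on \<open>U\<close>. The product rule holds
  even off \<open>U\<close>: there \<open>k x\<close> and \<open>grad k x\<close> are both 0 and
  annihilate whatever values \<open>u\<close> and \<open>grad u\<close> have.\<close>

lemma C1_mult_extend:
  assumes U: "open U" and V: "open V" and UV: "U \<union> V = UNIV"
    and k: "C1_on UNIV k" "\<And>x. x \<in> V \<Longrightarrow> k x = 0" and u: "C1_on U u"
  shows "C1_on UNIV (\<lambda>x. k x * u x)"
    and "grad (\<lambda>x. k x * u x) x = k x *\<^sub>R grad u x + u x *\<^sub>R grad k x"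
proof -
  let ?G = "\<lambda>x. k x *\<^sub>R grad u x + u x *\<^sub>R grad k x"
  have kU: "C1_on U k" using k(1) by (rule C1_on_subset) simp
  have k0: "k x = 0" "grad k x = 0" if "x \<in> V" for x
    using k(2) that grad_zero_open[OF V, of k x] by auto
  have D: "((\<lambda>x. k x * u x) has_derivative (\<lambda>d. ?G x \<bullet> d)) (at x)" for x
  proof (cases "x \<in> U")
    case True
    then show ?thesis using C1_onD[OF U C1_on_mult(1)[OF U kU u] True] C1_on_mult(2)[OF U kU u True] by simp
  next
    case False
    then have "x \<in> V" using UV by auto
    have "((\<lambda>x. 0) has_derivative (\<lambda>d. 0)) (at x)" by simp
    then have "((\<lambda>x. k x * u x) has_derivative (\<lambda>d. 0)) (at x)"
      by (rule has_derivative_transform_within_open[OF _ V \<open>x \<in> V\<close>]) (simp add: k)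
    then show ?thesis using k0[OF \<open>x \<in> V\<close>] by simp
  qed
  have "continuous_on (U \<union> V) ?G"
  proof (rule continuous_on_open_Un[OF U V])
    show "continuous_on U ?G" by (intro continuous_intros C1_on_continuous u kU)
    show "continuous_on V ?G" using k0 by (simp cong: continuous_on_cong)
  qed
  then have "continuous_on UNIV ?G" using UV by simp
  from C1_onI[OF open_UNIV D this] show "C1_on UNIV (\<lambda>x. k x * u x)" "grad (\<lambda>x. k x * u x) x = ?G x"
    by auto
qed

lemma C1_measurable:
  assumes "C1_on UNIV u"
  shows "u \<in> borel_measurable borel" "grad u \<in> borel_measurable borel"
  using C1_on_continuous[OF assms] by (auto intro: borel_measurable_continuous_onI)

lemma C1_DERIV_snd:
  assumes S: "open S" and u: "C1_on S u" and x: "(s, t) \<in> S"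
  shows "((\<lambda>t. u (s, t)) has_real_derivative snd (grad u (s, t))) (at t)"
proof -
  have "((\<lambda>t. (s, t)) has_derivative (\<lambda>d. (0, d))) (at t)"
    by (auto intro!: derivative_eq_intros)
  from has_derivative_compose[OF this C1_onD[OF S u x]] show ?thesis
    by (simp add: has_field_derivative_def inner_prod_def mult_commute_abs)
qed

lemma C1_DERIV_fst:
  assumes S: "open S" and u: "C1_on S u" and x: "(s, t) \<in> S"
  shows "((\<lambda>s. u (s, t)) has_real_derivative fst (grad u (s, t))) (at s)"
proof -
  have "((\<lambda>s. (s, t)) has_derivative (\<lambda>d. (d, 0))) (at s)"
    by (auto intro!: derivative_eq_intros)
  from has_derivative_compose[OF this C1_onD[OF S u x]] show ?thesis
    by (simp add: has_field_derivative_def inner_prod_def mult_commute_abs)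
qed

subsection \<open>A smooth step\<close>

text \<open>Squares of positive parts are C1, which is all the smoothness that test functions need
  here, and the closed formula yields explicit bounds for the derivative.\<close>

definition zeta :: "real \<Rightarrow> real" where
  "zeta t = (max 0 (1 - 4 * (max 0 t)\<^sup>2))\<^sup>2"

definition zeta_deriv :: "real \<Rightarrow> real" where
  "zeta_deriv t = - 16 * max 0 t * max 0 (1 - 4 * (max 0 t)\<^sup>2)"

lemma DERIV_max_power2: "((\<lambda>t::real. (max 0 t)\<^sup>2) has_real_derivative 2 * max 0 t) (at t)"
proof -
  consider "t > 0" | "t < 0" | "t = 0" by linarith
  then show ?thesis
  proof cases
    case 1
    have "((\<lambda>t::real. t\<^sup>2) has_real_derivative 2 * t) (at t)" by (auto intro!: derivative_eq_intros)
    then have "((\<lambda>t::real. (max 0 t)\<^sup>2) has_real_derivative 2 * t) (at t)"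
      by (rule DERIV_cong_ev[OF refl _ refl, THEN iffD1, rotated])
         (use eventually_gt_at_top 1 in \<open>auto intro!: eventually_mono[OF eventually_nhds_in_open[of "{0<..}"]]\<close>)
    then show ?thesis using 1 by simp
  next
    case 2
    have "((\<lambda>t::real. 0) has_real_derivative 0) (at t)" by simp
    then have "((\<lambda>t::real. (max 0 t)\<^sup>2) has_real_derivative 0) (at t)"
      by (rule DERIV_cong_ev[OF refl _ refl, THEN iffD1, rotated])
         (use 2 in \<open>auto intro!: eventually_mono[OF eventually_nhds_in_open[of "{..<0}"]]\<close>)
    then show ?thesis using 2 by simp
  next
    case 3
    have "((\<lambda>h::real. (max 0 h)\<^sup>2 / h) \<longlongrightarrow> 0) (at 0)"
    proof (rule Lim_null_comparison)
      show "\<forall>\<^sub>F h::real in at 0. norm ((max 0 h)\<^sup>2 / h) \<le> \<bar>h\<bar>"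
        by (rule always_eventually) (auto simp: max_def power2_eq_square)
      show "((\<lambda>h::real. \<bar>h\<bar>) \<longlongrightarrow> 0) (at 0)" by (auto intro!: tendsto_eq_intros)
    qed
    then show ?thesis using 3 by (simp add: DERIV_def)
  qed
qed

lemma DERIV_zeta: "(zeta has_real_derivative zeta_deriv t) (at t)"
proof -
  have 1: "((\<lambda>t. 1 - 4 * (max 0 t)\<^sup>2) has_real_derivative - (8 * max 0 t)) (at t)"
    by (rule derivative_eq_intros DERIV_max_power2 refl | simp)+
  have "((\<lambda>t. (max 0 (1 - 4 * (max 0 t)\<^sup>2))\<^sup>2) has_real_derivative
      2 * max 0 (1 - 4 * (max 0 t)\<^sup>2) * (- (8 * max 0 t))) (at t)"
    by (rule DERIV_chain2[OF DERIV_max_power2 1])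
  then show ?thesis
    unfolding zeta_deriv_def by (subst zeta_def[abs_def]) (simp add: mult_ac)
qed

lemma continuous_zeta_deriv: "continuous_on UNIV zeta_deriv"
  unfolding zeta_deriv_def[abs_def] by (intro continuous_intros)

lemma zeta_bounds: "0 \<le> zeta t" "zeta t \<le> 1"
proof -
  show "0 \<le> zeta t" by (simp add: zeta_def)
  have "max 0 (1 - 4 * (max 0 t)\<^sup>2) \<le> 1" by simp
  then show "zeta t \<le> 1" unfolding zeta_def by (intro power_le_one) auto
qed

lemma zeta_eq_1: "t \<le> 0 \<Longrightarrow> zeta t = 1" "t \<le> 0 \<Longrightarrow> zeta_deriv t = 0"
  by (simp_all add: zeta_def zeta_deriv_def)

lemma zeta_eq_0: "1 / 2 \<le> t \<Longrightarrow> zeta t = 0" "1 / 2 \<le> t \<Longrightarrow> zeta_deriv t = 0"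
proof -
  assume t: "1 / 2 \<le> t"
  have "(1 / 2)\<^sup>2 \<le> t\<^sup>2" using t by (intro power_mono) auto
  then have "1 - 4 * (max 0 t)\<^sup>2 \<le> 0" using t by (simp add: power2_eq_square)
  then show "zeta t = 0" "zeta_deriv t = 0" by (simp_all add: zeta_def zeta_deriv_def max_absorb1)
qed

lemma zeta_deriv_bounds: "\<bar>zeta_deriv t\<bar> \<le> 16 * max 0 t" "\<bar>zeta_deriv t\<bar> \<le> 8" "zeta_deriv t \<le> 0"
proof -
  have "max 0 (1 - 4 * (max 0 t)\<^sup>2) \<le> 1" by simp
  then have "(16 * max 0 t) * max 0 (1 - 4 * (max 0 t)\<^sup>2) \<le> (16 * max 0 t) * 1"
    by (intro mult_left_mono) auto
  then show *: "\<bar>zeta_deriv t\<bar> \<le> 16 * max 0 t"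
    unfolding zeta_deriv_def by (simp add: abs_mult)
  show "\<bar>zeta_deriv t\<bar> \<le> 8" using * zeta_eq_0(2)[of t] by (cases "1 / 2 \<le> t") auto
  show "zeta_deriv t \<le> 0" unfolding zeta_deriv_def by (simp add: mult_nonneg_nonneg)
qed

subsection \<open>Integration by parts and weak gradients\<close>

lemma integrable_compact_support:
  fixes F :: "'a::euclidean_space \<Rightarrow> 'b::euclidean_space"
  assumes "compact K" "continuous_on UNIV F" "\<And>x. x \<notin> K \<Longrightarrow> F x = 0"
  shows "integrable lborel F"
proof -
  have "integrable lborel (\<lambda>x. indicator K x *\<^sub>R F x)"
    by (rule borel_integrable_compact[OF assms(1)]) (use assms(2) in \<open>auto intro: continuous_on_subset\<close>)
  moreover have "(\<lambda>x. indicator K x *\<^sub>R F x) = F" using assms(3) by (auto simp: indicator_def)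
  ultimately show ?thesis by simp
qed

lemma L2_compact_support:
  fixes F :: "'a::euclidean_space \<Rightarrow> 'b::euclidean_space"
  assumes S: "S \<in> sets borel" and K: "compact K" and F: "continuous_on UNIV F" "\<And>x. x \<notin> K \<Longrightarrow> F x = 0"
  shows "L2 S F"
proof -
  have "integrable lborel (\<lambda>x. (norm (F x))\<^sup>2)"
    by (rule integrable_compact_support[OF K]) (use F in \<open>auto intro!: continuous_intros\<close>)
  then have "integrable (lebesgue_restr S) (\<lambda>x. (norm (F x))\<^sup>2)"
    using S integrable_mult_indicator[of S lborel "\<lambda>x. (norm (F x))\<^sup>2"] by (simp add: integrable_restrict_space)
  moreover have "F \<in> borel_measurable (lebesgue_restr S)"
    by (intro borel_measurable_restr borel_measurable_continuous_onI F)
  ultimately show ?thesis using S by (simp add: L2_iff)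
qed

lemma integral_deriv_bounded_support:
  fixes F :: "real \<Rightarrow> real"
  assumes D: "\<And>t. (F has_real_derivative F' t) (at t)" and c: "continuous_on UNIV F'"
    and z: "\<And>t. R \<le> \<bar>t\<bar> \<Longrightarrow> F t = 0" "\<And>t. R \<le> \<bar>t\<bar> \<Longrightarrow> F' t = 0" and "0 \<le> R"
  shows "(\<integral>t. F' t \<partial>lborel) = 0"
proof -
  have "(\<integral>t. F' t * indicator {- R .. R} t \<partial>lborel) = F R - F (- R)"
    by (rule integral_FTC_Icc_real) (use D c \<open>0 \<le> R\<close> in \<open>auto simp: continuous_on_eq_continuous_at\<close>)
  also have "\<dots> = 0" using z(1)[of R] z(1)[of "-R"] \<open>0 \<le> R\<close> by simp
  also have "(\<lambda>t. F' t * indicator {- R .. R} t) = F'"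
  proof
    fix t show "F' t * indicator {- R .. R} t = F' t"
      using z(2)[of t] by (cases "\<bar>t\<bar> \<le> R") (auto simp: indicator_def)
  qed
  finally show ?thesis by simp
qed

text \<open>Fubini's theorem reduces each partial derivative to an integral over lines, where the
  fundamental theorem of calculus gives 0.\<close>

lemma integral_grad_compact_support:
  fixes \<omega> :: "real \<times> real \<Rightarrow> real"
  assumes \<omega>: "C1_on UNIV \<omega>" and K: "compact K" and z: "\<And>x. x \<notin> K \<Longrightarrow> \<omega> x = 0"
  shows "integrable lborel (grad \<omega>)" and "(\<integral>x. grad \<omega> x \<partial>lborel) = 0"
proof -
  have z': "grad \<omega> x = 0" if "x \<notin> K" for x
    using grad_zero_open[of "- K" \<omega> x] K z that by (auto simp: compact_imp_closed open_Compl)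
  note c = C1_on_continuous(2)[OF \<omega>]
  show I: "integrable lborel (grad \<omega>)" by (rule integrable_compact_support[OF K c z'])
  obtain R where R: "\<And>x. x \<in> K \<Longrightarrow> norm x \<le> R" and "0 < R"
    using compact_imp_bounded[OF K] by (auto simp: bounded_pos)
  \<comment> \<open>A point of \<open>K\<close> may have a coordinate equal to \<open>R\<close>; at
    distance \<open>R + 1\<close> lines and end points surely miss \<open>K\<close>.\<close>
  have out: "x \<notin> K" if "R + 1 \<le> \<bar>fst x\<bar> \<or> R + 1 \<le> \<bar>snd x\<bar>" for x
    using R[of x] norm_fst_le[of "fst x" "snd x"] norm_snd_le[of "snd x" "fst x"] that by auto
  have I1: "integrable (lborel \<Otimes>\<^sub>M lborel) (\<lambda>(s, t). fst (grad \<omega> (s, t)))"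
   and I2: "integrable (lborel \<Otimes>\<^sub>M lborel) (\<lambda>(s, t). snd (grad \<omega> (s, t)))"
    using integrable_fst[OF I] integrable_snd[OF I] by (simp_all add: lborel_prod case_prod_beta')
  have "(\<integral>x. fst (grad \<omega> x) \<partial>lborel) = (\<integral>t. (\<integral>s. fst (grad \<omega> (s, t)) \<partial>lborel) \<partial>lborel)"
    using lborel_pair.integral_snd[OF I1] by (simp add: lborel_prod case_prod_beta')
  also have "\<dots> = 0"
  proof -
    have "(\<integral>s. fst (grad \<omega> (s, t)) \<partial>lborel) = 0" for t
    proof (rule integral_deriv_bounded_support[where F = "\<lambda>s. \<omega> (s, t)" and R = "R + 1"])
      show "continuous_on UNIV (\<lambda>s. fst (grad \<omega> (s, t)))"
        by (intro continuous_intros continuous_on_compose2[OF c]) auto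
    qed (use \<open>0 < R\<close> z z' out in \<open>auto intro!: C1_DERIV_fst[OF open_UNIV \<omega>]\<close>)
    then show ?thesis by simp
  qed
  finally have 1: "fst (\<integral>x. grad \<omega> x \<partial>lborel) = 0" using I by simp
  have "(\<integral>x. snd (grad \<omega> x) \<partial>lborel) = (\<integral>s. (\<integral>t. snd (grad \<omega> (s, t)) \<partial>lborel) \<partial>lborel)"
    using lborel_pair.integral_fst[OF I2] by (simp add: lborel_prod case_prod_beta')
  also have "\<dots> = 0"
  proof -
    have "(\<integral>t. snd (grad \<omega> (s, t)) \<partial>lborel) = 0" for s
    proof (rule integral_deriv_bounded_support[where F = "\<lambda>t. \<omega> (s, t)" and R = "R + 1"])
      show "continuous_on UNIV (\<lambda>t. snd (grad \<omega> (s, t)))"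
        by (intro continuous_intros continuous_on_compose2[OF c]) auto
    qed (use \<open>0 < R\<close> z z' out in \<open>auto intro!: C1_DERIV_snd[OF open_UNIV \<omega>]\<close>)
    then show ?thesis by simp
  qed
  finally have 2: "snd (\<integral>x. grad \<omega> x \<partial>lborel) = 0" using I by simp
  show "(\<integral>x. grad \<omega> x \<partial>lborel) = 0" using 1 2 by (simp add: prod_eq_iff)
qed

lemma test_functionD:
  assumes "test_function \<Omega> \<phi>"
  obtains K where "compact K" "K \<subseteq> \<Omega>" "C1_on UNIV \<phi>"
    "\<And>x. x \<notin> K \<Longrightarrow> \<phi> x = 0" "\<And>x. x \<notin> K \<Longrightarrow> grad \<phi> x = 0"
proof -
  let ?K = "closure {x. \<phi> x \<noteq> 0}"
  have z: "\<phi> x = 0" if "x \<notin> ?K" for x using closure_subset[of "{x. \<phi> x \<noteq> 0}"] that by auto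
  have "grad \<phi> x = 0" if "x \<notin> ?K" for x
    by (rule grad_zero_open[of "- ?K"]) (use z that in \<open>simp_all only: Compl_iff open_Compl closed_closure not_False_eq_True\<close>)
  moreover have "compact ?K" "?K \<subseteq> \<Omega>" "C1_on UNIV \<phi>" using assms by (simp_all add: test_function_def)
  ultimately show thesis using z by (intro that[of ?K])
qed

lemma test_functionI:
  assumes "C1_on UNIV \<phi>" "compact K" "K \<subseteq> \<Omega>" "\<And>x. x \<notin> K \<Longrightarrow> \<phi> x = 0"
  shows "test_function \<Omega> \<phi>"
proof -
  have "closure {x. \<phi> x \<noteq> 0} \<subseteq> K"
    using assms by (intro closure_minimal) (auto simp: compact_imp_closed)
  moreover from this have "compact (closure {x. \<phi> x \<noteq> 0})"
    using assms(2) by (meson bounded_subset closed_closure compact_eq_bounded_closed)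
  ultimately show ?thesis using assms by (auto simp: test_function_def)
qed

text \<open>The product of \<open>u\<close> with a test function, extended by 0, is C1 with compact
  support, so its gradient integrates to 0. No integrability of \<open>u\<close> up to the boundary
  is involved.\<close>

lemma weak_gradient_C1:
  assumes O: "open \<Omega>" and u: "C1_on \<Omega> u"
  shows "weak_gradient \<Omega> u (grad u)"
  unfolding weak_gradient_def
proof (intro allI impI)
  fix \<phi> assume "test_function \<Omega> \<phi>"
  then obtain K where K: "compact K" "K \<subseteq> \<Omega>" "C1_on UNIV \<phi>"
    "\<And>x. x \<notin> K \<Longrightarrow> \<phi> x = 0" "\<And>x. x \<notin> K \<Longrightarrow> grad \<phi> x = 0" by (elim test_functionD) blast
  have UV: "\<Omega> \<union> - K = UNIV" and oK: "open (- K)" using K by (auto simp: compact_imp_closed open_Compl)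
  note E = C1_mult_extend[OF O oK UV K(3) _ u]
  have \<omega>: "C1_on UNIV (\<lambda>x. \<phi> x * u x)"
   and g: "grad (\<lambda>x. \<phi> x * u x) x = \<phi> x *\<^sub>R grad u x + u x *\<^sub>R grad \<phi> x" for x
    using E K(4) by auto
  have i: "integrable lborel (grad (\<lambda>x. \<phi> x * u x))" "(\<integral>x. grad (\<lambda>x. \<phi> x * u x) x \<partial>lborel) = 0"
    using integral_grad_compact_support[OF \<omega> K(1)] K(4) by auto
  have "continuous_on (\<Omega> \<union> - K) (\<lambda>x. \<phi> x *\<^sub>R grad u x)"
  proof (rule continuous_on_open_Un[OF O oK])
    show "continuous_on \<Omega> (\<lambda>x. \<phi> x *\<^sub>R grad u x)"
      by (intro continuous_intros C1_on_continuous u C1_on_subset[OF K(3)]) auto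
    show "continuous_on (- K) (\<lambda>x. \<phi> x *\<^sub>R grad u x)"
      by (rule continuous_on_eq[of _ "\<lambda>_. 0"]) (simp_all add: K(4))
  qed
  then have i1: "integrable lborel (\<lambda>x. \<phi> x *\<^sub>R grad u x)"
    using UV K(4) by (intro integrable_compact_support[OF K(1)]) auto
  have "integrable lborel (\<lambda>x. grad (\<lambda>x. \<phi> x * u x) x - \<phi> x *\<^sub>R grad u x)"
    by (intro Bochner_Integration.integrable_diff i i1)
  then have i2: "integrable lborel (\<lambda>x. u x *\<^sub>R grad \<phi> x)" by (simp add: g)
  have "(\<integral>x. \<phi> x *\<^sub>R grad u x \<partial>lborel) + (\<integral>x. u x *\<^sub>R grad \<phi> x \<partial>lborel) = 0"
    using i(2) i1 i2 by (simp add: g)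
  moreover have "(\<lambda>x. indicator \<Omega> x *\<^sub>R \<phi> x *\<^sub>R grad u x) = (\<lambda>x. \<phi> x *\<^sub>R grad u x)"
    "(\<lambda>x. indicator \<Omega> x *\<^sub>R u x *\<^sub>R grad \<phi> x) = (\<lambda>x. u x *\<^sub>R grad \<phi> x)"
  proof -
    show "(\<lambda>x. indicator \<Omega> x *\<^sub>R \<phi> x *\<^sub>R grad u x) = (\<lambda>x. \<phi> x *\<^sub>R grad u x)"
    proof
      fix x show "indicator \<Omega> x *\<^sub>R \<phi> x *\<^sub>R grad u x = \<phi> x *\<^sub>R grad u x"
        using K(2) K(4)[of x] by (cases "x \<in> K") auto
    qed
    show "(\<lambda>x. indicator \<Omega> x *\<^sub>R u x *\<^sub>R grad \<phi> x) = (\<lambda>x. u x *\<^sub>R grad \<phi> x)"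
    proof
      fix x show "indicator \<Omega> x *\<^sub>R u x *\<^sub>R grad \<phi> x = u x *\<^sub>R grad \<phi> x"
        using K(2) K(5)[of x] by (cases "x \<in> K") auto
    qed
  qed
  ultimately show "(LINT x:\<Omega>|lborel. u x *\<^sub>R grad \<phi> x) = - (LINT x:\<Omega>|lborel. \<phi> x *\<^sub>R grad u x)"
    by (simp add: set_lebesgue_integral_def add_eq_0_iff)
qed

lemma test_function_L2:
  assumes O: "\<Omega> \<in> sets borel" and "test_function \<Omega> \<phi>"
  shows "L2 \<Omega> \<phi>" "L2 \<Omega> (grad \<phi>)"
proof -
  obtain K where K: "compact K" "K \<subseteq> \<Omega>" "C1_on UNIV \<phi>"
    "\<And>x. x \<notin> K \<Longrightarrow> \<phi> x = 0" "\<And>x. x \<notin> K \<Longrightarrow> grad \<phi> x = 0" using assms(2) by (elim test_functionD) blast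
  show "L2 \<Omega> \<phi>" "L2 \<Omega> (grad \<phi>)"
    using L2_compact_support[OF O K(1)] K C1_on_continuous[OF K(3)] by auto
qed

text \<open>Weak gradients are closed under L2 convergence. Thus any limit of C1 functions with
  convergent gradients is an admissible test function in Green's formula.\<close>

lemma H1_grad_limit:
  assumes O: "open \<Omega>" and c: "\<And>n. C1_on UNIV (\<phi> n)"
    and l: "tendsto_L2 \<Omega> \<phi> v" and lg: "tendsto_L2 \<Omega> (\<lambda>n. grad (\<phi> n)) h"
  shows "H1_grad \<Omega> v h"
  unfolding H1_grad_def weak_gradient_def
proof (intro conjI allI impI)
  show "L2 \<Omega> v" "L2 \<Omega> h" using tendsto_L2D[OF l] tendsto_L2D[OF lg] by auto
  fix \<psi> assume t: "test_function \<Omega> \<psi>"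
  have b: "\<Omega> \<in> sets borel" using O by auto
  note T = test_function_L2[OF b t]
  have 1: "(\<lambda>n. \<integral>x. \<phi> n x *\<^sub>R grad \<psi> x \<partial>lebesgue_restr \<Omega>) \<longlonglongrightarrow> (\<integral>x. v x *\<^sub>R grad \<psi> x \<partial>lebesgue_restr \<Omega>)"
    by (rule tendsto_L2_bilinear[OF b l tendsto_L2_const[OF T(2)] bounded_bilinear_scaleR])
  have 2: "(\<lambda>n. \<integral>x. \<psi> x *\<^sub>R grad (\<phi> n) x \<partial>lebesgue_restr \<Omega>) \<longlonglongrightarrow> (\<integral>x. \<psi> x *\<^sub>R h x \<partial>lebesgue_restr \<Omega>)"
    by (rule tendsto_L2_bilinear[OF b tendsto_L2_const[OF T(1)] lg bounded_bilinear_scaleR])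
  have "(\<integral>x. \<phi> n x *\<^sub>R grad \<psi> x \<partial>lebesgue_restr \<Omega>) = - (\<integral>x. \<psi> x *\<^sub>R grad (\<phi> n) x \<partial>lebesgue_restr \<Omega>)" for n
    using weak_gradient_C1[OF O C1_on_subset[OF c]] t b by (simp add: weak_gradient_def set_lint_restr)
  with 1 tendsto_minus[OF 2] show "(LINT x:\<Omega>|lborel. v x *\<^sub>R grad \<psi> x) = - (LINT x:\<Omega>|lborel. \<psi> x *\<^sub>R h x)"
    using b by (simp add: set_lint_restr LIMSEQ_unique)
qed

text \<open>The positive and the negative part of \<open>F\<close> are densities of two measures
  that agree on boxes. Boxes generate the Borel sets and are stable under intersection, so the
  measures and hence the densities agree.\<close>

lemma AE_zero_if_box_integrals_zero:
  fixes F :: "'a::euclidean_space \<Rightarrow> real"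
  assumes F: "integrable lborel F" and z: "\<And>a b. (\<integral>x. indicator (box a b) x * F x \<partial>lborel) = 0"
  shows "AE x in lborel. F x = 0"
proof -
  have [measurable]: "F \<in> borel_measurable borel" using F by auto
  let ?M = "density lborel (\<lambda>x. ennreal (F x))" and ?N = "density lborel (\<lambda>x. ennreal (- F x))"
  have fin: "emeasure ?M (box a b) < \<infinity>" for a b
  proof -
    have "emeasure ?M (box a b) \<le> (\<integral>\<^sup>+x. ennreal (norm (F x)) \<partial>lborel)"
      by (auto simp: emeasure_density indicator_def intro!: nn_integral_mono ennreal_leI)
    also have "\<dots> < \<infinity>" using F by (simp add: integrable_iff_bounded)
    finally show ?thesis .
  qed
  have eqb: "emeasure ?M (box a b) = emeasure ?N (box a b)" for a b
  proof -
    let ?G = "\<lambda>x. indicator (box a b) x * F x"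
    have G: "integrable lborel ?G"
      using integrable_mult_indicator[OF _ F, of "box a b"] by simp
    have P: "integrable lborel (\<lambda>x. max 0 (?G x))" "integrable lborel (\<lambda>x. max 0 (- ?G x))"
      using G by auto
    have "(\<integral>x. ?G x \<partial>lborel) = (\<integral>x. max 0 (?G x) - max 0 (- ?G x) \<partial>lborel)"
      by (intro Bochner_Integration.integral_cong) auto
    also have "\<dots> = (\<integral>x. max 0 (?G x) \<partial>lborel) - (\<integral>x. max 0 (- ?G x) \<partial>lborel)"
      by (rule Bochner_Integration.integral_diff[OF P])
    finally have e: "(\<integral>x. max 0 (?G x) \<partial>lborel) = (\<integral>x. max 0 (- ?G x) \<partial>lborel)" using z by simp
    have m1: "ennreal (F x) * indicator (box a b) x = ennreal (max 0 (?G x))" for x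
      by (cases "0 \<le> F x") (simp_all add: indicator_def ennreal_neg)
    have m2: "ennreal (- F x) * indicator (box a b) x = ennreal (max 0 (- ?G x))" for x
      by (cases "0 \<le> F x") (simp_all add: indicator_def ennreal_neg)
    have "emeasure ?M (box a b) = (\<integral>\<^sup>+x. ennreal (max 0 (?G x)) \<partial>lborel)"
      by (subst emeasure_density) (simp_all only: m1 measurable_lborel1, measurable)
    also have "\<dots> = ennreal (\<integral>x. max 0 (?G x) \<partial>lborel)" by (rule nn_integral_eq_integral[OF P(1)]) simp
    also have "\<dots> = (\<integral>\<^sup>+x. ennreal (max 0 (- ?G x)) \<partial>lborel)"
      unfolding e by (rule nn_integral_eq_integral[OF P(2), symmetric]) simp
    also have "\<dots> = emeasure ?N (box a b)"
      by (subst emeasure_density) (simp_all only: m2 measurable_lborel1, measurable)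
    finally show ?thesis .
  qed
  let ?E = "range (\<lambda>(a, b). box a b :: 'a set)"
  obtain A where A: "range A \<subseteq> ?E" "(\<Union>i::nat. A i) = (UNIV :: 'a set)"
  proof
    show "range (\<lambda>n::nat. box (- (real n *\<^sub>R One)) (real n *\<^sub>R One) :: 'a set) \<subseteq> ?E" by auto
    show "(\<Union>i::nat. box (- (real i *\<^sub>R One)) (real i *\<^sub>R One) :: 'a set) = UNIV"
      by (rule UN_box_eq_UNIV)
  qed
  have "?M = ?N"
  proof (rule measure_eqI_generator_eq[where E = ?E and \<Omega> = UNIV and A = A])
    show "Int_stable ?E"
    proof (rule Int_stableI)
      fix X Y assume "X \<in> ?E" "Y \<in> ?E"
      then obtain a b c d :: 'a where "X = box a b" "Y = box c d" by auto
      then obtain p q where "X \<inter> Y = box p q" using box_Int_box by blast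
      then show "X \<inter> Y \<in> ?E" by (intro image_eqI[of _ _ "(p, q)"]) auto
    qed
    show "emeasure ?M X = emeasure ?N X" if "X \<in> ?E" for X using that eqb by auto
    show "sets ?M = sigma_sets UNIV ?E" "sets ?N = sigma_sets UNIV ?E"
      by (simp_all add: borel_eq_box)
    show "emeasure ?M (A i) \<noteq> \<infinity>" for i
    proof -
      have "A i \<in> ?E" using A(1) by blast
      then obtain a b where "A i = box a b" by auto
      then show ?thesis using fin[of a b] by simp
    qed
  qed (use A in auto)
  \<comment> \<open>Negative numbers are truncated to 0 by \<open>ennreal\<close>; one side of this
    equation is therefore 0, and so is the other.\<close>
  then have "AE x in lborel. ennreal (F x) = ennreal (- F x)"
    by (intro sigma_finite_measure.density_unique[OF sigma_finite_lborel]) auto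
  then show ?thesis
  proof eventually_elim
    case (elim x)
    then show ?case
    proof (cases "0 \<le> F x")
      case True
      then have "ennreal (- F x) = 0" by (simp add: ennreal_neg)
      then have "ennreal (F x) = 0" using elim by metis
      then show ?thesis using True by (simp add: ennreal_eq_0_iff)
    next
      case False
      then have "ennreal (F x) = 0" by (simp add: ennreal_neg)
      then have "ennreal (- F x) = 0" using elim by metis
      then show ?thesis using False by (simp add: ennreal_eq_0_iff)
    qed
  qed
qed

text \<open>The fundamental lemma of the calculus of variations: indicators of boxes are bounded
  limits of test functions, vanishing box integrals force \<open>k = 0\<close> almost everywhere in
  each box, and countably many boxes cover \<Omega>.\<close>

lemma AE_zero_if_test_integrals_zero:
  fixes k :: "real \<times> real \<Rightarrow> real \<times> real"
  assumes O: "open \<Omega>" and k: "L2 \<Omega> k"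
    and z: "\<And>\<phi>. test_function \<Omega> \<phi> \<Longrightarrow> (\<integral>x. \<phi> x *\<^sub>R k x \<partial>lebesgue_restr \<Omega>) = 0"
  shows "AE x in lebesgue_restr \<Omega>. k x = 0"
proof -
  have b: "\<Omega> \<in> sets borel" using O by auto
  have box: "(\<integral>x. indicator (box a c) x *\<^sub>R k x \<partial>lebesgue_restr \<Omega>) = 0" if sub: "cbox a c \<subseteq> \<Omega>" for a c
  proof -
    \<comment> \<open>One factor for each side of the box: it is 0 beyond that side and reaches 1 at
      distance \<open>1 / (2 * n)\<close> inside.\<close>
    define \<phi> where "\<phi> n x = (1 - zeta (real n * (fst x - fst a))) * (1 - zeta (real n * (fst c - fst x))) *
       ((1 - zeta (real n * (snd x - snd a))) * (1 - zeta (real n * (snd c - snd x))))" for n x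
    have C1aff: "C1_on UNIV (\<lambda>x. 1 - zeta (p * fst x + q * snd x + r))" for p q r
      by (intro C1_on_diff C1_const C1_compose_real(1)[OF open_UNIV _ DERIV_zeta continuous_zeta_deriv]
            C1_on_add C1_on_cmult C1_fst C1_snd open_UNIV)
    have c1: "C1_on UNIV (\<phi> n)" for n
    proof -
      have "\<phi> n = (\<lambda>x. (1 - zeta (real n * fst x + 0 * snd x + (- real n * fst a))) * (1 - zeta (- real n * fst x + 0 * snd x + real n * fst c)) *
         ((1 - zeta (0 * fst x + real n * snd x + (- real n * snd a))) * (1 - zeta (0 * fst x + - real n * snd x + real n * snd c))))"
        by (auto simp: \<phi>_def fun_eq_iff algebra_simps)
      then show ?thesis by (simp only:) (intro C1_on_mult(1) open_UNIV C1aff)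
    qed
    have b1: "0 \<le> 1 - zeta t" "1 - zeta t \<le> 1" for t using zeta_bounds[of t] by auto
    have out: "\<phi> n x = 0" if "x \<notin> box a c" for n x
    proof -
      from that consider "fst x \<le> fst a" | "fst c \<le> fst x" | "snd x \<le> snd a" | "snd c \<le> snd x"
        by (cases x, cases a, cases c) (fastforce simp: mem_box Basis_prod_def)
      then show ?thesis by cases (auto simp: \<phi>_def zeta_eq_1 mult_nonneg_nonpos)
    qed
    have le1: "\<bar>\<phi> n x\<bar> \<le> 1" for n x
      unfolding \<phi>_def abs_mult using b1 by (intro mult_le_one mult_nonneg_nonneg abs_ge_zero) (auto simp: abs_le_iff)
    have le: "\<bar>\<phi> n x\<bar> \<le> indicator (box a c) x" for n x
      using le1[of n x] out[of x n] by (auto simp: indicator_def)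
    have t: "test_function \<Omega> (\<phi> n)" for n
      by (rule test_functionI[OF c1 compact_cbox sub]) (use out box_subset_cbox in blast)
    have zt: "(\<lambda>n. 1 - zeta (real n * d)) \<longlonglongrightarrow> 1" if "0 < d" for d
    proof -
      obtain N :: nat where "1 / (2 * d) < real N" using reals_Archimedean2 by blast
      then have "zeta (real n * d) = 0" if "n \<ge> N" for n
      proof -
        have "1 / (2 * d) \<le> real n" using \<open>1 / (2 * d) < real N\<close> that by linarith
        then show ?thesis using \<open>0 < d\<close> by (intro zeta_eq_0(1)) (simp add: field_simps)
      qed
      then have "\<forall>\<^sub>F n in sequentially. 1 - zeta (real n * d) = 1"
        by (auto simp: eventually_sequentially)
      then show ?thesis by (rule tendsto_eventually)
    qed
    have lim: "(\<lambda>n. \<phi> n x) \<longlonglongrightarrow> indicator (box a c) x" for x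
    proof (cases "x \<in> box a c")
      case True
      then have "fst a < fst x" "fst x < fst c" "snd a < snd x" "snd x < snd c"
        by (cases x; cases a; cases c; force simp: mem_box Basis_prod_def)+
      then have "(\<lambda>n. \<phi> n x) \<longlonglongrightarrow> 1 * 1 * (1 * 1)"
        unfolding \<phi>_def by (intro tendsto_mult zt) auto
      then show ?thesis using True by simp
    next
      case False
      then show ?thesis using out[OF False] by simp
    qed
    have "L2 (cbox a c) k" by (rule L2_subset(1)[OF b _ sub k]) simp
    then have "integrable (lebesgue_restr (cbox a c)) k"
      using L2_product(1)[of "cbox a c" "\<lambda>_. 1::real" k k 1] L2_const[of "cbox a c" "\<lambda>_. 1::real" 1]
      by (simp add: L2_measurable emeasure_lborel_cbox_eq)
    then have "integrable lborel (\<lambda>x. indicator (cbox a c) x *\<^sub>R k x)"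
      by (simp add: integrable_restrict_space)
    then have "integrable (lebesgue_restr \<Omega>) (\<lambda>x. indicator (cbox a c) x *\<^sub>R k x)"
      using b integrable_mult_indicator[of \<Omega> lborel "\<lambda>x. indicator (cbox a c) x *\<^sub>R k x"]
      by (simp add: integrable_restrict_space)
    then have dom: "integrable (lebesgue_restr \<Omega>) (\<lambda>x. norm (indicator (cbox a c) x *\<^sub>R k x))"
      by (rule integrable_norm)
    have mk: "k \<in> borel_measurable (lebesgue_restr \<Omega>)" by (rule L2_measurable[OF b k])
    have "(\<lambda>n. \<integral>x. \<phi> n x *\<^sub>R k x \<partial>lebesgue_restr \<Omega>) \<longlonglongrightarrow> (\<integral>x. indicator (box a c) x *\<^sub>R k x \<partial>lebesgue_restr \<Omega>)"
    proof (rule integral_dominated_convergence[OF _ _ dom])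
      show "(\<lambda>x. indicator (box a c) x *\<^sub>R k x) \<in> borel_measurable (lebesgue_restr \<Omega>)"
        by (rule borel_measurable_scaleR[OF borel_measurable_restr mk]) simp
      show "(\<lambda>x. \<phi> n x *\<^sub>R k x) \<in> borel_measurable (lebesgue_restr \<Omega>)" for n
        by (rule borel_measurable_scaleR[OF borel_measurable_restr mk]) (rule C1_measurable(1)[OF c1])
      show "AE x in lebesgue_restr \<Omega>. (\<lambda>n. \<phi> n x *\<^sub>R k x) \<longlonglongrightarrow> indicator (box a c) x *\<^sub>R k x"
        by (intro AE_I2 tendsto_scaleR lim tendsto_const)
      show "AE x in lebesgue_restr \<Omega>. norm (\<phi> n x *\<^sub>R k x) \<le> norm (indicator (cbox a c) x *\<^sub>R k x)" for n
      proof (rule AE_I2)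
        fix x
        have "\<bar>\<phi> n x\<bar> \<le> indicator (cbox a c) x"
          using le1[of n x] out[of x n] subsetD[OF box_subset_cbox, of x a c]
          by (cases "x \<in> box a c") (auto simp: indicator_def)
        then show "norm (\<phi> n x *\<^sub>R k x) \<le> norm (indicator (cbox a c) x *\<^sub>R k x)"
          by (simp add: mult_right_mono)
      qed
    qed
    moreover have "(\<integral>x. \<phi> n x *\<^sub>R k x \<partial>lebesgue_restr \<Omega>) = 0" for n by (rule z[OF t])
    ultimately show ?thesis using LIMSEQ_unique[OF _ tendsto_const] by fastforce
  qed
  have aebox: "AE x in lborel. x \<in> box a c \<longrightarrow> k x = 0" if sub: "cbox a c \<subseteq> \<Omega>" for a c
  proof -
    let ?F = "\<lambda>x. indicator (box a c) x *\<^sub>R k x"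
    have "L2 (box a c) k" by (rule L2_subset(1)[OF b _ _ k]) (use sub box_subset_cbox in auto)
    then have "integrable (lebesgue_restr (box a c)) k"
      using L2_product(1)[of "box a c" "\<lambda>_. 1::real" k k 1] L2_const[of "box a c" "\<lambda>_. 1::real" 1]
      by (simp add: L2_measurable emeasure_lborel_box_eq)
    then have iF: "integrable lborel ?F" by (simp add: integrable_restrict_space)
    have zF: "(\<integral>x. indicator (box a' c') x *\<^sub>R ?F x \<partial>lborel) = 0" for a' c'
    proof -
      \<comment> \<open>The intersection is again a box whose closure lies in \<Omega>, and only for
        such boxes have the integrals been shown to vanish.\<close>
      obtain p q where pq: "box a' c' \<inter> box a c = box p q" using box_Int_box by blast
      have "cbox p q \<subseteq> \<Omega> \<or> box p q = {}"
      proof (cases "box p q = {}")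
        case False
        then have "cbox p q = closure (box p q)" by simp
        also have "\<dots> \<subseteq> cbox a c" by (rule closure_minimal) (use pq box_subset_cbox in auto)
        finally show ?thesis using sub by auto
      qed simp
      then have "(\<integral>x. indicator (box p q) x *\<^sub>R k x \<partial>lebesgue_restr \<Omega>) = 0"
        by (elim disjE) (rule box, assumption, simp)
      also have "(\<integral>x. indicator (box p q) x *\<^sub>R k x \<partial>lebesgue_restr \<Omega>) = (\<integral>x. indicator (box a' c') x *\<^sub>R ?F x \<partial>lborel)"
      proof -
        have "indicator \<Omega> x *\<^sub>R indicator (box p q) x *\<^sub>R k x = indicator (box a' c') x *\<^sub>R ?F x" for x
        proof -
          have "x \<in> box p q \<longleftrightarrow> x \<in> box a' c' \<and> x \<in> box a c" using pq by blast
          moreover have "x \<in> box a c \<Longrightarrow> x \<in> \<Omega>" using sub box_subset_cbox[of a c] by blast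
          ultimately show ?thesis by (auto simp: indicator_def)
        qed
        then show ?thesis
          by (subst integral_restrict_space) (use b in simp, simp only:)
      qed
      finally show ?thesis .
    qed
    have iF': "integrable lborel (\<lambda>x. indicator (box a' c') x *\<^sub>R ?F x)" for a' c'
      using integrable_mult_indicator[OF _ iF, of "box a' c'"] by simp
    have "(\<integral>x. indicator (box a' c') x * fst (?F x) \<partial>lborel) = 0"
         "(\<integral>x. indicator (box a' c') x * snd (?F x) \<partial>lborel) = 0" for a' c'
      using integral_fst[OF iF'[of a' c']] integral_snd[OF iF'[of a' c']] zF[of a' c'] by (simp_all add: mult.assoc)
    then have "AE x in lborel. fst (?F x) = 0" "AE x in lborel. snd (?F x) = 0"
      using AE_zero_if_box_integrals_zero[OF integrable_fst[OF iF]] AE_zero_if_box_integrals_zero[OF integrable_snd[OF iF]]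
      by blast+
    then show ?thesis by eventually_elim (auto simp: prod_eq_iff)
  qed
  obtain D where D: "countable D" "D \<subseteq> Pow \<Omega>" "\<And>X. X \<in> D \<Longrightarrow> \<exists>a b. X = box a b" "\<Union>D = \<Omega>"
    using open_countable_Union_open_box[OF O] by metis
  obtain D' where D': "countable D'" "D' \<subseteq> Pow \<Omega>" "\<And>X. X \<in> D' \<Longrightarrow> \<exists>a b. X = cbox a b" "\<Union>D' = \<Omega>"
    using open_countable_Union_open_cbox[OF O] by metis
  have "AE x in lborel. \<forall>X\<in>D'. x \<in> interior X \<longrightarrow> k x = 0"
  proof (subst AE_ball_countable[OF D'(1)], intro ballI)
    fix X assume X: "X \<in> D'"
    then obtain a c where "X = cbox a c" using D'(3) by blast
    then show "AE x in lborel. x \<in> interior X \<longrightarrow> k x = 0" using aebox[of a c] D'(2) X by auto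
  qed
  \<comment> \<open>The closed boxes cover \<Omega>, but \<open>k = 0\<close> is known only in their
    interiors; the countably many frontiers form a null set.\<close>
  moreover have "AE x in lborel. \<forall>X\<in>D'. x \<notin> frontier X"
  proof (subst AE_ball_countable[OF D'(1)], intro ballI)
    fix X assume X: "X \<in> D'"
    then obtain a c where X: "X = cbox a c" using D'(3) by blast
    have "negligible (frontier X)" unfolding X by (rule negligible_convex_frontier) (simp add: convex_box)
    moreover have "frontier X \<in> sets borel" by simp
    ultimately have "frontier X \<in> null_sets lborel"
      by (simp add: negligible_iff_null_sets null_sets_completion_iff)
    then show "AE x in lborel. x \<notin> frontier X" by (rule AE_not_in)
  qed
  ultimately have "AE x in lborel. x \<in> \<Omega> \<longrightarrow> k x = 0"
  proof eventually_elim
    case (elim x)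
    show ?case
    proof
      assume "x \<in> \<Omega>"
      then obtain X where X: "X \<in> D'" "x \<in> X" using D'(4) by auto
      then have "x \<in> interior X" using elim(2) by (auto simp: frontier_def dest: subsetD[OF closure_subset])
      then show "k x = 0" using elim(1) X by auto
    qed
  qed
  then show ?thesis using b by (simp add: AE_restrict_space_iff)
qed

text \<open>Each trace condition and each weak equation carries a gradient of its own; they have to
  be identified before they can be combined.\<close>

lemma weak_gradient_unique:
  assumes O: "open \<Omega>" and g: "L2 \<Omega> g" "weak_gradient \<Omega> u g" and h: "L2 \<Omega> h" "weak_gradient \<Omega> u h"
  shows "AE x in lebesgue_restr \<Omega>. g x = h x"
proof -
  have b: "\<Omega> \<in> sets borel" using O by auto
  have "AE x in lebesgue_restr \<Omega>. g x - h x = 0"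
  proof (rule AE_zero_if_test_integrals_zero[OF O L2_diff(1)[OF b g(1) h(1)]])
    fix \<phi> assume t: "test_function \<Omega> \<phi>"
    have i: "integrable (lebesgue_restr \<Omega>) (\<lambda>x. \<phi> x *\<^sub>R f x)" if "L2 \<Omega> f" for f :: "real \<times> real \<Rightarrow> real \<times> real"
      using L2_product(1)[OF b test_function_L2(1)[OF b t] that, of "\<lambda>x. \<phi> x *\<^sub>R f x" 1]
        L2_measurable[OF b that] L2_measurable[OF b test_function_L2(1)[OF b t]] by auto
    have "(\<integral>x. \<phi> x *\<^sub>R g x \<partial>lebesgue_restr \<Omega>) = (\<integral>x. \<phi> x *\<^sub>R h x \<partial>lebesgue_restr \<Omega>)"
      using g(2) h(2) t b unfolding weak_gradient_def by (simp add: set_lint_restr)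
    then show "(\<integral>x. \<phi> x *\<^sub>R (g x - h x) \<partial>lebesgue_restr \<Omega>) = 0"
      using i[OF g(1)] i[OF h(1)] by (simp add: scaleR_diff_right)
  qed
  then show ?thesis by simp
qed

section \<open>Domains below height one and above a graph\<close>

definition channel :: "(real \<Rightarrow> real) \<Rightarrow> (real \<times> real) set" where
  "channel b = {(s, t). 0 < s \<and> s < 1 \<and> b s < t \<and> t < 1}"

definition layer :: "(real \<Rightarrow> real) \<Rightarrow> real \<Rightarrow> (real \<times> real) set" where
  "layer b r = {(s, t). 0 < s \<and> s < 1 \<and> b s < t \<and> t < 1 \<and> t < b s + r}"

text \<open>Traces are deliberately left out: conditions on the bottom and on the top are added as
  convergence of restrictions of the same sequence, so that several of them can be imposed
  together.\<close>

definition C1_approx ::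
    "(real \<times> real) set \<Rightarrow> (nat \<Rightarrow> real \<times> real \<Rightarrow> real) \<Rightarrow> (real \<times> real \<Rightarrow> real) \<Rightarrow> (real \<times> real \<Rightarrow> real \<times> real) \<Rightarrow> bool" where
  "C1_approx \<Omega> \<phi> v h \<longleftrightarrow> (\<forall>n. C1_on UNIV (\<phi> n)) \<and> tendsto_L2 \<Omega> \<phi> v \<and> tendsto_L2 \<Omega> (\<lambda>n. grad (\<phi> n)) h"

lemma C1_approxD:
  assumes "C1_approx \<Omega> \<phi> v h"
  shows "C1_on UNIV (\<phi> n)" "tendsto_L2 \<Omega> \<phi> v" "tendsto_L2 \<Omega> (\<lambda>n. grad (\<phi> n)) h"
  using assms by (auto simp: C1_approx_def)

lemma C1_approx_H1: "open \<Omega> \<Longrightarrow> C1_approx \<Omega> \<phi> v h \<Longrightarrow> H1_grad \<Omega> v h"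
  by (auto simp: C1_approx_def intro: H1_grad_limit)

lemma has_traceI:
  assumes "open \<Omega>" "C1_approx \<Omega> \<phi> v h" "tendsto_L2 {0<..<1} (\<lambda>n s. \<phi> n (s, c s)) t"
  shows "has_trace \<Omega> c v t"
  unfolding has_trace_def using C1_approx_H1[OF assms(1,2)] assms(2,3) by (auto simp: C1_approx_def)

text \<open>By uniqueness of weak gradients the approximants that witness the trace also converge to
  the prescribed gradient \<open>h\<close>.\<close>

lemma has_traceD:
  assumes O: "open \<Omega>" and t: "has_trace \<Omega> c v t" and h: "H1_grad \<Omega> v h"
  obtains \<phi> where "C1_approx \<Omega> \<phi> v h" "tendsto_L2 {0<..<1} (\<lambda>n s. \<phi> n (s, c s)) t"
proof -
  have b: "\<Omega> \<in> sets borel" using O by auto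
  from t obtain g \<phi> where g: "H1_grad \<Omega> v g" and \<phi>: "\<And>n. C1_on UNIV (\<phi> n)" "tendsto_L2 \<Omega> \<phi> v"
      "tendsto_L2 \<Omega> (\<lambda>n. grad (\<phi> n)) g" "tendsto_L2 {0<..<1} (\<lambda>n s. \<phi> n (s, c s)) t"
    unfolding has_trace_def by blast
  have "AE x in lebesgue_restr \<Omega>. g x = h x"
    using g h by (intro weak_gradient_unique[OF O]) (auto simp: H1_grad_def)
  then have "tendsto_L2 \<Omega> (\<lambda>n. grad (\<phi> n)) h"
    using h by (intro tendsto_L2_cong_AE[OF b \<phi>(3)]) (auto simp: H1_grad_def L2_measurable[OF b])
  then show thesis using \<phi> by (intro that[of \<phi>]) (auto simp: C1_approx_def)
qed

lemma C1_approx_lincomb: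
  assumes O: "open \<Omega>" and \<phi>: "C1_approx \<Omega> \<phi> v g" and \<psi>: "C1_approx \<Omega> \<psi> w h"
  shows "C1_approx \<Omega> (\<lambda>n x. \<phi> n x - \<psi> n x) (\<lambda>x. v x - w x) (\<lambda>x. g x - h x)"
proof -
  have b: "\<Omega> \<in> sets borel" using O by auto
  have "grad (\<lambda>x. \<phi> n x - \<psi> n x) = (\<lambda>x. grad (\<phi> n) x - grad (\<psi> n) x)" for n
    using C1_on_diff(2)[OF open_UNIV C1_approxD(1)[OF \<phi>] C1_approxD(1)[OF \<psi>]] by auto
  then show ?thesis
    using C1_on_diff(1)[OF open_UNIV C1_approxD(1)[OF \<phi>] C1_approxD(1)[OF \<psi>]]
      tendsto_L2_diff[OF b C1_approxD(2)[OF \<phi>] C1_approxD(2)[OF \<psi>]]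
      tendsto_L2_diff[OF b C1_approxD(3)[OF \<phi>] C1_approxD(3)[OF \<psi>]]
    by (simp add: C1_approx_def)
qed

text \<open>The compact set around \<Omega> serves to bound \<open>k\<close> and
  \<open>grad k\<close>, which makes multiplication by \<open>k\<close> continuous in H1.\<close>

lemma C1_approx_mult:
  assumes O: "open \<Omega>" and K: "compact K" "\<Omega> \<subseteq> K" and k: "C1_on UNIV k" and \<phi>: "C1_approx \<Omega> \<phi> v h"
  shows "C1_approx \<Omega> (\<lambda>n x. k x * \<phi> n x) (\<lambda>x. k x * v x) (\<lambda>x. k x *\<^sub>R h x + v x *\<^sub>R grad k x)"
proof -
  have b: "\<Omega> \<in> sets borel" using O by auto
  note kc = C1_on_continuous[OF k]
  obtain C where C: "\<And>x. x \<in> K \<Longrightarrow> norm (k x) \<le> C"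
    using compact_imp_bounded[OF compact_continuous_image[OF continuous_on_subset[OF kc(1) subset_UNIV] K(1)]]
    by (auto simp: bounded_iff)
  obtain C' where C': "\<And>x. x \<in> K \<Longrightarrow> norm (grad k x) \<le> C'"
    using compact_imp_bounded[OF compact_continuous_image[OF continuous_on_subset[OF kc(2) subset_UNIV] K(1)]]
    by (auto simp: bounded_iff)
  have mk: "k \<in> borel_measurable (lebesgue_restr \<Omega>)"
    by (intro borel_measurable_restr C1_measurable k)
  have mg: "grad k \<in> borel_measurable (lebesgue_restr \<Omega>)"
    by (intro borel_measurable_restr C1_measurable k)
  have 1: "tendsto_L2 \<Omega> (\<lambda>n x. k x *\<^sub>R \<phi> n x) (\<lambda>x. k x *\<^sub>R v x)"
    by (rule tendsto_L2_mult[OF b C1_approxD(2)[OF \<phi>] mk]) (use C K(2) in auto)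
  have 2: "tendsto_L2 \<Omega> (\<lambda>n x. k x *\<^sub>R grad (\<phi> n) x) (\<lambda>x. k x *\<^sub>R h x)"
    by (rule tendsto_L2_mult[OF b C1_approxD(3)[OF \<phi>] mk]) (use C K(2) in auto)
  note D = tendsto_L2D[OF C1_approxD(2)[OF \<phi>]]
  have L: "L2 \<Omega> (\<lambda>x. u x *\<^sub>R grad k x)" and N: "L2_norm \<Omega> (\<lambda>x. u x *\<^sub>R grad k x) \<le> max C' 0 * L2_norm \<Omega> u" if "L2 \<Omega> u" for u
  proof -
    have m: "(\<lambda>x. u x *\<^sub>R grad k x) \<in> borel_measurable (lebesgue_restr \<Omega>)"
      using mg L2_measurable[OF b that] by (intro borel_measurable_scaleR)
    have "norm (u x *\<^sub>R grad k x) \<le> max C' 0 * norm (u x)" if "x \<in> \<Omega>" for x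
    proof -
      have "norm (grad k x) \<le> max C' 0" using C'[of x] K(2) that by auto
      then have "norm (grad k x) * norm (u x) \<le> max C' 0 * norm (u x)" by (rule mult_right_mono) simp
      then show ?thesis by (simp add: mult.commute)
    qed
    from L2_bound[OF b m that this]
    show "L2 \<Omega> (\<lambda>x. u x *\<^sub>R grad k x)" "L2_norm \<Omega> (\<lambda>x. u x *\<^sub>R grad k x) \<le> max C' 0 * L2_norm \<Omega> u" by auto
  qed
  have 3: "tendsto_L2 \<Omega> (\<lambda>n x. \<phi> n x *\<^sub>R grad k x) (\<lambda>x. v x *\<^sub>R grad k x)"
  proof (rule tendsto_L2I)
    show "L2_norm \<Omega> (\<lambda>x. \<phi> n x *\<^sub>R grad k x - v x *\<^sub>R grad k x) \<le> max C' 0 * L2_norm \<Omega> (\<lambda>x. \<phi> n x - v x)" for n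
      using N[OF L2_diff(1)[OF b D(1,2)], of n] by (simp add: scaleR_diff_left)
    show "(\<lambda>n. max C' 0 * L2_norm \<Omega> (\<lambda>x. \<phi> n x - v x)) \<longlonglongrightarrow> 0"
      using tendsto_mult_left[OF D(3), of "max C' 0"] by simp
    show "L2 \<Omega> (\<lambda>x. \<phi> n x *\<^sub>R grad k x)" for n by (rule L[OF D(1)])
    show "L2 \<Omega> (\<lambda>x. v x *\<^sub>R grad k x)" by (rule L[OF D(2)])
  qed
  have g: "grad (\<lambda>x. k x * \<phi> n x) = (\<lambda>x. k x *\<^sub>R grad (\<phi> n) x + \<phi> n x *\<^sub>R grad k x)" for n
    using C1_on_mult(2)[OF open_UNIV k C1_approxD(1)[OF \<phi>]] by auto
  show ?thesis
    unfolding C1_approx_def g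
    using C1_on_mult(1)[OF open_UNIV k C1_approxD(1)[OF \<phi>]] 1 tendsto_L2_add[OF b 2 3] by simp
qed

text \<open>The right end \<open>d\<close> of the energy integral is kept apart from
  \<open>t\<close>, so that this integral is a constant when the estimate is later integrated in
  \<open>t\<close>. It may be infinite.\<close>

lemma Cauchy_Schwarz_increment:
  fixes F :: "real \<Rightarrow> real"
  assumes D: "\<And>x. a \<le> x \<Longrightarrow> x \<le> t \<Longrightarrow> (F has_real_derivative F' x) (at x)" and c: "continuous_on {a..t} F'"
    and t: "a < t" "t \<le> d"
  shows "ennreal ((F t - F a)\<^sup>2) \<le> ennreal (t - a) * (\<integral>\<^sup>+x. ennreal ((F' x)\<^sup>2) * indicator {a<..<d} x \<partial>lborel)"
proof -
  let ?M = "lebesgue_restr {a..t}"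
  have b: "{a..t} \<in> sets borel" by simp
  have m: "F' \<in> borel_measurable ?M"
    using borel_measurable_continuous_on_indicator[OF b c] b
    by (simp add: borel_measurable_restrict_space_iff)
  have i2: "integrable ?M (\<lambda>x. (F' x)\<^sup>2)"
    using borel_integrable_compact[OF compact_Icc, of a t "\<lambda>x. (F' x)\<^sup>2"] c
    by (simp add: integrable_restrict_space continuous_on_power)
  have i1: "integrable ?M (\<lambda>x. (1::real)\<^sup>2)"
    using borel_integrable_compact[OF compact_Icc, of a t "\<lambda>x. 1::real"] by (simp add: integrable_restrict_space)
  have "F t - F a = (\<integral>x. indicator {a..t} x *\<^sub>R F' x \<partial>lborel)"
    by (rule integral_FTC_Icc[symmetric])
       (use D c t in \<open>auto simp: has_real_derivative_iff_has_vector_derivative[symmetric] intro: has_field_derivative_at_within\<close>)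
  also have "\<dots> = (\<integral>x. F' x * 1 \<partial>?M)" by (simp add: integral_restrict_space)
  finally have "\<bar>F t - F a\<bar> \<le> sqrt (\<integral>x. (F' x)\<^sup>2 \<partial>?M) * sqrt (\<integral>x. 1\<^sup>2 \<partial>?M)"
    using Cauchy_Schwarz_integral(2)[OF m _ i2 i1] by simp
  then have "(F t - F a)\<^sup>2 \<le> (sqrt (\<integral>x. (F' x)\<^sup>2 \<partial>?M) * sqrt (\<integral>x. 1\<^sup>2 \<partial>?M))\<^sup>2"
    by (metis abs_ge_zero power2_abs power_mono)
  also have "\<dots> = (\<integral>x. (F' x)\<^sup>2 \<partial>?M) * (\<integral>x. 1 \<partial>?M)" by (simp add: power_mult_distrib)
  also have "(\<integral>x. 1 \<partial>?M) = t - a" using t by (simp add: measure_restrict_space)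
  finally have "ennreal ((F t - F a)\<^sup>2) \<le> ennreal ((t - a) * (\<integral>x. (F' x)\<^sup>2 \<partial>?M))"
    by (intro ennreal_leI) (simp add: mult.commute)
  also have "\<dots> = ennreal (t - a) * ennreal (\<integral>x. (F' x)\<^sup>2 \<partial>?M)" using t by (simp add: ennreal_mult)
  also have "ennreal (\<integral>x. (F' x)\<^sup>2 \<partial>?M) = (\<integral>\<^sup>+x. ennreal ((F' x)\<^sup>2) \<partial>?M)"
    by (rule nn_integral_eq_integral[symmetric, OF i2]) simp
  also have "\<dots> = (\<integral>\<^sup>+x. ennreal ((F' x)\<^sup>2) * indicator {a..t} x \<partial>lborel)"
    by (simp add: nn_integral_restrict_space)
  also have "\<dots> \<le> (\<integral>\<^sup>+x. ennreal ((F' x)\<^sup>2) * indicator {a<..<d} x \<partial>lborel)"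
  proof (rule nn_integral_mono_AE)
    show "AE x in lborel. ennreal ((F' x)\<^sup>2) * indicator {a..t} x \<le> ennreal ((F' x)\<^sup>2) * indicator {a<..<d} x"
      using AE_lborel_singleton[of a] AE_lborel_singleton[of t]
      by eventually_elim (use t in \<open>auto simp: indicator_def\<close>)
  qed
  finally show ?thesis by (simp add: mult_left_mono)
qed

text \<open>Three bottoms are treated alike: the rough one, the flat one
  \<open>\<lambda>_. 0\<close>, and \<open>f\<close> itself for the part of the cell below height
  1.\<close>

locale graph_domain =
  fixes b :: "real \<Rightarrow> real"
  assumes cont_b: "continuous_on UNIV b" and b_ge: "\<And>s. -1 \<le> b s" and b_le: "\<And>s. b s \<le> 0"
begin

lemma b_measurable [measurable]: "b \<in> borel_measurable borel"
  by (rule borel_measurable_continuous_onI[OF cont_b])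

lemma open_above: "open {x. b (fst x) + c < snd x}"
proof -
  have "continuous_on UNIV (\<lambda>x. b (fst x) + c)"
    by (intro continuous_intros continuous_on_compose2[OF cont_b]) auto
  then show ?thesis by (intro open_Collect_less) (auto intro!: continuous_intros)
qed

lemma open_below: "open {x. snd x < b (fst x) + c}"
proof -
  have "continuous_on UNIV (\<lambda>x. b (fst x) + c)"
    by (intro continuous_intros continuous_on_compose2[OF cont_b]) auto
  then show ?thesis by (intro open_Collect_less) (auto intro!: continuous_intros)
qed

lemma layer_eq: "layer b r = {x. 0 < fst x} \<inter> {x. fst x < 1} \<inter> {x. snd x < 1} \<inter> {x. b (fst x) + 0 < snd x} \<inter> {x. snd x < b (fst x) + r}"
  by (auto simp: layer_def)

text \<open>Heights above the graph stay below 2, so the truncation is void. Estimates on layers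
  thereby contain those on the whole channel.\<close>

lemma channel_eq_layer: "channel b = layer b 3"
proof -
  have "t < b s + 3" if "t < 1" for s t using b_ge[of s] that by linarith
  then show ?thesis by (auto simp: layer_def channel_def)
qed

lemma open_layer: "open (layer b r)"
  unfolding layer_eq by (intro open_Int open_above open_below open_Collect_less continuous_intros)

lemma layer_borel [measurable]: "layer b r \<in> sets borel" using open_layer by auto

lemma open_channel: "open (channel b)" unfolding channel_eq_layer by (rule open_layer)

lemma channel_borel [measurable]: "channel b \<in> sets borel" using open_channel by auto

lemma layer_subset: "layer b r \<subseteq> channel b" by (auto simp: layer_def channel_def)

definition closed_region :: "(real \<times> real) set" where
  "closed_region = {x. 0 \<le> fst x} \<inter> {x. fst x \<le> 1} \<inter> {x. snd x \<le> 1} \<inter> {x. b (fst x) \<le> snd x}"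

lemma compact_closed_region: "compact closed_region" and channel_subset_closed_region: "channel b \<subseteq> closed_region"
proof -
  have c: "continuous_on UNIV (\<lambda>x :: real \<times> real. b (fst x))"
    by (intro continuous_on_compose2[OF cont_b] continuous_intros) auto
  have "closed closed_region"
    unfolding closed_region_def by (intro closed_Int closed_Collect_le continuous_intros c)
  moreover have "closed_region \<subseteq> cbox (0, -1) (1, 1)"
  proof
    fix x assume "x \<in> closed_region"
    then show "x \<in> cbox (0, -1) (1, 1)"
      using b_ge[of "fst x"] by (cases x) (auto simp: closed_region_def cbox_Pair_eq)
  qed
  ultimately show "compact closed_region"
    by (meson bounded_cbox bounded_subset compact_eq_bounded_closed)
  show "channel b \<subseteq> closed_region" by (auto simp: channel_def closed_region_def)
qed

lemma emeasure_channel: "emeasure lborel (channel b) < \<infinity>"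
proof -
  have "emeasure lborel (channel b) \<le> emeasure lborel closed_region"
    by (intro emeasure_mono channel_subset_closed_region) (use compact_closed_region in \<open>auto intro: borel_compact\<close>)
  also have "\<dots> < \<infinity>" by (rule emeasure_compact_finite[OF compact_closed_region, simplified infinity_ennreal_def[symmetric]])
  finally show ?thesis .
qed

lemma L2_continuous:
  fixes u :: "real \<times> real \<Rightarrow> 'b::euclidean_space"
  assumes u: "continuous_on S u" "open S" "closed_region \<subseteq> S"
  shows "L2 (channel b) u" "integrable (lebesgue_restr (channel b)) u"
proof -
  have "bounded (u ` closed_region)"
    by (rule compact_imp_bounded[OF compact_continuous_image[OF continuous_on_subset[OF u(1,3)] compact_closed_region]])
  then obtain C where C: "\<And>x. x \<in> closed_region \<Longrightarrow> norm (u x) \<le> C"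
    by (auto simp: bounded_iff)
  have m: "u \<in> borel_measurable (lebesgue_restr (channel b))"
    using borel_measurable_continuous_on_indicator[of "channel b" u] u channel_subset_closed_region
    by (auto simp: borel_measurable_restrict_space_iff intro: continuous_on_subset)
  show *: "L2 (channel b) u"
    by (rule L2_const[OF channel_borel emeasure_channel m]) (use C channel_subset_closed_region in auto)
  have "L2 (channel b) (\<lambda>_. 1::real)" by (rule L2_const[OF channel_borel emeasure_channel, of _ 1]) auto
  from L2_product(1)[OF channel_borel this * m, of 1] show "integrable (lebesgue_restr (channel b)) u" by simp
qed

lemma nn_integral_layer:
  fixes F :: "real \<times> real \<Rightarrow> ennreal"
  assumes m: "(\<lambda>x. F x * indicator (layer b r) x) \<in> borel_measurable borel"
  shows "(\<integral>\<^sup>+x. F x * indicator (layer b r) x \<partial>lborel) =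
    (\<integral>\<^sup>+s. (\<integral>\<^sup>+t. F (s, t) * indicator {b s<..<min 1 (b s + r)} t \<partial>lborel) * indicator {0<..<1} s \<partial>lborel)"
proof -
  have "(\<integral>\<^sup>+x. F x * indicator (layer b r) x \<partial>lborel) =
     (\<integral>\<^sup>+s. (\<integral>\<^sup>+t. F (s, t) * indicator (layer b r) (s, t) \<partial>lborel) \<partial>lborel)"
    using lborel.nn_integral_fst[of "\<lambda>x. F x * indicator (layer b r) x" lborel] m
    by (simp add: lborel_prod)
  also have "\<dots> = (\<integral>\<^sup>+s. (\<integral>\<^sup>+t. F (s, t) * indicator {b s<..<min 1 (b s + r)} t \<partial>lborel) * indicator {0<..<1} s \<partial>lborel)"
  proof (rule nn_integral_cong)
    fix s :: real
    show "(\<integral>\<^sup>+t. F (s, t) * indicator (layer b r) (s, t) \<partial>lborel) =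
       (\<integral>\<^sup>+t. F (s, t) * indicator {b s<..<min 1 (b s + r)} t \<partial>lborel) * indicator {0<..<1} s"
      by (cases "s \<in> {0<..<1}")
         (auto simp: layer_def indicator_def intro!: nn_integral_cong)
  qed
  finally show ?thesis .
qed

lemma integral_channel:
  fixes F :: "real \<times> real \<Rightarrow> real"
  assumes i: "integrable (lebesgue_restr (channel b)) F"
  shows "(\<integral>x. F x \<partial>lebesgue_restr (channel b)) =
    (\<integral>s. (\<integral>t. F (s, t) * indicator {b s<..<1} t \<partial>lborel) * indicator {0<..<1} s \<partial>lborel)"
proof -
  have i': "integrable (lborel \<Otimes>\<^sub>M lborel) (\<lambda>(s, t). indicator (channel b) (s, t) * F (s, t))"
    using i by (simp add: integrable_restrict_space lborel_prod case_prod_beta')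
  have "(\<integral>x. F x \<partial>lebesgue_restr (channel b)) = (\<integral>x. indicator (channel b) x * F x \<partial>lborel)"
    by (simp add: integral_restrict_space)
  also have "\<dots> = (\<integral>s. (\<integral>t. indicator (channel b) (s, t) * F (s, t) \<partial>lborel) \<partial>lborel)"
    using lborel_pair.integral_fst[OF i'] by (simp add: lborel_prod case_prod_beta')
  also have "\<dots> = (\<integral>s. (\<integral>t. F (s, t) * indicator {b s<..<1} t \<partial>lborel) * indicator {0<..<1} s \<partial>lborel)"
  proof (rule Bochner_Integration.integral_cong[OF refl])
    fix s :: real
    show "(\<integral>t. indicator (channel b) (s, t) * F (s, t) \<partial>lborel) =
       (\<integral>t. F (s, t) * indicator {b s<..<1} t \<partial>lborel) * indicator {0<..<1} s"
      by (cases "s \<in> {0<..<1}")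
         (auto simp: channel_def indicator_def intro!: Bochner_Integration.integral_cong)
  qed
  finally show ?thesis .
qed

lemma integral_grad_snd:
  assumes S: "open S" "closed_region \<subseteq> S" and u: "C1_on S u"
  shows "(\<integral>x. snd (grad u x) \<partial>lebesgue_restr (channel b)) =
    (\<integral>s. u (s, 1) - u (s, b s) \<partial>lebesgue_restr {0<..<1})"
proof -
  have i: "integrable (lebesgue_restr (channel b)) (\<lambda>x. snd (grad u x))"
    by (rule L2_continuous(2)[OF _ S]) (intro continuous_intros C1_on_continuous u)
  have "(\<integral>t. snd (grad u (s, t)) * indicator {b s<..<1} t \<partial>lborel) = u (s, 1) - u (s, b s)"
    if s: "s \<in> {0<..<1}" for s
  proof -
    have in_S: "(s, t) \<in> S" if "b s \<le> t" "t \<le> 1" for t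
      using s that by (intro subsetD[OF S(2)]) (simp add: closed_region_def)
    have "(\<integral>t. snd (grad u (s, t)) * indicator {b s<..<1} t \<partial>lborel) = (\<integral>t. indicator {b s..1} t *\<^sub>R snd (grad u (s, t)) \<partial>lborel)"
    proof (rule integral_cong_AE)
      have "continuous_on {b s..1} (\<lambda>t. snd (grad u (s, t)))"
        by (intro continuous_intros continuous_on_compose2[OF C1_on_continuous(2)[OF u]]) (use in_S in auto)
      from borel_measurable_continuous_on_indicator[OF _ this]
      show m: "(\<lambda>t. indicator {b s..1} t *\<^sub>R snd (grad u (s, t))) \<in> borel_measurable lborel" by simp
      have "(\<lambda>t. indicator {b s<..<1} t * (indicator {b s..1} t *\<^sub>R snd (grad u (s, t)))) \<in> borel_measurable lborel"
        using m by measurable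
      moreover have "(\<lambda>t. indicator {b s<..<1} t * (indicator {b s..1} t *\<^sub>R snd (grad u (s, t)))) =
         (\<lambda>t. snd (grad u (s, t)) * indicator {b s<..<1} t)"
        by (auto simp: indicator_def)
      ultimately show "(\<lambda>t. snd (grad u (s, t)) * indicator {b s<..<1} t) \<in> borel_measurable lborel" by simp
      show "AE t in lborel. snd (grad u (s, t)) * indicator {b s<..<1} t = indicator {b s..1} t *\<^sub>R snd (grad u (s, t))"
        using AE_lborel_singleton[of "b s"] AE_lborel_singleton[of 1]
        by eventually_elim (auto simp: indicator_def)
    qed
    also have "\<dots> = u (s, 1) - u (s, b s)"
    proof (rule integral_FTC_Icc)
      show "b s \<le> 1" using b_le[of s] by linarith
      show "((\<lambda>t. u (s, t)) has_vector_derivative snd (grad u (s, t))) (at t within {b s..1})"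
        if "b s \<le> t" "t \<le> 1" for t
        using C1_DERIV_snd[OF S(1) u in_S[OF that]]
        by (simp add: has_real_derivative_iff_has_vector_derivative has_vector_derivative_at_within)
      show "continuous_on {b s..1} (\<lambda>t. snd (grad u (s, t)))"
        by (intro continuous_intros continuous_on_compose2[OF C1_on_continuous(2)[OF u]]) (use in_S in auto)
    qed
    finally show ?thesis .
  qed
  then have *: "(\<integral>t. snd (grad u (s, t)) * indicator {b s<..<1} t \<partial>lborel) * indicator {0<..<1} s = indicator {0<..<1} s *\<^sub>R (u (s, 1) - u (s, b s))" for s
    by (cases "s \<in> {0<..<1}") auto
  show ?thesis
    unfolding integral_channel[OF i] * by (simp add: integral_restrict_space)
qed

text \<open>Green's formula for the constant field (0, 1). It needs nothing but the fundamental
  theorem on vertical lines, applied to the approximants.\<close>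

lemma tendsto_traces_integral:
  assumes "C1_approx (channel b) \<phi> v h"
    and t0: "tendsto_L2 {0<..<1} (\<lambda>n s. \<phi> n (s, b s)) t0" and t1: "tendsto_L2 {0<..<1} (\<lambda>n s. \<phi> n (s, 1)) t1"
  shows "(\<integral>x. snd (h x) \<partial>lebesgue_restr (channel b)) = (\<integral>s. t1 s - t0 s \<partial>lebesgue_restr {0<..<1})"
proof -
  note A = C1_approxD[OF assms(1)]
  have I: "{0<..<1::real} \<in> sets borel" by simp
  have 1: "L2 (channel b) (\<lambda>_. (0, 1::real) :: real \<times> real)"
    by (rule L2_const[OF channel_borel emeasure_channel, of _ 1]) auto
  have 2: "L2 {0<..<1::real} (\<lambda>_. 1::real)" by (rule L2_const[OF I, where C = 1]) auto
  have "(\<lambda>n. \<integral>x. grad (\<phi> n) x \<bullet> (0, 1) \<partial>lebesgue_restr (channel b)) \<longlonglongrightarrow> (\<integral>x. h x \<bullet> (0, 1) \<partial>lebesgue_restr (channel b))"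
    by (rule tendsto_L2_bilinear[OF channel_borel A(3) tendsto_L2_const[OF 1] bounded_bilinear_inner])
  then have "(\<lambda>n. \<integral>x. snd (grad (\<phi> n) x) \<partial>lebesgue_restr (channel b)) \<longlonglongrightarrow> (\<integral>x. snd (h x) \<partial>lebesgue_restr (channel b))"
    by (simp add: inner_prod_def)
  moreover have "(\<lambda>n. \<integral>s. (\<phi> n (s, 1) - \<phi> n (s, b s)) * 1 \<partial>lebesgue_restr {0<..<1}) \<longlonglongrightarrow> (\<integral>s. (t1 s - t0 s) * 1 \<partial>lebesgue_restr {0<..<1})"
    by (rule tendsto_L2_bilinear[OF I tendsto_L2_diff[OF I t1 t0] tendsto_L2_const[OF 2] bounded_bilinear_mult])
  moreover have "(\<integral>x. snd (grad (\<phi> n) x) \<partial>lebesgue_restr (channel b)) = (\<integral>s. \<phi> n (s, 1) - \<phi> n (s, b s) \<partial>lebesgue_restr {0<..<1})" for n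
    by (rule integral_grad_snd[OF open_UNIV subset_UNIV A(1)])
  ultimately show ?thesis by (simp add: LIMSEQ_unique)
qed

text \<open>The two trace conditions come with unrelated approximating sequences; they are merged by a
  cut-off in the vertical direction.\<close>

lemma joint_approx:
  assumes \<phi>: "C1_approx (channel b) \<phi> v h" "tendsto_L2 {0<..<1} (\<lambda>n s. \<phi> n (s, b s)) t0"
    and \<psi>: "C1_approx (channel b) \<psi> v h" "tendsto_L2 {0<..<1} (\<lambda>n s. \<psi> n (s, 1)) t1"
  obtains \<omega> where "C1_approx (channel b) \<omega> v h" "tendsto_L2 {0<..<1} (\<lambda>n s. \<omega> n (s, b s)) t0"
    "tendsto_L2 {0<..<1} (\<lambda>n s. \<omega> n (s, 1)) t1"
proof -
  \<comment> \<open>On the graph, which lies below height 0, this is \<phi>, and above height 1/2 it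
    is \<psi>. As both sequences have the same limit, the cut-off term tends to 0 together with its
    gradient.\<close>
  define \<omega> where "\<omega> n x = \<psi> n x - zeta (snd x) * (\<psi> n x - \<phi> n x)" for n x
  have z: "C1_on UNIV (\<lambda>x. zeta (snd x))"
    by (rule C1_compose_real(1)[OF open_UNIV C1_snd DERIV_zeta continuous_zeta_deriv])
  have "C1_approx (channel b) \<omega> (\<lambda>x. v x - zeta (snd x) * (v x - v x))
     (\<lambda>x. h x - (zeta (snd x) *\<^sub>R (h x - h x) + (v x - v x) *\<^sub>R grad (\<lambda>x. zeta (snd x)) x))"
    unfolding \<omega>_def[abs_def]
    by (intro C1_approx_lincomb[OF open_channel \<psi>(1)] C1_approx_mult[OF open_channel compact_closed_region channel_subset_closed_region z]
        C1_approx_lincomb[OF open_channel \<psi>(1) \<phi>(1)])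
  then have "C1_approx (channel b) \<omega> v h" by simp
  moreover have "\<omega> n (s, b s) = \<phi> n (s, b s)" "\<omega> n (s, 1) = \<psi> n (s, 1)" for n s
    using b_le[of s] by (simp_all add: \<omega>_def zeta_eq_1 zeta_eq_0)
  ultimately show thesis using \<phi>(2) \<psi>(2) by (intro that[of \<omega>]) simp_all
qed

text \<open>A weighted Hardy inequality on vertical lines: the increment from the graph is at most
  \<open>t - b s\<close> times the energy of the line, and \<open>K\<close> bounds the moment of the
  weight that this produces. The bottom term is kept because approximants vanish on the graph only
  in the limit.\<close>

lemma layer_bound_C1:
  fixes a :: "real \<times> real \<Rightarrow> real"
  assumes \<phi>: "C1_on UNIV \<phi>" and a: "a \<in> borel_measurable borel" "\<And>x. x \<in> channel b \<Longrightarrow> \<bar>a x\<bar> \<le> C" and "0 \<le> C" and "0 \<le> K"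
    and K: "\<And>s. (\<integral>\<^sup>+t. ennreal ((t - b s) * (a (s, t))\<^sup>2) * indicator {b s<..<min 1 (b s + r)} t \<partial>lborel) \<le> ennreal K"
  shows "(L2_norm (layer b r) (\<lambda>x. a x * \<phi> x))\<^sup>2 \<le>
     4 * C\<^sup>2 * (L2_norm {0<..<1} (\<lambda>s. \<phi> (s, b s)))\<^sup>2 + 2 * K * (L2_norm (layer b r) (grad \<phi>))\<^sup>2"
proof -
  let ?I = "\<lambda>s. {b s<..<min 1 (b s + r)}"
  let ?E = "\<lambda>s. \<integral>\<^sup>+t. ennreal ((snd (grad \<phi> (s, t)))\<^sup>2) * indicator (?I s) t \<partial>lborel"
  have [measurable]: "\<phi> \<in> borel_measurable borel" "grad \<phi> \<in> borel_measurable borel" "a \<in> borel_measurable borel"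
    using C1_measurable[OF \<phi>] a by auto
  have slice: "(\<integral>\<^sup>+t. ennreal ((a (s, t) * \<phi> (s, t))\<^sup>2) * indicator (?I s) t \<partial>lborel)
      \<le> ennreal (4 * C\<^sup>2 * (\<phi> (s, b s))\<^sup>2) + ennreal (2 * K) * ?E s" if s: "s \<in> {0<..<1}" for s
  proof -
    have pt: "ennreal ((a (s, t) * \<phi> (s, t))\<^sup>2) * indicator (?I s) t \<le>
        ennreal (2 * C\<^sup>2 * (\<phi> (s, b s))\<^sup>2) * indicator {b s..1} t
        + (ennreal 2 * ?E s) * (ennreal ((t - b s) * (a (s, t))\<^sup>2) * indicator (?I s) t)" for t
    proof (cases "t \<in> ?I s")
      case True
      then have t: "b s < t" "t \<le> min 1 (b s + r)" "t < 1" by auto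
      have D: "((\<lambda>t. \<phi> (s, t)) has_real_derivative snd (grad \<phi> (s, x))) (at x)" for x
        by (rule C1_DERIV_snd[OF open_UNIV \<phi>]) simp
      have cont: "continuous_on {b s..t} (\<lambda>x. snd (grad \<phi> (s, x)))"
        by (intro continuous_intros continuous_on_compose2[OF C1_on_continuous(2)[OF \<phi>]]) auto
      have cs: "ennreal ((\<phi> (s, t) - \<phi> (s, b s))\<^sup>2) \<le> ennreal (t - b s) * ?E s"
        by (rule Cauchy_Schwarz_increment[OF D cont t(1,2)])
      have "(s, t) \<in> channel b" using s t by (auto simp: channel_def)
      then have aC: "(a (s, t))\<^sup>2 \<le> C\<^sup>2" using a(2) by (metis abs_ge_zero power2_abs power_mono)
      have "(\<phi> (s, t))\<^sup>2 \<le> 2 * (\<phi> (s, b s))\<^sup>2 + 2 * (\<phi> (s, t) - \<phi> (s, b s))\<^sup>2"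
        using sum_squares_bound[of "\<phi> (s, b s)" "\<phi> (s, t) - \<phi> (s, b s)"]
          power2_sum[of "\<phi> (s, b s)" "\<phi> (s, t) - \<phi> (s, b s)"] by simp
      then have "(a (s, t) * \<phi> (s, t))\<^sup>2 \<le> (a (s, t))\<^sup>2 * (2 * (\<phi> (s, b s))\<^sup>2 + 2 * (\<phi> (s, t) - \<phi> (s, b s))\<^sup>2)"
        unfolding power_mult_distrib by (intro mult_left_mono) auto
      also have "\<dots> = (a (s, t))\<^sup>2 * (2 * (\<phi> (s, b s))\<^sup>2) + 2 * (a (s, t))\<^sup>2 * (\<phi> (s, t) - \<phi> (s, b s))\<^sup>2"
        by (simp add: algebra_simps)
      also have "\<dots> \<le> C\<^sup>2 * (2 * (\<phi> (s, b s))\<^sup>2) + 2 * (a (s, t))\<^sup>2 * (\<phi> (s, t) - \<phi> (s, b s))\<^sup>2"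
        using aC by (intro add_mono mult_right_mono) auto
      finally have "ennreal ((a (s, t) * \<phi> (s, t))\<^sup>2) \<le>
          ennreal (2 * C\<^sup>2 * (\<phi> (s, b s))\<^sup>2) + ennreal (2 * (a (s, t))\<^sup>2) * ennreal ((\<phi> (s, t) - \<phi> (s, b s))\<^sup>2)"
        by (subst ennreal_mult[symmetric], simp, simp, subst ennreal_plus[symmetric], simp, simp)
           (intro ennreal_leI, simp add: mult_ac)
      also have "\<dots> \<le> ennreal (2 * C\<^sup>2 * (\<phi> (s, b s))\<^sup>2) + ennreal (2 * (a (s, t))\<^sup>2) * (ennreal (t - b s) * ?E s)"
        by (intro add_left_mono mult_left_mono cs) simp
      also have "ennreal (2 * (a (s, t))\<^sup>2) * (ennreal (t - b s) * ?E s) = (ennreal 2 * ?E s) * ennreal ((t - b s) * (a (s, t))\<^sup>2)"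
        using t by (simp add: ennreal_mult mult_ac)
      finally show ?thesis using True t by (simp add: indicator_def)
    next
      case False
      then have "indicator (?I s) t = (0 :: ennreal)" by (rule indicator_simps(2))
      then show ?thesis by (simp only: mult_zero_right add_0_right zero_le)
    qed
    have "(\<integral>\<^sup>+t. ennreal ((a (s, t) * \<phi> (s, t))\<^sup>2) * indicator (?I s) t \<partial>lborel) \<le>
      (\<integral>\<^sup>+t. ennreal (2 * C\<^sup>2 * (\<phi> (s, b s))\<^sup>2) * indicator {b s..1} t
        + (ennreal 2 * ?E s) * (ennreal ((t - b s) * (a (s, t))\<^sup>2) * indicator (?I s) t) \<partial>lborel)"
      by (rule nn_integral_mono) (rule pt)
    also have "\<dots> = (\<integral>\<^sup>+t. ennreal (2 * C\<^sup>2 * (\<phi> (s, b s))\<^sup>2) * indicator {b s..1} t \<partial>lborel)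
        + (\<integral>\<^sup>+t. (ennreal 2 * ?E s) * (ennreal ((t - b s) * (a (s, t))\<^sup>2) * indicator (?I s) t) \<partial>lborel)"
      by (rule nn_integral_add) measurable
    also have "\<dots> = ennreal (2 * C\<^sup>2 * (\<phi> (s, b s))\<^sup>2) * emeasure lborel {b s..1}
        + (ennreal 2 * ?E s) * (\<integral>\<^sup>+t. ennreal ((t - b s) * (a (s, t))\<^sup>2) * indicator (?I s) t \<partial>lborel)"
      by (subst nn_integral_cmult, measurable) (subst nn_integral_cmult_indicator, simp_all)
    also have "\<dots> \<le> ennreal (2 * C\<^sup>2 * (\<phi> (s, b s))\<^sup>2) * ennreal 2 + (ennreal 2 * ?E s) * ennreal K"
    proof (intro add_mono mult_left_mono K)
      \<comment> \<open>This length is why the bottom term has the factor 4 rather than 2.\<close>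
      show "emeasure lborel {b s..1} \<le> ennreal 2"
      proof (subst emeasure_lborel_Icc)
        show "b s \<le> 1" using b_le[of s] by linarith
        show "ennreal (1 - b s) \<le> ennreal 2" using b_ge[of s] by (intro ennreal_leI) linarith
      qed
    qed simp_all
    also have "\<dots> = ennreal (4 * C\<^sup>2 * (\<phi> (s, b s))\<^sup>2) + ennreal (2 * K) * ?E s"
    proof -
      have "ennreal (2 * C\<^sup>2 * (\<phi> (s, b s))\<^sup>2) * ennreal 2 = ennreal (4 * C\<^sup>2 * (\<phi> (s, b s))\<^sup>2)"
        by (subst ennreal_mult[symmetric]) (simp_all add: mult_ac)
      moreover have "ennreal (2 * K) = ennreal 2 * ennreal K" using \<open>0 \<le> K\<close> by (simp add: ennreal_mult)
      ultimately show ?thesis by (simp add: mult_ac)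
    qed
    finally show ?thesis .
  qed
  have mE: "?E \<in> borel_measurable borel"
  proof -
    let ?W = "{x. b (fst x) + 0 < snd x} \<inter> {x. snd x < 1} \<inter> {x. snd x < b (fst x) + r}"
    have "open ?W" by (intro open_Int open_above open_below open_Collect_less continuous_intros)
    then have W [measurable]: "?W \<in> sets borel" by simp
    define g where "g x = snd (grad \<phi> x)" for x
    have [measurable]: "g \<in> borel_measurable borel"
      unfolding g_def[abs_def]
      by (intro borel_measurable_continuous_onI continuous_on_snd C1_on_continuous(2)[OF \<phi>])
    have "(\<lambda>x. ennreal ((g x)\<^sup>2) * indicator ?W x) \<in> borel_measurable borel"
      using W by (intro borel_measurable_times_ennreal borel_measurable_indicator) measurable
    then have "(\<lambda>s. \<integral>\<^sup>+t. ennreal ((g (s, t))\<^sup>2) * indicator ?W (s, t) \<partial>lborel) \<in> borel_measurable lborel"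
      by (intro lborel.borel_measurable_nn_integral_fst) (simp add: lborel_prod)
    moreover have "indicator ?W (s, t) = (indicator (?I s) t :: ennreal)" for s t by (simp add: indicator_def)
    ultimately show ?thesis by (simp add: g_def)
  qed
  have Lphi: "L2 (channel b) (grad \<phi>)"
    by (rule L2_continuous(1)[OF C1_on_continuous(2)[OF \<phi>]]) auto
  then have Ll: "L2 (layer b r) (grad \<phi>)"
    by (rule L2_subset(1)[OF channel_borel layer_borel layer_subset])
  have I: "{0<..<1::real} \<in> sets borel" by simp
  have Lb: "L2 {0<..<1} (\<lambda>s. \<phi> (s, b s))"
  proof -
    have c: "continuous_on UNIV (\<lambda>s. \<phi> (s, b s))"
      by (intro continuous_on_compose2[OF C1_on_continuous(1)[OF \<phi>]] continuous_intros cont_b) auto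
    have "bounded ((\<lambda>s. \<phi> (s, b s)) ` {0..1})"
      by (rule compact_imp_bounded[OF compact_continuous_image[OF continuous_on_subset[OF c]]]) auto
    then obtain B where "\<forall>s\<in>{0..1}. norm (\<phi> (s, b s)) \<le> B"
      by (auto simp: bounded_iff)
    then show ?thesis
      using c by (intro L2_const[OF I, where C = B]) (auto intro!: borel_measurable_restr borel_measurable_continuous_onI)
  qed
  have "(\<integral>\<^sup>+x. ennreal ((norm (a x * \<phi> x))\<^sup>2) * indicator (layer b r) x \<partial>lborel) =
     (\<integral>\<^sup>+s. (\<integral>\<^sup>+t. ennreal ((a (s, t) * \<phi> (s, t))\<^sup>2) * indicator (?I s) t \<partial>lborel) * indicator {0<..<1} s \<partial>lborel)"
    by (subst nn_integral_layer) simp_all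
  also have "\<dots> \<le> (\<integral>\<^sup>+s. (ennreal (4 * C\<^sup>2 * (\<phi> (s, b s))\<^sup>2) + ennreal (2 * K) * ?E s) * indicator {0<..<1} s \<partial>lborel)"
    by (rule nn_integral_mono) (use slice in \<open>auto simp: indicator_def\<close>)
  also have "\<dots> = (\<integral>\<^sup>+s. ennreal (4 * C\<^sup>2) * (ennreal ((norm (\<phi> (s, b s)))\<^sup>2) * indicator {0<..<1} s)
      + ennreal (2 * K) * (?E s * indicator {0<..<1} s) \<partial>lborel)"
    by (rule nn_integral_cong) (simp add: ennreal_mult indicator_def)
  also have "\<dots> = ennreal (4 * C\<^sup>2) * (\<integral>\<^sup>+s. ennreal ((norm (\<phi> (s, b s)))\<^sup>2) * indicator {0<..<1} s \<partial>lborel)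
      + ennreal (2 * K) * (\<integral>\<^sup>+s. ?E s * indicator {0<..<1} s \<partial>lborel)"
    using mE by (subst nn_integral_add, simp, simp) (subst (1 2) nn_integral_cmult, simp_all)
  also have "(\<integral>\<^sup>+s. ?E s * indicator {0<..<1} s \<partial>lborel) = (\<integral>\<^sup>+x. ennreal ((snd (grad \<phi> x))\<^sup>2) * indicator (layer b r) x \<partial>lborel)"
  proof (rule nn_integral_layer[symmetric])
    have "(\<lambda>x. snd (grad \<phi> x)) \<in> borel_measurable borel"
      by (intro borel_measurable_continuous_onI continuous_on_snd C1_on_continuous(2)[OF \<phi>])
    then show "(\<lambda>x. ennreal ((snd (grad \<phi> x))\<^sup>2) * indicator (layer b r) x) \<in> borel_measurable borel"
      by (intro borel_measurable_times_ennreal borel_measurable_indicator layer_borel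
          measurable_compose[OF _ measurable_ennreal] borel_measurable_power)
  qed
  also have "\<dots> \<le> (\<integral>\<^sup>+x. ennreal ((norm (grad \<phi> x))\<^sup>2) * indicator (layer b r) x \<partial>lborel)"
    by (intro nn_integral_mono mult_right_mono ennreal_leI) (auto simp: norm_prod_def)
  also have "\<dots> = ennreal ((L2_norm (layer b r) (grad \<phi>))\<^sup>2)" by (rule L2_nn[OF layer_borel Ll])
  also have "(\<integral>\<^sup>+s. ennreal ((norm (\<phi> (s, b s)))\<^sup>2) * indicator {0<..<1} s \<partial>lborel) = ennreal ((L2_norm {0<..<1} (\<lambda>s. \<phi> (s, b s)))\<^sup>2)"
    by (rule L2_nn[OF I Lb])
  finally have "(\<integral>\<^sup>+x. ennreal ((norm (a x * \<phi> x))\<^sup>2) * indicator (layer b r) x \<partial>lborel) \<le>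
     ennreal (4 * C\<^sup>2 * (L2_norm {0<..<1} (\<lambda>s. \<phi> (s, b s)))\<^sup>2 + 2 * K * (L2_norm (layer b r) (grad \<phi>))\<^sup>2)"
    using \<open>0 \<le> K\<close> by (simp add: ennreal_mult mult_left_mono)
  then show ?thesis
    using \<open>0 \<le> K\<close> by (intro L2_I_nn(2)[OF layer_borel]) (auto intro!: borel_measurable_restr)
qed

text \<open>In the limit the bottom term disappears. With \<open>a = 1\<close> this is a Poincare
  inequality in which a thin layer gains a factor \<open>r\<close>; with an inverse power of the
  stretched height it is a Hardy inequality.\<close>

lemma layer_bound:
  fixes a :: "real \<times> real \<Rightarrow> real"
  assumes \<phi>: "C1_approx (channel b) \<phi> v h" and t0: "tendsto_L2 {0<..<1} (\<lambda>n s. \<phi> n (s, b s)) (\<lambda>_. 0)"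
    and a: "a \<in> borel_measurable borel" "\<And>x. x \<in> channel b \<Longrightarrow> \<bar>a x\<bar> \<le> C" and "0 \<le> C" and "0 \<le> K"
    and K: "\<And>s. (\<integral>\<^sup>+t. ennreal ((t - b s) * (a (s, t))\<^sup>2) * indicator {b s<..<min 1 (b s + r)} t \<partial>lborel) \<le> ennreal K"
  shows "(L2_norm (layer b r) (\<lambda>x. a x * v x))\<^sup>2 \<le> 2 * K * (L2_norm (layer b r) h)\<^sup>2"
proof -
  note A = C1_approxD[OF \<phi>]
  note sub = tendsto_L2_subset[OF channel_borel layer_borel layer_subset]
  have am: "a \<in> borel_measurable (lebesgue_restr (layer b r))" by (intro borel_measurable_restr a)
  have "tendsto_L2 (layer b r) (\<lambda>n x. a x *\<^sub>R \<phi> n x) (\<lambda>x. a x *\<^sub>R v x)"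
    by (rule tendsto_L2_mult[OF layer_borel sub[OF A(2)] am]) (use a layer_subset in blast)
  from tendsto_L2_norm[OF layer_borel this]
  have 1: "(\<lambda>n. (L2_norm (layer b r) (\<lambda>x. a x * \<phi> n x))\<^sup>2) \<longlonglongrightarrow> (L2_norm (layer b r) (\<lambda>x. a x * v x))\<^sup>2" by simp
  have 2: "(\<lambda>n. 4 * C\<^sup>2 * (L2_norm {0<..<1} (\<lambda>s. \<phi> n (s, b s)))\<^sup>2 + 2 * K * (L2_norm (layer b r) (grad (\<phi> n)))\<^sup>2)
     \<longlonglongrightarrow> 4 * C\<^sup>2 * (L2_norm {0<..<1} (\<lambda>s::real. 0::real))\<^sup>2 + 2 * K * (L2_norm (layer b r) h)\<^sup>2"
    by (intro tendsto_add tendsto_mult_left tendsto_L2_norm[OF _ t0] tendsto_L2_norm[OF layer_borel sub[OF A(3)]]) simp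
  have "(L2_norm (layer b r) (\<lambda>x. a x * v x))\<^sup>2 \<le>
     4 * C\<^sup>2 * (L2_norm {0<..<1} (\<lambda>s::real. 0::real))\<^sup>2 + 2 * K * (L2_norm (layer b r) h)\<^sup>2"
    by (rule LIMSEQ_le[OF 1 2]) (use layer_bound_C1[OF A(1) a \<open>0 \<le> C\<close> \<open>0 \<le> K\<close> K] in blast)
  then show ?thesis by (simp add: L2_norm_def set_lebesgue_integral_def)
qed

end

section \<open>Cut-offs near a Lipschitz graph\<close>

lemma L2_norm_support:
  assumes "T \<subseteq> S" "\<And>x. x \<in> S \<Longrightarrow> x \<notin> T \<Longrightarrow> F x = 0"
  shows "L2_norm S F = L2_norm T F"
proof -
  have "indicator S x *\<^sub>R (norm (F x))\<^sup>2 = indicator T x *\<^sub>R (norm (F x))\<^sup>2" for x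
    using assms by (cases "x \<in> S"; cases "x \<in> T") auto
  then show ?thesis by (simp only: L2_norm_def set_lebesgue_integral_def)
qed

lemma L2_dominated_cutoff:
  fixes u :: "'a::euclidean_space \<Rightarrow> 'b::euclidean_space" and k :: "nat \<Rightarrow> 'a \<Rightarrow> real"
  assumes S: "S \<in> sets borel" and u: "L2 S u"
    and k: "\<And>n. k n \<in> borel_measurable (lebesgue_restr S)" "\<And>n x. x \<in> S \<Longrightarrow> \<bar>k n x\<bar> \<le> 1"
    and lim: "\<And>x. x \<in> S \<Longrightarrow> (\<lambda>n. k n x) \<longlonglongrightarrow> 0"
  shows "(\<lambda>n. L2_norm S (\<lambda>x. k n x *\<^sub>R u x)) \<longlonglongrightarrow> 0"
proof -
  have i: "integrable (lebesgue_restr S) (\<lambda>x. (norm (u x))\<^sup>2)" using u S by (simp add: L2_iff)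
  have mu: "u \<in> borel_measurable (lebesgue_restr S)" by (rule L2_measurable[OF S u])
  have "(\<lambda>n. \<integral>x. (norm (k n x *\<^sub>R u x))\<^sup>2 \<partial>lebesgue_restr S) \<longlonglongrightarrow> (\<integral>x. 0 \<partial>lebesgue_restr S)"
  proof (rule integral_dominated_convergence[OF _ _ i])
    show "(\<lambda>x. (norm (k n x *\<^sub>R u x))\<^sup>2) \<in> borel_measurable (lebesgue_restr S)" for n
      using k(1)[of n] mu by simp
    show "AE x in lebesgue_restr S. (\<lambda>n. (norm (k n x *\<^sub>R u x))\<^sup>2) \<longlonglongrightarrow> 0"
    proof (rule AE_I2)
      fix x assume "x \<in> space (lebesgue_restr S)"
      then have "x \<in> S" by (simp add: space_restrict_space)
      from tendsto_power[OF tendsto_norm[OF tendsto_scaleR[OF lim[OF this] tendsto_const[of "u x"]]], of 2]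
      show "(\<lambda>n. (norm (k n x *\<^sub>R u x))\<^sup>2) \<longlonglongrightarrow> 0" by simp
    qed
    show "AE x in lebesgue_restr S. norm ((norm (k n x *\<^sub>R u x))\<^sup>2) \<le> (norm (u x))\<^sup>2" for n
    proof (rule AE_I2)
      fix x assume "x \<in> space (lebesgue_restr S)"
      then have "\<bar>k n x\<bar> \<le> 1" using k(2) by (simp add: space_restrict_space)
      then have "norm (k n x *\<^sub>R u x) \<le> norm (u x)" by (simp add: mult_left_le_one_le)
      then show "norm ((norm (k n x *\<^sub>R u x))\<^sup>2) \<le> (norm (u x))\<^sup>2" by (simp add: power_mono)
    qed
  qed simp
  then have "(\<lambda>n. (L2_norm S (\<lambda>x. k n x *\<^sub>R u x))\<^sup>2) \<longlonglongrightarrow> 0" using S by (simp add: L2_norm_power2)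
  from tendsto_real_sqrt[OF this] show ?thesis by simp
qed

locale lipschitz_graph_domain = graph_domain +
  fixes L :: real
  assumes lip: "\<And>s t. \<bar>b s - b t\<bar> \<le> L * \<bar>s - t\<bar>"
begin

lemma L_nonneg: "0 \<le> L" using lip[of 1 0] by simp

text \<open>The forward average of \<open>b\<close> over an interval of length \<sigma>, expressed
  by an antiderivative \<open>P\<close>. Its derivative is a difference quotient of
  \<open>b\<close>, hence continuous and bounded by the Lipschitz constant.\<close>

lemma mollify:
  assumes "0 < \<sigma>"
  shows "\<exists>c c'. continuous_on UNIV c' \<and>
    (\<forall>s. (c has_real_derivative c' s) (at s) \<and> \<bar>c' s\<bar> \<le> L \<and> \<bar>c s - b s\<bar> \<le> L * \<sigma>)"
proof -
  have "isCont b x" for x using cont_b by (simp add: continuous_on_eq_continuous_at)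
  then obtain P where P: "(P has_vector_derivative b x) (at x)" for x
    using einterval_antiderivative[of "-\<infinity>" \<infinity> b] by auto
  then have D: "(P has_real_derivative b x) (at x)" for x
    by (simp add: has_real_derivative_iff_has_vector_derivative)
  show ?thesis
  proof (rule exI[of _ "\<lambda>s. (P (s + \<sigma>) - P s) / \<sigma>"], rule exI[of _ "\<lambda>s. (b (s + \<sigma>) - b s) / \<sigma>"],
      intro conjI allI)
    fix s
    have "((\<lambda>s. P (s + \<sigma>)) has_real_derivative b (s + \<sigma>) * 1) (at s)"
      by (rule DERIV_chain2[OF D]) (auto intro!: derivative_eq_intros)
    from DERIV_cdivide[OF DERIV_diff[OF this D], of \<sigma>]
    show "((\<lambda>s. (P (s + \<sigma>) - P s) / \<sigma>) has_real_derivative (b (s + \<sigma>) - b s) / \<sigma>) (at s)" by simp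
    show "\<bar>(b (s + \<sigma>) - b s) / \<sigma>\<bar> \<le> L"
      using lip[of "s + \<sigma>" s] assms by (simp add: field_simps)
    obtain z where z: "s < z" "z < s + \<sigma>" "P (s + \<sigma>) - P s = (s + \<sigma> - s) * b z"
      using MVT2[of s "s + \<sigma>" P b] D assms by auto
    then have "(P (s + \<sigma>) - P s) / \<sigma> = b z" using assms by simp
    moreover have "L * \<bar>z - s\<bar> \<le> L * \<sigma>" using z L_nonneg by (intro mult_left_mono) auto
    ultimately show "\<bar>(P (s + \<sigma>) - P s) / \<sigma> - b s\<bar> \<le> L * \<sigma>" using lip[of z s] by linarith
  next
    show "continuous_on UNIV (\<lambda>s. (b (s + \<sigma>) - b s) / \<sigma>)"
      by (intro continuous_intros continuous_on_compose2[OF cont_b] cont_b) (use assms in auto)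
  qed
qed

lemma cutoff:
  assumes "p < q"
  shows "\<exists>k. C1_on UNIV k \<and> (\<forall>x. 0 \<le> k x \<and> k x \<le> 1 \<and> (snd x - b (fst x) \<le> p \<longrightarrow> k x = 0) \<and>
    (q \<le> snd x - b (fst x) \<longrightarrow> k x = 1) \<and> norm (grad k x) \<le> 8 * (L + 1) / (q - p))"
proof -
  define d where "d = q - p"
  have d: "0 < d" using assms by (simp add: d_def)
  \<comment> \<open>Adding 1 to \<open>L\<close> avoids division by 0 for a flat graph; the averaged
    graph stays within \<open>d / 4\<close> of \<open>b\<close>.\<close>
  define \<sigma> where "\<sigma> = d / (4 * (L + 1))"
  have \<sigma>: "0 < \<sigma>" "L * \<sigma> \<le> d / 4"
  proof -
    show "0 < \<sigma>" using d L_nonneg by (simp add: \<sigma>_def)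
    have "(L + 1) * \<sigma> = d / 4" using L_nonneg by (simp add: \<sigma>_def field_simps)
    then show "L * \<sigma> \<le> d / 4" using \<open>0 < \<sigma>\<close> by (simp add: algebra_simps)
  qed
  obtain c c' where cc: "continuous_on UNIV c' \<and>
      (\<forall>s. (c has_real_derivative c' s) (at s) \<and> \<bar>c' s\<bar> \<le> L \<and> \<bar>c s - b s\<bar> \<le> L * \<sigma>)"
    using mollify[OF \<sigma>(1)] by (elim exE)
  note cs = cc[THEN conjunct2, THEN spec]
  note c = cs[THEN conjunct1] cc[THEN conjunct1] cs[THEN conjunct2, THEN conjunct1] cs[THEN conjunct2, THEN conjunct2]
  \<comment> \<open>The offset \<open>d / 4\<close> absorbs the distance of the averaged graph
    \<open>c\<close> from \<open>b\<close>: \<open>A\<close> is nonpositive up to height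
    \<open>p\<close> and at least 1/2 from height \<open>q\<close> on, which are the two thresholds
    of \<open>zeta\<close>.\<close>
  define A where "A x = (1 / d) * (snd x - c (fst x) + (- p - d / 4))" for x
  note C = C1_compose_real[OF open_UNIV C1_fst c(1,2)]
  note D = C1_on_diff[OF open_UNIV C1_snd C(1)]
  note E = C1_on_add[OF open_UNIV D(1) C1_const[of "- p - d / 4"]]
  have A: "C1_on UNIV A" "grad A x = (1 / d) *\<^sub>R (- c' (fst x), 1)" for x
    unfolding A_def[abs_def] using C1_on_cmult[OF open_UNIV E(1), where c = "1 / d"] E(2)[of x] D(2)[of x] C(2)[of x]
    by auto
  note Z = C1_compose_real[OF open_UNIV A(1) DERIV_zeta continuous_zeta_deriv]
  note k = C1_on_diff[OF open_UNIV C1_const[of 1] Z(1)]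
  show ?thesis
  proof (intro exI[of _ "\<lambda>x. 1 - zeta (A x)"] conjI allI impI)
    show "C1_on UNIV (\<lambda>x. 1 - zeta (A x))" by (rule k(1))
    show "0 \<le> 1 - zeta (A x)" "1 - zeta (A x) \<le> 1" for x using zeta_bounds[of "A x"] by auto
    show "1 - zeta (A x) = 0" if "snd x - b (fst x) \<le> p" for x
    proof -
      have "snd x - c (fst x) - p - d / 4 \<le> 0" using c(4)[of "fst x"] \<sigma>(2) that by linarith
      then have "A x \<le> 0" using d by (simp add: A_def divide_le_0_iff)
      then show ?thesis by (simp add: zeta_eq_1)
    qed
    show "1 - zeta (A x) = 1" if "q \<le> snd x - b (fst x)" for x
    proof -
      have "d / 2 \<le> snd x - c (fst x) - p - d / 4" proof -
        have "q = p + d" by (simp add: d_def)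
        then show ?thesis using c(4)[of "fst x"] \<sigma>(2) that by linarith
      qed
      then have "1 / 2 \<le> A x" using d by (simp add: A_def field_simps)
      then show ?thesis by (simp add: zeta_eq_0)
    qed
    show "norm (grad (\<lambda>x. 1 - zeta (A x)) x) \<le> 8 * (L + 1) / (q - p)" for x
    proof -
      have "norm (- c' (fst x), 1::real) \<le> norm (- c' (fst x)) + norm (1::real)" by (rule norm_Pair_le)
      also have "\<dots> \<le> L + 1" using c(3)[of "fst x"] by simp
      finally have "(1 / d) * norm (- c' (fst x), 1::real) \<le> (1 / d) * (L + 1)"
        by (rule mult_left_mono) (use d in simp)
      moreover have "norm (grad A x) = (1 / d) * norm (- c' (fst x), 1::real)"
        unfolding A(2) norm_scaleR using d by simp
      ultimately have "norm (grad A x) \<le> (1 / d) * (L + 1)" by (simp only:)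
      then have "\<bar>zeta_deriv (A x)\<bar> * norm (grad A x) \<le> 8 * ((1 / d) * (L + 1))"
        by (rule mult_mono[OF zeta_deriv_bounds(2)]) simp_all
      then show ?thesis using k(2)[of x] Z(2)[of x] by (simp add: d_def)
    qed
  qed
qed

text \<open>Starting at 1/2 makes \<open>2 * tau m \<le> 1\<close>; as \<open>b \<le> 0\<close>, all
  cut-offs are then equal to 1 at the top and leave the trace there untouched.\<close>

definition tau :: "nat \<Rightarrow> real" where "tau m = 1 / real (m + 2)"

lemma tau: "0 < tau m" "2 * tau m \<le> 1" "tau \<longlonglongrightarrow> 0"
proof -
  show "0 < tau m" "2 * tau m \<le> 1" by (simp_all add: tau_def)
  have "(\<lambda>m. 1 / real (m + 2)) \<longlonglongrightarrow> 0"
    using LIMSEQ_ignore_initial_segment[OF lim_1_over_n, of 2] by simp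
  then show "tau \<longlonglongrightarrow> 0" by (simp add: tau_def[abs_def])
qed

definition cutoff_sequence :: "(nat \<Rightarrow> real \<times> real \<Rightarrow> real) \<Rightarrow> bool" where
  "cutoff_sequence k \<longleftrightarrow> (\<forall>m. C1_on UNIV (k m)) \<and> (\<forall>m x. 0 \<le> k m x \<and> k m x \<le> 1 \<and>
    (snd x - b (fst x) \<le> tau m \<longrightarrow> k m x = 0) \<and> (2 * tau m \<le> snd x - b (fst x) \<longrightarrow> k m x = 1) \<and>
    norm (grad (k m) x) \<le> 8 * (L + 1) / tau m)"

lemma cutoff_sequence_ex: "\<exists>k. cutoff_sequence k"
proof -
  have "\<exists>k. C1_on UNIV k \<and> (\<forall>x. 0 \<le> k x \<and> k x \<le> 1 \<and> (snd x - b (fst x) \<le> tau m \<longrightarrow> k x = 0) \<and>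
     (2 * tau m \<le> snd x - b (fst x) \<longrightarrow> k x = 1) \<and> norm (grad k x) \<le> 8 * (L + 1) / tau m)" for m
    using cutoff[of "tau m" "2 * tau m"] tau(1)[of m] by simp
  then show ?thesis unfolding cutoff_sequence_def by metis
qed

lemma cutoff_sequenceD:
  assumes "cutoff_sequence k"
  shows "C1_on UNIV (k m)" "0 \<le> k m x" "k m x \<le> 1"
    "snd x - b (fst x) \<le> tau m \<Longrightarrow> k m x = 0" "2 * tau m \<le> snd x - b (fst x) \<Longrightarrow> k m x = 1"
    "norm (grad (k m) x) \<le> 8 * (L + 1) / tau m"
  using assms unfolding cutoff_sequence_def by blast+

text \<open>The cut-off is constant on the open set of heights above \<open>2 * tau m\<close>. The
  thickness \<open>3 * tau m\<close> leaves room for the boundary of that set, where the derivative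
  is not read off.\<close>

lemma cutoff_sequence_grad_zero:
  assumes k: "cutoff_sequence k" and x: "x \<in> channel b" "x \<notin> layer b (3 * tau m)"
  shows "grad (k m) x = 0"
proof -
  have "grad (k m) x = grad (\<lambda>_. 1) x"
  proof (rule has_derivative_local_cong[OF open_above])
    show "x \<in> {x. b (fst x) + 2 * tau m < snd x}"
      using x tau(1)[of m] by (auto simp: channel_def layer_def)
    show "k m y = 1" if "y \<in> {x. b (fst x) + 2 * tau m < snd x}" for y
      by (rule cutoff_sequenceD(5)[OF k]) (use that in simp)
  qed
  then show ?thesis by simp
qed

lemma cutoff_sequence_tendsto:
  assumes k: "cutoff_sequence k" and "x \<in> channel b"
  shows "(\<lambda>m. k m x) \<longlonglongrightarrow> 1"
proof -
  have pos: "0 < (snd x - b (fst x)) / 2" using assms(2) by (auto simp: channel_def)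
  have "\<forall>\<^sub>F m in sequentially. tau m < (snd x - b (fst x)) / 2"
    using order_tendstoD(2)[OF tau(3) pos] .
  then have "\<forall>\<^sub>F m in sequentially. k m x = 1"
  proof eventually_elim
    case (elim m)
    show ?case by (rule cutoff_sequenceD(5)[OF k]) (use elim in simp)
  qed
  then show ?thesis by (rule tendsto_eventually)
qed

lemma L2_norm_layer_tendsto:
  fixes u :: "real \<times> real \<Rightarrow> 'b::euclidean_space"
  assumes u: "L2 (channel b) u" and r: "r \<longlonglongrightarrow> 0"
  shows "(\<lambda>m. L2_norm (layer b (r m)) u) \<longlonglongrightarrow> 0"
proof -
  have "(\<lambda>m. L2_norm (channel b) (\<lambda>x. indicator (layer b (r m)) x *\<^sub>R u x)) \<longlonglongrightarrow> 0"
  proof (rule L2_dominated_cutoff[OF channel_borel u])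
    show "indicat_real (layer b (r n)) \<in> borel_measurable (lebesgue_restr (channel b))" for n
      by (intro borel_measurable_restr) measurable
    show "(\<lambda>n. indicat_real (layer b (r n)) x) \<longlonglongrightarrow> 0" if "x \<in> channel b" for x
    proof -
      have pos: "0 < snd x - b (fst x)" using that by (auto simp: channel_def)
      have "\<forall>\<^sub>F m in sequentially. r m < snd x - b (fst x)"
        using order_tendstoD(2)[OF r pos] .
      then have "\<forall>\<^sub>F m in sequentially. indicat_real (layer b (r m)) x = 0"
        by eventually_elim (auto simp: layer_def indicator_def field_simps)
      then show ?thesis by (rule tendsto_eventually)
    qed
  qed (auto simp: indicator_def)
  moreover have "L2_norm (channel b) (\<lambda>x. indicator (layer b \<rho>) x *\<^sub>R u x) = L2_norm (layer b \<rho>) u" for \<rho>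
  proof -
    have "L2_norm (channel b) (\<lambda>x. indicator (layer b \<rho>) x *\<^sub>R u x) = L2_norm (layer b \<rho>) (\<lambda>x. indicator (layer b \<rho>) x *\<^sub>R u x)"
      by (rule L2_norm_support[OF layer_subset]) simp
    also have "\<dots> = L2_norm (layer b \<rho>) u"
      unfolding L2_norm_def set_lebesgue_integral_def
      by (intro arg_cong[where f = sqrt] Bochner_Integration.integral_cong) (auto simp: indicator_def)
    finally show ?thesis .
  qed
  ultimately show ?thesis by simp
qed

text \<open>The moment of the constant weight over the layer is at most \<open>r * r\<close>; the
  resulting factor sqrt 2 is rounded up to 2.\<close>

lemma layer_bound_zero_trace:
  assumes \<phi>: "C1_approx (channel b) \<phi> v h" and t0: "tendsto_L2 {0<..<1} (\<lambda>n s. \<phi> n (s, b s)) (\<lambda>_. 0)" and "0 \<le> r"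
  shows "L2_norm (layer b r) v \<le> 2 * r * L2_norm (layer b r) h"
proof -
  have K: "(\<integral>\<^sup>+t. ennreal ((t - b s) * 1\<^sup>2) * indicator {b s<..<min 1 (b s + r)} t \<partial>lborel) \<le> ennreal (r * r)" for s
  proof -
    have "(\<integral>\<^sup>+t. ennreal ((t - b s) * 1\<^sup>2) * indicator {b s<..<min 1 (b s + r)} t \<partial>lborel) \<le>
       (\<integral>\<^sup>+t. ennreal r * indicator {b s..b s + r} t \<partial>lborel)"
      by (rule nn_integral_mono) (auto simp: indicator_def intro!: ennreal_leI)
    also have "\<dots> = ennreal (r * r)"
      using \<open>0 \<le> r\<close> by (subst nn_integral_cmult_indicator) (auto simp: ennreal_mult)
    finally show ?thesis .
  qed
  have "(L2_norm (layer b r) (\<lambda>x. 1 * v x))\<^sup>2 \<le> 2 * (r * r) * (L2_norm (layer b r) h)\<^sup>2"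
    by (rule layer_bound[OF \<phi> t0, where C = 1]) (use \<open>0 \<le> r\<close> K in auto)
  also have "\<dots> \<le> (2 * r * L2_norm (layer b r) h)\<^sup>2"
    using mult_nonneg_nonneg[OF zero_le_power2[of r] zero_le_power2[of "L2_norm (layer b r) h"]]
    by (simp add: power2_eq_square algebra_simps)
  finally show ?thesis
    using power2_le_imp_le[of "L2_norm (layer b r) v" "2 * r * L2_norm (layer b r) h"] \<open>0 \<le> r\<close> by simp
qed

text \<open>A weakly harmonic field may be tested with functions of vanishing bottom trace: the cut-off at
  distance \<open>tau m\<close> has gradient of order \<open>1 / tau m\<close>, which is compensated by the size
  of \<open>v\<close> in that layer.\<close>

lemma test_zero_trace:
  assumes G: "L2 (channel b) G"
    and wh: "\<And>\<omega>. test_function (channel b) \<omega> \<Longrightarrow> (\<integral>x. G x \<bullet> grad \<omega> x \<partial>lebesgue_restr (channel b)) = 0"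
    and \<phi>: "C1_approx (channel b) \<phi> v h" and t0: "tendsto_L2 {0<..<1} (\<lambda>n s. \<phi> n (s, b s)) (\<lambda>_. 0)"
    and \<Psi>: "C1_on UNIV \<Psi>" and "0 < \<alpha>"
    and supp: "\<And>x. fst x < \<alpha> \<or> 1 - \<alpha> < fst x \<or> 1 - \<alpha> < snd x \<Longrightarrow> \<Psi> x = 0"
  shows "(\<integral>x. G x \<bullet> (\<Psi> x *\<^sub>R h x + v x *\<^sub>R grad \<Psi> x) \<partial>lebesgue_restr (channel b)) = 0"
proof -
  let ?D = "channel b" and ?M = "lebesgue_restr (channel b)"
  obtain k where ks: "cutoff_sequence k" using cutoff_sequence_ex by blast
  note k = cutoff_sequenceD[OF ks] cutoff_sequence_grad_zero[OF ks] cutoff_sequence_tendsto[OF ks]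
  note mult = C1_approx_mult[OF open_channel compact_closed_region channel_subset_closed_region]
  note P1 = mult[OF \<Psi> \<phi>]
  let ?v = "\<lambda>x. \<Psi> x * v x" and ?h = "\<lambda>x. \<Psi> x *\<^sub>R h x + v x *\<^sub>R grad \<Psi> x"
  have Lh: "L2 ?D ?h" and Lv: "L2 ?D ?v" and Lv': "L2 ?D v"
    using tendsto_L2D[OF C1_approxD(3)[OF P1]] tendsto_L2D[OF C1_approxD(2)[OF P1]] tendsto_L2D[OF C1_approxD(2)[OF \<phi>]] by auto
  have mG: "G \<in> borel_measurable ?M" and mh: "?h \<in> borel_measurable ?M" and mv: "?v \<in> borel_measurable ?M"
    using L2_measurable[OF channel_borel] G Lh Lv by auto
  have mk: "k m \<in> borel_measurable ?M" "grad (k m) \<in> borel_measurable ?M" for m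
    by (intro borel_measurable_restr C1_measurable k)+
  have eq: "(\<integral>x. G x \<bullet> (k m x *\<^sub>R ?h x + ?v x *\<^sub>R grad (k m) x) \<partial>?M) = 0" for m
  proof -
    note P2 = mult[OF k(1)[of m] P1]
    have lim: "(\<lambda>n. \<integral>x. G x \<bullet> grad (\<lambda>x. k m x * (\<Psi> x * \<phi> n x)) x \<partial>?M) \<longlonglongrightarrow>
        (\<integral>x. G x \<bullet> (k m x *\<^sub>R ?h x + ?v x *\<^sub>R grad (k m) x) \<partial>?M)"
      by (rule tendsto_L2_bilinear[OF channel_borel tendsto_L2_const[OF G] C1_approxD(3)[OF P2] bounded_bilinear_inner])
    \<comment> \<open>\<open>k m\<close> keeps the support away from the graph and \<Psi> keeps it
      away from the other three sides, so the product is a test function although the approximants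
      need not vanish on the graph.\<close>
    let ?K = "{x. \<alpha> \<le> fst x} \<inter> {x. fst x \<le> 1 - \<alpha>} \<inter> {x. snd x \<le> 1 - \<alpha>} \<inter> {x. b (fst x) + tau m \<le> snd x}"
    have sub: "?K \<subseteq> ?D" using \<open>0 < \<alpha>\<close> tau(1)[of m] by (auto simp: channel_def)
    have cK: "compact ?K"
    proof -
      have "continuous_on UNIV (\<lambda>x :: real \<times> real. b (fst x))"
        by (intro continuous_on_compose2[OF cont_b] continuous_intros) auto
      note c = continuous_on_add[OF this continuous_on_const[of _ "tau m"]]
      have "closed ?K" by (intro closed_Int closed_Collect_le continuous_intros c)
      moreover have "?K \<subseteq> closed_region" using sub channel_subset_closed_region by blast
      ultimately show ?thesis
        using compact_closed_region by (meson bounded_subset compact_eq_bounded_closed)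
    qed
    have "test_function ?D (\<lambda>x. k m x * (\<Psi> x * \<phi> n x))" for n
    proof (rule test_functionI[OF C1_approxD(1)[OF P2] cK sub])
      fix x assume "x \<notin> ?K"
      then consider "fst x < \<alpha> \<or> 1 - \<alpha> < fst x \<or> 1 - \<alpha> < snd x" | "snd x - b (fst x) \<le> tau m" by force
      then show "k m x * (\<Psi> x * \<phi> n x) = 0" using supp[of x] k(4)[of x m] by cases auto
    qed
    then have "(\<integral>x. G x \<bullet> grad (\<lambda>x. k m x * (\<Psi> x * \<phi> n x)) x \<partial>?M) = 0" for n by (rule wh)
    with lim show ?thesis using LIMSEQ_unique[OF _ tendsto_const] by fastforce
  qed
  have Fi: "integrable ?M (\<lambda>x. G x \<bullet> ?h x)"
    using L2_product(1)[OF channel_borel G Lh, of "\<lambda>x. G x \<bullet> ?h x" 1] borel_measurable_inner[OF mG mh]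
    by (simp add: Cauchy_Schwarz_ineq2)
  have lim1: "(\<lambda>m. \<integral>x. k m x * (G x \<bullet> ?h x) \<partial>?M) \<longlonglongrightarrow> (\<integral>x. G x \<bullet> ?h x \<partial>?M)"
  proof (rule integral_dominated_convergence[OF _ _ integrable_norm[OF Fi]])
    show "(\<lambda>x. G x \<bullet> ?h x) \<in> borel_measurable ?M" by (rule borel_measurable_inner[OF mG mh])
    then show "(\<lambda>x. k m x * (G x \<bullet> ?h x)) \<in> borel_measurable ?M" for m by (rule borel_measurable_times[OF mk(1)])
    show "AE x in ?M. (\<lambda>m. k m x * (G x \<bullet> ?h x)) \<longlonglongrightarrow> G x \<bullet> ?h x"
    proof (rule AE_I2)
      fix x assume "x \<in> space ?M"
      then have "x \<in> ?D" by (simp add: space_restrict_space)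
      from tendsto_mult_right[OF k(8)[OF this], of "G x \<bullet> ?h x"]
      show "(\<lambda>m. k m x * (G x \<bullet> ?h x)) \<longlonglongrightarrow> G x \<bullet> ?h x" by simp
    qed
    show "AE x in ?M. norm (k m x * (G x \<bullet> ?h x)) \<le> norm (G x \<bullet> ?h x)" for m
      by (rule AE_I2) (simp add: abs_mult k mult_left_le_one_le)
  qed
  obtain C where C: "0 \<le> C" "\<And>x. x \<in> ?D \<Longrightarrow> \<bar>\<Psi> x\<bar> \<le> C"
  proof -
    have "bounded (\<Psi> ` closed_region)"
      by (rule compact_imp_bounded[OF compact_continuous_image[OF continuous_on_subset[OF C1_on_continuous(1)[OF \<Psi>] subset_UNIV] compact_closed_region]])
    then obtain B where "\<forall>x\<in>closed_region. \<bar>\<Psi> x\<bar> \<le> B" by (auto simp: bounded_iff)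
    then show thesis
      using channel_subset_closed_region by (intro that[of "max B 0"]) (auto simp: le_max_iff_disj)
  qed
  let ?c = "\<lambda>m. 8 * (L + 1) / tau m"
  have c0: "0 \<le> ?c m" for m using L_nonneg tau(1)[of m] by simp
  \<comment> \<open>The factor \<open>6 * tau m\<close> from the Poincare inequality cancels the
    gradient of the cut-off. What remains tends to 0 because the energy of \<open>G\<close> in the
    layer does.\<close>
  have bound: "\<bar>\<integral>x. G x \<bullet> (?v x *\<^sub>R grad (k m) x) \<partial>?M\<bar> \<le> (48 * (L + 1) * C * L2_norm ?D h) * L2_norm (layer b (3 * tau m)) G" for m
  proof -
    let ?l = "layer b (3 * tau m)"
    have Cc: "0 \<le> C * ?c m" by (rule mult_nonneg_nonneg[OF C(1) c0])
    have T: "L2 ?l v" "L2 ?l G" using L2_subset(1)[OF channel_borel layer_borel layer_subset] Lv' G by auto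
    let ?F = "\<lambda>x. G x \<bullet> (?v x *\<^sub>R grad (k m) x)"
    have mF: "?F \<in> borel_measurable ?M" by (intro borel_measurable_inner borel_measurable_scaleR mG mv mk)
    have rr: "restrict_space ?M ?l = lebesgue_restr ?l"
    proof -
      have "restrict_space ?M ?l = lebesgue_restr (?D \<inter> ?l)" by (rule restrict_restrict_space) simp_all
      also have "?D \<inter> ?l = ?l" using layer_subset by blast
      finally show ?thesis .
    qed
    have mF': "?F \<in> borel_measurable (lebesgue_restr ?l)"
      using measurable_restrict_space1[OF mF, of ?l] unfolding rr .
    have "(\<integral>x. ?F x \<partial>?M) = (\<integral>x. ?F x \<partial>lebesgue_restr ?l)"
    proof -
      have "indicator ?D x *\<^sub>R ?F x = indicator ?l x *\<^sub>R ?F x" for x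
        using k(7)[of x m] layer_subset[of "3 * tau m"] by (cases "x \<in> ?D"; cases "x \<in> ?l") auto
      then have "(\<integral>x. indicator ?D x *\<^sub>R ?F x \<partial>lborel) = (\<integral>x. indicator ?l x *\<^sub>R ?F x \<partial>lborel)" by (simp only:)
      then show ?thesis by (subst (1 2) integral_restrict_space) simp_all
    qed
    also have "norm \<dots> \<le> (C * ?c m) * (L2_norm ?l v * L2_norm ?l G)"
    proof (rule L2_product(2)[OF layer_borel T mF'])
      fix x assume "x \<in> ?l"
      then have "x \<in> ?D" using layer_subset by blast
      have "norm (?F x) \<le> norm (G x) * (\<bar>\<Psi> x\<bar> * \<bar>v x\<bar> * norm (grad (k m) x))"
        using Cauchy_Schwarz_ineq2[of "G x" "?v x *\<^sub>R grad (k m) x"] by (simp add: abs_mult)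
      also have "\<dots> \<le> norm (G x) * (C * \<bar>v x\<bar> * ?c m)"
        by (intro mult_left_mono mult_mono C k \<open>x \<in> ?D\<close>) (use C c0 in auto)
      finally show "norm (?F x) \<le> (C * ?c m) * (norm (v x) * norm (G x))" by (simp add: mult_ac)
    qed (rule Cc)
    also have "\<dots> \<le> (C * ?c m) * ((6 * tau m * L2_norm ?D h) * L2_norm ?l G)"
    proof (intro mult_left_mono mult_right_mono)
      have "L2_norm ?l v \<le> 2 * (3 * tau m) * L2_norm ?l h"
        by (rule layer_bound_zero_trace[OF \<phi> t0]) (use tau(1)[of m] in simp)
      also have "\<dots> \<le> 2 * (3 * tau m) * L2_norm ?D h"
        using tau(1)[of m] L2_subset(2)[OF channel_borel layer_borel layer_subset tendsto_L2D(2)[OF C1_approxD(3)[OF \<phi>]]]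
        by (intro mult_left_mono) auto
      finally show "L2_norm ?l v \<le> 6 * tau m * L2_norm ?D h" by simp
    qed (rule Cc L2_norm_nonneg)+
    also have "\<dots> = (48 * (L + 1) * C * L2_norm ?D h) * L2_norm ?l G"
      using tau(1)[of m] by (simp add: field_simps)
    finally show ?thesis by simp
  qed
  have lim2: "(\<lambda>m. \<integral>x. G x \<bullet> (?v x *\<^sub>R grad (k m) x) \<partial>?M) \<longlonglongrightarrow> 0"
  proof (rule Lim_null_comparison)
    show "\<forall>\<^sub>F m in sequentially. norm (\<integral>x. G x \<bullet> (?v x *\<^sub>R grad (k m) x) \<partial>?M) \<le>
        (48 * (L + 1) * C * L2_norm ?D h) * L2_norm (layer b (3 * tau m)) G"
      unfolding real_norm_def by (rule always_eventually, rule allI, rule bound)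
    show "(\<lambda>m. (48 * (L + 1) * C * L2_norm ?D h) * L2_norm (layer b (3 * tau m)) G) \<longlonglongrightarrow> 0"
      using tendsto_mult_left[OF L2_norm_layer_tendsto[OF G tendsto_mult_right_zero[OF tau(3)]], of "48 * (L + 1) * C * L2_norm ?D h"] by simp
  qed
  have "(\<integral>x. k m x * (G x \<bullet> ?h x) \<partial>?M) = - (\<integral>x. G x \<bullet> (?v x *\<^sub>R grad (k m) x) \<partial>?M)" for m
  proof -
    note P2 = tendsto_L2D(2)[OF C1_approxD(3)[OF mult[OF k(1)[of m] P1]]]
    have Li: "L2 ?D (\<lambda>x. k m x *\<^sub>R ?h x)"
      by (rule L2_mult(1)[OF channel_borel Lh mk(1), where C = 1]) (use k in \<open>auto simp: abs_le_iff intro: order.trans[of _ 0]\<close>)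
    have L3: "L2 ?D (\<lambda>x. ?v x *\<^sub>R grad (k m) x)"
      using L2_diff(1)[OF channel_borel P2 Li] by (simp add: algebra_simps)
    have ip: "integrable ?M (\<lambda>x. G x \<bullet> f x)" if "L2 ?D f" for f
      using L2_product(1)[OF channel_borel G that, of "\<lambda>x. G x \<bullet> f x" 1] borel_measurable_inner[OF mG L2_measurable[OF channel_borel that]]
      by (simp add: Cauchy_Schwarz_ineq2)
    have "(\<integral>x. G x \<bullet> (k m x *\<^sub>R ?h x) \<partial>?M) + (\<integral>x. G x \<bullet> (?v x *\<^sub>R grad (k m) x) \<partial>?M) = 0"
      using eq[of m] ip[OF Li] ip[OF L3] by (simp only: inner_add_right Bochner_Integration.integral_add)
    then show ?thesis by simp
  qed
  with lim1 tendsto_minus[OF lim2] show ?thesis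
    using LIMSEQ_unique by fastforce
qed

text \<open>Cutting off near the graph costs \<open>u\<close> times the gradient of the cut-off, at
  most \<open>8 * (L + 1) / tau m\<close> times the layer norm. If that norm is o(tau m), the cut
  functions converge in H1, so that \<open>u\<close> has zero trace; they even vanish exactly on the
  graph.\<close>

lemma C1_approx_of_layer_decay:
  assumes u: "C1_on {x. b (fst x) < snd x} u" and Lu: "L2 (channel b) u" and Lg: "L2 (channel b) (grad u)"
    and decay: "(\<lambda>m. L2_norm (layer b (3 * tau m)) u / tau m) \<longlonglongrightarrow> 0"
  obtains \<phi> where "C1_approx (channel b) \<phi> u (grad u)" "\<And>n s. \<phi> n (s, b s) = 0" "\<And>n s. \<phi> n (s, 1) = u (s, 1)"
proof -
  let ?D = "channel b" and ?M = "lebesgue_restr (channel b)"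
  obtain k where ks: "cutoff_sequence k" using cutoff_sequence_ex by blast
  note k = cutoff_sequenceD[OF ks] cutoff_sequence_grad_zero[OF ks] cutoff_sequence_tendsto[OF ks]
  let ?U = "{x. b (fst x) < snd x}"
  have U: "open ?U" using open_above[of 0] by simp
  have ext: "C1_on UNIV (\<lambda>x. k m x * u x)" "grad (\<lambda>x. k m x * u x) x = k m x *\<^sub>R grad u x + u x *\<^sub>R grad (k m) x" for m x
  proof -
    have UV: "?U \<union> {x. snd x < b (fst x) + tau m} = UNIV" using tau(1)[of m] by (force simp: not_less)
    show "C1_on UNIV (\<lambda>x. k m x * u x)" "grad (\<lambda>x. k m x * u x) x = k m x *\<^sub>R grad u x + u x *\<^sub>R grad (k m) x"
      by (rule C1_mult_extend[OF U open_below UV k(1) _ u]; use k(4) in force)+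
  qed
  have mk: "k m \<in> borel_measurable ?M" "grad (k m) \<in> borel_measurable ?M" for m
    by (intro borel_measurable_restr C1_measurable k)+
  have mk1: "(\<lambda>x. k m x - 1) \<in> borel_measurable ?M" for m using mk(1) by simp
  have k1: "\<bar>k m x - 1\<bar> \<le> 1" "\<bar>k m x\<bar> \<le> 1" for m x using k(2,3)[of m x] by auto
  have k0: "(\<lambda>m. k m x - 1) \<longlonglongrightarrow> 0" if "x \<in> ?D" for x using k(8)[OF that] by (rule LIM_zero)
  have A: "tendsto_L2 ?D (\<lambda>m x. k m x *\<^sub>R w x) w" if "L2 ?D w" for w :: "real \<times> real \<Rightarrow> 'b::euclidean_space"
  proof (rule tendsto_L2I[OF _ that])
    show "L2 ?D (\<lambda>x. k m x *\<^sub>R w x)" for m by (rule L2_mult(1)[OF channel_borel that mk(1) k1(2)])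
    show "L2_norm ?D (\<lambda>x. k m x *\<^sub>R w x - w x) \<le> L2_norm ?D (\<lambda>x. (k m x - 1) *\<^sub>R w x)" for m
      by (simp add: scaleR_diff_left)
    show "(\<lambda>m. L2_norm ?D (\<lambda>x. (k m x - 1) *\<^sub>R w x)) \<longlonglongrightarrow> 0"
      by (rule L2_dominated_cutoff[OF channel_borel that mk1 k1(1) k0])
  qed
  let ?c = "\<lambda>m. 8 * (L + 1) / tau m"
  have c0: "0 \<le> ?c m" for m using L_nonneg tau(1)[of m] by simp
  have B0: "L2 ?D (\<lambda>x. u x *\<^sub>R grad (k m) x)" for m
  proof (rule L2_bound(1)[OF channel_borel _ Lu _ c0[of m]])
    show "(\<lambda>x. u x *\<^sub>R grad (k m) x) \<in> borel_measurable ?M"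
      by (intro borel_measurable_scaleR mk L2_measurable[OF channel_borel Lu])
    show "norm (u x *\<^sub>R grad (k m) x) \<le> ?c m * norm (u x)" for x
      using mult_right_mono[OF k(6)[where m = m and x = x], of "norm (u x)"] by (simp add: mult.commute)
  qed
  have B: "tendsto_L2 ?D (\<lambda>m x. u x *\<^sub>R grad (k m) x) (\<lambda>_. 0)"
  proof (rule tendsto_L2I[OF B0])
    show "L2 ?D (\<lambda>_. 0 :: real \<times> real)" by (rule L2_const[OF channel_borel emeasure_channel, where C = 0]) auto
    show "L2_norm ?D (\<lambda>x. u x *\<^sub>R grad (k m) x - 0) \<le> 8 * (L + 1) * (L2_norm (layer b (3 * tau m)) u / tau m)" for m
    proof -
      let ?l = "layer b (3 * tau m)"
      have "L2_norm ?D (\<lambda>x. u x *\<^sub>R grad (k m) x - 0) = L2_norm ?l (\<lambda>x. u x *\<^sub>R grad (k m) x)"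
        using L2_norm_support[OF layer_subset, of "3 * tau m" "\<lambda>x. u x *\<^sub>R grad (k m) x"] k(7)[of _ m] by simp
      also have "\<dots> \<le> ?c m * L2_norm ?l u"
      proof (rule L2_bound(2)[OF layer_borel _ _ _ c0[of m]])
        show "L2 ?l u" by (rule L2_subset(1)[OF channel_borel layer_borel layer_subset Lu])
        show "(\<lambda>x. u x *\<^sub>R grad (k m) x) \<in> borel_measurable (lebesgue_restr ?l)"
          by (rule L2_measurable[OF layer_borel L2_subset(1)[OF channel_borel layer_borel layer_subset B0]])
        show "norm (u x *\<^sub>R grad (k m) x) \<le> ?c m * norm (u x)" for x
          using mult_right_mono[OF k(6)[where m = m and x = x], of "norm (u x)"] by (simp add: mult.commute)
      qed
      finally show ?thesis by simp
    qed
    show "(\<lambda>m. 8 * (L + 1) * (L2_norm (layer b (3 * tau m)) u / tau m)) \<longlonglongrightarrow> 0"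
      using tendsto_mult_left[OF decay, of "8 * (L + 1)"] by simp
  qed
  have g: "grad (\<lambda>x. k m x * u x) = (\<lambda>x. k m x *\<^sub>R grad u x + u x *\<^sub>R grad (k m) x)" for m
    using ext(2) by auto
  have "C1_approx ?D (\<lambda>m x. k m x * u x) u (grad u)"
    unfolding C1_approx_def g
    using ext(1) A[OF Lu] tendsto_L2_add[OF channel_borel A[OF Lg] B] by simp
  moreover have "k m (s, b s) * u (s, b s) = 0" for m s using k(4)[of "(s, b s)" m] tau(1)[of m] by simp
  moreover have "k m (s, 1) * u (s, 1) = u (s, 1)" for m s
    using k(5)[where m = m and x = "(s, 1)"] tau(2)[of m] b_le[of s] by simp
  ultimately show thesis by (intro that[of "\<lambda>m x. k m x * u x"]) auto
qed

end

section \<open>The cell problem\<close>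

lemma nn_integral_FTC_continuous:
  fixes g :: "real \<Rightarrow> real"
  assumes "a \<le> b" and D: "\<And>t. a \<le> t \<Longrightarrow> t \<le> b \<Longrightarrow> (F has_real_derivative g t) (at t)"
    and c: "continuous_on {a..b} g" and pos: "\<And>t. a \<le> t \<Longrightarrow> t \<le> b \<Longrightarrow> 0 \<le> g t"
  shows "(\<integral>\<^sup>+t. ennreal (g t) * indicator {a..b} t \<partial>lborel) = ennreal (F b - F a)"
proof -
  have i: "integrable lborel (\<lambda>t. indicator {a..b} t *\<^sub>R g t)"
    by (rule borel_integrable_compact[OF compact_Icc c])
  have "(\<integral>\<^sup>+t. ennreal (g t) * indicator {a..b} t \<partial>lborel) = (\<integral>\<^sup>+t. ennreal (indicator {a..b} t *\<^sub>R g t) \<partial>lborel)"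
    by (rule nn_integral_cong) (simp add: indicator_def)
  also have "\<dots> = ennreal (\<integral>t. indicator {a..b} t *\<^sub>R g t \<partial>lborel)"
    by (rule nn_integral_eq_integral[OF i]) (use pos in \<open>auto simp: indicator_def\<close>)
  also have "(\<integral>t. indicator {a..b} t *\<^sub>R g t \<partial>lborel) = F b - F a"
    by (rule integral_FTC_Icc[OF \<open>a \<le> b\<close> _ c])
       (use D in \<open>auto simp: has_real_derivative_iff_has_vector_derivative[symmetric] intro: has_field_derivative_at_within\<close>)
  finally show ?thesis .
qed

lemma integrable_Ioo_continuous:
  fixes g :: "real \<Rightarrow> real"
  assumes c: "continuous_on {a..b} g"
  shows "integrable lborel (\<lambda>t. g t * indicator {a<..<b} t)"
proof -
  have i: "integrable lborel (\<lambda>t. indicator {a..b} t *\<^sub>R g t)"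
    by (rule borel_integrable_compact[OF compact_Icc c])
  have "integrable lborel (\<lambda>t. indicator {a<..<b} t *\<^sub>R (indicator {a..b} t *\<^sub>R g t))"
    by (rule integrable_mult_indicator[OF _ i]) simp
  moreover have "(\<lambda>t. indicator {a<..<b} t *\<^sub>R (indicator {a..b} t *\<^sub>R g t)) = (\<lambda>t. g t * indicator {a<..<b} t)"
    by (auto simp: indicator_def)
  ultimately show ?thesis by (simp only:)
qed

lemma integral_Icc_lborel:
  fixes g :: "real \<Rightarrow> real"
  assumes c: "continuous_on {a..b} g"
  shows "integral {a..b} g = (\<integral>t. g t * indicator {a<..<b} t \<partial>lborel)"
proof -
  have i: "integrable lborel (\<lambda>t. indicator {a..b} t *\<^sub>R g t)"
    by (rule borel_integrable_compact[OF compact_Icc c])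
  then have "integral {a..b} g = (\<integral>t. indicator {a..b} t *\<^sub>R g t \<partial>lborel)"
    using set_borel_integral_eq_integral(2)[of "{a..b}" g] by (simp add: set_integrable_def set_lebesgue_integral_def)
  also have "\<dots> = (\<integral>t. g t * indicator {a<..<b} t \<partial>lborel)"
  proof (rule integral_cong_AE[OF borel_measurable_integrable[OF i] borel_measurable_integrable[OF integrable_Ioo_continuous[OF c]]])
    show "AE t in lborel. indicator {a..b} t *\<^sub>R g t = g t * indicator {a<..<b} t"
      using AE_lborel_singleton[of a] AE_lborel_singleton[of b] by eventually_elim (auto simp: indicator_def)
  qed
  finally show ?thesis .
qed

lemma nn_integral_Ioo_continuous:
  fixes g :: "real \<Rightarrow> real"
  assumes c: "continuous_on {a..b} g" and pos: "\<And>t. t \<in> {a..b} \<Longrightarrow> 0 \<le> g t"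
  shows "(\<integral>\<^sup>+t. ennreal (g t) * indicator {a<..<b} t \<partial>lborel) = ennreal (integral {a..b} g)"
proof -
  have "(\<integral>\<^sup>+t. ennreal (g t) * indicator {a<..<b} t \<partial>lborel) = (\<integral>\<^sup>+t. ennreal (g t * indicator {a<..<b} t) \<partial>lborel)"
    by (rule nn_integral_cong) (simp add: indicator_def)
  also have "\<dots> = ennreal (\<integral>t. g t * indicator {a<..<b} t \<partial>lborel)"
    by (rule nn_integral_eq_integral[OF integrable_Ioo_continuous[OF c]]) (use pos in \<open>auto simp: indicator_def\<close>)
  finally show ?thesis by (simp add: integral_Icc_lborel[OF c])
qed

lemma borel_measurable_ennreal_indicator:
  fixes g :: "'a::euclidean_space \<Rightarrow> real"
  assumes S: "S \<in> sets borel" and g: "continuous_on S g"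
  shows "(\<lambda>x. ennreal (g x) * indicator S x) \<in> borel_measurable borel"
proof -
  have "(\<lambda>x. ennreal (indicator S x *\<^sub>R g x)) \<in> borel_measurable borel"
    by (rule measurable_compose[OF borel_measurable_continuous_on_indicator[OF S g] measurable_ennreal])
  moreover have "ennreal (indicator S x *\<^sub>R g x) = ennreal (g x) * indicator S x" for x
    by (simp add: indicator_def)
  ultimately show ?thesis by (simp only:)
qed

locale cell_problem =
  fixes f :: "real \<Rightarrow> real" and L \<delta> :: real and \<beta> :: "real \<times> real \<Rightarrow> real"
  assumes f_lip: "\<And>s t. \<bar>f s - f t\<bar> \<le> L * \<bar>s - t\<bar>"
    and f_periodic: "\<And>s. f (s + 1) = f s"
    and \<delta>_pos: "0 < \<delta>" and f_bounds: "\<And>s. -1 + \<delta> < f s" "\<And>s. f s < - \<delta>"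
    and sol: "cell_solution f \<beta>"
begin

lemma f_continuous: "continuous_on UNIV f"
proof -
  have "L-lipschitz_on UNIV f"
    using f_lip f_lip[of 1 0] by (auto simp: lipschitz_on_def dist_real_def)
  then show ?thesis by (rule lipschitz_on_continuous_on)
qed

lemma lipschitz_graph_domain_f: "lipschitz_graph_domain f L"
proof
  show "-1 \<le> f s" "f s \<le> 0" for s using f_bounds[of s] \<delta>_pos by auto
qed (use f_continuous f_lip in auto)

abbreviation strip :: "(real \<times> real) set" where "strip \<equiv> cell_strip f"

lemma strip_eq: "strip = {x. f (fst x) < snd x}" by (auto simp: cell_strip_def)

lemma open_strip: "open strip"
proof -
  interpret lipschitz_graph_domain f L by (rule lipschitz_graph_domain_f)
  show ?thesis using open_above[of 0] by (simp add: strip_eq)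
qed

lemma cell_borel [measurable]: "cell f \<in> sets borel"
proof -
  have "cell f = {x. 0 < fst x} \<inter> {x. fst x < 1} \<inter> strip" by (auto simp: cell_def cell_strip_def)
  then have "open (cell f)" using open_strip by (auto intro!: open_Int open_Collect_less continuous_intros)
  then show ?thesis by auto
qed

lemma cell_subset_strip: "cell f \<subseteq> strip" by (auto simp: cell_def cell_strip_def)

lemma \<beta>_C1: "C1_on strip \<beta>" "C1_on strip (\<lambda>y. fst (grad \<beta> y))" "C1_on strip (\<lambda>y. snd (grad \<beta> y))"
  and \<beta>_laplacian: "\<And>x. x \<in> strip \<Longrightarrow>
    fst (grad (\<lambda>y. fst (grad \<beta> y)) x) + snd (grad (\<lambda>y. snd (grad \<beta> y)) x) = 0"
  using sol by (auto simp: cell_solution_def harmonic_on_def C2_on_def laplacian_def)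

lemma \<beta>_periodic: "x \<in> strip \<Longrightarrow> \<beta> (fst x + 1, snd x) = \<beta> x"
  using sol by (auto simp: cell_solution_def cell_strip_def)

lemma grad_\<beta>_L2: "L2 (cell f) (grad \<beta>)"
  using sol by (simp add: cell_solution_def)

lemma grad_\<beta>_periodic: "x \<in> strip \<Longrightarrow> grad \<beta> (fst x + 1, snd x) = grad \<beta> x"
proof -
  assume x: "x \<in> strip"
  let ?x' = "(fst x + 1, snd x)"
  have x': "?x' \<in> strip" using x f_periodic by (auto simp: cell_strip_def)
  have "(\<beta> has_derivative (\<lambda>d. grad \<beta> ?x' \<bullet> d)) (at (x + (1, 0)))"
    using C1_onD[OF open_strip \<beta>_C1(1) x'] by (simp add: prod_eq_iff plus_prod_def)
  moreover have "((\<lambda>y. y + (1, 0)) has_derivative (\<lambda>d. d)) (at x)"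
    by (auto intro!: derivative_eq_intros)
  ultimately have "((\<lambda>y. \<beta> (y + (1, 0))) has_derivative (\<lambda>d. grad \<beta> ?x' \<bullet> d)) (at x)"
    using has_derivative_compose by fastforce
  then have "(\<beta> has_derivative (\<lambda>d. grad \<beta> ?x' \<bullet> d)) (at x)"
  proof (rule has_derivative_transform_within_open[OF _ open_strip x])
    show "\<beta> (y + (1, 0)) = \<beta> y" if "y \<in> strip" for y
      using \<beta>_periodic[OF that] by (simp add: plus_prod_def)
  qed
  then show "grad \<beta> ?x' = grad \<beta> x" by (simp add: grad_eqI)
qed

text \<open>Whole horizontal lines down to height -\<delta> lie in the strip, so quantities defined
  on lines are differentiable at height 0 from both sides.\<close>

lemma upper_in_strip: "- \<delta> < t \<Longrightarrow> (s, t) \<in> strip"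
  using f_bounds(2)[of s] by (simp add: cell_strip_def)

section \<open>Means over one horizontal period, flux and energy of the cell solution\<close>

abbreviation "p \<equiv> (\<lambda>y. fst (grad \<beta> y))"
abbreviation "q \<equiv> (\<lambda>y. snd (grad \<beta> y))"

definition slice :: "(real \<times> real \<Rightarrow> real) \<Rightarrow> real \<Rightarrow> real" where
  "slice F t = integral {0..1} (\<lambda>s. F (s, t))"

lemma slice_continuous: "continuous_on strip F \<Longrightarrow> - \<delta> < t \<Longrightarrow> continuous_on {0..1} (\<lambda>s. F (s, t))"
  by (rule continuous_on_compose2[where g = F]) (auto intro!: continuous_intros upper_in_strip)

lemma slice_integrable:
  fixes F :: "real \<times> real \<Rightarrow> real"
  shows "continuous_on strip F \<Longrightarrow> - \<delta> < t \<Longrightarrow> (\<lambda>s. F (s, t)) integrable_on {0..1}"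
  by (rule integrable_continuous_real[OF slice_continuous])

lemma slice_has_derivative:
  assumes F: "C1_on strip F" and t: "- \<delta> < t"
  shows "(slice F has_real_derivative slice (\<lambda>x. snd (grad F x)) t) (at t)"
proof -
  let ?U = "{- \<delta><..}"
  have "((\<lambda>t. integral (cbox 0 1) (\<lambda>s. F (s, t))) has_field_derivative
     integral (cbox 0 1) (\<lambda>s. snd (grad F (s, t)))) (at t within ?U)"
  proof (rule leibniz_rule_field_derivative[where fx = "\<lambda>t s. snd (grad F (s, t))"])
    show "((\<lambda>t. F (s, t)) has_field_derivative snd (grad F (s, t))) (at t within ?U)" if "t \<in> ?U" for t s
      by (rule has_field_derivative_at_within[OF C1_DERIV_snd[OF open_strip F]]) (use that in \<open>auto intro: upper_in_strip\<close>)
    show "(\<lambda>s. F (s, t)) integrable_on cbox 0 1" if "t \<in> ?U" for t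
      using slice_integrable[OF C1_on_continuous(1)[OF F], of t] that by simp
    show "continuous_on (?U \<times> cbox 0 1) (\<lambda>(t, s). snd (grad F (s, t)))"
      unfolding case_prod_beta
      by (intro continuous_on_snd continuous_on_compose2[OF C1_on_continuous(2)[OF F]] continuous_intros)
         (auto intro: upper_in_strip)
  qed (use t in auto)
  moreover have "at t within ?U = at t" using t by (intro at_within_open) auto
  ultimately show ?thesis by (simp add: slice_def[abs_def])
qed

lemma slice_continuous_on:
  assumes F: "continuous_on strip F" shows "continuous_on {- \<delta><..} (slice F)"
proof -
  have "continuous_on ({- \<delta><..} \<times> cbox 0 1) (\<lambda>(t, s). F (s, t))"
    unfolding case_prod_beta
    by (intro continuous_on_compose2[OF F] continuous_intros) (auto intro: upper_in_strip)
  from integral_continuous_on_param[OF this] show ?thesis by (simp add: slice_def[abs_def])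
qed

lemma slice_p_deriv_zero:
  assumes F: "C1_on strip F" and per: "\<And>x. x \<in> strip \<Longrightarrow> F (fst x + 1, snd x) = F x" and t: "- \<delta> < t"
  shows "slice (\<lambda>x. fst (grad F x)) t = 0"
proof -
  have "((\<lambda>s. fst (grad F (s, t))) has_integral (F (1, t) - F (0, t))) {0..1}"
  proof (rule fundamental_theorem_of_calculus)
    show "((\<lambda>s. F (s, t)) has_vector_derivative fst (grad F (s, t))) (at s within {0..1})" for s
      using C1_DERIV_fst[OF open_strip F upper_in_strip[OF t]]
      by (simp add: has_real_derivative_iff_has_vector_derivative has_vector_derivative_at_within)
  qed simp
  moreover have "F (1, t) = F (0, t)" using per[OF upper_in_strip[OF t], of 0] by simp
  ultimately show ?thesis by (simp add: slice_def integral_unique)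
qed

definition "E = slice (\<lambda>x. (p x)\<^sup>2 + (q x)\<^sup>2)"
definition "J = slice (\<lambda>x. \<beta> x * q x)"

lemma grad_norm: "(norm (grad \<beta> x))\<^sup>2 = (p x)\<^sup>2 + (q x)\<^sup>2"
  by (simp add: norm_prod_def)

lemma cont_pq: "continuous_on strip p" "continuous_on strip q" "continuous_on strip \<beta>"
  using \<beta>_C1 C1_on_continuous by blast+

lemma E_nonneg: "0 \<le> E t" if "- \<delta> < t"
  unfolding E_def slice_def
  by (intro Henstock_Kurzweil_Integration.integral_nonneg slice_integrable[where F = "\<lambda>x. (p x)\<^sup>2 + (q x)\<^sup>2"] continuous_intros cont_pq that) simp

text \<open>The field \<beta> grad \<beta> has divergence |grad \<beta>|^2 because \<beta> is
  harmonic, and its horizontal part contributes nothing over a period. Adding the vanishing mean of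
  the horizontal derivative completes the divergence.\<close>

lemma DERIV_J: assumes t: "- \<delta> < t" shows "(J has_real_derivative E t) (at t)"
proof -
  note M = C1_on_mult[OF open_strip \<beta>_C1(1) \<beta>_C1(3)]
  note M1 = C1_on_mult[OF open_strip \<beta>_C1(1) \<beta>_C1(2)]
  have per: "\<beta> (fst x + 1, snd x) * p (fst x + 1, snd x) = \<beta> x * p x" if "x \<in> strip" for x
    using \<beta>_periodic[OF that] grad_\<beta>_periodic[OF that] by simp
  have z: "slice (\<lambda>x. fst (grad (\<lambda>x. \<beta> x * p x) x)) t = 0"
    by (rule slice_p_deriv_zero[where F = "\<lambda>x. \<beta> x * p x", OF M1(1) per t])
  have "slice (\<lambda>x. snd (grad (\<lambda>x. \<beta> x * q x) x)) t =
     slice (\<lambda>x. snd (grad (\<lambda>x. \<beta> x * q x) x)) t + slice (\<lambda>x. fst (grad (\<lambda>x. \<beta> x * p x) x)) t"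
    by (simp add: z)
  also have "\<dots> = integral {0..1} (\<lambda>s. snd (grad (\<lambda>x. \<beta> x * q x) (s, t)) + fst (grad (\<lambda>x. \<beta> x * p x) (s, t)))"
    unfolding slice_def
    by (rule Henstock_Kurzweil_Integration.integral_add[symmetric];
        rule slice_integrable[OF _ t]; intro continuous_on_fst continuous_on_snd C1_on_continuous M(1) M1(1))
  also have "\<dots> = E t"
    unfolding E_def slice_def
  proof (rule Henstock_Kurzweil_Integration.integral_cong)
    fix s :: real
    have s: "(s, t) \<in> strip" by (rule upper_in_strip[OF t])
    have "snd (grad q (s, t)) = - fst (grad p (s, t))" using \<beta>_laplacian[OF s] by simp
    then show "snd (grad (\<lambda>x. \<beta> x * q x) (s, t)) + fst (grad (\<lambda>x. \<beta> x * p x) (s, t)) = (p (s, t))\<^sup>2 + (q (s, t))\<^sup>2"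
      using M(2)[OF s] M1(2)[OF s] by (simp add: power2_eq_square)
  qed
  finally show ?thesis using slice_has_derivative[OF M(1) t] unfolding J_def by simp
qed

lemma nn_upper:
  assumes W: "W \<in> borel_measurable borel" and F: "continuous_on strip F" "\<And>x. 0 \<le> F x"
  shows "(\<integral>\<^sup>+x. ennreal (W (snd x) * F x) * indicator ({0<..<1} \<times> {0<..<T}) x \<partial>lborel) =
    (\<integral>\<^sup>+t. ennreal (W t) * ennreal (slice F t) * indicator {0<..<T} t \<partial>lborel)"
proof -
  let ?R = "{0<..<1} \<times> {0<..<T} :: (real \<times> real) set"
  have R: "?R \<in> sets borel" by (intro borel_open open_Times) auto
  have sub: "?R \<subseteq> strip" using \<delta>_pos by (auto intro!: upper_in_strip)
  have [measurable]: "W \<in> borel_measurable borel" by (rule W)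
  have mF: "(\<lambda>x. indicator ?R x *\<^sub>R F x) \<in> borel_measurable borel"
    by (rule borel_measurable_continuous_on_indicator[OF R continuous_on_subset[OF F(1) sub]])
  have m: "(\<lambda>x. ennreal (W (snd x)) * ennreal (indicator ?R x *\<^sub>R F x)) \<in> borel_measurable (lborel \<Otimes>\<^sub>M lborel)"
    unfolding lborel_prod
    by (intro borel_measurable_times_ennreal measurable_compose[OF mF measurable_ennreal, simplified measurable_lborel1]
        measurable_compose[OF _ measurable_ennreal] measurable_compose[OF _ W])
       (use mF in \<open>auto intro!: borel_measurable_continuous_onI continuous_intros measurable_compose[OF _ measurable_ennreal]\<close>)
  have eq: "ennreal (W (snd x) * F x) * indicator ?R x = ennreal (W (snd x)) * ennreal (indicator ?R x *\<^sub>R F x)" for x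
  proof (cases "x \<in> ?R")
    case True
    then show ?thesis using F(2)[of x] by (simp add: ennreal_mult'')
  qed simp
  have "(\<integral>\<^sup>+x. ennreal (W (snd x) * F x) * indicator ?R x \<partial>lborel) =
      (\<integral>\<^sup>+t. \<integral>\<^sup>+s. ennreal (W t) * ennreal (indicator ?R (s, t) *\<^sub>R F (s, t)) \<partial>lborel \<partial>lborel)"
    using lborel_pair.nn_integral_snd[of "\<lambda>x. ennreal (W (snd x)) * ennreal (indicator ?R x *\<^sub>R F x)"] m
    by (simp only: eq lborel_prod snd_conv)
  also have "\<dots> = (\<integral>\<^sup>+t. ennreal (W t) * ennreal (slice F t) * indicator {0<..<T} t \<partial>lborel)"
  proof (rule nn_integral_cong)
    fix t :: real
    show "(\<integral>\<^sup>+s. ennreal (W t) * ennreal (indicator ?R (s, t) *\<^sub>R F (s, t)) \<partial>lborel) = ennreal (W t) * ennreal (slice F t) * indicator {0<..<T} t"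
    proof (cases "t \<in> {0<..<T}")
      case True
      then have t: "- \<delta> < t" using \<delta>_pos by simp
      have c: "continuous_on {0..1} (\<lambda>s. F (s, t))" by (rule slice_continuous[OF F(1) t])
      have e: "ennreal (indicator ?R (s, t) *\<^sub>R F (s, t)) = ennreal (F (s, t)) * indicator {0<..<1} s" for s
        using True by (auto simp: indicator_def)
      have "(\<integral>\<^sup>+s. ennreal (indicator ?R (s, t) *\<^sub>R F (s, t)) \<partial>lborel) = ennreal (slice F t)"
        unfolding e slice_def by (rule nn_integral_Ioo_continuous[OF c]) (simp add: F(2))
      moreover have "(\<lambda>s. ennreal (indicator ?R (s, t) *\<^sub>R F (s, t))) \<in> borel_measurable lborel"
      proof -
        have "(\<lambda>s. indicator {0..1} s *\<^sub>R F (s, t)) \<in> borel_measurable borel"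
          by (rule borel_measurable_continuous_on_indicator[OF _ c]) simp
        then have "(\<lambda>s. ennreal (indicator {0..1} s *\<^sub>R F (s, t)) * indicator {0<..<1} s) \<in> borel_measurable lborel" by measurable
        moreover have "ennreal (indicator {0..1} s *\<^sub>R F (s, t)) * indicator {0<..<1} s = ennreal (F (s, t)) * indicator {0<..<1} s" for s
          by (simp add: indicator_def)
        ultimately show ?thesis by (simp only: e)
      qed
      ultimately show ?thesis using True by (simp add: nn_integral_cmult)
    next
      case False
      then have "indicator ?R (s, t) = (0::real)" for s by (auto simp: indicator_def)
      then show ?thesis using False by simp
    qed
  qed
  finally show ?thesis .
qed

lemma J_increment: "0 \<le> a \<Longrightarrow> a \<le> T \<Longrightarrow> J a \<le> J T"
  using \<delta>_pos by (intro DERIV_nonneg_imp_nondecreasing[of a T J]) (auto intro!: exI DERIV_J E_nonneg)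

lemma E_continuous: "continuous_on {- \<delta><..} E"
  unfolding E_def by (intro slice_continuous_on continuous_intros cont_pq)

lemma J_bounded_increment:
  assumes "0 \<le> T"
  shows "J T - J 0 \<le> (L2_norm (cell f) (grad \<beta>))\<^sup>2"
proof -
  have "ennreal (J T - J 0) = (\<integral>\<^sup>+t. ennreal (E t) * indicator {0..T} t \<partial>lborel)"
    by (rule nn_integral_FTC_continuous[symmetric, OF assms])
       (use \<delta>_pos in \<open>auto intro!: DERIV_J E_nonneg continuous_on_subset[OF E_continuous]\<close>)
  also have "\<dots> = (\<integral>\<^sup>+t. ennreal 1 * ennreal (E t) * indicator {0<..<T} t \<partial>lborel)"
  proof (rule nn_integral_cong_AE)
    show "AE t in lborel. ennreal (E t) * indicator {0..T} t = ennreal 1 * ennreal (E t) * indicator {0<..<T} t"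
      using AE_lborel_singleton[of 0] AE_lborel_singleton[of T] by eventually_elim (auto simp: indicator_def)
  qed
  also have "\<dots> = (\<integral>\<^sup>+x. ennreal (1 * ((p x)\<^sup>2 + (q x)\<^sup>2)) * indicator ({0<..<1} \<times> {0<..<T}) x \<partial>lborel)"
    unfolding E_def by (rule nn_upper[symmetric]) (auto intro!: continuous_intros cont_pq)
  also have "\<dots> \<le> (\<integral>\<^sup>+x. ennreal ((norm (grad \<beta> x))\<^sup>2) * indicator (cell f) x \<partial>lborel)"
  proof (rule nn_integral_mono)
    fix x :: "real \<times> real"
    have "{0<..<1} \<times> {0<..<T} \<subseteq> cell f"
      using f_bounds(2) \<delta>_pos by (auto simp: cell_def) (smt (verit))
    then show "ennreal (1 * ((p x)\<^sup>2 + (q x)\<^sup>2)) * indicator ({0<..<1} \<times> {0<..<T}) x \<le> ennreal ((norm (grad \<beta> x))\<^sup>2) * indicator (cell f) x"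
      by (auto simp: indicator_def grad_norm)
  qed
  also have "\<dots> = ennreal ((L2_norm (cell f) (grad \<beta>))\<^sup>2)" by (rule L2_nn[OF cell_borel grad_\<beta>_L2])
  finally show ?thesis by simp
qed

text \<open>Finite Dirichlet energy does not say that \<open>E\<close> tends to 0, only that it is
  small at some arbitrarily large heights. This suffices, since it is compared with quantities that
  are constant or monotone in the height.\<close>

lemma E_small:
  assumes "0 < c"
  obtains t where "a \<le> t" "0 \<le> t" "E t < c"
proof -
  have "\<exists>t. a \<le> t \<and> 0 \<le> t \<and> E t < c"
  proof (rule ccontr)
    assume "\<not> (\<exists>t. a \<le> t \<and> 0 \<le> t \<and> E t < c)"
    then have E: "c \<le> E t" if "a \<le> t" "0 \<le> t" for t using that by (meson not_le)
    define a' where "a' = max a 0"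
    define K where "K = (L2_norm (cell f) (grad \<beta>))\<^sup>2"
    \<comment> \<open>On an interval of this length, \<open>E \<ge> c\<close> would produce the
      energy \<open>K + 1\<close>, more than the total.\<close>
    define T where "T = a' + (K + 1) / c"
    have K: "0 \<le> K" by (simp add: K_def)
    have a': "0 \<le> a'" "a \<le> a'" by (simp_all add: a'_def)
    have T: "a' < T" using K assms by (simp add: T_def)
    have "\<exists>z. a' < z \<and> z < T \<and> J T - J a' = (T - a') * E z"
      by (rule MVT2[OF T]) (rule DERIV_J, use \<delta>_pos a' in linarith)
    then obtain z where z: "a' < z" "z < T" "J T - J a' = (T - a') * E z" by blast
    have "(T - a') * c \<le> (T - a') * E z" using E[of z] z T a' by (intro mult_left_mono) auto
    moreover have "(T - a') * c = K + 1" using assms by (simp add: T_def)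
    moreover have "J T - J 0 \<le> K" using J_bounded_increment[of T] T a' by (simp add: K_def)
    moreover have "J 0 \<le> J a'" by (rule J_increment) (use a' in auto)
    ultimately show False using z by linarith
  qed
  then show thesis using that by blast
qed

lemma slice_square_le:
  assumes t: "- \<delta> < t" and g: "continuous_on strip g"
  shows "(slice g t)\<^sup>2 \<le> slice (\<lambda>x. (g x)\<^sup>2) t"
proof -
  define m where "m = slice g t"
  have i: "((\<lambda>s. g (s, t)) has_integral m) {0..1}"
    unfolding m_def slice_def by (rule integrable_integral[OF slice_integrable[OF g t]])
  have c2: "continuous_on strip (\<lambda>x. (g x)\<^sup>2)" by (intro continuous_intros g)
  have i2: "((\<lambda>s. (g (s, t))\<^sup>2) has_integral slice (\<lambda>x. (g x)\<^sup>2) t) {0..1}"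
    unfolding slice_def by (rule integrable_integral[OF slice_integrable[OF c2 t]])
  have ic: "((\<lambda>s. m\<^sup>2) has_integral m\<^sup>2) {0..1::real}" using has_integral_const_real[of "m\<^sup>2" 0 1] by simp
  have "((\<lambda>s. (g (s, t))\<^sup>2 - (2 * m) * g (s, t) + m\<^sup>2) has_integral (slice (\<lambda>x. (g x)\<^sup>2) t - (2 * m) * m + m\<^sup>2)) {0..1}"
    by (rule has_integral_add[OF has_integral_diff[OF i2 has_integral_mult_right[OF i]] ic])
  moreover have "0 \<le> (g (s, t))\<^sup>2 - (2 * m) * g (s, t) + m\<^sup>2" for s
    using zero_le_power2[of "g (s, t) - m"] by (simp add: power2_eq_square algebra_simps)
  ultimately have "0 \<le> slice (\<lambda>x. (g x)\<^sup>2) t - (2 * m) * m + m\<^sup>2"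
    by (rule has_integral_nonneg) 
  then show ?thesis unfolding m_def[symmetric] by (simp add: power2_eq_square)
qed

lemma slice_const:
  assumes F: "continuous_on strip F" and D: "\<And>u. - \<delta> < u \<Longrightarrow> (slice F has_real_derivative 0) (at u)"
    and t: "- \<delta> < t" "- \<delta> < u"
  shows "slice F t = slice F u"
proof -
  have *: "slice F y = slice F x" if "x < y" "- \<delta> < x" for x y
  proof (rule DERIV_isconst_end[OF that(1)])
    show "continuous_on {x..y} (slice F)"
      by (rule continuous_on_subset[OF slice_continuous_on[OF F]]) (use that in auto)
    show "(slice F has_real_derivative 0) (at z)" if "x < z" "z < y" for z
      by (rule D) (use that \<open>- \<delta> < x\<close> in simp)
  qed
  show ?thesis
  proof (cases t u rule: linorder_cases)
    case less
    then show ?thesis using *[of t u] t by simp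
  next
    case greater
    then show ?thesis using *[of u t] t by simp
  qed simp
qed

text \<open>The flux through a horizontal line does not depend on the height, by harmonicity and
  periodicity. Its square is at most \<open>E\<close>, which gets arbitrarily small; this excludes
  linear growth of \<beta>.\<close>

lemma slice_q_zero: assumes t: "- \<delta> < t" shows "slice q t = 0"
proof (rule ccontr)
  assume n: "slice q t \<noteq> 0"
  have D: "(slice q has_real_derivative 0) (at u)" if u: "- \<delta> < u" for u
  proof -
    have "slice (\<lambda>x. snd (grad q x)) u = slice (\<lambda>x. - fst (grad p x)) u"
      unfolding slice_def
    proof (rule Henstock_Kurzweil_Integration.integral_cong)
      fix s :: real
      show "snd (grad q (s, u)) = - fst (grad p (s, u))" using \<beta>_laplacian[OF upper_in_strip[OF u], of s] by simp
    qed
    also have "\<dots> = - slice (\<lambda>x. fst (grad p x)) u" by (simp add: slice_def)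
    also have "\<dots> = 0"
      using slice_p_deriv_zero[OF \<beta>_C1(2) _ u] grad_\<beta>_periodic by simp
    finally show ?thesis using slice_has_derivative[OF \<beta>_C1(3) u] by simp
  qed
  have "0 < (slice q t)\<^sup>2" using n by simp
  then obtain u where u: "0 \<le> u" "E u < (slice q t)\<^sup>2" by (rule E_small)
  then have u': "- \<delta> < u" using \<delta>_pos by simp
  have "(slice q t)\<^sup>2 = (slice q u)\<^sup>2" using slice_const[OF cont_pq(2) D t u'] by simp
  also have "\<dots> \<le> slice (\<lambda>x. (q x)\<^sup>2) u" by (rule slice_square_le[OF u' cont_pq(2)])
  also have "\<dots> \<le> E u"
  proof -
    have c: "continuous_on strip (\<lambda>x. (q x)\<^sup>2)" "continuous_on strip (\<lambda>x. (p x)\<^sup>2 + (q x)\<^sup>2)"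
      by (intro continuous_intros cont_pq)+
    show ?thesis
      unfolding E_def slice_def by (rule integral_le[OF slice_integrable[OF c(1) u'] slice_integrable[OF c(2) u']]) simp
  qed
  finally show False using u by simp
qed

lemma slice_\<beta>: assumes t: "- \<delta> < t" shows "slice \<beta> t = beta_bar \<beta>"
proof -
  have D: "(slice \<beta> has_real_derivative 0) (at u)" if u: "- \<delta> < u" for u
    using slice_has_derivative[OF \<beta>_C1(1) u] slice_q_zero[OF u] by simp
  have "slice \<beta> t = slice \<beta> 0" by (rule slice_const[OF cont_pq(3) D t]) (use \<delta>_pos in auto)
  also have "\<dots> = beta_bar \<beta>"
  proof -
    have "continuous_on {0..1} (\<lambda>s. \<beta> (s, 0))" by (rule slice_continuous[OF cont_pq(3)]) (use \<delta>_pos in simp)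
    from integral_Icc_lborel[OF this] show ?thesis
      by (simp add: slice_def beta_bar_def set_lebesgue_integral_def mult.commute)
  qed
  finally show ?thesis .
qed

section \<open>Poincare inequality on lines and exponential decay\<close>

abbreviation "B\<^sub>0 \<equiv> beta_bar \<beta>"

text \<open>By Cauchy-Schwarz over a length of at most 1, any two values on the line differ by at
  most the root of the right-hand side; hence so do a value and the mean, which is
  \<open>B\<^sub>0\<close> at every height.\<close>

lemma \<beta>_oscillation:
  assumes t: "- \<delta> < t" and s: "s \<in> {0..1}"
  shows "(\<beta> (s, t) - B\<^sub>0)\<^sup>2 \<le> slice (\<lambda>x. (p x)\<^sup>2) t"
proof -
  let ?P = "slice (\<lambda>x. (p x)\<^sup>2) t"
  have cp: "continuous_on strip (\<lambda>x. (p x)\<^sup>2)" by (intro continuous_intros cont_pq)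
  have P0: "0 \<le> ?P" unfolding slice_def
    by (rule Henstock_Kurzweil_Integration.integral_nonneg[OF slice_integrable[OF cp t]]) simp
  have osc': "(\<beta> (y, t) - \<beta> (x, t))\<^sup>2 \<le> ?P" if xy: "x < y" "x \<in> {0..1}" "y \<in> {0..1}" for x y
  proof -
    have "ennreal ((\<beta> (y, t) - \<beta> (x, t))\<^sup>2) \<le> ennreal (y - x) * (\<integral>\<^sup>+s. ennreal ((p (s, t))\<^sup>2) * indicator {x<..<y} s \<partial>lborel)"
      by (rule Cauchy_Schwarz_increment[where F = "\<lambda>s. \<beta> (s, t)"])
         (use xy in \<open>auto intro!: C1_DERIV_fst[OF open_strip \<beta>_C1(1) upper_in_strip[OF t]] continuous_on_subset[OF slice_continuous[OF cont_pq(1) t]]\<close>)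
    also have "\<dots> \<le> ennreal 1 * (\<integral>\<^sup>+s. ennreal ((p (s, t))\<^sup>2) * indicator {0<..<1} s \<partial>lborel)"
      by (intro mult_mono nn_integral_mono ennreal_leI) (use xy in \<open>auto simp: indicator_def\<close>)
    also have "(\<integral>\<^sup>+s. ennreal ((p (s, t))\<^sup>2) * indicator {0<..<1} s \<partial>lborel) = ennreal ?P"
      unfolding slice_def by (rule nn_integral_Ioo_continuous) (use slice_continuous[OF cp t] in auto)
    finally show ?thesis using P0 by simp
  qed
  have osc: "\<bar>\<beta> (s, t) - \<beta> (x, t)\<bar> \<le> sqrt ?P" if x: "x \<in> {0..1}" for x
  proof (cases x s rule: linorder_cases)
    case less
    then show ?thesis using osc'[of x s] s x by (metis real_sqrt_abs real_sqrt_le_mono)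
  next
    case greater
    then show ?thesis using osc'[of s x] s x by (metis real_sqrt_abs real_sqrt_le_mono abs_minus_commute)
  qed (use P0 in simp)
  have i: "(\<lambda>s. \<beta> (s, t)) integrable_on {0..1}" by (rule slice_integrable[OF cont_pq(3) t])
  have "integral {0..1::real} (\<lambda>x. \<beta> (s, t) - sqrt ?P) \<le> slice \<beta> t"
    unfolding slice_def[of \<beta>]
  proof (rule integral_le[OF _ i])
    show "\<beta> (s, t) - sqrt ?P \<le> \<beta> (x, t)" if "x \<in> {0..1}" for x using osc[OF that] by linarith
  qed (rule integrable_const_ivl)
  moreover have "slice \<beta> t \<le> integral {0..1::real} (\<lambda>x. \<beta> (s, t) + sqrt ?P)"
    unfolding slice_def[of \<beta>]
  proof (rule integral_le[OF i])
    show "\<beta> (x, t) \<le> \<beta> (s, t) + sqrt ?P" if "x \<in> {0..1}" for x using osc[OF that] by linarith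
  qed (rule integrable_const_ivl)
  ultimately have "\<bar>\<beta> (s, t) - B\<^sub>0\<bar> \<le> sqrt ?P" using slice_\<beta>[OF t] by simp
  then have "\<bar>\<beta> (s, t) - B\<^sub>0\<bar>\<^sup>2 \<le> (sqrt ?P)\<^sup>2" by (rule power_mono) simp
  then show ?thesis using P0 by simp
qed

text \<open>Since \<open>q\<close> has mean 0, \<beta> may be replaced by its deviation from the
  mean. The oscillation bound and 2ab \<le> a^2 + b^2 then give exactly the energy.\<close>

lemma J_bound: assumes t: "- \<delta> < t" shows "2 * \<bar>J t\<bar> \<le> E t"
proof -
  let ?P = "slice (\<lambda>x. (p x)\<^sup>2) t" and ?Q = "slice (\<lambda>x. (q x)\<^sup>2) t"
  have cp: "continuous_on strip (\<lambda>x. (p x)\<^sup>2)" "continuous_on strip (\<lambda>x. (q x)\<^sup>2)" by (intro continuous_intros cont_pq)+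
  have iq: "(\<lambda>s. q (s, t)) integrable_on {0..1}" by (rule slice_integrable[OF cont_pq(2) t])
  have iqq: "(\<lambda>s. (q (s, t))\<^sup>2) integrable_on {0..1}" by (rule slice_integrable[OF cp(2) t])
  have ib: "(\<lambda>s. (\<beta> (s, t) - B\<^sub>0) * q (s, t)) integrable_on {0..1}"
    by (rule slice_integrable[where F = "\<lambda>x. (\<beta> x - B\<^sub>0) * q x"]) (intro continuous_intros cont_pq t)+
  have iB: "(\<lambda>s. B\<^sub>0 * q (s, t)) integrable_on {0..1}"
    by (rule slice_integrable[where F = "\<lambda>x. B\<^sub>0 * q x"]) (intro continuous_intros cont_pq t)+
  have "J t = integral {0..1} (\<lambda>s. (\<beta> (s, t) - B\<^sub>0) * q (s, t) + B\<^sub>0 * q (s, t))"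
    by (simp add: J_def slice_def algebra_simps)
  also have "\<dots> = integral {0..1} (\<lambda>s. (\<beta> (s, t) - B\<^sub>0) * q (s, t)) + B\<^sub>0 * slice q t"
    by (subst Henstock_Kurzweil_Integration.integral_add[OF ib iB]) (simp add: slice_def)
  finally have J: "J t = integral {0..1} (\<lambda>s. (\<beta> (s, t) - B\<^sub>0) * q (s, t))" using slice_q_zero[OF t] by simp
  have pt: "\<bar>(\<beta> (s, t) - B\<^sub>0) * q (s, t)\<bar> \<le> (?P + (q (s, t))\<^sup>2) / 2" if "s \<in> {0..1}" for s
    using \<beta>_oscillation[OF t that] sum_squares_bound[of "\<bar>\<beta> (s, t) - B\<^sub>0\<bar>" "\<bar>q (s, t)\<bar>"]
    by (simp add: abs_mult)
  have "\<bar>J t\<bar> \<le> integral {0..1} (\<lambda>s. (?P + (q (s, t))\<^sup>2) / 2)"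
    unfolding J real_norm_def[symmetric]
    by (rule Henstock_Kurzweil_Integration.integral_norm_bound_integral[OF ib])
       (use pt in \<open>auto intro!: integrable_on_divide integrable_add iqq\<close>)
  also have "\<dots> = (?P + ?Q) / 2"
  proof -
    have "integral {0..1} (\<lambda>s. ?P + (q (s, t))\<^sup>2) = integral {0..1::real} (\<lambda>_. ?P) + integral {0..1} (\<lambda>s. (q (s, t))\<^sup>2)"
      by (rule Henstock_Kurzweil_Integration.integral_add[OF integrable_const_ivl iqq])
    then show ?thesis by (simp add: slice_def)
  qed
  also have "?P + ?Q = E t"
    unfolding E_def slice_def
    by (rule Henstock_Kurzweil_Integration.integral_add[symmetric]) (rule slice_integrable[OF cp(1) t], rule iqq)
  finally show ?thesis by simp
qed

text \<open>A positive value of the nondecreasing \<open>J\<close> would persist at all larger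
  heights and keep \<open>E\<close> away from 0.\<close>

lemma J_nonpos: assumes "0 \<le> t" shows "J t \<le> 0"
proof (rule ccontr)
  assume "\<not> J t \<le> 0"
  then have "0 < J t" by simp
  then obtain u where u: "t \<le> u" "0 \<le> u" "E u < 2 * J t" using E_small[of "2 * J t" t] by auto
  have "2 * J t \<le> 2 * \<bar>J u\<bar>" using J_increment[OF assms u(1)] by simp
  also have "\<dots> \<le> E u" using J_bound[of u] u \<delta>_pos by simp
  finally show False using u by simp
qed

text \<open>The derivative of J exp(2t) is (E + 2J) exp(2t), which is nonnegative. The exponential
  is split between the two sides because the energy is integrated against the weight exp(t)
  below.\<close>

lemma J_decay: assumes "0 \<le> t" shows "J 0 * exp (- t) \<le> exp t * J t"
proof -
  have "J 0 * exp (2 * 0) \<le> J t * exp (2 * t)"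
  proof (rule DERIV_nonneg_imp_nondecreasing[OF assms])
    fix x assume x: "0 \<le> x" "x \<le> t"
    then have x': "- \<delta> < x" using \<delta>_pos by simp
    have "((\<lambda>x. J x * exp (2 * x)) has_real_derivative E x * exp (2 * x) + exp (2 * x) * 2 * J x) (at x)"
      by (auto intro!: derivative_eq_intros DERIV_J x')
    moreover have "0 \<le> E x * exp (2 * x) + exp (2 * x) * 2 * J x"
    proof -
      have "0 \<le> exp (2 * x) * (E x + 2 * J x)" using J_bound[OF x'] by (intro mult_nonneg_nonneg) auto
      then show ?thesis by (simp add: algebra_simps)
    qed
    ultimately show "\<exists>y. ((\<lambda>x. J x * exp (2 * x)) has_real_derivative y) (at x) \<and> 0 \<le> y" by blast
  qed
  then have "J 0 \<le> J t * (exp t * exp t)" by (simp add: mult_exp_exp)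
  then have "J 0 * exp (- t) \<le> J t * (exp t * exp t) * exp (- t)" by (intro mult_right_mono) auto
  also have "\<dots> = exp t * J t" by (simp add: exp_minus field_simps)
  finally show ?thesis .
qed

text \<open>Integration by parts: exp(t) J has derivative exp(t) E + exp(t) J, and by
  \<open>J_decay\<close> the second term is at least J(0) exp(-t). Adding J(0) exp(-t) to the
  primitive compensates for it; the boundary terms at \<open>T\<close> have the good sign, and those
  at 0 add up to -2 J(0).\<close>

lemma E_exp_integral:
  assumes "0 \<le> T"
  shows "(\<integral>\<^sup>+t. ennreal (exp t) * ennreal (E t) * indicator {0<..<T} t \<partial>lborel) \<le> ennreal (- 2 * J 0)"
proof -
  let ?\<Psi> = "\<lambda>t. exp t * J t + J 0 * exp (- t)"
  let ?\<psi> = "\<lambda>t. exp t * E t + (exp t * J t - J 0 * exp (- t))"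
  have ge: "exp t * E t \<le> ?\<psi> t" if "0 \<le> t" for t using J_decay[OF that] by simp
  have Jc: "continuous_on {0..T} J"
  proof (intro continuous_at_imp_continuous_on ballI)
    fix x assume "x \<in> {0..T}"
    then show "isCont J x" using \<delta>_pos by (intro DERIV_isCont[OF DERIV_J]) simp
  qed
  have "(\<integral>\<^sup>+t. ennreal (exp t) * ennreal (E t) * indicator {0<..<T} t \<partial>lborel) \<le> (\<integral>\<^sup>+t. ennreal (?\<psi> t) * indicator {0..T} t \<partial>lborel)"
  proof (rule nn_integral_mono)
    fix t :: real
    show "ennreal (exp t) * ennreal (E t) * indicator {0<..<T} t \<le> ennreal (?\<psi> t) * indicator {0..T} t"
    proof (cases "t \<in> {0<..<T}")
      case True
      then have "ennreal (exp t * E t) \<le> ennreal (?\<psi> t)" using ge[of t] by (intro ennreal_leI) simp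
      moreover have "ennreal (exp t) * ennreal (E t) = ennreal (exp t * E t)"
        using E_nonneg[of t] True \<delta>_pos by (simp add: ennreal_mult)
      ultimately show ?thesis using True by (simp add: indicator_def)
    qed simp
  qed
  also have "\<dots> = ennreal (?\<Psi> T - ?\<Psi> 0)"
  proof (rule nn_integral_FTC_continuous[OF assms])
    fix t assume t: "0 \<le> t" "t \<le> T"
    then have t': "- \<delta> < t" using \<delta>_pos by simp
    show "(?\<Psi> has_real_derivative ?\<psi> t) (at t)"
      by (rule derivative_eq_intros DERIV_J[OF t'] refl | simp add: algebra_simps)+
    have "0 \<le> exp t * E t" using E_nonneg[OF t'] by simp
    then show "0 \<le> ?\<psi> t" using ge[OF t(1)] by linarith
  next
    show "continuous_on {0..T} ?\<psi>"
      using \<delta>_pos by (intro continuous_intros Jc continuous_on_subset[OF E_continuous]) auto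
  qed
  also have "\<dots> \<le> ennreal (- 2 * J 0)"
  proof (rule ennreal_leI)
    have "exp T * J T \<le> 0" using J_nonpos[OF assms] by (simp add: mult_nonneg_nonpos)
    moreover have "J 0 * exp (- T) \<le> 0" using J_nonpos[of 0] by (simp add: mult_nonpos_nonneg)
    ultimately show "?\<Psi> T - ?\<Psi> 0 \<le> - 2 * J 0" by simp
  qed
  finally show ?thesis .
qed

text \<open>One term of the exponential series, with 720 = 6!. The exponent 6 is the square of the
  cubic weight in which the decay is used.\<close>

lemma power_le_exp: "0 \<le> x \<Longrightarrow> x ^ 6 \<le> 720 * exp x" for x :: real
proof -
  assume x: "0 \<le> x"
  have "x ^ 6 / fact 6 \<le> (\<Sum>i. x ^ i / fact i)"
    using sum_le_suminf[OF summable_exp_generic[of x, simplified scaleR_conv_of_real], of "{6}"] x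
    by (simp add: divide_inverse mult.commute scaleR_conv_of_real)
  also have "\<dots> = exp x" by (simp add: exp_def divide_inverse mult.commute scaleR_conv_of_real)
  finally show ?thesis by (simp add: fact_numeral)
qed

lemma SUP_upper:
  fixes F :: "real \<times> real \<Rightarrow> real"
  assumes bd: "\<And>n::nat. (\<integral>\<^sup>+x. ennreal (F x) * indicator ({0<..<1} \<times> {0<..<real n}) x \<partial>lborel) \<le> c"
    and m: "\<And>n::nat. (\<lambda>x. ennreal (F x) * indicator ({0<..<1} \<times> {0<..<real n}) x) \<in> borel_measurable lborel"
  shows "(\<integral>\<^sup>+x. ennreal (F x) * indicator ({0<..<1} \<times> {0<..}) x \<partial>lborel) \<le> c"
proof -
  let ?G = "\<lambda>(n::nat) x. ennreal (F x) * indicator ({0<..<1} \<times> {0<..<real n}) x"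
  have "(\<integral>\<^sup>+x. ennreal (F x) * indicator ({0<..<1} \<times> {0<..}) x \<partial>lborel) \<le> (\<integral>\<^sup>+x. (SUP n. ?G n x) \<partial>lborel)"
  proof (rule nn_integral_mono)
    fix x :: "real \<times> real"
    obtain n :: nat where "snd x < real n" using reals_Archimedean2 by blast
    then have "ennreal (F x) * indicator ({0<..<1} \<times> {0<..}) x \<le> ?G n x" by (cases x) (auto simp: indicator_def)
    also have "\<dots> \<le> (SUP n. ?G n x)" by (rule SUP_upper) simp
    finally show "ennreal (F x) * indicator ({0<..<1} \<times> {0<..}) x \<le> (SUP n. ?G n x)" .
  qed
  also have "\<dots> = (SUP n. \<integral>\<^sup>+x. ?G n x \<partial>lborel)"
    by (rule nn_integral_monotone_convergence_SUP[OF _ m])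
       (auto simp: incseq_def le_fun_def indicator_def)
  also have "\<dots> \<le> c" by (rule SUP_least) (rule bd)
  finally show ?thesis .
qed

text \<open>The constant \<open>720 * exp 2\<close> comes from bounding (t + 2)^6 by 720 exp(t + 2).
  The statement serves both |grad \<beta>|^2 and the squared deviation of \<beta> from its
  mean.\<close>

lemma weighted_upper:
  assumes F: "continuous_on strip F" "\<And>x. 0 \<le> F x" and le: "\<And>t. 0 < t \<Longrightarrow> slice F t \<le> E t"
  shows "(\<integral>\<^sup>+x. ennreal ((snd x + 2) ^ 6 * F x) * indicator ({0<..<1} \<times> {0<..}) x \<partial>lborel) \<le> ennreal (720 * exp 2 * (- 2 * J 0))"
proof (rule SUP_upper)
  fix n :: nat
  have W: "(\<lambda>t::real. (t + 2) ^ 6) \<in> borel_measurable borel" by measurable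
  have "(\<integral>\<^sup>+x. ennreal ((snd x + 2) ^ 6 * F x) * indicator ({0<..<1} \<times> {0<..<real n}) x \<partial>lborel) =
     (\<integral>\<^sup>+t. ennreal ((t + 2) ^ 6) * ennreal (slice F t) * indicator {0<..<real n} t \<partial>lborel)"
    by (rule nn_upper[OF W F])
  also have "\<dots> \<le> (\<integral>\<^sup>+t. ennreal (720 * exp 2) * (ennreal (exp t) * ennreal (E t) * indicator {0<..<real n} t) \<partial>lborel)"
  proof (rule nn_integral_mono)
    fix t :: real
    show "ennreal ((t + 2) ^ 6) * ennreal (slice F t) * indicator {0<..<real n} t \<le> ennreal (720 * exp 2) * (ennreal (exp t) * ennreal (E t) * indicator {0<..<real n} t)"
    proof (cases "t \<in> {0<..<real n}")
      case True
      have "(t + 2) ^ 6 \<le> 720 * exp 2 * exp t" using power_le_exp[of "t + 2"] True by (simp add: exp_add mult_ac)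
      then have "ennreal ((t + 2) ^ 6) * ennreal (slice F t) \<le> ennreal (720 * exp 2 * exp t) * ennreal (E t)"
        using le[of t] True by (intro mult_mono ennreal_leI) auto
      also have "\<dots> = ennreal (720 * exp 2) * (ennreal (exp t) * ennreal (E t))" by (simp add: ennreal_mult mult_ac)
      finally show ?thesis using True by (simp add: indicator_def)
    qed simp
  qed
  also have "\<dots> = ennreal (720 * exp 2) * (\<integral>\<^sup>+t. ennreal (exp t) * ennreal (E t) * indicator {0<..<real n} t \<partial>lborel)"
  proof (rule nn_integral_cmult)
    have "(\<lambda>t. indicator {0<..<real n} t *\<^sub>R E t) \<in> borel_measurable borel"
      using \<delta>_pos by (intro borel_measurable_continuous_on_indicator continuous_on_subset[OF E_continuous]) auto
    then have "(\<lambda>t. ennreal (exp t) * ennreal (indicator {0<..<real n} t *\<^sub>R E t)) \<in> borel_measurable lborel" by measurable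
    moreover have "ennreal (exp t) * ennreal (indicator {0<..<real n} t *\<^sub>R E t) = ennreal (exp t) * ennreal (E t) * indicator {0<..<real n} t" for t
      by (simp add: indicator_def)
    ultimately show "(\<lambda>t. ennreal (exp t) * ennreal (E t) * indicator {0<..<real n} t) \<in> borel_measurable lborel" by simp
  qed
  also have "\<dots> \<le> ennreal (720 * exp 2) * ennreal (- 2 * J 0)"
    by (intro mult_left_mono E_exp_integral) auto
  also have "\<dots> = ennreal (720 * exp 2 * (- 2 * J 0))" by (rule ennreal_mult'[symmetric]) simp
  finally show "(\<integral>\<^sup>+x. ennreal ((snd x + 2) ^ 6 * F x) * indicator ({0<..<1} \<times> {0<..<real n}) x \<partial>lborel) \<le> ennreal (720 * exp 2 * (- 2 * J 0))" .
next
  fix n :: nat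
  let ?R = "{0<..<1} \<times> {0<..<real n} :: (real \<times> real) set"
  have R: "?R \<in> sets borel" by (intro borel_open open_Times) auto
  have sub: "?R \<subseteq> strip" using \<delta>_pos by (auto intro!: upper_in_strip)
  have "continuous_on ?R (\<lambda>x. (snd x + 2) ^ 6 * F x)"
    by (intro continuous_intros continuous_on_subset[OF F(1) sub])
  from borel_measurable_ennreal_indicator[OF R this]
  show "(\<lambda>x. ennreal ((snd x + 2) ^ 6 * F x) * indicator ?R x) \<in> borel_measurable lborel" by (simp only: measurable_lborel2)
qed

lemma slice_le_E:
  assumes t: "0 < t"
  shows "slice (\<lambda>x. (p x)\<^sup>2 + (q x)\<^sup>2) t \<le> E t" and "slice (\<lambda>x. (\<beta> x - B\<^sub>0)\<^sup>2) t \<le> E t"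
proof -
  show "slice (\<lambda>x. (p x)\<^sup>2 + (q x)\<^sup>2) t \<le> E t" by (simp add: E_def)
  have t': "- \<delta> < t" using t \<delta>_pos by simp
  have c: "continuous_on strip (\<lambda>x. (\<beta> x - B\<^sub>0)\<^sup>2)" "continuous_on strip (\<lambda>x. (p x)\<^sup>2)" "continuous_on strip (\<lambda>x. (p x)\<^sup>2 + (q x)\<^sup>2)"
    by (intro continuous_intros cont_pq)+
  have "slice (\<lambda>x. (\<beta> x - B\<^sub>0)\<^sup>2) t \<le> integral {0..1::real} (\<lambda>_. slice (\<lambda>x. (p x)\<^sup>2) t)"
    unfolding slice_def[of "\<lambda>x. (\<beta> x - B\<^sub>0)\<^sup>2"]
    by (rule integral_le[OF slice_integrable[OF c(1) t']]) (use \<beta>_oscillation[OF t'] in auto)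
  also have "\<dots> = slice (\<lambda>x. (p x)\<^sup>2) t" by simp
  also have "\<dots> \<le> E t"
    unfolding E_def slice_def by (rule integral_le[OF slice_integrable[OF c(2) t'] slice_integrable[OF c(3) t']]) simp
  finally show "slice (\<lambda>x. (\<beta> x - B\<^sub>0)\<^sup>2) t \<le> E t" .
qed

text \<open>The first summand pays for heights above 0, where the energy decays exponentially; the
  second for the rest of the cell, where the weight is at most 2^6 = 64. Being a quantity of the
  cell problem, it does not depend on \<epsilon>.\<close>

definition decay_const :: real where
  "decay_const = 720 * exp 2 * (- 2 * J 0) + 64 * (L2_norm (cell f) (grad \<beta>))\<^sup>2"

lemma decay_gradient:
  "(\<integral>\<^sup>+x. ennreal ((snd x + 2) ^ 6 * (norm (grad \<beta> x))\<^sup>2) * indicator (cell f) x \<partial>lborel) \<le> ennreal decay_const"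
  and decay_value: "(\<integral>\<^sup>+x. ennreal ((snd x + 2) ^ 6 * (\<beta> x - B\<^sub>0)\<^sup>2) * indicator ({0<..<1} \<times> {0<..}) x \<partial>lborel) \<le> ennreal decay_const"
  and decay_const_nonneg: "0 \<le> decay_const"
proof -
  let ?A = "720 * exp 2 * (- 2 * J 0)" and ?N = "(L2_norm (cell f) (grad \<beta>))\<^sup>2"
  let ?F = "\<lambda>x. ennreal ((norm (grad \<beta> x))\<^sup>2)"
  have "0 \<le> - 2 * J 0" using J_nonpos[of 0] by simp
  then have A0: "0 \<le> ?A" by (intro mult_nonneg_nonneg[of "720 * exp 2"]) auto
  let ?Q = "{0<..<1} \<times> {0<..} :: (real \<times> real) set"
  have Q: "?Q \<in> sets borel" by (intro borel_open open_Times) auto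
  have mQ: "(\<lambda>x. ennreal ((snd x + 2) ^ 6 * (norm (grad \<beta> x))\<^sup>2) * indicator ?Q x) \<in> borel_measurable lborel"
  proof -
    have sub: "?Q \<subseteq> strip" using \<delta>_pos by (auto intro!: upper_in_strip)
    have "continuous_on ?Q (\<lambda>x. (snd x + 2) ^ 6 * (norm (grad \<beta> x))\<^sup>2)"
      by (intro continuous_intros continuous_on_subset[OF C1_on_continuous(2)[OF \<beta>_C1(1)] sub])
    from borel_measurable_ennreal_indicator[OF Q this] show ?thesis by (simp only: measurable_lborel2)
  qed
  have mC: "(\<lambda>x. ?F x * indicator (cell f) x) \<in> borel_measurable lborel"
  proof -
    have "continuous_on (cell f) (\<lambda>x. (norm (grad \<beta> x))\<^sup>2)"
      by (intro continuous_intros continuous_on_subset[OF C1_on_continuous(2)[OF \<beta>_C1(1)] cell_subset_strip])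
    from borel_measurable_ennreal_indicator[OF cell_borel this] show ?thesis by (simp only: measurable_lborel2)
  qed
  have "(\<integral>\<^sup>+x. ennreal ((snd x + 2) ^ 6 * (norm (grad \<beta> x))\<^sup>2) * indicator (cell f) x \<partial>lborel) \<le>
     (\<integral>\<^sup>+x. ennreal ((snd x + 2) ^ 6 * (norm (grad \<beta> x))\<^sup>2) * indicator ?Q x + ennreal 64 * (?F x * indicator (cell f) x) \<partial>lborel)"
  proof (rule nn_integral_mono)
    fix x :: "real \<times> real"
    show "ennreal ((snd x + 2) ^ 6 * (norm (grad \<beta> x))\<^sup>2) * indicator (cell f) x \<le>
      ennreal ((snd x + 2) ^ 6 * (norm (grad \<beta> x))\<^sup>2) * indicator ?Q x + ennreal 64 * (?F x * indicator (cell f) x)"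
    proof (cases "x \<in> cell f \<and> x \<notin> ?Q")
      case True
      then have "0 \<le> snd x + 2" "snd x + 2 \<le> 2" using f_bounds(1)[of "fst x"] \<delta>_pos by (auto simp: cell_def mem_Times_iff)
      then have "(snd x + 2) ^ 6 \<le> 2 ^ 6" by (intro power_mono)
      then have "(snd x + 2) ^ 6 * (norm (grad \<beta> x))\<^sup>2 \<le> 64 * (norm (grad \<beta> x))\<^sup>2" by (intro mult_right_mono) auto
      then have "ennreal ((snd x + 2) ^ 6 * (norm (grad \<beta> x))\<^sup>2) \<le> ennreal (64 * (norm (grad \<beta> x))\<^sup>2)" by (rule ennreal_leI)
      also have "\<dots> = ennreal 64 * ?F x" by (rule ennreal_mult) auto
      finally show ?thesis using True by simp
    next
      case False
      then show ?thesis by (cases "x \<in> cell f") auto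
    qed
  qed
  also have "\<dots> = (\<integral>\<^sup>+x. ennreal ((snd x + 2) ^ 6 * (norm (grad \<beta> x))\<^sup>2) * indicator ?Q x \<partial>lborel) + ennreal 64 * (\<integral>\<^sup>+x. ?F x * indicator (cell f) x \<partial>lborel)"
    by (simp only: nn_integral_add[OF mQ borel_measurable_times_ennreal[OF borel_measurable_const mC]] nn_integral_cmult[OF mC])
  also have "\<dots> \<le> ennreal ?A + ennreal 64 * ennreal ?N"
  proof (intro add_mono mult_left_mono)
    show "(\<integral>\<^sup>+x. ennreal ((snd x + 2) ^ 6 * (norm (grad \<beta> x))\<^sup>2) * indicator ?Q x \<partial>lborel) \<le> ennreal ?A"
      unfolding grad_norm by (rule weighted_upper) (auto intro!: continuous_intros cont_pq slice_le_E(1))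
    show "(\<integral>\<^sup>+x. ?F x * indicator (cell f) x \<partial>lborel) \<le> ennreal ?N"
      using L2_nn[OF cell_borel grad_\<beta>_L2] by (rule eq_refl)
  qed simp
  also have "\<dots> = ennreal (?A + 64 * ?N)"
  proof -
    have "ennreal 64 * ennreal ?N = ennreal (64 * ?N)" by (rule ennreal_mult[symmetric]) simp_all
    moreover have "ennreal ?A + ennreal (64 * ?N) = ennreal (?A + 64 * ?N)"
      by (rule ennreal_plus[OF A0, symmetric]) simp
    ultimately show ?thesis by (simp only:)
  qed
  finally show "(\<integral>\<^sup>+x. ennreal ((snd x + 2) ^ 6 * (norm (grad \<beta> x))\<^sup>2) * indicator (cell f) x \<partial>lborel) \<le> ennreal decay_const"
    unfolding decay_const_def .
  have le: "?A \<le> decay_const" by (simp add: decay_const_def)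
  then show "0 \<le> decay_const" using A0 by linarith
  have "(\<integral>\<^sup>+x. ennreal ((snd x + 2) ^ 6 * (\<beta> x - B\<^sub>0)\<^sup>2) * indicator ?Q x \<partial>lborel) \<le> ennreal ?A"
    by (rule weighted_upper) (auto intro!: continuous_intros cont_pq slice_le_E(2))
  also have "\<dots> \<le> ennreal decay_const" by (rule ennreal_leI[OF le])
  finally show "(\<integral>\<^sup>+x. ennreal ((snd x + 2) ^ 6 * (\<beta> x - B\<^sub>0)\<^sup>2) * indicator ?Q x \<partial>lborel) \<le> ennreal decay_const" .
qed

end

section \<open>The rescaled cell solution\<close>

lemma nn_integral_affine:
  fixes G :: "'a::euclidean_space \<Rightarrow> ennreal"
  assumes [measurable]: "G \<in> borel_measurable borel" and c: "c \<noteq> 0"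
  shows "(\<integral>\<^sup>+x. G x \<partial>lborel) = ennreal (\<bar>c\<bar> ^ DIM('a)) * (\<integral>\<^sup>+x. G (t + c *\<^sub>R x) \<partial>lborel)"
  by (subst lborel_affine[OF c, of t]) (simp add: nn_integral_density nn_integral_distr nn_integral_cmult)

lemma integral_affine:
  fixes G :: "'a::euclidean_space \<Rightarrow> real"
  assumes [measurable]: "G \<in> borel_measurable borel" and c: "c \<noteq> 0"
  shows "(\<integral>x. G x \<partial>lborel) = \<bar>c\<bar> ^ DIM('a) * (\<integral>x. G (t + c *\<^sub>R x) \<partial>lborel)"
  by (subst lborel_affine[OF c, of t]) (simp add: integral_density integral_distr)

lemma nn_integral_periodic_window:
  fixes g :: "real \<Rightarrow> ennreal"
  assumes g [measurable]: "g \<in> borel_measurable borel" and per: "\<And>s. g (s + 1) = g s"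
  shows "(\<integral>\<^sup>+s. g s * indicator {of_int m..<of_int m + real n} s \<partial>lborel) = of_nat n * (\<integral>\<^sup>+s. g s * indicator {0<..<1} s \<partial>lborel)"
proof -
  have per_nat: "g (s + real k) = g s" for s k
  proof (induction k)
    case (Suc k)
    have "g (s + real (Suc k)) = g ((s + real k) + 1)" by (simp add: add_ac)
    then show ?case using Suc per by (simp only:)
  qed simp
  have per_int: "g (s + of_int k) = g s" for s and k :: int
  proof (cases "0 \<le> k")
    case True
    then show ?thesis using per_nat[of s "nat k"] by simp
  next
    case False
    then have "s + of_int k + real (nat (- k)) = s" by simp
    then show ?thesis using per_nat[of "s + of_int k" "nat (- k)"] by simp
  qed
  have one: "(\<integral>\<^sup>+s. g s * indicator {of_int k..<of_int k + 1} s \<partial>lborel) = (\<integral>\<^sup>+s. g s * indicator {0<..<1} s \<partial>lborel)" for k :: int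
  proof -
    have "(\<integral>\<^sup>+s. g s * indicator {of_int k..<of_int k + 1} s \<partial>lborel) =
       (\<integral>\<^sup>+s. g (of_int k + 1 * s) * indicator {of_int k..<of_int k + 1} (of_int k + 1 * s) \<partial>lborel)"
      using nn_integral_real_affine[of "\<lambda>s. g s * indicator {of_int k..<of_int k + 1} s" 1 "of_int k"] by simp
    also have "\<dots> = (\<integral>\<^sup>+s. g s * indicator {0<..<1} s \<partial>lborel)"
    proof (rule nn_integral_cong_AE)
      show "AE s in lborel. g (of_int k + 1 * s) * indicator {of_int k..<of_int k + 1} (of_int k + 1 * s) = g s * indicator {0<..<1} s"
        using AE_lborel_singleton[of "0::real"]
        by eventually_elim (simp add: per_int add.commute indicator_def)
    qed
    finally show ?thesis .
  qed
  show ?thesis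
  proof (induction n)
    case 0
    then show ?case by simp
  next
    case (Suc n)
    have "(\<integral>\<^sup>+s. g s * indicator {of_int m..<of_int m + real (Suc n)} s \<partial>lborel) =
       (\<integral>\<^sup>+s. g s * indicator {of_int m..<of_int m + real n} s + g s * indicator {of_int (m + int n)..<of_int (m + int n) + 1} s \<partial>lborel)"
      by (rule nn_integral_cong) (auto simp: indicator_def)
    also have "\<dots> = (\<integral>\<^sup>+s. g s * indicator {of_int m..<of_int m + real n} s \<partial>lborel) + (\<integral>\<^sup>+s. g s * indicator {of_int (m + int n)..<of_int (m + int n) + 1} s \<partial>lborel)"
      by (rule nn_integral_add) simp_all
    also have "\<dots> = of_nat (Suc n) * (\<integral>\<^sup>+s. g s * indicator {0<..<1} s \<partial>lborel)"
      unfolding Suc.IH one by (simp add: distrib_right add.commute)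
    finally show ?case .
  qed
qed

text \<open>Stretching by 1/\<epsilon> costs the area factor \<epsilon>^2 and turns the window into
  one of length (c - a)/\<epsilon>, which is covered by \<open>n\<close> whole periods starting at
  an integer.\<close>

lemma nn_integral_scaled_periodic:
  fixes F :: "real \<times> real \<Rightarrow> ennreal"
  assumes F [measurable]: "F \<in> borel_measurable borel" and per: "\<And>y. F (fst y + 1, snd y) = F y" and "0 < \<epsilon>"
    and win: "a < c" "{a / \<epsilon><..<c / \<epsilon>} \<subseteq> {of_int m..<of_int m + real n}"
  shows "(\<integral>\<^sup>+x. F ((1 / \<epsilon>) *\<^sub>R x) * indicator {a<..<c} (fst x) \<partial>lborel) \<le>
    ennreal (\<epsilon>\<^sup>2) * (of_nat n * (\<integral>\<^sup>+y. F y * indicator {0<..<1} (fst y) \<partial>lborel))"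
proof -
  have mfst [measurable]: "(fst :: real \<times> real \<Rightarrow> real) \<in> borel_measurable borel"
    by (rule borel_measurable_continuous_onI) (rule continuous_on_fst[OF continuous_on_id])
  have Fm: "(\<lambda>y. F y * indicator A (fst y)) \<in> borel_measurable borel" if "A \<in> sets borel" for A
    using that by measurable
  define g where "g s = (\<integral>\<^sup>+t. F (s, t) \<partial>lborel)" for s
  have gm [measurable]: "g \<in> borel_measurable borel"
    using lborel.borel_measurable_nn_integral_fst[of F lborel] by (simp add: g_def[abs_def] lborel_prod)
  have gper: "g (s + 1) = g s" for s using per[of "(s, _)"] by (simp add: g_def)
  have fub: "(\<integral>\<^sup>+y. F y * indicator A (fst y) \<partial>lborel) = (\<integral>\<^sup>+s. g s * indicator A s \<partial>lborel)" if A: "A \<in> sets borel" for A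
  proof -
    have "(\<integral>\<^sup>+y. F y * indicator A (fst y) \<partial>lborel) = (\<integral>\<^sup>+s. \<integral>\<^sup>+t. F (s, t) * indicator A s \<partial>lborel \<partial>lborel)"
      using lborel.nn_integral_fst[of "\<lambda>y. F y * indicator A (fst y)" lborel] Fm[OF A] by (simp add: lborel_prod)
    also have "\<dots> = (\<integral>\<^sup>+s. g s * indicator A s \<partial>lborel)"
      by (rule nn_integral_cong) (simp add: g_def indicator_def)
    finally show ?thesis .
  qed
  have "(\<integral>\<^sup>+x. F ((1 / \<epsilon>) *\<^sub>R x) * indicator {a<..<c} (fst x) \<partial>lborel) =
     ennreal (\<epsilon>\<^sup>2) * (\<integral>\<^sup>+x. F ((1 / \<epsilon>) *\<^sub>R (\<epsilon> *\<^sub>R x)) * indicator {a<..<c} (fst (\<epsilon> *\<^sub>R x)) \<partial>lborel)"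
  proof -
    have "(\<lambda>x. F ((1 / \<epsilon>) *\<^sub>R x) * indicator {a<..<c} (fst x)) \<in> borel_measurable borel"
    proof (intro borel_measurable_times_ennreal measurable_compose[OF _ F] borel_measurable_indicator')
      show "(\<lambda>x. (1 / \<epsilon>) *\<^sub>R x) \<in> borel_measurable (borel :: (real \<times> real) measure)"
        by (rule borel_measurable_continuous_onI) (intro continuous_intros)
      show "{x :: real \<times> real \<in> space borel. fst x \<in> {a<..<c}} \<in> sets borel"
        by (simp add: mfst)
    qed
    from nn_integral_affine[OF this, of \<epsilon> 0] show ?thesis using \<open>0 < \<epsilon>\<close> by (simp add: power2_eq_square)
  qed
  also have "(\<integral>\<^sup>+x. F ((1 / \<epsilon>) *\<^sub>R (\<epsilon> *\<^sub>R x)) * indicator {a<..<c} (fst (\<epsilon> *\<^sub>R x)) \<partial>lborel) =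
      (\<integral>\<^sup>+x. F x * indicator {a / \<epsilon><..<c / \<epsilon>} (fst x) \<partial>lborel)"
    using \<open>0 < \<epsilon>\<close> by (intro nn_integral_cong) (auto simp: indicator_def field_simps)
  also have "\<dots> = (\<integral>\<^sup>+s. g s * indicator {a / \<epsilon><..<c / \<epsilon>} s \<partial>lborel)" by (rule fub) simp
  also have "\<dots> \<le> (\<integral>\<^sup>+s. g s * indicator {of_int m..<of_int m + real n} s \<partial>lborel)"
    using win(2) by (intro nn_integral_mono mult_left_mono) (auto simp: indicator_def)
  also have "\<dots> = of_nat n * (\<integral>\<^sup>+s. g s * indicator {0<..<1} s \<partial>lborel)"
    by (rule nn_integral_periodic_window[OF gm gper])
  also have "(\<integral>\<^sup>+s. g s * indicator {0<..<1} s \<partial>lborel) = (\<integral>\<^sup>+y. F y * indicator {0<..<1} (fst y) \<partial>lborel)"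
    by (rule fub[symmetric]) simp
  finally show ?thesis by (simp add: mult_left_mono)
qed

text \<open>At most 1/\<epsilon> + 1 cells meet the unit interval, the last one possibly only in
  part. Their scaled areas give \<epsilon> + \<epsilon>^2, which is at most 2\<epsilon>.\<close>

lemma nn_integral_scaled_periodic_all:
  fixes F :: "real \<times> real \<Rightarrow> ennreal"
  assumes F: "F \<in> borel_measurable borel" and per: "\<And>y. F (fst y + 1, snd y) = F y" and \<epsilon>: "0 < \<epsilon>" "\<epsilon> \<le> 1"
  shows "(\<integral>\<^sup>+x. F ((1 / \<epsilon>) *\<^sub>R x) * indicator {0<..<1} (fst x) \<partial>lborel) \<le>
    ennreal (2 * \<epsilon>) * (\<integral>\<^sup>+y. F y * indicator {0<..<1} (fst y) \<partial>lborel)"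
proof -
  obtain n :: nat where n: "1 / \<epsilon> \<le> real n" "real n \<le> 1 / \<epsilon> + 1"
  proof
    have "0 < 1 / \<epsilon>" using \<epsilon> by simp
    then have "0 \<le> \<lceil>1 / \<epsilon>\<rceil>" by linarith
    then show "real (nat \<lceil>1 / \<epsilon>\<rceil>) \<le> 1 / \<epsilon> + 1" using of_int_ceiling_le_add_one[of "1 / \<epsilon>"] by simp
  qed (rule real_nat_ceiling_ge)
  have "\<epsilon>\<^sup>2 * real n \<le> \<epsilon>\<^sup>2 * (1 / \<epsilon> + 1)" by (rule mult_left_mono[OF n(2)]) simp
  also have "\<dots> = \<epsilon> + \<epsilon> * \<epsilon>" using \<epsilon> by (simp add: power2_eq_square field_simps)
  also have "\<dots> \<le> 2 * \<epsilon>" using \<epsilon> mult_left_le[of \<epsilon> \<epsilon>] by simp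
  finally have le: "\<epsilon>\<^sup>2 * real n \<le> 2 * \<epsilon>" .
  have "(\<integral>\<^sup>+x. F ((1 / \<epsilon>) *\<^sub>R x) * indicator {0<..<1} (fst x) \<partial>lborel) \<le>
    ennreal (\<epsilon>\<^sup>2) * (of_nat n * (\<integral>\<^sup>+y. F y * indicator {0<..<1} (fst y) \<partial>lborel))"
  proof (rule nn_integral_scaled_periodic[OF F _ \<epsilon>(1), where a = 0 and c = 1 and m = 0 and n = n])
    show "{0 / \<epsilon><..<1 / \<epsilon>} \<subseteq> {of_int 0..<of_int 0 + real n}"
      using n(1) by (simp add: subset_iff)
  qed (rule per, simp)
  also have "\<dots> = ennreal (\<epsilon>\<^sup>2 * real n) * (\<integral>\<^sup>+y. F y * indicator {0<..<1} (fst y) \<partial>lborel)"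
  proof -
    have "ennreal (\<epsilon>\<^sup>2 * real n) = ennreal (\<epsilon>\<^sup>2) * of_nat n"
      unfolding ennreal_of_nat_eq_real_of_nat by (rule ennreal_mult) simp_all
    then show ?thesis by (simp only: mult.assoc)
  qed
  also have "\<dots> \<le> ennreal (2 * \<epsilon>) * (\<integral>\<^sup>+y. F y * indicator {0<..<1} (fst y) \<partial>lborel)"
    using le by (intro mult_right_mono ennreal_leI) auto
  finally show ?thesis .
qed

text \<open>The left window is one period. The right one has unit length after stretching but need
  not start at an integer, so two periods are needed to cover it. The total of 3 is rounded up to 4,
  whose root is rational.\<close>

lemma nn_integral_scaled_periodic_ends:
  fixes F :: "real \<times> real \<Rightarrow> ennreal"
  assumes F [measurable]: "F \<in> borel_measurable borel" and per: "\<And>y. F (fst y + 1, snd y) = F y" and \<epsilon>: "0 < \<epsilon>" "\<epsilon> \<le> 1"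
  shows "(\<integral>\<^sup>+x. F ((1 / \<epsilon>) *\<^sub>R x) * indicator ({0<..<\<epsilon>} \<union> {1 - \<epsilon><..<1}) (fst x) \<partial>lborel) \<le>
    ennreal (4 * \<epsilon>\<^sup>2) * (\<integral>\<^sup>+y. F y * indicator {0<..<1} (fst y) \<partial>lborel)"
proof -
  let ?I = "\<integral>\<^sup>+y. F y * indicator {0<..<1} (fst y) \<partial>lborel"
  have m: "(\<lambda>x. F ((1 / \<epsilon>) *\<^sub>R x) * indicator {a<..<c} (fst x)) \<in> borel_measurable lborel" for a c
  proof -
    have [measurable]: "(fst :: real \<times> real \<Rightarrow> real) \<in> borel_measurable borel"
      by (rule borel_measurable_continuous_onI) (rule continuous_on_fst[OF continuous_on_id])
    have [measurable]: "(\<lambda>x. (1 / \<epsilon>) *\<^sub>R x) \<in> borel_measurable (borel :: (real \<times> real) measure)"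
      by (rule borel_measurable_continuous_onI) (intro continuous_intros)
    show ?thesis
      by (intro borel_measurable_times_ennreal measurable_compose[OF _ F] borel_measurable_indicator') simp_all
  qed
  have "(\<integral>\<^sup>+x. F ((1 / \<epsilon>) *\<^sub>R x) * indicator ({0<..<\<epsilon>} \<union> {1 - \<epsilon><..<1}) (fst x) \<partial>lborel) \<le>
     (\<integral>\<^sup>+x. F ((1 / \<epsilon>) *\<^sub>R x) * indicator {0<..<\<epsilon>} (fst x) + F ((1 / \<epsilon>) *\<^sub>R x) * indicator {1 - \<epsilon><..<1} (fst x) \<partial>lborel)"
    by (intro nn_integral_mono) (auto simp: indicator_def)
  also have "\<dots> = (\<integral>\<^sup>+x. F ((1 / \<epsilon>) *\<^sub>R x) * indicator {0<..<\<epsilon>} (fst x) \<partial>lborel) + (\<integral>\<^sup>+x. F ((1 / \<epsilon>) *\<^sub>R x) * indicator {1 - \<epsilon><..<1} (fst x) \<partial>lborel)"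
    by (rule nn_integral_add[OF m m])
  also have "\<dots> \<le> ennreal (\<epsilon>\<^sup>2) * (of_nat 1 * ?I) + ennreal (\<epsilon>\<^sup>2) * (of_nat 2 * ?I)"
  proof (intro add_mono)
    show "(\<integral>\<^sup>+x. F ((1 / \<epsilon>) *\<^sub>R x) * indicator {0<..<\<epsilon>} (fst x) \<partial>lborel) \<le> ennreal (\<epsilon>\<^sup>2) * (of_nat 1 * ?I)"
      by (rule nn_integral_scaled_periodic[OF F _ \<epsilon>(1), where m = 0 and n = 1]) (auto simp: per \<epsilon>)
    show "(\<integral>\<^sup>+x. F ((1 / \<epsilon>) *\<^sub>R x) * indicator {1 - \<epsilon><..<1} (fst x) \<partial>lborel) \<le> ennreal (\<epsilon>\<^sup>2) * (of_nat 2 * ?I)"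
    proof (rule nn_integral_scaled_periodic[OF F _ \<epsilon>(1), where m = "\<lfloor>1 / \<epsilon> - 1\<rfloor>" and n = 2])
      have "(1 - \<epsilon>) / \<epsilon> = 1 / \<epsilon> - 1" using \<epsilon> by (simp add: field_simps)
      then show "{(1 - \<epsilon>) / \<epsilon><..<1 / \<epsilon>} \<subseteq> {of_int \<lfloor>1 / \<epsilon> - 1\<rfloor>..<of_int \<lfloor>1 / \<epsilon> - 1\<rfloor> + real 2}"
        by (auto simp: subset_iff) linarith+
    qed (simp_all add: per \<epsilon>)
  qed
  also have "\<dots> = ennreal (3 * \<epsilon>\<^sup>2) * ?I"
  proof -
    have "ennreal (3 * \<epsilon>\<^sup>2) = ennreal (\<epsilon>\<^sup>2) * 3" by (simp add: ennreal_mult mult.commute)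
    moreover have "ennreal (\<epsilon>\<^sup>2) * (of_nat 1 * ?I) + ennreal (\<epsilon>\<^sup>2) * (of_nat 2 * ?I) = ennreal (\<epsilon>\<^sup>2) * ((1 + 2) * ?I)"
      by (simp only: distrib_left distrib_right of_nat_1 of_nat_numeral)
    ultimately show ?thesis by (simp add: mult.assoc)
  qed
  also have "\<dots> \<le> ennreal (4 * \<epsilon>\<^sup>2) * ?I" by (intro mult_right_mono ennreal_leI) auto
  finally show ?thesis .
qed

text \<open>For harmonic \<open>u\<close> the integrand is the divergence of \<omega> grad u, and
  this field, extended by 0, is C1 with compact support.\<close>

lemma integral_harmonic_test:
  assumes O: "open \<Omega>" and h: "harmonic_on \<Omega> u" and t: "test_function \<Omega> \<omega>"
  shows "(\<integral>x. grad u x \<bullet> grad \<omega> x \<partial>lebesgue_restr \<Omega>) = 0"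
proof -
  have u1: "C1_on \<Omega> u" and P: "C1_on \<Omega> (\<lambda>y. fst (grad u y))" and Q: "C1_on \<Omega> (\<lambda>y. snd (grad u y))"
    and lap: "\<And>x. x \<in> \<Omega> \<Longrightarrow> fst (grad (\<lambda>y. fst (grad u y)) x) + snd (grad (\<lambda>y. snd (grad u y)) x) = 0"
    using h by (auto simp: harmonic_on_def C2_on_def laplacian_def)
  obtain K where K: "compact K" "K \<subseteq> \<Omega>" "C1_on UNIV \<omega>"
    "\<And>x. x \<notin> K \<Longrightarrow> \<omega> x = 0" "\<And>x. x \<notin> K \<Longrightarrow> grad \<omega> x = 0" using t by (elim test_functionD) blast
  have UV: "\<Omega> \<union> - K = UNIV" and oK: "open (- K)" using K by (auto simp: compact_imp_closed open_Compl)
  note EP = C1_mult_extend[OF O oK UV K(3) _ P] and EQ = C1_mult_extend[OF O oK UV K(3) _ Q]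
  have CP: "C1_on UNIV (\<lambda>x. \<omega> x * fst (grad u x))" and CQ: "C1_on UNIV (\<lambda>x. \<omega> x * snd (grad u x))"
    and gP: "\<And>x. grad (\<lambda>x. \<omega> x * fst (grad u x)) x = \<omega> x *\<^sub>R grad (\<lambda>y. fst (grad u y)) x + fst (grad u x) *\<^sub>R grad \<omega> x"
    and gQ: "\<And>x. grad (\<lambda>x. \<omega> x * snd (grad u x)) x = \<omega> x *\<^sub>R grad (\<lambda>y. snd (grad u y)) x + snd (grad u x) *\<^sub>R grad \<omega> x"
    using EP EQ K(4) by auto
  note IP = integral_grad_compact_support[OF CP K(1)] and IQ = integral_grad_compact_support[OF CQ K(1)]
  have zP: "\<omega> x * fst (grad u x) = 0" "\<omega> x * snd (grad u x) = 0" if "x \<notin> K" for x using K(4)[OF that] by auto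
  have "indicator \<Omega> x *\<^sub>R (grad u x \<bullet> grad \<omega> x) =
      fst (grad (\<lambda>x. \<omega> x * fst (grad u x)) x) + snd (grad (\<lambda>x. \<omega> x * snd (grad u x)) x)" for x
  proof (cases "x \<in> \<Omega>")
    case True
    have "\<omega> x * fst (grad (\<lambda>y. fst (grad u y)) x) + \<omega> x * snd (grad (\<lambda>y. snd (grad u y)) x) = 0"
      using lap[OF True] by (simp add: distrib_left[symmetric])
    then show ?thesis using True by (simp add: gP gQ inner_prod_def)
  next
    case False
    then have "x \<notin> K" using K(2) by auto
    then show ?thesis using False K(4)[of x] K(5)[of x] by (simp add: gP gQ)
  qed
  then have "(\<integral>x. grad u x \<bullet> grad \<omega> x \<partial>lebesgue_restr \<Omega>) =
      (\<integral>x. fst (grad (\<lambda>x. \<omega> x * fst (grad u x)) x) + snd (grad (\<lambda>x. \<omega> x * snd (grad u x)) x) \<partial>lborel)"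
    using O by (subst integral_restrict_space) auto
  also have "\<dots> = fst (\<integral>x. grad (\<lambda>x. \<omega> x * fst (grad u x)) x \<partial>lborel) + snd (\<integral>x. grad (\<lambda>x. \<omega> x * snd (grad u x)) x \<partial>lborel)"
    using IP(1) IQ(1) zP by (subst Bochner_Integration.integral_add) auto
  also have "\<dots> = 0" using IP(2) IQ(2) zP by simp
  finally show ?thesis .
qed

lemma C1_on_cong:
  assumes "open S" "C1_on S u" "\<And>x. x \<in> S \<Longrightarrow> u x = v x"
  shows "C1_on S v" and "\<And>x. x \<in> S \<Longrightarrow> grad v x = grad u x"
proof -
  have "(v has_derivative (\<lambda>d. grad u x \<bullet> d)) (at x)" if "x \<in> S" for x
    by (rule has_derivative_transform_within_open[OF C1_onD[OF assms(1,2) that] assms(1) that assms(3)])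
  from C1_onI[OF assms(1) this C1_on_continuous(2)[OF assms(2)]]
  show "C1_on S v" "\<And>x. x \<in> S \<Longrightarrow> grad v x = grad u x" by auto
qed

lemma C1_on_scale:
  assumes S: "open S" and u: "C1_on S u"
  shows "C1_on {x. c *\<^sub>R x \<in> S} (\<lambda>x. u (c *\<^sub>R x))" and "\<And>x. c *\<^sub>R x \<in> S \<Longrightarrow> grad (\<lambda>x. u (c *\<^sub>R x)) x = c *\<^sub>R grad u (c *\<^sub>R x)"
proof -
  have O: "open {x. c *\<^sub>R x \<in> S}"
    using continuous_open_vimage[OF S, of "\<lambda>x. c *\<^sub>R x"] by (simp add: vimage_def continuous_intros)
  have D: "((\<lambda>x. u (c *\<^sub>R x)) has_derivative (\<lambda>d. (c *\<^sub>R grad u (c *\<^sub>R x)) \<bullet> d)) (at x)" if "x \<in> {x. c *\<^sub>R x \<in> S}" for x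
  proof -
    have "((\<lambda>x. c *\<^sub>R x) has_derivative (\<lambda>d. c *\<^sub>R d)) (at x)" by (auto intro!: derivative_eq_intros)
    from has_derivative_compose[OF this C1_onD[OF S u]] show ?thesis using that by simp
  qed
  have "continuous_on {x. c *\<^sub>R x \<in> S} (\<lambda>x. c *\<^sub>R grad u (c *\<^sub>R x))"
    by (intro continuous_intros continuous_on_compose2[OF C1_on_continuous(2)[OF u]]) auto
  from C1_onI[OF O D this] show "C1_on {x. c *\<^sub>R x \<in> S} (\<lambda>x. u (c *\<^sub>R x))"
    "\<And>x. c *\<^sub>R x \<in> S \<Longrightarrow> grad (\<lambda>x. u (c *\<^sub>R x)) x = c *\<^sub>R grad u (c *\<^sub>R x)" by auto
qed

context graph_domain
begin

lemma C1_approx_const: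
  assumes "C1_on S u" "open S" "closed_region \<subseteq> S" "C1_on UNIV u"
  shows "C1_approx (channel b) (\<lambda>_. u) u (grad u)"
  unfolding C1_approx_def
  using assms L2_continuous(1)[OF C1_on_continuous(1)[OF assms(1)] assms(2,3)]
    L2_continuous(1)[OF C1_on_continuous(2)[OF assms(1)] assms(2,3)] by (auto intro: tendsto_L2_const)

lemma C1_approx_C1: "C1_on UNIV u \<Longrightarrow> C1_approx (channel b) (\<lambda>_. u) u (grad u)"
  by (rule C1_approx_const) auto

end

lemma borel_measurable_restr_continuous:
  fixes g :: "'a::euclidean_space \<Rightarrow> 'b::euclidean_space"
  assumes "S \<in> sets borel" "continuous_on S g"
  shows "g \<in> borel_measurable (lebesgue_restr S)"
  using borel_measurable_continuous_on_indicator[OF assms] assms(1)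
  by (simp add: borel_measurable_restrict_space_iff)

context cell_problem
begin

sublocale F: lipschitz_graph_domain f L by (rule lipschitz_graph_domain_f)

text \<open>This turns the boundary condition of the cell problem into a homogeneous one: the
  function is harmonic with zero trace on the graph.\<close>

definition \<eta>\<^sub>0 :: "real \<times> real \<Rightarrow> real" where "\<eta>\<^sub>0 y = snd y + \<beta> y"

lemma channel_f_eq: "cell f \<inter> {y. snd y < 1} = channel f"
  by (auto simp: cell_def channel_def)

lemma channel_f_subset: "channel f \<subseteq> cell f" "channel f \<subseteq> strip"
  by (auto simp: cell_def channel_def cell_strip_def)

lemma \<beta>_trace: "has_trace (channel f) f \<beta> (\<lambda>s. - f s)"
  using sol by (simp add: cell_solution_def channel_f_eq)

lemma \<beta>_L2: "L2 (channel f) \<beta>"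
  using \<beta>_trace by (auto simp: has_trace_def H1_grad_def)

lemma grad_\<beta>_L2_channel: "L2 (channel f) (grad \<beta>)"
  by (rule L2_subset(1)[OF cell_borel F.channel_borel channel_f_subset(1) grad_\<beta>_L2])

lemma \<eta>\<^sub>0_C1: "C1_on strip \<eta>\<^sub>0" "\<And>y. y \<in> strip \<Longrightarrow> grad \<eta>\<^sub>0 y = (0, 1) + grad \<beta> y"
proof -
  note A = C1_on_add[OF open_strip C1_on_subset[OF C1_snd subset_UNIV] \<beta>_C1(1)]
  show "C1_on strip \<eta>\<^sub>0" unfolding \<eta>\<^sub>0_def[abs_def] by (rule A(1))
  show "grad \<eta>\<^sub>0 y = (0, 1) + grad \<beta> y" if "y \<in> strip" for y
    unfolding \<eta>\<^sub>0_def[abs_def] using A(2)[OF that] by simp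
qed

lemma \<eta>\<^sub>0_layer:
  assumes "0 \<le> r"
  shows "L2_norm (layer f r) \<eta>\<^sub>0 \<le> 2 * r * L2_norm (layer f r) (\<lambda>y. grad \<beta> y + (0, 1))"
proof -
  have "H1_grad (channel f) \<beta> (grad \<beta>)"
    unfolding H1_grad_def
    using \<beta>_L2 grad_\<beta>_L2_channel weak_gradient_C1[OF F.open_channel C1_on_subset[OF \<beta>_C1(1) channel_f_subset(2)]] by simp
  then obtain \<phi> where \<phi>: "C1_approx (channel f) \<phi> \<beta> (grad \<beta>)" "tendsto_L2 {0<..<1} (\<lambda>n s. \<phi> n (s, f s)) (\<lambda>s. - f s)"
    by (rule has_traceD[OF F.open_channel \<beta>_trace])
  note ms = C1_on_cmult[OF open_UNIV C1_snd, where c = "-1"]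
  note A = C1_approx_lincomb[OF F.open_channel \<phi>(1) F.C1_approx_C1[OF ms(1)]]
  have I: "{0<..<1::real} \<in> sets borel" by simp
  have Lf: "L2 {0<..<1} f"
  proof (rule L2_const[OF I, where C = 1])
    show "f \<in> borel_measurable (lebesgue_restr {0<..<1})"
      by (intro borel_measurable_restr borel_measurable_continuous_onI f_continuous)
    show "norm (f s) \<le> 1" for s using f_bounds[of s] \<delta>_pos by (simp add: abs_le_iff)
  qed simp
  have "tendsto_L2 {0<..<1} (\<lambda>n s. \<phi> n (s, f s) + f s) (\<lambda>s. - f s + f s)"
    by (rule tendsto_L2_add[OF I \<phi>(2) tendsto_L2_const[OF Lf]])
  then have t: "tendsto_L2 {0<..<1} (\<lambda>n s. \<phi> n (s, f s) - - 1 * snd (s, f s)) (\<lambda>_. 0)" by simp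
  have "L2_norm (layer f r) (\<lambda>x. \<beta> x - -1 * snd x) \<le> 2 * r * L2_norm (layer f r) (\<lambda>x. grad \<beta> x - grad (\<lambda>x. -1 * snd x) x)"
    by (rule F.layer_bound_zero_trace[OF A t assms])
  moreover have "(\<lambda>x. \<beta> x - -1 * snd x) = \<eta>\<^sub>0" by (auto simp: \<eta>\<^sub>0_def)
  moreover have "(\<lambda>x. grad \<beta> x - grad (\<lambda>x. -1 * snd x) x) = (\<lambda>y. grad \<beta> y + (0, 1))"
  proof
    fix x :: "real \<times> real"
    have "grad (\<lambda>x. -1 * snd x) x = (-1) *\<^sub>R (0, 1 :: real)" using ms(2)[of x] by (simp del: mult_minus1)
    then show "grad \<beta> x - grad (\<lambda>x. -1 * snd x) x = grad \<beta> x + (0, 1)" by (simp only:) simp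
  qed
  ultimately show ?thesis by simp
qed

end

section \<open>The corrector at scale \<epsilon>: weighted bounds and zero trace\<close>

locale scaled_cell = cell_problem f L \<delta> \<beta> for f L \<delta> \<beta> +
  fixes \<epsilon> :: real
  assumes \<epsilon>: "0 < \<epsilon>" "\<epsilon> \<le> 1"
begin

abbreviation b :: "real \<Rightarrow> real" where "b \<equiv> rough_bottom f \<epsilon>"

lemma b_lt: "b s < 0" "- \<epsilon> < b s"
proof -
  have "\<epsilon> * f (s / \<epsilon>) < \<epsilon> * 0" using f_bounds(2)[of "s / \<epsilon>"] \<delta>_pos \<epsilon> by (intro mult_strict_left_mono) auto
  then show "b s < 0" by (simp add: rough_bottom_def)
  have "\<epsilon> * (-1) < \<epsilon> * f (s / \<epsilon>)" using f_bounds(1)[of "s / \<epsilon>"] \<delta>_pos \<epsilon> by (intro mult_strict_left_mono) auto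
  then show "- \<epsilon> < b s" by (simp add: rough_bottom_def)
qed

lemma lipschitz_graph_domain_b: "lipschitz_graph_domain b L"
proof
  show "continuous_on UNIV b"
    unfolding rough_bottom_def[abs_def] by (intro continuous_intros continuous_on_compose2[OF f_continuous]) (use \<epsilon> in auto)
  show "-1 \<le> b s" "b s \<le> 0" for s using b_lt[of s] \<epsilon> by auto
  show "\<bar>b s - b t\<bar> \<le> L * \<bar>s - t\<bar>" for s t
  proof -
    have "\<bar>b s - b t\<bar> = \<epsilon> * \<bar>f (s / \<epsilon>) - f (t / \<epsilon>)\<bar>"
      unfolding rough_bottom_def right_diff_distrib[symmetric] abs_mult using \<epsilon> by simp
    also have "\<dots> \<le> \<epsilon> * (L * \<bar>s / \<epsilon> - t / \<epsilon>\<bar>)" by (rule mult_left_mono[OF f_lip]) (use \<epsilon> in simp)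
    also have "\<bar>s / \<epsilon> - t / \<epsilon>\<bar> = \<bar>s - t\<bar> / \<epsilon>" using \<epsilon> by (simp add: diff_divide_distrib[symmetric])
    finally show ?thesis using \<epsilon> by simp
  qed
qed

sublocale D: lipschitz_graph_domain b L by (rule lipschitz_graph_domain_b)

lemma rough_domain_eq: "rough_domain f \<epsilon> = channel b"
  by (auto simp: rough_domain_def channel_def)

abbreviation \<sigma> :: "real \<times> real \<Rightarrow> real \<times> real" where "\<sigma> x \<equiv> (1 / \<epsilon>) *\<^sub>R x"
abbreviation above :: "(real \<times> real) set" where "above \<equiv> {x. b (fst x) < snd x}"

definition B :: "real \<times> real \<Rightarrow> real" where "B x = \<epsilon> * \<beta> (\<sigma> x)"
definition \<eta> :: "real \<times> real \<Rightarrow> real" where "\<eta> x = snd x + B x"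

lemma above_eq: "above = {x. \<sigma> x \<in> strip}"
  using \<epsilon> by (auto simp: cell_strip_def rough_bottom_def pos_less_divide_eq mult.commute)

lemma \<sigma>_strip: "x \<in> above \<Longrightarrow> \<sigma> x \<in> strip"
  unfolding above_eq by simp

lemma open_above': "open above"
  using D.open_above[of 0] by simp

lemma channel_above: "channel b \<subseteq> above"
  by (auto simp: channel_def)

lemma scaled_C1:
  assumes u: "C1_on strip u"
  shows "C1_on above (\<lambda>x. c * u (\<sigma> x))" and "\<And>x. x \<in> above \<Longrightarrow> grad (\<lambda>x. c * u (\<sigma> x)) x = (c / \<epsilon>) *\<^sub>R grad u (\<sigma> x)"
proof -
  note S = C1_on_scale[OF open_strip u, where c = "1 / \<epsilon>"]
  have S1: "C1_on above (\<lambda>x. u (\<sigma> x))" unfolding above_eq by (rule S(1))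
  note M = C1_on_cmult[OF open_above' S1, where c = c]
  show "C1_on above (\<lambda>x. c * u (\<sigma> x))" by (rule M(1))
  show "grad (\<lambda>x. c * u (\<sigma> x)) x = (c / \<epsilon>) *\<^sub>R grad u (\<sigma> x)" if "x \<in> above" for x
    using M(2)[OF that] S(2)[OF \<sigma>_strip[OF that]] by simp
qed

lemma B_C1: "C1_on above B" "\<And>x. x \<in> above \<Longrightarrow> grad B x = grad \<beta> (\<sigma> x)"
proof -
  note S = scaled_C1[OF \<beta>_C1(1), where c = \<epsilon>]
  show "C1_on above B" unfolding B_def[abs_def] by (rule S(1))
  show "grad B x = grad \<beta> (\<sigma> x)" if "x \<in> above" for x
    unfolding B_def[abs_def] using S(2)[OF that] \<epsilon> by simp
qed

lemma \<eta>_C1: "C1_on above \<eta>" "\<And>x. x \<in> above \<Longrightarrow> grad \<eta> x = (0, 1) + grad B x"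
proof -
  note A = C1_on_add[OF open_above' C1_on_subset[OF C1_snd subset_UNIV] B_C1(1)]
  show "C1_on above \<eta>" unfolding \<eta>_def[abs_def] by (rule A(1))
  show "grad \<eta> x = (0, 1) + grad B x" if "x \<in> above" for x
    unfolding \<eta>_def[abs_def] using A(2)[OF that] by simp
qed

lemma B_harmonic: "harmonic_on above B"
proof -
  note P = scaled_C1[OF \<beta>_C1(2), where c = 1] and Q = scaled_C1[OF \<beta>_C1(3), where c = 1]
  note P' = C1_on_cong[OF open_above' P(1), where v = "\<lambda>y. fst (grad B y)"] and Q' = C1_on_cong[OF open_above' Q(1), where v = "\<lambda>y. snd (grad B y)"]
  have "laplacian B x = 0" if x: "x \<in> above" for x
    using P'(2)[OF _ x] Q'(2)[OF _ x] P(2)[OF x] Q(2)[OF x] \<beta>_laplacian[OF \<sigma>_strip[OF x]] B_C1(2) \<epsilon>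
    by (simp add: laplacian_def add_divide_distrib[symmetric])
  then show ?thesis using P'(1) Q'(1) B_C1 by (simp add: harmonic_on_def C2_on_def)
qed

lemma harmonic_on_channel: "harmonic_on (channel b) B"
  using B_harmonic channel_above unfolding harmonic_on_def C2_on_def by (blast intro: C1_on_subset)

lemma test_B: "test_function (channel b) \<omega> \<Longrightarrow> (\<integral>x. grad B x \<bullet> grad \<omega> x \<partial>lebesgue_restr (channel b)) = 0"
  by (rule integral_harmonic_test[OF D.open_channel harmonic_on_channel])

text \<open>Transfers integrals over a part of the rough domain to one cell. The periodic set
  \<open>T\<close> restricts the heights, and the second bound is the gain from staying within the
  two outermost cells.\<close>

lemma scaled_nn:
  assumes T: "T \<in> sets borel" "T \<subseteq> strip" "\<And>y. (fst y + 1, snd y) \<in> T \<longleftrightarrow> y \<in> T"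
    and g: "continuous_on strip g" "\<And>y. y \<in> strip \<Longrightarrow> g (fst y + 1, snd y) = g y"
    and S: "\<And>x. x \<in> S \<Longrightarrow> 0 < fst x \<and> fst x < 1 \<and> \<sigma> x \<in> T"
  shows "(\<integral>\<^sup>+x. ennreal (g (\<sigma> x)) * indicator S x \<partial>lborel) \<le>
      ennreal (2 * \<epsilon>) * (\<integral>\<^sup>+y. ennreal (g y) * indicator (cell f \<inter> T) y \<partial>lborel)"
    and "(\<And>x. x \<in> S \<Longrightarrow> fst x < \<epsilon> \<or> 1 - \<epsilon> < fst x) \<Longrightarrow> (\<integral>\<^sup>+x. ennreal (g (\<sigma> x)) * indicator S x \<partial>lborel) \<le>
      ennreal (4 * \<epsilon>\<^sup>2) * (\<integral>\<^sup>+y. ennreal (g y) * indicator (cell f \<inter> T) y \<partial>lborel)"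
proof -
  define G where "G y = ennreal (g y) * indicator T y" for y
  have m: "G \<in> borel_measurable borel"
    unfolding G_def using borel_measurable_ennreal_indicator[OF T(1) continuous_on_subset[OF g(1) T(2)]] by simp
  have per: "G (fst y + 1, snd y) = G y" for y
    using T(2,3) g(2)[of y] by (cases "y \<in> T") (auto simp: G_def)
  have R: "(\<integral>\<^sup>+y. G y * indicator {0<..<1} (fst y) \<partial>lborel) = (\<integral>\<^sup>+y. ennreal (g y) * indicator (cell f \<inter> T) y \<partial>lborel)"
    using T(2) by (intro nn_integral_cong) (auto simp: G_def indicator_def cell_def cell_strip_def)
  have "(\<integral>\<^sup>+x. ennreal (g (\<sigma> x)) * indicator S x \<partial>lborel) \<le> (\<integral>\<^sup>+x. G (\<sigma> x) * indicator {0<..<1} (fst x) \<partial>lborel)"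
  proof (rule nn_integral_mono)
    fix x show "ennreal (g (\<sigma> x)) * indicator S x \<le> G (\<sigma> x) * indicator {0<..<1} (fst x)"
      using S[of x] by (cases "x \<in> S") (simp_all add: G_def)
  qed
  also have "\<dots> \<le> ennreal (2 * \<epsilon>) * (\<integral>\<^sup>+y. G y * indicator {0<..<1} (fst y) \<partial>lborel)"
    by (rule nn_integral_scaled_periodic_all[where F = G, OF m per \<epsilon>])
  finally show "(\<integral>\<^sup>+x. ennreal (g (\<sigma> x)) * indicator S x \<partial>lborel) \<le>
      ennreal (2 * \<epsilon>) * (\<integral>\<^sup>+y. ennreal (g y) * indicator (cell f \<inter> T) y \<partial>lborel)" by (simp only: R)
  assume ends: "\<And>x. x \<in> S \<Longrightarrow> fst x < \<epsilon> \<or> 1 - \<epsilon> < fst x"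
  have "(\<integral>\<^sup>+x. ennreal (g (\<sigma> x)) * indicator S x \<partial>lborel) \<le> (\<integral>\<^sup>+x. G (\<sigma> x) * indicator ({0<..<\<epsilon>} \<union> {1 - \<epsilon><..<1}) (fst x) \<partial>lborel)"
  proof (rule nn_integral_mono)
    fix x show "ennreal (g (\<sigma> x)) * indicator S x \<le> G (\<sigma> x) * indicator ({0<..<\<epsilon>} \<union> {1 - \<epsilon><..<1}) (fst x)"
      using S[of x] ends[of x] by (cases "x \<in> S") (simp_all add: G_def)
  qed
  also have "\<dots> \<le> ennreal (4 * \<epsilon>\<^sup>2) * (\<integral>\<^sup>+y. G y * indicator {0<..<1} (fst y) \<partial>lborel)"
    by (rule nn_integral_scaled_periodic_ends[where F = G, OF m per \<epsilon>])
  finally show "(\<integral>\<^sup>+x. ennreal (g (\<sigma> x)) * indicator S x \<partial>lborel) \<le>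
      ennreal (4 * \<epsilon>\<^sup>2) * (\<integral>\<^sup>+y. ennreal (g y) * indicator (cell f \<inter> T) y \<partial>lborel)" by (simp only: R)
qed

lemma strip_borel: "strip \<in> sets borel" using open_strip by auto

lemma strip_periodic: "(fst y + 1, snd y) \<in> strip \<longleftrightarrow> y \<in> strip"
  using f_periodic by (auto simp: cell_strip_def split: prod.splits)

text \<open>The weight \<open>wt\<close> is the stretched height, shifted so as to be at least one above the graph.\<close>

definition wt :: "real \<times> real \<Rightarrow> real" where "wt x = snd x / \<epsilon> + 2"

lemma wt_eq: "wt x = snd (\<sigma> x) + 2" by (simp add: wt_def)

lemma wt_ge: "x \<in> above \<Longrightarrow> 1 \<le> wt x"
proof -
  assume "x \<in> above"
  then have "- \<epsilon> < snd x" using b_lt(2)[of "fst x"] by simp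
  then have "- 1 < snd x / \<epsilon>" using \<epsilon> by (simp add: field_simps)
  then show ?thesis by (simp add: wt_def)
qed

lemma wt_continuous: "continuous_on S wt"
  unfolding wt_def[abs_def] by (intro continuous_intros) (use \<epsilon> in auto)

definition ends :: "(real \<times> real) set" where
  "ends = channel b \<inter> ({x. fst x < \<epsilon>} \<union> {x. 1 - \<epsilon> < fst x})"

lemma ends_borel [measurable]: "ends \<in> sets borel"
proof -
  have "open ends" unfolding ends_def by (intro open_Int D.open_channel open_Un open_Collect_less continuous_intros)
  then show ?thesis by auto
qed

lemma ends_subset: "ends \<subseteq> channel b" by (auto simp: ends_def)

lemma channel_in_strip: "x \<in> channel b \<Longrightarrow> 0 < fst x \<and> fst x < 1 \<and> \<sigma> x \<in> strip"
  using \<sigma>_strip channel_above by (auto simp: channel_def)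

text \<open>The gradient of \<open>B\<close> is the rescaled gradient of \<beta> without a factor
  \<epsilon>, so only the covered area counts: order \<epsilon> for all cells together, but
  \<epsilon>^2 for the outermost two. This difference makes the energy error of order \<epsilon>
  instead of its root.\<close>

lemma weighted_grad_B:
  "L2 (channel b) (\<lambda>x. wt x ^ 3 *\<^sub>R grad B x)"
  "(L2_norm (channel b) (\<lambda>x. wt x ^ 3 *\<^sub>R grad B x))\<^sup>2 \<le> 2 * \<epsilon> * decay_const"
  "(L2_norm ends (\<lambda>x. wt x ^ 3 *\<^sub>R grad B x))\<^sup>2 \<le> 4 * \<epsilon>\<^sup>2 * decay_const"
proof -
  let ?g = "\<lambda>y. (snd y + 2) ^ 6 * (norm (grad \<beta> y))\<^sup>2"
  have g: "continuous_on strip ?g" by (intro continuous_intros C1_on_continuous(2)[OF \<beta>_C1(1)])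
  have gp: "?g (fst y + 1, snd y) = ?g y" if "y \<in> strip" for y using grad_\<beta>_periodic[OF that] by simp
  have cs: "cell f \<inter> strip = cell f" using cell_subset_strip by blast
  have eq: "ennreal ((norm (wt x ^ 3 *\<^sub>R grad B x))\<^sup>2) * indicator S x = ennreal (?g (\<sigma> x)) * indicator S x" if "S \<subseteq> channel b" for S x
  proof (cases "x \<in> S")
    case True
    then have "x \<in> above" using that channel_above by blast
    have "(norm (wt x ^ 3 *\<^sub>R grad B x))\<^sup>2 = (\<bar>wt x\<bar> ^ 3)\<^sup>2 * (norm (grad B x))\<^sup>2"
      by (simp add: power_mult_distrib power_abs)
    also have "(\<bar>wt x\<bar> ^ 3)\<^sup>2 = wt x ^ 6" by (simp add: power_mult[symmetric] power_even_abs)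
    finally show ?thesis using B_C1(2)[OF \<open>x \<in> above\<close>] by (simp add: wt_eq)
  qed simp
  have m: "(\<lambda>x. wt x ^ 3 *\<^sub>R grad B x) \<in> borel_measurable (lebesgue_restr S)" if "S \<in> sets borel" "S \<subseteq> channel b" for S
    using that channel_above
    by (intro borel_measurable_restr_continuous continuous_intros wt_continuous continuous_on_subset[OF C1_on_continuous(2)[OF B_C1(1)]]) auto
  have n1: "(\<integral>\<^sup>+x. ennreal ((norm (wt x ^ 3 *\<^sub>R grad B x))\<^sup>2) * indicator (channel b) x \<partial>lborel) \<le> ennreal (2 * \<epsilon> * decay_const)"
  proof -
    have "(\<integral>\<^sup>+x. ennreal (?g (\<sigma> x)) * indicator (channel b) x \<partial>lborel) \<le> ennreal (2 * \<epsilon>) * (\<integral>\<^sup>+y. ennreal (?g y) * indicator (cell f \<inter> strip) y \<partial>lborel)"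
      by (rule scaled_nn(1)[where g = ?g, OF strip_borel order_refl strip_periodic g gp channel_in_strip])
    also have "\<dots> \<le> ennreal (2 * \<epsilon>) * ennreal decay_const" unfolding cs by (rule mult_left_mono[OF decay_gradient]) simp
    also have "\<dots> = ennreal (2 * \<epsilon> * decay_const)" using \<epsilon> decay_const_nonneg by (simp add: ennreal_mult[symmetric])
    finally show ?thesis unfolding eq[OF order_refl] .
  qed
  have n2: "(\<integral>\<^sup>+x. ennreal ((norm (wt x ^ 3 *\<^sub>R grad B x))\<^sup>2) * indicator ends x \<partial>lborel) \<le> ennreal (4 * \<epsilon>\<^sup>2 * decay_const)"
  proof -
    have "(\<integral>\<^sup>+x. ennreal (?g (\<sigma> x)) * indicator ends x \<partial>lborel) \<le> ennreal (4 * \<epsilon>\<^sup>2) * (\<integral>\<^sup>+y. ennreal (?g y) * indicator (cell f \<inter> strip) y \<partial>lborel)"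
    proof (rule scaled_nn(2)[where g = ?g, OF strip_borel order_refl strip_periodic g gp])
      show "0 < fst x \<and> fst x < 1 \<and> \<sigma> x \<in> strip" if "x \<in> ends" for x
        using channel_in_strip that ends_subset by blast
      show "fst x < \<epsilon> \<or> 1 - \<epsilon> < fst x" if "x \<in> ends" for x using that by (simp add: ends_def)
    qed
    also have "\<dots> \<le> ennreal (4 * \<epsilon>\<^sup>2) * ennreal decay_const" unfolding cs by (rule mult_left_mono[OF decay_gradient]) simp
    also have "\<dots> = ennreal (4 * \<epsilon>\<^sup>2 * decay_const)" using \<epsilon> decay_const_nonneg by (simp add: ennreal_mult[symmetric])
    finally show ?thesis unfolding eq[OF ends_subset] .
  qed
  have nn: "0 \<le> 2 * \<epsilon> * decay_const" "0 \<le> 4 * \<epsilon>\<^sup>2 * decay_const" using \<epsilon> decay_const_nonneg by simp_all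
  show "L2 (channel b) (\<lambda>x. wt x ^ 3 *\<^sub>R grad B x)"
    by (rule L2_I_nn(1)[OF D.channel_borel m[OF D.channel_borel order_refl] n1 nn(1)])
  show "(L2_norm (channel b) (\<lambda>x. wt x ^ 3 *\<^sub>R grad B x))\<^sup>2 \<le> 2 * \<epsilon> * decay_const"
    by (rule L2_I_nn(2)[OF D.channel_borel m[OF D.channel_borel order_refl] n1 nn(1)])
  show "(L2_norm ends (\<lambda>x. wt x ^ 3 *\<^sub>R grad B x))\<^sup>2 \<le> 4 * \<epsilon>\<^sup>2 * decay_const"
    by (rule L2_I_nn(2)[OF ends_borel m[OF ends_borel ends_subset] n2 nn(2)])
qed

lemma smooth_domain_eq: "smooth_domain = channel (\<lambda>_. 0)"
  by (auto simp: smooth_domain_def channel_def)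

lemma smooth_subset: "channel (\<lambda>_. 0) \<subseteq> channel b"
  using b_lt(1) by (auto simp: channel_def intro: less_trans)

sublocale D0: graph_domain "\<lambda>_. 0 :: real"
  by unfold_locales auto

text \<open>Here \<open>B\<close> itself brings a factor \<epsilon>, and its square joins the area
  factor to make \<epsilon>^3. Only the flat domain is considered, as the decay of the values of
  \<beta> is available above height 0.\<close>

lemma weighted_B:
  "L2 (channel (\<lambda>_. 0)) (\<lambda>x. wt x ^ 3 *\<^sub>R (B x - \<epsilon> * B\<^sub>0))"
  "(L2_norm (channel (\<lambda>_. 0)) (\<lambda>x. wt x ^ 3 *\<^sub>R (B x - \<epsilon> * B\<^sub>0)))\<^sup>2 \<le> 2 * \<epsilon> ^ 3 * decay_const"
proof -
  let ?g = "\<lambda>y. (snd y + 2) ^ 6 * (\<beta> y - B\<^sub>0)\<^sup>2" and ?T = "{y :: real \<times> real. 0 < snd y}" and ?S = "channel (\<lambda>_. 0)"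
  have g: "continuous_on strip ?g" by (intro continuous_intros cont_pq)
  have gp: "?g (fst y + 1, snd y) = ?g y" if "y \<in> strip" for y using \<beta>_periodic[OF that] by simp
  have T: "?T \<in> sets borel" by (intro borel_open open_Collect_less continuous_intros)
  have Ts: "?T \<subseteq> strip" using upper_in_strip \<delta>_pos by force
  have cs: "cell f \<inter> ?T = {0<..<1} \<times> {0<..}"
  proof -
    have "f s < t" if "0 < t" for s t using f_bounds(2)[of s] \<delta>_pos that by linarith
    then show ?thesis by (auto simp: cell_def)
  qed
  have eq: "ennreal ((norm (wt x ^ 3 *\<^sub>R (B x - \<epsilon> * B\<^sub>0)))\<^sup>2) * indicator ?S x = ennreal (\<epsilon>\<^sup>2) * (ennreal (?g (\<sigma> x)) * indicator ?S x)" for x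
  proof -
    have "B x - \<epsilon> * B\<^sub>0 = \<epsilon> * (\<beta> (\<sigma> x) - B\<^sub>0)" by (simp add: B_def algebra_simps)
    moreover have "(norm (wt x ^ 3 *\<^sub>R (B x - \<epsilon> * B\<^sub>0)))\<^sup>2 = (wt x ^ 3)\<^sup>2 * (B x - \<epsilon> * B\<^sub>0)\<^sup>2"
      by (simp add: power_mult_distrib)
    moreover have "(wt x ^ 3)\<^sup>2 = wt x ^ 6" by (simp add: power_mult[symmetric])
    ultimately have "(norm (wt x ^ 3 *\<^sub>R (B x - \<epsilon> * B\<^sub>0)))\<^sup>2 = \<epsilon>\<^sup>2 * ?g (\<sigma> x)"
      by (simp only: power_mult_distrib wt_eq mult_ac)
    then show ?thesis by (simp add: ennreal_mult mult.assoc)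
  qed
  have "(\<integral>\<^sup>+x. ennreal ((norm (wt x ^ 3 *\<^sub>R (B x - \<epsilon> * B\<^sub>0)))\<^sup>2) * indicator ?S x \<partial>lborel) = ennreal (\<epsilon>\<^sup>2) * (\<integral>\<^sup>+x. ennreal (?g (\<sigma> x)) * indicator ?S x \<partial>lborel)"
    unfolding eq
  proof (rule nn_integral_cmult)
    have "continuous_on ?S (\<lambda>x. ?g (\<sigma> x))"
      by (rule continuous_on_compose2[OF g]) (use channel_in_strip smooth_subset in \<open>auto intro!: continuous_intros\<close>)
    from borel_measurable_ennreal_indicator[OF D0.channel_borel this]
    show "(\<lambda>x. ennreal (?g (\<sigma> x)) * indicator ?S x) \<in> borel_measurable lborel" by simp
  qed
  also have "\<dots> \<le> ennreal (\<epsilon>\<^sup>2) * (ennreal (2 * \<epsilon>) * (\<integral>\<^sup>+y. ennreal (?g y) * indicator (cell f \<inter> ?T) y \<partial>lborel))"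
  proof (rule mult_left_mono[OF scaled_nn(1)[where g = ?g, OF T Ts _ g gp]])
    show "0 < fst x \<and> fst x < 1 \<and> \<sigma> x \<in> ?T" if "x \<in> ?S" for x using that \<epsilon> by (auto simp: channel_def)
  qed auto
  also have "\<dots> \<le> ennreal (\<epsilon>\<^sup>2) * (ennreal (2 * \<epsilon>) * ennreal decay_const)"
    unfolding cs by (intro mult_left_mono decay_value) auto
  also have "\<dots> = ennreal (2 * \<epsilon> ^ 3 * decay_const)"
    using \<epsilon> decay_const_nonneg by (simp add: ennreal_mult[symmetric] power2_eq_square power3_eq_cube mult_ac)
  finally have n: "(\<integral>\<^sup>+x. ennreal ((norm (wt x ^ 3 *\<^sub>R (B x - \<epsilon> * B\<^sub>0)))\<^sup>2) * indicator ?S x \<partial>lborel) \<le> ennreal (2 * \<epsilon> ^ 3 * decay_const)" .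
  have m: "(\<lambda>x. wt x ^ 3 *\<^sub>R (B x - \<epsilon> * B\<^sub>0)) \<in> borel_measurable (lebesgue_restr ?S)"
    using smooth_subset channel_above
    by (intro borel_measurable_restr_continuous continuous_intros wt_continuous continuous_on_subset[OF C1_on_continuous(1)[OF B_C1(1)]]) auto
  have nn: "0 \<le> 2 * \<epsilon> ^ 3 * decay_const" using \<epsilon> decay_const_nonneg by simp
  show "L2 ?S (\<lambda>x. wt x ^ 3 *\<^sub>R (B x - \<epsilon> * B\<^sub>0))" by (rule L2_I_nn(1)[OF D0.channel_borel m n nn])
  show "(L2_norm ?S (\<lambda>x. wt x ^ 3 *\<^sub>R (B x - \<epsilon> * B\<^sub>0)))\<^sup>2 \<le> 2 * \<epsilon> ^ 3 * decay_const"
    by (rule L2_I_nn(2)[OF D0.channel_borel m n nn])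
qed

lemma grad_B_L2: "L2 (channel b) (grad B)"
proof (rule L2_bound(1)[OF D.channel_borel _ weighted_grad_B(1), where C = 1])
  show "grad B \<in> borel_measurable (lebesgue_restr (channel b))"
    by (rule borel_measurable_restr_continuous[OF D.channel_borel continuous_on_subset[OF C1_on_continuous(2)[OF B_C1(1)] channel_above]])
  show "norm (grad B x) \<le> 1 * norm (wt x ^ 3 *\<^sub>R grad B x)" if "x \<in> channel b" for x
  proof -
    have "1 \<le> wt x ^ 3" using wt_ge[of x] that channel_above by (intro one_le_power) auto
    then have "1 * norm (grad B x) \<le> \<bar>wt x ^ 3\<bar> * norm (grad B x)" by (intro mult_right_mono) auto
    then show ?thesis by simp
  qed
qed simp

text \<open>Below height 1 the square integrability of \<beta> is part of the trace condition of the
  cell problem; above height 0 it follows from the decay, the weight there being at least 1. The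
  overlap does no harm to an upper bound.\<close>

lemma B_L2: "L2 (channel b) B"
proof -
  have c: "L2 (channel b) (\<lambda>_. \<epsilon> * B\<^sub>0)" by (rule L2_const[OF D.channel_borel D.emeasure_channel, where C = "\<bar>\<epsilon> * B\<^sub>0\<bar>"]) auto
  let ?g = "\<lambda>y. (\<beta> y - B\<^sub>0)\<^sup>2" and ?Q = "{0<..<1} \<times> {0<..} :: (real \<times> real) set"
  have g: "continuous_on strip ?g" by (intro continuous_intros cont_pq)
  have gp: "?g (fst y + 1, snd y) = ?g y" if "y \<in> strip" for y using \<beta>_periodic[OF that] by simp
  have "L2 (channel f) (\<lambda>_. B\<^sub>0)" by (rule L2_const[OF F.channel_borel F.emeasure_channel, where C = "\<bar>B\<^sub>0\<bar>"]) auto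
  from L2_nn[OF F.channel_borel L2_diff(1)[OF F.channel_borel \<beta>_L2 this]]
  have low: "(\<integral>\<^sup>+y. ennreal (?g y) * indicator (channel f) y \<partial>lborel) = ennreal ((L2_norm (channel f) (\<lambda>y. \<beta> y - B\<^sub>0))\<^sup>2)" by simp
  have mlow: "(\<lambda>y. ennreal (?g y) * indicator (channel f) y) \<in> borel_measurable lborel"
    using borel_measurable_ennreal_indicator[OF F.channel_borel continuous_on_subset[OF g channel_f_subset(2)]] by simp
  have Q: "?Q \<in> sets borel" by (intro borel_open open_Times) auto
  have Qs: "?Q \<subseteq> strip" using \<delta>_pos by (auto intro!: upper_in_strip)
  have cw: "continuous_on ?Q (\<lambda>y. (snd y + 2) ^ 6 * (\<beta> y - B\<^sub>0)\<^sup>2)"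
    by (intro continuous_intros continuous_on_subset[OF cont_pq(3) Qs])
  have mup: "(\<lambda>y. ennreal ((snd y + 2) ^ 6 * (\<beta> y - B\<^sub>0)\<^sup>2) * indicator ?Q y) \<in> borel_measurable lborel"
    using borel_measurable_ennreal_indicator[OF Q cw] by (simp only: measurable_lborel2)
  let ?K = "(L2_norm (channel f) (\<lambda>y. \<beta> y - B\<^sub>0))\<^sup>2 + decay_const"
  have "(\<integral>\<^sup>+y. ennreal (?g y) * indicator (cell f \<inter> strip) y \<partial>lborel) \<le>
     (\<integral>\<^sup>+y. ennreal (?g y) * indicator (channel f) y + ennreal ((snd y + 2) ^ 6 * (\<beta> y - B\<^sub>0)\<^sup>2) * indicator ?Q y \<partial>lborel)"
  proof (rule nn_integral_mono)
    fix y :: "real \<times> real"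
    have "y \<in> channel f \<or> y \<in> ?Q" if "y \<in> cell f"
      using that by (cases y) (auto simp: cell_def channel_def)
    moreover have "ennreal (?g y) \<le> ennreal ((snd y + 2) ^ 6 * (\<beta> y - B\<^sub>0)\<^sup>2)" if "y \<in> ?Q"
    proof (rule ennreal_leI)
      have "1 \<le> (snd y + 2) ^ 6" using that by (intro one_le_power) (auto simp: mem_Times_iff)
      then have "1 * ?g y \<le> (snd y + 2) ^ 6 * ?g y" by (intro mult_right_mono) auto
      then show "?g y \<le> (snd y + 2) ^ 6 * (\<beta> y - B\<^sub>0)\<^sup>2" by simp
    qed
    ultimately show "ennreal (?g y) * indicator (cell f \<inter> strip) y \<le>
        ennreal (?g y) * indicator (channel f) y + ennreal ((snd y + 2) ^ 6 * (\<beta> y - B\<^sub>0)\<^sup>2) * indicator ?Q y"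
      by (cases "y \<in> cell f"; cases "y \<in> channel f"; cases "y \<in> ?Q") (auto simp: indicator_def)
  qed
  also have "\<dots> = (\<integral>\<^sup>+y. ennreal (?g y) * indicator (channel f) y \<partial>lborel) + (\<integral>\<^sup>+y. ennreal ((snd y + 2) ^ 6 * (\<beta> y - B\<^sub>0)\<^sup>2) * indicator ?Q y \<partial>lborel)"
    by (rule nn_integral_add[OF mlow mup])
  also have "\<dots> \<le> ennreal ((L2_norm (channel f) (\<lambda>y. \<beta> y - B\<^sub>0))\<^sup>2) + ennreal decay_const"
    by (rule add_mono[OF eq_refl[OF low] decay_value])
  also have "\<dots> = ennreal ?K" by (rule ennreal_plus[symmetric]) (simp_all add: decay_const_nonneg)
  finally have K: "(\<integral>\<^sup>+y. ennreal (?g y) * indicator (cell f \<inter> strip) y \<partial>lborel) \<le> ennreal ?K" .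
  have K0: "0 \<le> ?K" using decay_const_nonneg by simp
  have "L2 (channel b) (\<lambda>x. \<beta> (\<sigma> x) - B\<^sub>0)"
  proof (rule L2_I_nn(1)[OF D.channel_borel])
    show "(\<lambda>x. \<beta> (\<sigma> x) - B\<^sub>0) \<in> borel_measurable (lebesgue_restr (channel b))"
      by (intro borel_measurable_restr_continuous D.channel_borel continuous_intros continuous_on_compose2[OF cont_pq(3)])
         (use channel_in_strip in auto)
    have "(\<integral>\<^sup>+x. ennreal (?g (\<sigma> x)) * indicator (channel b) x \<partial>lborel) \<le> ennreal (2 * \<epsilon>) * ennreal ?K"
      by (rule order.trans[OF scaled_nn(1)[where g = ?g, OF strip_borel order_refl strip_periodic g gp channel_in_strip] mult_left_mono[OF K]]) simp_all
    then show "(\<integral>\<^sup>+x. ennreal ((norm (\<beta> (\<sigma> x) - B\<^sub>0))\<^sup>2) * indicator (channel b) x \<partial>lborel) \<le> ennreal (2 * \<epsilon> * ?K)"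
      using \<epsilon> K0 by (simp add: ennreal_mult[symmetric])
    show "0 \<le> 2 * \<epsilon> * ?K" using \<epsilon> K0 by simp
  qed
  from L2_add(1)[OF D.channel_borel L2_cmult(1)[OF D.channel_borel this, of \<epsilon>] c]
  show ?thesis by (simp add: B_def[abs_def] algebra_simps)
qed

lemma \<eta>_L2: "L2 (channel b) \<eta>" "L2 (channel b) (grad \<eta>)"
proof -
  have "L2 (channel b) snd" by (rule D.L2_continuous(1)[OF continuous_on_snd[OF continuous_on_id] open_UNIV]) simp
  from L2_add(1)[OF D.channel_borel this B_L2] show "L2 (channel b) \<eta>" by (simp add: \<eta>_def[abs_def])
  have c: "L2 (channel b) (\<lambda>_. (0, 1 :: real) :: real \<times> real)"
    by (rule L2_const[OF D.channel_borel D.emeasure_channel, where C = 1]) auto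
  have m: "grad \<eta> \<in> borel_measurable (lebesgue_restr (channel b))"
    by (rule borel_measurable_restr_continuous[OF D.channel_borel continuous_on_subset[OF C1_on_continuous(2)[OF \<eta>_C1(1)] channel_above]])
  show "L2 (channel b) (grad \<eta>)"
    by (rule L2_cong_AE(1)[OF D.channel_borel m L2_add(1)[OF D.channel_borel c grad_B_L2]])
       (use \<eta>_C1(2) channel_above in \<open>auto simp: space_restrict_space intro!: AE_I2\<close>)
qed

text \<open>A layer of thickness \<open>r\<close> is, after stretching, a layer of thickness
  \<open>r / \<epsilon>\<close> over repeated cells, where the Poincare inequality for the zero
  trace applies.\<close>

lemma \<eta>_layer:
  assumes r: "0 \<le> r" "r \<le> \<epsilon>"
  shows "L2_norm (layer b r) \<eta> \<le> 3 * r * L2_norm (layer f (r / \<epsilon>)) (\<lambda>y. grad \<beta> y + (0, 1))"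
proof -
  let ?T = "{y. f (fst y) + 0 < snd y} \<inter> {y. snd y < f (fst y) + r / \<epsilon>}" and ?g = "\<lambda>y. (\<eta>\<^sub>0 y)\<^sup>2"
  let ?N = "L2_norm (layer f (r / \<epsilon>)) (\<lambda>y. grad \<beta> y + (0, 1))"
  have re: "0 \<le> r / \<epsilon>" "r / \<epsilon> \<le> 1" using r \<epsilon> by simp_all
  have T: "?T \<in> sets borel" using F.open_above[of 0] F.open_below[of "r / \<epsilon>"] by auto
  have Ts: "?T \<subseteq> strip" by (auto simp: cell_strip_def)
  have Tp: "(fst y + 1, snd y) \<in> ?T \<longleftrightarrow> y \<in> ?T" for y by (simp add: f_periodic)
  have g: "continuous_on strip ?g" by (intro continuous_intros C1_on_continuous(1)[OF \<eta>\<^sub>0_C1(1)])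
  have gp: "?g (fst y + 1, snd y) = ?g y" if "y \<in> strip" for y using \<beta>_periodic[OF that] by (simp add: \<eta>\<^sub>0_def)
  have cT: "cell f \<inter> ?T = layer f (r / \<epsilon>)"
  proof -
    \<comment> \<open>Here \<open>r \<le> \<epsilon>\<close> enters: the layer in the cell stays
      below height 1, so the truncation built into \<open>layer\<close> is not felt.\<close>
    have "t < 1" if "t < f s + r / \<epsilon>" for s t using that re(2) f_bounds(2)[of s] \<delta>_pos by linarith
    then show ?thesis by (auto simp: cell_def layer_def)
  qed
  have L0: "L2 (layer f (r / \<epsilon>)) \<eta>\<^sub>0"
  proof -
    have "L2 (channel f) snd" by (rule F.L2_continuous(1)[OF continuous_on_snd[OF continuous_on_id] open_UNIV]) simp
    from L2_add(1)[OF F.channel_borel this \<beta>_L2] have "L2 (channel f) \<eta>\<^sub>0" by (simp add: \<eta>\<^sub>0_def[abs_def])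
    then show ?thesis by (rule L2_subset(1)[OF F.channel_borel F.layer_borel F.layer_subset])
  qed
  have eq: "ennreal ((norm (\<eta> x))\<^sup>2) * indicator (layer b r) x = ennreal (\<epsilon>\<^sup>2) * (ennreal (?g (\<sigma> x)) * indicator (layer b r) x)" for x
  proof -
    have "\<eta> x = \<epsilon> * \<eta>\<^sub>0 (\<sigma> x)" using \<epsilon> by (simp add: \<eta>_def \<eta>\<^sub>0_def B_def algebra_simps)
    then show ?thesis by (simp add: power_mult_distrib ennreal_mult mult.assoc)
  qed
  have "(\<integral>\<^sup>+x. ennreal ((norm (\<eta> x))\<^sup>2) * indicator (layer b r) x \<partial>lborel) = ennreal (\<epsilon>\<^sup>2) * (\<integral>\<^sup>+x. ennreal (?g (\<sigma> x)) * indicator (layer b r) x \<partial>lborel)"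
    unfolding eq
  proof (rule nn_integral_cmult)
    have "continuous_on (layer b r) (\<lambda>x. ?g (\<sigma> x))"
      by (rule continuous_on_compose2[OF g]) (use channel_in_strip[OF subsetD[OF D.layer_subset]] in \<open>auto intro!: continuous_intros\<close>)
    from borel_measurable_ennreal_indicator[OF D.layer_borel this]
    show "(\<lambda>x. ennreal (?g (\<sigma> x)) * indicator (layer b r) x) \<in> borel_measurable lborel" by simp
  qed
  also have "\<dots> \<le> ennreal (\<epsilon>\<^sup>2) * (ennreal (2 * \<epsilon>) * (\<integral>\<^sup>+y. ennreal (?g y) * indicator (cell f \<inter> ?T) y \<partial>lborel))"
  proof (rule mult_left_mono[OF scaled_nn(1)[where g = ?g, OF T Ts Tp g gp]])
    show "0 < fst x \<and> fst x < 1 \<and> \<sigma> x \<in> ?T" if "x \<in> layer b r" for x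
      using that \<epsilon> by (auto simp: layer_def rough_bottom_def field_simps)
  qed auto
  also have "(\<integral>\<^sup>+y. ennreal (?g y) * indicator (cell f \<inter> ?T) y \<partial>lborel) = ennreal ((L2_norm (layer f (r / \<epsilon>)) \<eta>\<^sub>0)\<^sup>2)"
    unfolding cT using L2_nn[OF F.layer_borel L0] by simp
  also have "ennreal (\<epsilon>\<^sup>2) * (ennreal (2 * \<epsilon>) * \<dots>) = ennreal (2 * \<epsilon> ^ 3 * (L2_norm (layer f (r / \<epsilon>)) \<eta>\<^sub>0)\<^sup>2)"
    using \<epsilon> by (simp add: ennreal_mult[symmetric] power2_eq_square power3_eq_cube mult_ac)
  finally have n: "(\<integral>\<^sup>+x. ennreal ((norm (\<eta> x))\<^sup>2) * indicator (layer b r) x \<partial>lborel) \<le> ennreal (2 * \<epsilon> ^ 3 * (L2_norm (layer f (r / \<epsilon>)) \<eta>\<^sub>0)\<^sup>2)" .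
  have m: "\<eta> \<in> borel_measurable (lebesgue_restr (layer b r))"
    by (rule L2_measurable[OF D.layer_borel L2_subset(1)[OF D.channel_borel D.layer_borel D.layer_subset \<eta>_L2(1)]])
  have "(L2_norm (layer b r) \<eta>)\<^sup>2 \<le> 2 * \<epsilon> ^ 3 * (L2_norm (layer f (r / \<epsilon>)) \<eta>\<^sub>0)\<^sup>2"
    by (rule L2_I_nn(2)[OF D.layer_borel m n]) (use \<epsilon> in simp)
  also have "\<dots> \<le> 2 * \<epsilon> ^ 3 * (2 * (r / \<epsilon>) * ?N)\<^sup>2"
    by (intro mult_left_mono power_mono \<eta>\<^sub>0_layer) (use \<epsilon> re in auto)
  \<comment> \<open>The number 8 is the factor 2 of the cell count times the squared Poincare factor
    2; it is rounded up to 9 and \<epsilon> is bounded by 1.\<close>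
  also have "\<dots> = \<epsilon> * (8 * (r * ?N)\<^sup>2)" using \<epsilon> by (simp add: power2_eq_square power3_eq_cube)
  also have "\<dots> \<le> 1 * (9 * (r * ?N)\<^sup>2)" using \<epsilon> by (intro mult_mono) auto
  also have "\<dots> = (3 * r * ?N)\<^sup>2" by (simp add: power2_eq_square)
  finally show ?thesis by (rule power2_le_imp_le) (use r in simp)
qed

text \<open>The approximants that witness the trace of \<beta> live on a single cell and need not
  match across its sides, so they cannot be rescaled and glued. Smallness in thin layers can be
  transferred from the cell, and it suffices to build new approximants by cutting off \<eta>
  itself.\<close>

lemma \<eta>_approx:
  obtains \<phi> where "C1_approx (channel b) \<phi> \<eta> (grad \<eta>)" "\<And>n s. \<phi> n (s, b s) = 0" "\<And>n s. \<phi> n (s, 1) = \<eta> (s, 1)"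
proof (rule D.C1_approx_of_layer_decay[OF \<eta>_C1(1) \<eta>_L2])
  let ?r = "\<lambda>m. 3 * D.tau m / \<epsilon>"
  have r0: "?r \<longlonglongrightarrow> 0" using tendsto_mult_left[OF D.tau(3), of "3 / \<epsilon>"] by simp
  have c: "L2 (channel f) (\<lambda>_. (0, 1 :: real) :: real \<times> real)"
    by (rule L2_const[OF F.channel_borel F.emeasure_channel, where C = 1]) auto
  have lim: "(\<lambda>m. 9 * L2_norm (layer f (?r m)) (\<lambda>y. grad \<beta> y + (0, 1))) \<longlonglongrightarrow> 0"
    using tendsto_mult_left[OF F.L2_norm_layer_tendsto[OF L2_add(1)[OF F.channel_borel grad_\<beta>_L2_channel c] r0], of 9] by simp
  show "(\<lambda>m. L2_norm (layer b (3 * D.tau m)) \<eta> / D.tau m) \<longlonglongrightarrow> 0"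
  proof (rule Lim_null_comparison[OF _ lim])
    have "\<forall>\<^sub>F m in sequentially. ?r m < 1" using order_tendstoD(2)[OF r0, of 1] by simp
    then show "\<forall>\<^sub>F m in sequentially. norm (L2_norm (layer b (3 * D.tau m)) \<eta> / D.tau m) \<le> 9 * L2_norm (layer f (?r m)) (\<lambda>y. grad \<beta> y + (0, 1))"
    proof eventually_elim
      case (elim m)
      have "L2_norm (layer b (3 * D.tau m)) \<eta> \<le> 3 * (3 * D.tau m) * L2_norm (layer f (?r m)) (\<lambda>y. grad \<beta> y + (0, 1))"
        by (rule \<eta>_layer) (use elim \<epsilon> D.tau(1)[of m] in \<open>auto simp: field_simps\<close>)
      then show ?case using D.tau(1)[of m] by (simp add: field_simps)
    qed
  qed
qed blast

end

lemma C1_zeta_affine: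
  "C1_on UNIV (\<lambda>x. zeta (p * fst x + r))" "grad (\<lambda>x. zeta (p * fst x + r)) x = (p * zeta_deriv (p * fst x + r), 0)"
  "C1_on UNIV (\<lambda>x. zeta (snd x))" "grad (\<lambda>x. zeta (snd x)) x = (0, zeta_deriv (snd x))"
proof -
  note A = C1_on_cmult[OF open_UNIV C1_fst, where c = p]
  note A' = C1_on_add[OF open_UNIV A(1) C1_const[of r]]
  note Z = C1_compose_real[OF open_UNIV A'(1) DERIV_zeta continuous_zeta_deriv]
  show "C1_on UNIV (\<lambda>x. zeta (p * fst x + r))" by (rule Z(1))
  show "grad (\<lambda>x. zeta (p * fst x + r)) x = (p * zeta_deriv (p * fst x + r), 0)"
    using Z(2)[of x] A'(2)[of x] A(2)[of x] by simp
  note S = C1_compose_real[OF open_UNIV C1_snd DERIV_zeta continuous_zeta_deriv]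
  show "C1_on UNIV (\<lambda>x. zeta (snd x))" "grad (\<lambda>x. zeta (snd x)) x = (0, zeta_deriv (snd x))"
    using S(1) S(2)[of x] by simp_all
qed

section \<open>The sign of the mean of the cell solution\<close>

context cell_problem
begin

text \<open>On a horizontal line the cut-off and its derivative are mere numbers. After expanding,
  only the means of \<open>q\<close>, of \<beta> and of \<beta> q remain, which are 0,
  \<open>B\<^sub>0\<close> and \<open>J\<close>.\<close>

lemma slice_energy:
  assumes t: "- \<delta> < t"
  shows "slice (\<lambda>x. \<zeta> * ((p x)\<^sup>2 + (1 + q x)\<^sup>2) + \<zeta>' * (\<eta>\<^sub>0 x * (1 + q x))) t = \<zeta> * (E t + 1) + \<zeta>' * (t + B\<^sub>0 + J t)"
proof -
  have c: "continuous_on strip (\<lambda>x. (p x)\<^sup>2 + (q x)\<^sup>2)" "continuous_on strip (\<lambda>x. \<beta> x * q x)"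
    by (intro continuous_intros cont_pq)+
  have E: "((\<lambda>s. (p (s, t))\<^sup>2 + (q (s, t))\<^sup>2) has_integral E t) {0..1}"
    unfolding E_def slice_def by (rule integrable_integral[OF slice_integrable[OF c(1) t]])
  have J: "((\<lambda>s. \<beta> (s, t) * q (s, t)) has_integral J t) {0..1}"
    unfolding J_def slice_def by (rule integrable_integral[OF slice_integrable[OF c(2) t]])
  have q: "((\<lambda>s. q (s, t)) has_integral 0) {0..1}"
    using integrable_integral[OF slice_integrable[OF cont_pq(2) t]] slice_q_zero[OF t] by (simp add: slice_def)
  have \<beta>: "((\<lambda>s. \<beta> (s, t)) has_integral B\<^sub>0) {0..1}"
    using integrable_integral[OF slice_integrable[OF cont_pq(3) t]] slice_\<beta>[OF t] by (simp add: slice_def)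
  have one: "((\<lambda>s. 1) has_integral 1) {0..1::real}" "((\<lambda>s. t) has_integral t) {0..1::real}"
    using has_integral_const_real[of 1 0 1] has_integral_const_real[of t 0 1] by simp_all
  have "((\<lambda>s. \<zeta> * (((p (s, t))\<^sup>2 + (q (s, t))\<^sup>2) + (1 + 2 * q (s, t))) + \<zeta>' * ((t + \<beta> (s, t)) + (t * q (s, t) + \<beta> (s, t) * q (s, t))))
      has_integral (\<zeta> * (E t + (1 + 2 * 0)) + \<zeta>' * ((t + B\<^sub>0) + (t * 0 + J t)))) {0..1}"
    by (intro has_integral_add has_integral_mult_right E J q \<beta> one)
  then have "((\<lambda>s. \<zeta> * ((p (s, t))\<^sup>2 + (1 + q (s, t))\<^sup>2) + \<zeta>' * (\<eta>\<^sub>0 (s, t) * (1 + q (s, t)))) has_integral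
      (\<zeta> * (E t + 1) + \<zeta>' * (t + B\<^sub>0 + J t))) {0..1}"
    by (simp add: \<eta>\<^sub>0_def power2_eq_square algebra_simps)
  then show ?thesis unfolding slice_def by (rule integral_unique)
qed

end

context scaled_cell
begin

lemma test_zero_trace_B:
  assumes "C1_approx (channel b) \<phi> v h" "tendsto_L2 {0<..<1} (\<lambda>n s. \<phi> n (s, b s)) (\<lambda>_. 0)"
    "C1_on UNIV \<Psi>" "0 < \<alpha>" "\<And>x. fst x < \<alpha> \<or> 1 - \<alpha> < fst x \<or> 1 - \<alpha> < snd x \<Longrightarrow> \<Psi> x = 0"
  shows "(\<integral>x. grad B x \<bullet> (\<Psi> x *\<^sub>R h x + v x *\<^sub>R grad \<Psi> x) \<partial>lebesgue_restr (channel b)) = 0"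
  by (rule D.test_zero_trace[OF grad_B_L2 test_B assms])

text \<open>grad \<eta> is (0, 1) plus the gradient of \<open>B\<close>. Both summands are
  orthogonal to the gradient of \<Psi> \<eta>: the constant field because this product vanishes on
  the bottom and at the top, the other by harmonicity.\<close>

lemma energy_identity:
  assumes \<Psi>: "C1_on UNIV \<Psi>" and \<alpha>: "0 < \<alpha>" "\<alpha> < 1"
    and supp: "\<And>x. fst x < \<alpha> \<or> 1 - \<alpha> < fst x \<or> 1 - \<alpha> < snd x \<Longrightarrow> \<Psi> x = 0"
  shows "integrable (lebesgue_restr (channel b)) (\<lambda>x. grad \<eta> x \<bullet> (\<Psi> x *\<^sub>R grad \<eta> x + \<eta> x *\<^sub>R grad \<Psi> x))"
    and "(\<integral>x. grad \<eta> x \<bullet> (\<Psi> x *\<^sub>R grad \<eta> x + \<eta> x *\<^sub>R grad \<Psi> x) \<partial>lebesgue_restr (channel b)) = 0"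
proof -
  let ?M = "lebesgue_restr (channel b)" and ?h = "\<lambda>x. \<Psi> x *\<^sub>R grad \<eta> x + \<eta> x *\<^sub>R grad \<Psi> x"
  obtain \<phi> where \<phi>: "C1_approx (channel b) \<phi> \<eta> (grad \<eta>)" "\<And>n s. \<phi> n (s, b s) = 0" "\<And>n s. \<phi> n (s, 1) = \<eta> (s, 1)"
    by (rule \<eta>_approx) blast
  have Z: "tendsto_L2 {0<..<1} (\<lambda>(n::nat) (s::real). 0::real) (\<lambda>_. 0)"
    by (rule tendsto_L2_const) (rule L2_const[where C = 0], auto)
  have t0: "tendsto_L2 {0<..<1} (\<lambda>n s. \<phi> n (s, b s)) (\<lambda>_. 0)" using Z by (simp only: \<phi>(2))
  note P = C1_approx_mult[OF D.open_channel D.compact_closed_region D.channel_subset_closed_region \<Psi> \<phi>(1)]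
  have Lh: "L2 (channel b) ?h" by (rule tendsto_L2D(2)[OF C1_approxD(3)[OF P]])
  have ip: "integrable ?M (\<lambda>x. G x \<bullet> ?h x)" if "L2 (channel b) G" for G
    using L2_product(1)[OF D.channel_borel that Lh, of "\<lambda>x. G x \<bullet> ?h x" 1]
      borel_measurable_inner[OF L2_measurable[OF D.channel_borel that] L2_measurable[OF D.channel_borel Lh]]
    by (simp add: Cauchy_Schwarz_ineq2)
  show "integrable ?M (\<lambda>x. grad \<eta> x \<bullet> ?h x)" by (rule ip[OF \<eta>_L2(2)])
  have 1: "(\<integral>x. grad B x \<bullet> ?h x \<partial>?M) = 0" by (rule test_zero_trace_B[OF \<phi>(1) t0 \<Psi> \<alpha>(1) supp])
  have 2: "(\<integral>x. snd (?h x) \<partial>?M) = 0"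
  proof -
    have "\<Psi> (s, 1) = 0" for s using supp[of "(s, 1)"] \<alpha> by simp
    then have "(\<integral>x. snd (?h x) \<partial>?M) = (\<integral>s. 0 - 0 \<partial>lebesgue_restr {0<..<1::real})"
      using Z by (intro D.tendsto_traces_integral[OF P]) (simp_all add: \<phi>(2))
    then show ?thesis by simp
  qed
  have c: "L2 (channel b) (\<lambda>_. (0, 1 :: real) :: real \<times> real)"
    by (rule L2_const[OF D.channel_borel D.emeasure_channel, where C = 1]) auto
  have "(\<integral>x. grad \<eta> x \<bullet> ?h x \<partial>?M) = (\<integral>x. (0, 1) \<bullet> ?h x + grad B x \<bullet> ?h x \<partial>?M)"
    by (rule Bochner_Integration.integral_cong)
       (use \<eta>_C1(2) channel_above in \<open>auto simp: space_restrict_space inner_add_left\<close>)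
  also have "\<dots> = (\<integral>x. (0, 1) \<bullet> ?h x \<partial>?M) + (\<integral>x. grad B x \<bullet> ?h x \<partial>?M)"
    by (rule Bochner_Integration.integral_add[OF ip[OF c] ip[OF grad_B_L2]])
  also have "(\<integral>x. (0, 1) \<bullet> ?h x \<partial>?M) = (\<integral>x. snd (?h x) \<partial>?M)" by (simp add: inner_prod_def)
  finally show "(\<integral>x. grad \<eta> x \<bullet> ?h x \<partial>?M) = 0" using 1 2 by simp
qed

text \<open>Testing with a partition of unity \<open>X\<close> in the horizontal direction reduces the energy identity
  to one period: the contributions of \<open>X'\<close> cancel.\<close>

lemma energy_one_period:
  assumes e: "\<epsilon> = 1 / 4"
  defines "W \<equiv> channel b \<inter> {x. 1 / 4 < fst x} \<inter> {x. fst x < 1 / 2}"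
    and "a \<equiv> \<lambda>x. zeta (snd x) * (norm (grad \<eta> x))\<^sup>2 + zeta_deriv (snd x) * (\<eta> x * snd (grad \<eta> x))"
  shows "integrable lborel (\<lambda>x. indicator W x * a x)" and "(\<integral>x. indicator W x * a x \<partial>lborel) = 0"
proof -
  \<comment> \<open>A step minus its translate by the period 1/4, so that the sum of the translates
    of \<open>X\<close> telescopes to 1.\<close>
  define X where "X s = zeta (4 * s + -2) - zeta (4 * s + -1)" for s
  define X' where "X' s = 4 * zeta_deriv (4 * s + -2) - 4 * zeta_deriv (4 * s + -1)" for s
  define \<Psi> where "\<Psi> x = X (fst x) * zeta (snd x)" for x
  note XC = C1_on_diff[OF open_UNIV C1_zeta_affine(1)[of 4 "-2"] C1_zeta_affine(1)[of 4 "-1"]]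
  have XC1: "C1_on UNIV (\<lambda>x. X (fst x))" "grad (\<lambda>x. X (fst x)) x = (X' (fst x), 0)" for x
    unfolding X_def X'_def using XC(1) XC(2)[of x] C1_zeta_affine(2)[of 4 "-2" x] C1_zeta_affine(2)[of 4 "-1" x] by simp_all
  note PC = C1_on_mult[OF open_UNIV XC1(1) C1_zeta_affine(3)]
  have \<Psi>: "C1_on UNIV \<Psi>" "grad \<Psi> x = (X' (fst x) * zeta (snd x), X (fst x) * zeta_deriv (snd x))" for x
    unfolding \<Psi>_def[abs_def] using PC(1) PC(2)[of x] XC1(2)[of x] C1_zeta_affine(4)[of x] by (simp_all add: mult.commute)
  have X0: "X s = 0 \<and> X' s = 0" if "s \<le> 1 / 4 \<or> 3 / 4 \<le> s" for s
    using that by (auto simp: X_def X'_def zeta_eq_0 zeta_eq_1)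
  have Xsum: "X s + X (s + 1 / 4) = 1" "X' s + X' (s + 1 / 4) = 0" if "1 / 4 < s" "s < 1 / 2" for s
    using that by (simp_all add: X_def X'_def zeta_eq_0 zeta_eq_1 distrib_left)
  define c where "c x = zeta (snd x) * (\<eta> x * fst (grad \<eta> x))" for x
  let ?I = "\<lambda>x. grad \<eta> x \<bullet> (\<Psi> x *\<^sub>R grad \<eta> x + \<eta> x *\<^sub>R grad \<Psi> x)"
  have supp: "\<Psi> x = 0" if "fst x < 1 / 4 \<or> 1 - 1 / 4 < fst x \<or> 1 - 1 / 4 < snd x" for x
    using that X0[of "fst x"] by (auto simp: \<Psi>_def zeta_eq_0)
  have I: "integrable (lebesgue_restr (channel b)) ?I" "(\<integral>x. ?I x \<partial>lebesgue_restr (channel b)) = 0"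
    using energy_identity[where \<alpha> = "1 / 4", OF \<Psi>(1) _ _ supp] by simp_all
  have Ieq: "?I x = X (fst x) * a x + X' (fst x) * c x" for x
    by (simp add: a_def c_def \<Psi>_def \<Psi>(2) inner_prod_def norm_prod_def power2_eq_square[symmetric] algebra_simps)
  let ?H = "\<lambda>x. indicator (channel b) x * ?I x"
  have H: "integrable lborel ?H" "(\<integral>x. ?H x \<partial>lborel) = 0"
    using I by (simp_all add: integrable_restrict_space integral_restrict_space)
  define W2 where "W2 = channel b \<inter> {x. 1 / 2 < fst x} \<inter> {x. fst x < 3 / 4}"
  have Wb: "W \<in> sets borel" "W2 \<in> sets borel"
    unfolding W_def W2_def by (intro borel_open open_Int D.open_channel open_Collect_less continuous_intros)+
  have i1: "integrable lborel (\<lambda>x. indicator W x * ?I x)" and i2: "integrable lborel (\<lambda>x. indicator W2 x * ?I x)"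
  proof -
    have *: "integrable lborel (\<lambda>x. indicator V x * ?I x)" if V: "V \<in> sets borel" "V \<subseteq> channel b" for V
    proof -
      have "integrable lborel (\<lambda>x. indicator V x *\<^sub>R ?H x)"
        by (rule integrable_mult_indicator[OF _ H(1)]) (use V in simp)
      moreover have "indicator V x *\<^sub>R ?H x = indicator V x * ?I x" for x
        using subsetD[OF V(2), of x] by (cases "x \<in> V") simp_all
      ultimately show ?thesis by (simp only:)
    qed
    show "integrable lborel (\<lambda>x. indicator W x * ?I x)" by (rule *[OF Wb(1)]) (auto simp: W_def)
    show "integrable lborel (\<lambda>x. indicator W2 x * ?I x)" by (rule *[OF Wb(2)]) (auto simp: W2_def)
  qed
  have "(\<integral>x. ?H x \<partial>lborel) = (\<integral>x. indicator W x * ?I x + indicator W2 x * ?I x \<partial>lborel)"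
  proof (rule integral_cong_AE)
    \<comment> \<open>The vertical line between the two periods lies in neither \<open>W\<close> nor
      \<open>W2\<close>, but it is a null set.\<close>
    have "AE x in (lborel :: (real \<times> real) measure). fst x \<noteq> 1 / 2"
    proof -
      have n: "negligible {x :: real \<times> real. x \<bullet> (1, 0) = 1 / 2}"
        by (rule negligible_standard_hyperplane) (simp add: Basis_prod_def)
      have "closed {x :: real \<times> real. x \<bullet> (1, 0) = 1 / 2}" by (intro closed_Collect_eq continuous_intros)
      then have "{x :: real \<times> real. x \<bullet> (1, 0) = 1 / 2} \<in> null_sets lborel"
        using n by (simp add: negligible_iff_null_sets null_sets_completion_iff)
      then have "AE x in lborel. x \<notin> {x :: real \<times> real. x \<bullet> (1, 0) = 1 / 2}" by (rule AE_not_in)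
      then show ?thesis by (simp add: inner_prod_def)
    qed
    then show "AE x in lborel. ?H x = indicator W x * ?I x + indicator W2 x * ?I x"
    proof eventually_elim
      case (elim x)
      show ?case
      proof (cases "x \<in> channel b \<and> 1 / 4 < fst x \<and> fst x < 3 / 4")
        case True
        then show ?thesis using elim by (cases "fst x < 1 / 2") (auto simp: W_def W2_def indicator_def)
      next
        case False
        then have "indicator W x = (0::real)" "indicator W2 x = (0::real)" "x \<in> channel b \<Longrightarrow> ?I x = 0"
          unfolding Ieq using X0[of "fst x"] by (auto simp: W_def W2_def indicator_def)
        then show ?thesis by (cases "x \<in> channel b") auto
      qed
    qed
  qed (use H(1) i1 i2 in auto)
  then have sum: "(\<integral>x. indicator W x * ?I x \<partial>lborel) + (\<integral>x. indicator W2 x * ?I x \<partial>lborel) = 0"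
    using H(2) i1 i2 by simp
  have channel_iff: "y \<in> channel b \<longleftrightarrow> 0 < fst y \<and> fst y < 1 \<and> b (fst y) < snd y \<and> snd y < 1" for y
    by (auto simp: channel_def)
  \<comment> \<open>The second period is moved onto the first; \<eta>, its gradient and the graph
    are periodic, so only the argument of \<open>X\<close> changes.\<close>
  have shift: "indicator W2 ((1 / 4, 0) + x) * ?I ((1 / 4, 0) + x) = indicator W x * (X (fst x + 1 / 4) * a x + X' (fst x + 1 / 4) * c x)" for x
  proof (cases "x \<in> W")
    case True
    then have x: "x \<in> above" "1 / 4 < fst x" "fst x < 1 / 2" "snd x < 1" using channel_above by (auto simp: W_def channel_def)
    have bp: "b (1 / 4 + fst x) = b (fst x)" using f_periodic[of "4 * fst x"] by (simp add: rough_bottom_def e algebra_simps)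
    have x': "(1 / 4, 0) + x \<in> above" using x(1) bp by simp
    have m: "(1 / 4, 0) + x \<in> W2" using x x' by (simp add: W2_def channel_iff)
    have s: "\<sigma> ((1 / 4, 0) + x) = (fst (\<sigma> x) + 1, snd (\<sigma> x))" by (simp add: e prod_eq_iff scaleR_right_distrib)
    have Bp: "B ((1 / 4, 0) + x) = B x" unfolding B_def s using \<beta>_periodic[OF \<sigma>_strip[OF x(1)]] by simp
    have gp: "grad B ((1 / 4, 0) + x) = grad B x"
      using B_C1(2)[OF x'] B_C1(2)[OF x(1)] grad_\<beta>_periodic[OF \<sigma>_strip[OF x(1)]] unfolding s by simp
    have "a ((1 / 4, 0) + x) = a x" "c ((1 / 4, 0) + x) = c x"
      using Bp gp \<eta>_C1(2)[OF x'] \<eta>_C1(2)[OF x(1)] by (simp_all add: a_def c_def \<eta>_def)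
    then show ?thesis unfolding Ieq using m True by (simp add: add.commute)
  next
    case False
    have "(1 / 4, 0) + x \<notin> W2"
    proof
      assume m: "(1 / 4, 0) + x \<in> W2"
      have "b (1 / 4 + fst x) = b (fst x)" using f_periodic[of "4 * fst x"] by (simp add: rough_bottom_def e algebra_simps)
      with m have "x \<in> W" by (simp add: W_def W2_def channel_iff)
      with False show False by simp
    qed
    then show ?thesis using False by simp
  qed
  have mW2: "(\<lambda>x. indicator W2 x * ?I x) \<in> borel_measurable borel" using i2 by auto
  have sh: "(\<integral>x. indicator W2 x * ?I x \<partial>lborel) = (\<integral>x. indicator W x * (X (fst x + 1 / 4) * a x + X' (fst x + 1 / 4) * c x) \<partial>lborel)"
    using integral_affine[OF mW2, of 1 "(1 / 4, 0)"] shift by simp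
  have i2': "integrable lborel (\<lambda>x. indicator W x * (X (fst x + 1 / 4) * a x + X' (fst x + 1 / 4) * c x))"
  proof -
    have "integrable (distr lborel borel ((+) (1 / 4, 0))) (\<lambda>x. indicator W2 x * ?I x)"
      using i2 by (simp add: lborel_distr_plus)
    then have "integrable lborel (\<lambda>x. indicator W2 ((1 / 4, 0) + x) * ?I ((1 / 4, 0) + x))"
      by (subst (asm) integrable_distr_eq) (use mW2 in simp_all)
    then show ?thesis by (simp only: shift)
  qed
  have eq: "indicator W x * ?I x + indicator W x * (X (fst x + 1 / 4) * a x + X' (fst x + 1 / 4) * c x) = indicator W x * a x" for x
  proof (cases "x \<in> W")
    case True
    then have s: "1 / 4 < fst x" "fst x < 1 / 2" by (auto simp: W_def)
    have "(X (fst x) + X (fst x + 1 / 4)) * a x + (X' (fst x) + X' (fst x + 1 / 4)) * c x = a x" using Xsum[OF s] by simp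
    then show ?thesis unfolding Ieq using True by (simp add: algebra_simps)
  qed simp
  have "integrable lborel (\<lambda>x. indicator W x * ?I x + indicator W x * (X (fst x + 1 / 4) * a x + X' (fst x + 1 / 4) * c x))"
    by (rule Bochner_Integration.integrable_add[OF i1 i2'])
  then show "integrable lborel (\<lambda>x. indicator W x * a x)" by (simp only: eq)
  have "(\<integral>x. indicator W x * ?I x + indicator W x * (X (fst x + 1 / 4) * a x + X' (fst x + 1 / 4) * c x) \<partial>lborel) = 0"
    using sum sh i1 i2' by simp
  then show "(\<integral>x. indicator W x * a x \<partial>lborel) = 0" by (simp only: eq)
qed

text \<open>At \<open>\<epsilon> = 1 / 4\<close> the channel contains a full period away from its vertical sides.\<close>

lemma beta_bar_nonneg_quarter:
  assumes e: "\<epsilon> = 1 / 4"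
  shows "0 \<le> B\<^sub>0"
proof -
  define W where "W = channel b \<inter> {x. 1 / 4 < fst x} \<inter> {x. fst x < 1 / 2}"
  define a where "a = (\<lambda>x. zeta (snd x) * (norm (grad \<eta> x))\<^sup>2 + zeta_deriv (snd x) * (\<eta> x * snd (grad \<eta> x)))"
  have A: "integrable lborel (\<lambda>x. indicator W x * a x)" "(\<integral>x. indicator W x * a x \<partial>lborel) = 0"
    unfolding W_def a_def using energy_one_period[OF e] by simp_all
  let ?V = "{1 / 4<..<1 / 2} \<times> {0<..<1} :: (real \<times> real) set"
  have Vb: "?V \<in> sets borel" by (intro borel_open open_Times) auto
  have VW: "?V \<subseteq> W"
  proof -
    have "b s < t" if "0 < t" for s t using b_lt(1)[of s] that by linarith
    then show ?thesis by (auto simp: W_def channel_def)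
  qed
  have AV: "integrable lborel (\<lambda>x. indicator ?V x * a x)"
  proof -
    have "integrable lborel (\<lambda>x. indicator ?V x *\<^sub>R (indicator W x * a x))"
      by (rule integrable_mult_indicator[OF _ A(1)]) (use Vb in simp)
    moreover have "indicator ?V x *\<^sub>R (indicator W x * a x) = indicator ?V x * a x" for x
      using VW by (auto simp: indicator_def)
    ultimately show ?thesis by (simp only:)
  qed
  \<comment> \<open>At heights up to 0 the integrand is the square of the gradient. Dropping the
    rough part can only decrease the integral and leaves a region where means over lines are
    defined.\<close>
  have le: "(\<integral>x. indicator ?V x * a x \<partial>lborel) \<le> 0"
  proof -
    have "(\<integral>x. indicator ?V x * a x \<partial>lborel) \<le> (\<integral>x. indicator W x * a x \<partial>lborel)"
    proof (rule integral_mono[OF AV A(1)])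
      fix x :: "real \<times> real"
      show "indicator ?V x * a x \<le> indicator W x * a x"
      proof (cases "x \<in> W \<and> x \<notin> ?V")
        case True
        then have "snd x \<le> 0" by (auto simp: W_def channel_def)
        then have "a x = (norm (grad \<eta> x))\<^sup>2" by (simp add: a_def zeta_eq_1)
        then show ?thesis using True by simp
      qed (use VW in \<open>auto simp: indicator_def\<close>)
    qed
    then show ?thesis using A(2) by simp
  qed
  \<comment> \<open>The integrand in cell coordinates. Scaling by 1/4 shrinks \<eta> but not its
    gradient, whence the additional division by 4 in the second term.\<close>
  define g where "g y = zeta (snd y / 4) * ((p y)\<^sup>2 + (1 + q y)\<^sup>2) + (zeta_deriv (snd y / 4) / 4) * (\<eta>\<^sub>0 y * (1 + q y))" for y
  let ?R = "{0<..<1} \<times> {0<..<4} :: (real \<times> real) set"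
  have change: "indicator ?V ((1 / 4, 0) + (1 / 4) *\<^sub>R y) * a ((1 / 4, 0) + (1 / 4) *\<^sub>R y) = indicator ?R y * g y" for y
  proof (cases "y \<in> ?R")
    case True
    let ?x = "(1 / 4, 0) + (1 / 4) *\<^sub>R y"
    have V: "?x \<in> ?V" using True by (cases y) auto
    have "?x \<in> channel b" using subsetD[OF VW V] unfolding W_def by blast
    then have x: "?x \<in> above" by (rule subsetD[OF channel_above])
    have y: "y \<in> strip" using True upper_in_strip[of "snd y" "fst y"] \<delta>_pos by (cases y) auto
    have s: "\<sigma> ?x = (fst y + 1, snd y)" by (simp add: e prod_eq_iff scaleR_right_distrib)
    have gr: "grad \<eta> ?x = (p y, 1 + q y)"
      using \<eta>_C1(2)[OF x] B_C1(2)[OF x] grad_\<beta>_periodic[OF y] unfolding s by (simp add: prod_eq_iff)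
    have et: "\<eta> ?x = \<eta>\<^sub>0 y / 4"
      using \<beta>_periodic[OF y] unfolding \<eta>_def B_def s by (simp add: e \<eta>\<^sub>0_def)
    show ?thesis using True V by (simp add: a_def g_def gr et norm_prod_def)
  next
    case False
    then have "(1 / 4, 0) + (1 / 4) *\<^sub>R y \<notin> ?V" by (cases y) auto
    then show ?thesis using False by simp
  qed
  have mV: "(\<lambda>x. indicator ?V x * a x) \<in> borel_measurable borel" using AV by auto
  have int_g: "(\<integral>x. indicator ?V x * a x \<partial>lborel) = (1 / 16) * (\<integral>y. indicator ?R y * g y \<partial>lborel)"
    using integral_affine[OF mV, of "1 / 4" "(1 / 4, 0)"] change by (simp add: power2_eq_square)
  have gc: "continuous_on strip g"
    unfolding g_def[abs_def] zeta_def[abs_def] zeta_deriv_def[abs_def]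
    by (intro continuous_intros cont_pq C1_on_continuous(1)[OF \<eta>\<^sub>0_C1(1)]) auto
  let ?C = "cbox (0, 0) (1, 4) :: (real \<times> real) set"
  have Cs: "?C \<subseteq> strip" using \<delta>_pos by (auto simp: cbox_Pair_eq intro!: upper_in_strip)
  have Rb: "?R \<in> sets borel" by (intro borel_open open_Times) auto
  have RC: "?R \<subseteq> ?C" by (auto simp: cbox_Pair_eq)
  have ig: "integrable lborel (\<lambda>y. indicator ?R y * g y)"
  proof -
    have "integrable lborel (\<lambda>y. indicator ?C y *\<^sub>R g y)"
      by (rule borel_integrable_compact[OF compact_cbox continuous_on_subset[OF gc Cs]])
    then have "integrable lborel (\<lambda>y. indicator ?R y *\<^sub>R (indicator ?C y *\<^sub>R g y))"
      by (rule integrable_mult_indicator[rotated]) (use Rb in simp)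
    moreover have "indicator ?R y *\<^sub>R (indicator ?C y *\<^sub>R g y) = indicator ?R y * g y" for y
      using RC by (auto simp: indicator_def)
    ultimately show ?thesis by (simp only:)
  qed
  \<comment> \<open>An exact primitive of the mean over lines, since t + B0 + J has derivative 1 +
    E. It vanishes at 4, where the cut-off is 0, so the whole integral reduces to the value at
    height 0.\<close>
  define P where "P t = zeta (t / 4) * (t + B\<^sub>0 + J t)" for t
  define P' where "P' t = zeta (t / 4) * (E t + 1) + (zeta_deriv (t / 4) / 4) * (t + B\<^sub>0 + J t)" for t
  have sl: "slice g t = P' t" if "- \<delta> < t" for t
    using slice_energy[OF that, of "zeta (t / 4)" "zeta_deriv (t / 4) / 4"]
    by (simp add: g_def[abs_def] slice_def P'_def)
  have inner: "(\<integral>s. indicator ?R (s, t) * g (s, t) \<partial>lborel) = P' t * indicator {0<..<4} t" for t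
  proof (cases "t \<in> {0<..<4}")
    case True
    then have t: "- \<delta> < t" using \<delta>_pos by simp
    have "(\<integral>s. indicator ?R (s, t) * g (s, t) \<partial>lborel) = (\<integral>s. g (s, t) * indicator {0<..<1} s \<partial>lborel)"
      using True by (intro Bochner_Integration.integral_cong) (auto simp: indicator_def)
    also have "\<dots> = slice g t" unfolding slice_def by (rule integral_Icc_lborel[OF slice_continuous[OF gc t], symmetric])
    finally show ?thesis using True sl[OF t] by simp
  next
    case False
    then have "indicator ?R (s, t) = (0::real)" for s by (auto simp: indicator_def)
    then show ?thesis using False by simp
  qed
  have P'c: "continuous_on {0..4} P'"
  proof -
    have "continuous_on {0..4} J"
    proof (intro continuous_at_imp_continuous_on ballI)
      fix x :: real assume "x \<in> {0..4}"
      then show "isCont J x" using \<delta>_pos by (intro DERIV_isCont[OF DERIV_J]) simp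
    qed
    moreover have "continuous_on {0..4} E" by (rule continuous_on_subset[OF E_continuous]) (use \<delta>_pos in auto)
    ultimately show ?thesis
      unfolding P'_def[abs_def] zeta_def zeta_deriv_def by (intro continuous_intros) auto
  qed
  have "integrable (lborel \<Otimes>\<^sub>M lborel) (\<lambda>(s, t). indicator ?R (s, t) * g (s, t))"
    using ig by (simp add: lborel_prod case_prod_beta')
  from lborel_pair.integral_snd[OF this]
  have "(\<integral>y. indicator ?R y * g y \<partial>lborel) = (\<integral>t. P' t * indicator {0<..<4} t \<partial>lborel)"
    by (simp add: inner lborel_prod case_prod_beta')
  also have "\<dots> = integral {0..4} P'" by (rule integral_Icc_lborel[OF P'c, symmetric])
  also have "\<dots> = P 4 - P 0"
  proof (rule integral_unique, rule fundamental_theorem_of_calculus)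
    fix t :: real assume "t \<in> {0..4}"
    then have t: "- \<delta> < t" using \<delta>_pos by simp
    have z: "((\<lambda>t. zeta (t / 4)) has_real_derivative zeta_deriv (t / 4) * (1 / 4)) (at t)"
      by (rule DERIV_chain2[OF DERIV_zeta]) (auto intro!: derivative_eq_intros)
    have l: "((\<lambda>t. t + B\<^sub>0 + J t) has_real_derivative 1 + E t) (at t)"
      by (auto intro!: derivative_eq_intros DERIV_J[OF t])
    have "(P has_real_derivative P' t) (at t)"
      unfolding P_def[abs_def] P'_def using DERIV_mult[OF z l] by (simp add: algebra_simps)
    then show "(P has_vector_derivative P' t) (at t within {0..4})"
      by (simp add: has_real_derivative_iff_has_vector_derivative has_vector_derivative_at_within)
  qed simp
  also have "\<dots> = - (B\<^sub>0 + J 0)" by (simp add: P_def zeta_eq_0 zeta_eq_1)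
  finally have "0 \<le> B\<^sub>0 + J 0" using le int_g by simp
  then show ?thesis using J_nonpos[of 0] by simp
qed

end

text \<open>The mean does not involve \<epsilon>, so one convenient scale decides its sign. The sign
  makes the wall law a dissipative Robin condition and keeps 1 + \<epsilon> B0 away from 0.\<close>

lemma (in cell_problem) beta_bar_nonneg: "0 \<le> B\<^sub>0"
proof -
  interpret Q: scaled_cell f L \<delta> \<beta> "1 / 4" by unfold_locales auto
  show ?thesis by (rule Q.beta_bar_nonneg_quarter) simp
qed

section \<open>The wall law\<close>

lemma C1_approx_cong:
  assumes O: "open \<Omega>" and \<phi>: "C1_approx \<Omega> \<phi> v h" and h: "\<And>x. x \<in> \<Omega> \<Longrightarrow> v x = v' x" "\<And>x. x \<in> \<Omega> \<Longrightarrow> h x = h' x"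
    and m: "v' \<in> borel_measurable (lebesgue_restr \<Omega>)" "h' \<in> borel_measurable (lebesgue_restr \<Omega>)"
  shows "C1_approx \<Omega> \<phi> v' h'"
proof -
  have b: "\<Omega> \<in> sets borel" using O by auto
  show ?thesis
    using C1_approxD[OF \<phi>] h
    by (auto simp: C1_approx_def space_restrict_space
        intro!: tendsto_L2_cong_AE[OF b _ m(1), of \<phi> v] tendsto_L2_cong_AE[OF b _ m(2), of _ h] AE_I2)
qed

text \<open>\<open>c\<close> is chosen so that the affine function attains \<open>U\<close> at the
  top. The difference from it is an admissible test function, and its energy equals -\<epsilon> B0
  times the squared norm of q - c; with B0 \<ge> 0 both sides must vanish.\<close>

lemma wall_law_unique:
  assumes sol: "wall_law_solution B\<^sub>0 U \<epsilon> u" and "0 \<le> B\<^sub>0" "0 < \<epsilon>"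
  defines "c \<equiv> U / (1 + \<epsilon> * B\<^sub>0)"
  shows "L2 smooth_domain u" and "L2_norm smooth_domain (\<lambda>x. u x - c * (snd x + \<epsilon> * B\<^sub>0)) = 0"
proof -
  interpret graph_domain "\<lambda>_. 0 :: real" by unfold_locales auto
  let ?D = "channel (\<lambda>_. 0 :: real)" and ?I = "{0<..<1::real}"
  have dom: "smooth_domain = ?D" by (auto simp: smooth_domain_def channel_def)
  have pos: "0 < 1 + \<epsilon> * B\<^sub>0" using assms by (simp add: add_pos_nonneg)
  have Ib: "?I \<in> sets borel" by simp
  from sol obtain g q where top: "has_trace ?D (\<lambda>_. 1) u (\<lambda>_. U)" and g: "H1_grad ?D u g" and q: "L2 ?I q"
    and bot: "has_trace ?D (\<lambda>_. 0) u (\<lambda>s. \<epsilon> * B\<^sub>0 * q s)"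
    and green: "\<And>v h t. H1_grad ?D v h \<Longrightarrow> has_trace ?D (\<lambda>_. 1) v (\<lambda>_. 0) \<Longrightarrow> has_trace ?D (\<lambda>_. 0) v t \<Longrightarrow>
        (\<integral>x. g x \<bullet> h x \<partial>lebesgue_restr ?D) = - (\<integral>s. q s * t s \<partial>lebesgue_restr ?I)"
    unfolding wall_law_solution_def dom by (auto simp: set_lint_restr)
  show Lu: "L2 smooth_domain u" using g by (simp add: dom H1_grad_def)
  obtain \<phi> where \<phi>: "C1_approx ?D \<phi> u g" "tendsto_L2 ?I (\<lambda>n s. \<phi> n (s, 1)) (\<lambda>_. U)"
    by (rule has_traceD[OF open_channel top g])
  obtain \<psi> where \<psi>: "C1_approx ?D \<psi> u g" "tendsto_L2 ?I (\<lambda>n s. \<psi> n (s, 0)) (\<lambda>s. \<epsilon> * B\<^sub>0 * q s)"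
    by (rule has_traceD[OF open_channel bot g])
  obtain \<omega> where \<omega>: "C1_approx ?D \<omega> u g" "tendsto_L2 ?I (\<lambda>n s. \<omega> n (s, 0)) (\<lambda>s. \<epsilon> * B\<^sub>0 * q s)"
    "tendsto_L2 ?I (\<lambda>n s. \<omega> n (s, 1)) (\<lambda>_. U)"
    by (rule joint_approx[OF \<psi> \<phi>])
  define l where "l x = c * (snd x + \<epsilon> * B\<^sub>0)" for x :: "real \<times> real"
  note A = C1_on_add[OF open_UNIV C1_snd C1_const[of "\<epsilon> * B\<^sub>0"]]
  note M = C1_on_cmult[OF open_UNIV A(1), where c = c]
  have lC: "C1_on UNIV l" "grad l = (\<lambda>x. (0, c))"
    unfolding l_def[abs_def] using M(1) M(2) A(2) by auto
  let ?z = "\<lambda>x. u x - l x" and ?h = "\<lambda>x. g x - (0, c)" and ?t = "\<lambda>s. \<epsilon> * B\<^sub>0 * (q s - c)"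
  have Z: "C1_approx ?D (\<lambda>n x. \<omega> n x - l x) ?z ?h"
    using C1_approx_lincomb[OF open_channel \<omega>(1) C1_approx_C1[OF lC(1)]] by (simp add: lC(2))
  have Lc: "L2 ?I (\<lambda>_. k)" for k :: real by (rule L2_const[OF Ib, where C = "\<bar>k\<bar>"]) auto
  have z1: "tendsto_L2 ?I (\<lambda>n s. \<omega> n (s, 1) - l (s, 1)) (\<lambda>_. 0)"
  proof -
    have "l (s, 1) = U" for s using pos by (simp add: l_def c_def)
    then show ?thesis using tendsto_L2_diff[OF Ib \<omega>(3) tendsto_L2_const[OF Lc[of U]]] by simp
  qed
  have z0: "tendsto_L2 ?I (\<lambda>n s. \<omega> n (s, 0) - l (s, 0)) ?t"
    using tendsto_L2_diff[OF Ib \<omega>(2) tendsto_L2_const[OF Lc[of "c * (\<epsilon> * B\<^sub>0)"]]] by (simp add: l_def algebra_simps)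
  have gr: "(\<integral>x. g x \<bullet> ?h x \<partial>lebesgue_restr ?D) = - (\<integral>s. q s * ?t s \<partial>lebesgue_restr ?I)"
    by (rule green[OF C1_approx_H1[OF open_channel Z] has_traceI[OF open_channel Z z1] has_traceI[OF open_channel Z z0]])
  have int: "(\<integral>x. snd (?h x) \<partial>lebesgue_restr ?D) = (\<integral>s. 0 - ?t s \<partial>lebesgue_restr ?I)"
    by (rule tendsto_traces_integral[OF Z z0 z1])
  have Lg: "L2 ?D g" and Lh: "L2 ?D ?h" and Lt: "L2 ?I ?t"
    using g tendsto_L2D[OF C1_approxD(3)[OF Z]] tendsto_L2D[OF z0] by (auto simp: H1_grad_def)
  have Le: "L2 ?D (\<lambda>_. (0, c) :: real \<times> real)" by (rule L2_const[OF channel_borel emeasure_channel, where C = "\<bar>c\<bar>"]) auto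
  have ip: "integrable (lebesgue_restr ?D) (\<lambda>x. G x \<bullet> ?h x)" if "L2 ?D G" for G
    using L2_product(1)[OF channel_borel that Lh, of "\<lambda>x. G x \<bullet> ?h x" 1]
      borel_measurable_inner[OF L2_measurable[OF channel_borel that] L2_measurable[OF channel_borel Lh]]
    by (simp add: Cauchy_Schwarz_ineq2)
  have it: "integrable (lebesgue_restr ?I) (\<lambda>s. w s * ?t s)" if "L2 ?I w" for w
    using L2_product(1)[OF Ib that Lt, of "\<lambda>s. w s * ?t s" 1]
      borel_measurable_times[OF L2_measurable[OF Ib that] L2_measurable[OF Ib Lt]] by (simp add: abs_mult)
  have qc: "L2 ?I (\<lambda>s. q s - c)" by (rule L2_diff(1)[OF Ib q Lc])
  have "(L2_norm ?D ?h)\<^sup>2 = (\<integral>x. g x \<bullet> ?h x - (0, c) \<bullet> ?h x \<partial>lebesgue_restr ?D)"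
    by (simp add: L2_norm_power2[OF channel_borel] power2_norm_eq_inner inner_diff_left)
  also have "\<dots> = (\<integral>x. g x \<bullet> ?h x \<partial>lebesgue_restr ?D) - (\<integral>x. (0, c) \<bullet> ?h x \<partial>lebesgue_restr ?D)"
    by (rule Bochner_Integration.integral_diff[OF ip[OF Lg] ip[OF Le]])
  also have "(\<integral>x. (0, c) \<bullet> ?h x \<partial>lebesgue_restr ?D) = c * (\<integral>x. snd (?h x) \<partial>lebesgue_restr ?D)"
    by (simp add: inner_prod_def)
  also have "\<dots> = - (\<integral>s. c * ?t s \<partial>lebesgue_restr ?I)" unfolding int by simp
  also have "(\<integral>x. g x \<bullet> ?h x \<partial>lebesgue_restr ?D) - - (\<integral>s. c * ?t s \<partial>lebesgue_restr ?I) =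
      - ((\<integral>s. q s * ?t s \<partial>lebesgue_restr ?I) - (\<integral>s. c * ?t s \<partial>lebesgue_restr ?I))" unfolding gr by simp
  also have "\<dots> = - (\<integral>s. q s * ?t s - c * ?t s \<partial>lebesgue_restr ?I)"
    using Bochner_Integration.integral_diff[OF it[OF q] it[OF Lc[of c]]] by simp
  also have "(\<lambda>s. q s * ?t s - c * ?t s) = (\<lambda>s. \<epsilon> * B\<^sub>0 * (norm (q s - c))\<^sup>2)"
    by (auto simp: power2_eq_square algebra_simps)
  also have "(\<integral>s. \<epsilon> * B\<^sub>0 * (norm (q s - c))\<^sup>2 \<partial>lebesgue_restr ?I) = \<epsilon> * B\<^sub>0 * (L2_norm ?I (\<lambda>s. q s - c))\<^sup>2"
    by (simp add: L2_norm_power2[OF Ib])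
  finally have E: "(L2_norm ?D ?h)\<^sup>2 = - (\<epsilon> * B\<^sub>0 * (L2_norm ?I (\<lambda>s. q s - c))\<^sup>2)" .
  have "0 \<le> \<epsilon> * B\<^sub>0 * (L2_norm ?I (\<lambda>s. q s - c))\<^sup>2" using assms by simp
  with E zero_le_power2[of "L2_norm ?D ?h"] have h0: "L2_norm ?D ?h = 0" and q0: "\<epsilon> * B\<^sub>0 * (L2_norm ?I (\<lambda>s. q s - c))\<^sup>2 = 0"
    by (auto simp del: zero_le_power2)
  \<comment> \<open>For \<open>B\<^sub>0 = 0\<close> nothing has been learnt about \<open>q\<close>,
    but the bottom trace of the difference carries the factor \<open>B\<^sub>0\<close> and vanishes
    in either case.\<close>
  have "L2_norm ?I ?t = \<bar>\<epsilon> * B\<^sub>0\<bar> * L2_norm ?I (\<lambda>s. q s - c)" using L2_cmult(2)[OF Ib qc, of "\<epsilon> * B\<^sub>0"] by simp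
  then have t0: "L2_norm ?I ?t = 0" using q0 by auto
  have z0': "tendsto_L2 ?I (\<lambda>n s. \<omega> n (s, 0) - l (s, 0)) (\<lambda>_. 0)"
  proof (rule tendsto_L2I[OF tendsto_L2D(1)[OF z0] Lc _ tendsto_L2D(3)[OF z0]])
    show "L2_norm ?I (\<lambda>s. \<omega> n (s, 0) - l (s, 0) - 0) \<le> L2_norm ?I (\<lambda>s. \<omega> n (s, 0) - l (s, 0) - ?t s)" for n
      using L2_norm_triangle[OF Ib tendsto_L2D(1)[OF z0, of n] Lt Lc[of 0]] t0 by simp
  qed
  \<comment> \<open>With zero gradient and zero bottom trace, the Poincare inequality on the whole
    square makes the difference vanish.\<close>
  have K: "(\<integral>\<^sup>+t. ennreal ((t - 0) * 1\<^sup>2) * indicator {0<..<min 1 (0 + 3)} t \<partial>lborel) \<le> ennreal 1"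
  proof -
    have "(\<integral>\<^sup>+t. ennreal ((t - 0) * 1\<^sup>2) * indicator {0<..<min 1 (0 + 3)} t \<partial>lborel) \<le> (\<integral>\<^sup>+t. ennreal 1 * indicator {0..1::real} t \<partial>lborel)"
      by (rule nn_integral_mono) (auto simp: indicator_def)
    also have "\<dots> = ennreal 1" by (subst nn_integral_cmult_indicator) auto
    finally show ?thesis .
  qed
  have "(L2_norm (layer (\<lambda>_. 0) 3) (\<lambda>x. 1 * ?z x))\<^sup>2 \<le> 2 * 1 * (L2_norm (layer (\<lambda>_. 0) 3) ?h)\<^sup>2"
    by (rule layer_bound[OF Z z0', where C = 1]) (use K in auto)
  then have "L2_norm ?D ?z = 0" unfolding channel_eq_layer[symmetric] using h0 by simp
  then show "L2_norm smooth_domain (\<lambda>x. u x - c * (snd x + \<epsilon> * B\<^sub>0)) = 0" by (simp add: l_def dom)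
qed

subsection \<open>The multiplier for the \<open>L\<^sup>2\<close> estimate\<close>

locale multiplier = fixes \<epsilon> :: real assumes \<epsilon>: "0 < \<epsilon>" "\<epsilon> \<le> 1"
begin

definition \<rho> :: "real \<Rightarrow> real" where "\<rho> t = 1 / sqrt (t\<^sup>2 + \<epsilon>\<^sup>2)"
text \<open>A regularisation of t - t^2 / 2, the solution of -\<theta>'' = 1 with \<theta>(0) = 0
  and \<theta>'(1) = 0. Replacing t by t^2 / sqrt(t^2 + \<epsilon>^2) makes the derivative vanish at
  0 too, so that \<theta> extends by 0 as a C1 function and no boundary term appears at height 0,
  where the trace of the error is unknown.\<close>

definition \<theta> :: "real \<Rightarrow> real" where "\<theta> t = (max 0 t)\<^sup>2 * (\<rho> t - 1 / 2)"
definition \<theta>' :: "real \<Rightarrow> real" where "\<theta>' t = 2 * max 0 t * (\<rho> t - 1 / 2) - (max 0 t)\<^sup>2 * (t * \<rho> t ^ 3)"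

text \<open>As \<open>\<theta>'\<close> has a corner at the origin, its restriction to the half line is extended smoothly by \<open>\<kappa>\<close>.\<close>

definition \<kappa> :: "real \<Rightarrow> real" where "\<kappa> t = t * \<rho> t + \<epsilon>\<^sup>2 * (t * \<rho> t ^ 3) - t"
definition \<kappa>' :: "real \<Rightarrow> real" where "\<kappa>' t = \<epsilon>\<^sup>2 * (2 * \<epsilon>\<^sup>2 - t\<^sup>2) * \<rho> t ^ 5 - 1"

lemma sum_pos: "0 < t\<^sup>2 + \<epsilon>\<^sup>2" using \<epsilon> by (intro add_nonneg_pos) auto

lemma \<rho>_pos: "0 < \<rho> t" using \<epsilon> by (simp add: \<rho>_def sum_power2_gt_zero_iff)

lemma \<rho>_sq: "\<rho> t ^ 2 * (t\<^sup>2 + \<epsilon>\<^sup>2) = 1"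
  using \<epsilon> by (simp add: \<rho>_def power_divide sum_power2_eq_zero_iff)

lemma \<rho>_le: "\<epsilon> * \<rho> t \<le> 1" "\<bar>t\<bar> * \<rho> t \<le> 1"
proof -
  have s: "(\<epsilon> * \<rho> t)\<^sup>2 + (\<bar>t\<bar> * \<rho> t)\<^sup>2 = 1"
    using \<rho>_sq[of t] by (simp add: power_mult_distrib algebra_simps)
  have "(\<epsilon> * \<rho> t)\<^sup>2 \<le> 1" using s zero_le_power2[of "\<bar>t\<bar> * \<rho> t"] by linarith
  then show "\<epsilon> * \<rho> t \<le> 1" using power2_le_imp_le[of "\<epsilon> * \<rho> t" 1] by simp
  have "(\<bar>t\<bar> * \<rho> t)\<^sup>2 \<le> 1" using s zero_le_power2[of "\<epsilon> * \<rho> t"] by linarith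
  then show "\<bar>t\<bar> * \<rho> t \<le> 1" using power2_le_imp_le[of "\<bar>t\<bar> * \<rho> t" 1] by simp
qed

lemma DERIV_\<rho>: "(\<rho> has_real_derivative - (t * \<rho> t ^ 3)) (at t)"
proof -
  have s: "((\<lambda>t. sqrt (t\<^sup>2 + \<epsilon>\<^sup>2)) has_real_derivative t * \<rho> t) (at t)"
    using sum_pos[of t] by (auto intro!: derivative_eq_intros simp: \<rho>_def divide_simps)
  have "((\<lambda>t. 1 / sqrt (t\<^sup>2 + \<epsilon>\<^sup>2)) has_real_derivative - (t * \<rho> t) * (\<rho> t * \<rho> t)) (at t)"
    using DERIV_inverse_fun[OF s] sum_pos[of t] \<epsilon> by (simp add: inverse_eq_divide \<rho>_def power2_eq_square)
  then show ?thesis unfolding \<rho>_def[abs_def] by (simp add: power3_eq_cube mult_ac \<rho>_def)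
qed

lemma continuous_\<rho>: "continuous_on S \<rho>"
  by (intro continuous_at_imp_continuous_on ballI DERIV_isCont[OF DERIV_\<rho>])

lemma DERIV_\<theta>: "(\<theta> has_real_derivative \<theta>' t) (at t)"
proof -
  have "((\<lambda>t. \<rho> t - 1 / 2) has_real_derivative - (t * \<rho> t ^ 3)) (at t)"
    using DERIV_diff[OF DERIV_\<rho> DERIV_const[of "1 / 2"]] by simp
  from DERIV_mult[OF DERIV_max_power2 this] show ?thesis
    unfolding \<theta>_def[abs_def] \<theta>'_def by (simp add: algebra_simps)
qed

lemma continuous_\<theta>': "continuous_on S \<theta>'"
  unfolding \<theta>'_def[abs_def] by (intro continuous_intros continuous_\<rho>)

lemma DERIV_\<kappa>: "(\<kappa> has_real_derivative \<kappa>' t) (at t)"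
proof -
  have 3: "((\<lambda>t. \<rho> t ^ 3) has_real_derivative 3 * \<rho> t ^ 2 * - (t * \<rho> t ^ 3)) (at t)"
    using DERIV_power[OF DERIV_\<rho>, of 3] by (simp add: mult_ac)
  have "(\<kappa> has_real_derivative (1 * \<rho> t + - (t * \<rho> t ^ 3) * t) + \<epsilon>\<^sup>2 * (1 * \<rho> t ^ 3 + (3 * \<rho> t ^ 2 * - (t * \<rho> t ^ 3)) * t) - 1) (at t)"
    unfolding \<kappa>_def[abs_def]
    by (intro DERIV_diff DERIV_add DERIV_cmult DERIV_mult DERIV_ident DERIV_\<rho> 3)
  moreover have "(1 * \<rho> t + - (t * \<rho> t ^ 3) * t) + \<epsilon>\<^sup>2 * (1 * \<rho> t ^ 3 + (3 * \<rho> t ^ 2 * - (t * \<rho> t ^ 3)) * t) - 1 = \<kappa>' t"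
  proof -
    let ?r = "\<rho> t"
    have e: "?r ^ 2 * (t\<^sup>2 + \<epsilon>\<^sup>2) = 1" by (rule \<rho>_sq)
    \<comment> \<open>All terms are brought to the common power \<open>?r ^ 5\<close> by means of
      \<rho>^2 (t^2 + \<epsilon>^2) = 1.\<close>
    have r3: "?r ^ 3 = ?r ^ 5 * (t\<^sup>2 + \<epsilon>\<^sup>2)"
    proof -
      have "?r ^ 5 * (t\<^sup>2 + \<epsilon>\<^sup>2) = ?r ^ 3 * (?r ^ 2 * (t\<^sup>2 + \<epsilon>\<^sup>2))" by (simp add: power_add[symmetric] mult.assoc[symmetric])
      then show ?thesis using e by simp
    qed
    have "?r = ?r ^ 3 * (t\<^sup>2 + \<epsilon>\<^sup>2)"
    proof -
      have "?r ^ 3 * (t\<^sup>2 + \<epsilon>\<^sup>2) = ?r * (?r ^ 2 * (t\<^sup>2 + \<epsilon>\<^sup>2))" by (simp add: power3_eq_cube power2_eq_square mult_ac)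
      then show ?thesis using e by simp
    qed
    then have "(1 * ?r + - (t * ?r ^ 3) * t) = \<epsilon>\<^sup>2 * ?r ^ 3" by (simp add: algebra_simps power2_eq_square)
    moreover have "3 * ?r ^ 2 * - (t * ?r ^ 3) * t = - 3 * t\<^sup>2 * ?r ^ 5"
      by (simp add: power2_eq_square power_add[symmetric] numeral_eq_Suc)
    ultimately have "(1 * ?r + - (t * ?r ^ 3) * t) + \<epsilon>\<^sup>2 * (1 * ?r ^ 3 + (3 * ?r ^ 2 * - (t * ?r ^ 3)) * t) - 1 =
       \<epsilon>\<^sup>2 * ?r ^ 3 + \<epsilon>\<^sup>2 * (?r ^ 3 - 3 * t\<^sup>2 * ?r ^ 5) - 1" by simp
    also have "\<dots> = \<epsilon>\<^sup>2 * (?r ^ 5 * (t\<^sup>2 + \<epsilon>\<^sup>2)) + \<epsilon>\<^sup>2 * (?r ^ 5 * (t\<^sup>2 + \<epsilon>\<^sup>2) - 3 * t\<^sup>2 * ?r ^ 5) - 1" by (simp only: r3)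
    also have "\<dots> = \<kappa>' t" unfolding \<kappa>'_def by (simp add: algebra_simps)
    finally show ?thesis .
  qed
  ultimately show ?thesis by simp
qed

lemma continuous_\<kappa>': "continuous_on S \<kappa>'"
  unfolding \<kappa>'_def[abs_def] by (intro continuous_intros continuous_\<rho>)

lemma continuous_\<kappa>: "continuous_on S \<kappa>"
  unfolding \<kappa>_def[abs_def] by (intro continuous_intros continuous_\<rho>)

lemma \<theta>'_eq: "0 \<le> t \<Longrightarrow> \<theta>' t = \<kappa> t" "t \<le> 0 \<Longrightarrow> \<theta>' t = 0" "t \<le> 0 \<Longrightarrow> \<theta> t = 0"
proof -
  have "t * \<rho> t = t * (\<rho> t * (\<rho> t ^ 2 * (t\<^sup>2 + \<epsilon>\<^sup>2)))" using \<rho>_sq[of t] by simp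
  then have "t * \<rho> t = t\<^sup>2 * (t * \<rho> t ^ 3) + \<epsilon>\<^sup>2 * (t * \<rho> t ^ 3)" by (simp add: power2_eq_square power3_eq_cube algebra_simps)
  then show "0 \<le> t \<Longrightarrow> \<theta>' t = \<kappa> t" by (simp add: \<theta>'_def \<kappa>_def algebra_simps)
qed (simp_all add: \<theta>'_def \<theta>_def)

text \<open>For \<open>t\<close> and \<epsilon> up to 1 the root is below 2, so \<rho> is at least
  1/2 and \<theta> is nonnegative; this sign later allows the gradient term to be discarded.\<close>

lemma \<theta>_bounds:
  assumes t: "0 \<le> t" "t \<le> 1"
  shows "0 \<le> \<theta> t" "\<theta> t \<le> t" "\<bar>\<theta>' t\<bar> \<le> 2"
proof -
  have "t\<^sup>2 + \<epsilon>\<^sup>2 \<le> 1 + 1" using t \<epsilon> by (intro add_mono power_le_one) auto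
  then have "sqrt (t\<^sup>2 + \<epsilon>\<^sup>2) \<le> sqrt (2\<^sup>2)" by (intro real_sqrt_le_mono) simp
  then have "sqrt (t\<^sup>2 + \<epsilon>\<^sup>2) \<le> 2" by simp
  then have "1 / 2 \<le> \<rho> t" using sum_pos[of t] by (simp add: \<rho>_def field_simps)
  then show "0 \<le> \<theta> t" by (simp add: \<theta>_def)
  have "\<theta> t \<le> t\<^sup>2 * \<rho> t" using t by (simp add: \<theta>_def algebra_simps)
  also have "\<dots> = t * (\<bar>t\<bar> * \<rho> t)" using t by (simp add: power2_eq_square)
  also have "\<dots> \<le> t * 1" by (rule mult_left_mono[OF \<rho>_le(2) t(1)])
  finally show "\<theta> t \<le> t" by simp
  have a: "0 \<le> t * \<rho> t" "t * \<rho> t \<le> 1" using t \<rho>_pos[of t] \<rho>_le(2)[of t] by simp_all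
  have "(\<epsilon> * \<rho> t)\<^sup>2 \<le> 1" using \<rho>_le(1)[of t] \<rho>_pos[of t] \<epsilon> by (intro power_le_one) auto
  then have "(\<epsilon> * \<rho> t)\<^sup>2 * (t * \<rho> t) \<le> 1 * 1" by (intro mult_mono a) (use a in auto)
  moreover have "0 \<le> (\<epsilon> * \<rho> t)\<^sup>2 * (t * \<rho> t)" using a by simp
  moreover have "\<kappa> t = t * \<rho> t + (\<epsilon> * \<rho> t)\<^sup>2 * (t * \<rho> t) - t" by (simp add: \<kappa>_def power2_eq_square power3_eq_cube algebra_simps)
  ultimately have "\<bar>\<kappa> t\<bar> \<le> 2" using a t by linarith
  then show "\<bar>\<theta>' t\<bar> \<le> 2" using \<theta>'_eq(1)[OF t(1)] by simp
qed

text \<open>The deviation of \<theta>'' from -1 is at most of the order of (\<epsilon> \<rho>)^5 /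
  \<epsilon>, and one power may be dropped. The result is the square of the weight in the Hardy
  inequality, so the deviation is paid for by that inequality. The constant is 162 = 2 *
  3^4.\<close>

lemma \<kappa>'_bound:
  assumes t: "0 \<le> t"
  shows "\<epsilon> * (1 + \<kappa>' t) \<le> 162 * (1 / (t / \<epsilon> + 2)\<^sup>2)\<^sup>2"
proof -
  let ?y = "t / \<epsilon>"
  have y: "0 \<le> ?y" "t = \<epsilon> * ?y" using t \<epsilon> by simp_all
  have er0: "0 < \<epsilon> * \<rho> t" using \<rho>_pos[of t] \<epsilon> by simp
  have "1 + \<kappa>' t = \<epsilon>\<^sup>2 * (2 * \<epsilon>\<^sup>2 - t\<^sup>2) * \<rho> t ^ 5" by (simp add: \<kappa>'_def)
  also have "\<dots> \<le> \<epsilon>\<^sup>2 * (2 * \<epsilon>\<^sup>2) * \<rho> t ^ 5" using \<rho>_pos[of t] by (intro mult_right_mono mult_left_mono) auto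
  finally have "\<epsilon> * (1 + \<kappa>' t) \<le> \<epsilon> * (\<epsilon>\<^sup>2 * (2 * \<epsilon>\<^sup>2) * \<rho> t ^ 5)" using \<epsilon> by (intro mult_left_mono) auto
  also have "\<dots> = 2 * (\<epsilon> * \<rho> t) ^ 5" by (simp add: power_mult_distrib numeral_eq_Suc)
  also have "\<dots> \<le> 2 * (\<epsilon> * \<rho> t) ^ 4"
    using er0 \<rho>_le(1)[of t] power_decreasing[of 4 5 "\<epsilon> * \<rho> t"] by simp
  also have "\<epsilon> * \<rho> t \<le> 3 / (?y + 2)"
  proof -
    have "(\<epsilon> * \<rho> t)\<^sup>2 * (?y\<^sup>2 + 1) = 1" (is "?e\<^sup>2 * _ = 1")
      using \<rho>_sq[of t] \<epsilon> by (simp add: power_mult_distrib power_divide field_simps)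
    moreover have "(\<epsilon> * \<rho> t)\<^sup>2 * (?y + 2)\<^sup>2 \<le> (\<epsilon> * \<rho> t)\<^sup>2 * (9 * (?y\<^sup>2 + 1))"
    proof (rule mult_left_mono)
      \<comment> \<open>This sum of squares is the difference 9 (y^2 + 1) - (y + 2)^2.\<close>
      have "0 \<le> (2 * y - 1)\<^sup>2 + 4 * y\<^sup>2 + 4" for y :: real by simp
      then have "(y + 2)\<^sup>2 \<le> 9 * (y\<^sup>2 + 1)" for y :: real by (simp add: power2_eq_square algebra_simps)
      then show "(?y + 2)\<^sup>2 \<le> 9 * (?y\<^sup>2 + 1)" .
    qed simp
    moreover have "(?e * (?y + 2))\<^sup>2 = ?e\<^sup>2 * (?y + 2)\<^sup>2" "?e\<^sup>2 * (9 * (?y\<^sup>2 + 1)) = 9 * (?e\<^sup>2 * (?y\<^sup>2 + 1))"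
      by (simp_all only: power_mult_distrib mult.left_commute)
    ultimately have "(?e * (?y + 2))\<^sup>2 \<le> 3\<^sup>2" by simp
    then have "\<epsilon> * \<rho> t * (?y + 2) \<le> 3" by (rule power2_le_imp_le) simp
    then show ?thesis using y by (simp add: pos_le_divide_eq)
  qed
  then have "2 * (\<epsilon> * \<rho> t) ^ 4 \<le> 2 * (3 / (?y + 2)) ^ 4" using er0 by (intro mult_left_mono power_mono) auto
  also have "\<dots> = 162 * (1 / (?y + 2)\<^sup>2)\<^sup>2" by (simp add: power_divide power_mult[symmetric])
  finally show ?thesis .
qed

end

section \<open>The error estimate\<close>

lemma restr_subset:
  fixes F :: "'a::euclidean_space \<Rightarrow> 'b::euclidean_space"
  assumes "S \<in> sets borel" "T \<in> sets borel" "T \<subseteq> S" "\<And>x. x \<in> S - T \<Longrightarrow> F x = 0"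
  shows "F \<in> borel_measurable (lebesgue_restr S) \<longleftrightarrow> F \<in> borel_measurable (lebesgue_restr T)"
    and "integrable (lebesgue_restr S) F \<longleftrightarrow> integrable (lebesgue_restr T) F"
    and "(\<integral>x. F x \<partial>lebesgue_restr S) = (\<integral>x. F x \<partial>lebesgue_restr T)"
proof -
  have e: "(\<lambda>x. indicator S x *\<^sub>R F x) = (\<lambda>x. indicator T x *\<^sub>R F x)"
  proof
    fix x show "indicator S x *\<^sub>R F x = indicator T x *\<^sub>R F x"
      using assms(3) assms(4)[of x] by (cases "x \<in> T"; cases "x \<in> S") auto
  qed
  have r: "F \<in> borel_measurable (lebesgue_restr V) \<longleftrightarrow> (\<lambda>x. indicator V x *\<^sub>R F x) \<in> borel_measurable lborel"
    "integrable (lebesgue_restr V) F \<longleftrightarrow> integrable lborel (\<lambda>x. indicator V x *\<^sub>R F x)"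
    "(\<integral>x. F x \<partial>lebesgue_restr V) = (\<integral>x. indicator V x *\<^sub>R F x \<partial>lborel)" if "V \<in> sets borel" for V
    using that by (simp_all add: integrable_restrict_space integral_restrict_space borel_measurable_restrict_space_iff)
  show "F \<in> borel_measurable (lebesgue_restr S) \<longleftrightarrow> F \<in> borel_measurable (lebesgue_restr T)"
    "integrable (lebesgue_restr S) F \<longleftrightarrow> integrable (lebesgue_restr T) F"
    "(\<integral>x. F x \<partial>lebesgue_restr S) = (\<integral>x. F x \<partial>lebesgue_restr T)"
    by (simp_all only: r[OF assms(1)] r[OF assms(2)] e)
qed

text \<open>Both norms are taken over the set where the integrand lives; the small area of the
  outermost cells would be lost with norms over the whole domain.\<close>

lemma L2_product_on:
  fixes u :: "'a::euclidean_space \<Rightarrow> 'b::euclidean_space" and v :: "'a \<Rightarrow> 'c::euclidean_space"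
    and F :: "'a \<Rightarrow> 'd::euclidean_space"
  assumes S: "S \<in> sets borel" and T: "T \<in> sets borel" "T \<subseteq> S" and u: "L2 T u" and v: "L2 T v"
    and m: "F \<in> borel_measurable (lebesgue_restr S)" and z: "\<And>x. x \<in> S - T \<Longrightarrow> F x = 0"
    and le: "\<And>x. x \<in> T \<Longrightarrow> norm (F x) \<le> norm (u x) * norm (v x)"
  shows "integrable (lebesgue_restr S) F"
    and "norm (\<integral>x. F x \<partial>lebesgue_restr S) \<le> L2_norm T u * L2_norm T v"
proof -
  note R = restr_subset[where F = F, OF S T z]
  have mT: "F \<in> borel_measurable (lebesgue_restr T)" using m R(1) by blast
  have "integrable (lebesgue_restr T) F" by (rule L2_product(1)[OF T(1) u v mT, where C = 1]) (use le in auto)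
  then show "integrable (lebesgue_restr S) F" using R(2) by blast
  have "norm (\<integral>x. F x \<partial>lebesgue_restr T) \<le> 1 * (L2_norm T u * L2_norm T v)"
    by (rule L2_product(2)[OF T(1) u v mT]) (use le in auto)
  then show "norm (\<integral>x. F x \<partial>lebesgue_restr S) \<le> L2_norm T u * L2_norm T v" using R(3) by simp
qed

text \<open>The integrand is the vertical derivative of \<kappa> w^2. It leaves no boundary term: at
  the top \<open>w\<close> vanishes, at the bottom \<kappa> does, and so no trace of
  \<open>w\<close> at height 0 is needed.\<close>

lemma weighted_trace_identity:
  assumes \<omega>: "C1_approx (channel (\<lambda>_. 0)) \<omega> w h" and top: "tendsto_L2 {0<..<1} (\<lambda>n s. \<omega> n (s, 1)) (\<lambda>_. 0)"
    and \<kappa>: "\<And>t. (\<kappa> has_real_derivative \<kappa>' t) (at t)" "continuous_on UNIV \<kappa>'" "\<kappa> 0 = 0"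
  shows "(\<integral>x. w x * (2 * (\<kappa> (snd x) * snd (h x)) + \<kappa>' (snd x) * w x) \<partial>lebesgue_restr (channel (\<lambda>_. 0))) = 0"
proof -
  interpret graph_domain "\<lambda>_. 0 :: real" by unfold_locales auto
  let ?D = "channel (\<lambda>_. 0 :: real)" and ?I = "{0<..<1::real}"
  have Ib: "?I \<in> sets borel" by simp
  note A = C1_approxD[OF \<omega>]
  have c\<kappa>: "continuous_on S \<kappa>" for S by (intro continuous_at_imp_continuous_on ballI DERIV_isCont[OF \<kappa>(1)])
  have *: "tendsto_L2 ?D (\<lambda>n x. k (snd x) *\<^sub>R z n x) (\<lambda>x. k (snd x) *\<^sub>R z' x)"
    if k: "continuous_on UNIV k" and z: "tendsto_L2 ?D z z'" for k :: "real \<Rightarrow> real" and z and z' :: "real \<times> real \<Rightarrow> real"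
  proof -
    have c: "continuous_on UNIV (\<lambda>x :: real \<times> real. k (snd x))"
      by (rule continuous_on_compose2[OF k continuous_on_snd[OF continuous_on_id]]) auto
    have "bounded (k ` {0..1})" by (intro compact_imp_bounded compact_continuous_image continuous_on_subset[OF k]) auto
    then obtain C where C: "\<forall>t\<in>{0..1}. norm (k t) \<le> C" by (auto simp: bounded_iff)
    show ?thesis
    proof (rule tendsto_L2_mult[OF channel_borel z])
      show "(\<lambda>x. k (snd x)) \<in> borel_measurable (lebesgue_restr ?D)"
        by (rule borel_measurable_restr_continuous[OF channel_borel continuous_on_subset[OF c]]) simp
      show "\<bar>k (snd x)\<bar> \<le> C" if "x \<in> ?D" for x using bspec[OF C, of "snd x"] that by (auto simp: channel_def)
    qed
  qed
  have z: "tendsto_L2 ?D (\<lambda>n x. (\<kappa> (snd x) *\<^sub>R snd (grad (\<omega> n) x) + \<kappa> (snd x) *\<^sub>R snd (grad (\<omega> n) x)) + \<kappa>' (snd x) *\<^sub>R \<omega> n x)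
      (\<lambda>x. (\<kappa> (snd x) *\<^sub>R snd (h x) + \<kappa> (snd x) *\<^sub>R snd (h x)) + \<kappa>' (snd x) *\<^sub>R w x)"
    by (intro tendsto_L2_add[OF channel_borel] * c\<kappa> \<kappa>(2) A(2) tendsto_L2_linear[OF channel_borel A(3) bounded_linear_snd])
  have lim: "(\<lambda>n. \<integral>x. \<omega> n x * ((\<kappa> (snd x) *\<^sub>R snd (grad (\<omega> n) x) + \<kappa> (snd x) *\<^sub>R snd (grad (\<omega> n) x)) + \<kappa>' (snd x) *\<^sub>R \<omega> n x) \<partial>lebesgue_restr ?D)
      \<longlonglongrightarrow> (\<integral>x. w x * ((\<kappa> (snd x) *\<^sub>R snd (h x) + \<kappa> (snd x) *\<^sub>R snd (h x)) + \<kappa>' (snd x) *\<^sub>R w x) \<partial>lebesgue_restr ?D)"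
    by (rule tendsto_L2_bilinear[OF channel_borel A(2) z bounded_bilinear_mult])
  have eq: "(\<integral>x. \<omega> n x * ((\<kappa> (snd x) *\<^sub>R snd (grad (\<omega> n) x) + \<kappa> (snd x) *\<^sub>R snd (grad (\<omega> n) x)) + \<kappa>' (snd x) *\<^sub>R \<omega> n x) \<partial>lebesgue_restr ?D)
      = \<kappa> 1 * (L2_norm ?I (\<lambda>s. \<omega> n (s, 1)))\<^sup>2" for n
  proof -
    note K = C1_compose_real[OF open_UNIV C1_snd \<kappa>(1,2)]
    note M = C1_on_mult[OF open_UNIV A(1)[of n] A(1)[of n]]
    note N = C1_on_mult[OF open_UNIV M(1) K(1)]
    have g: "snd (grad (\<lambda>x. (\<omega> n x * \<omega> n x) * \<kappa> (snd x)) x) =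
      \<omega> n x * ((\<kappa> (snd x) *\<^sub>R snd (grad (\<omega> n) x) + \<kappa> (snd x) *\<^sub>R snd (grad (\<omega> n) x)) + \<kappa>' (snd x) *\<^sub>R \<omega> n x)" for x
      using N(2)[of x] M(2)[of x] K(2)[of x] by (simp add: algebra_simps)
    have "(\<integral>x. snd (grad (\<lambda>x. (\<omega> n x * \<omega> n x) * \<kappa> (snd x)) x) \<partial>lebesgue_restr ?D) =
       (\<integral>s. \<omega> n (s, 1) * \<omega> n (s, 1) * \<kappa> (snd (s, 1::real)) - \<omega> n (s, 0) * \<omega> n (s, 0) * \<kappa> (snd (s, 0::real)) \<partial>lebesgue_restr ?I)"
      by (rule integral_grad_snd[OF open_UNIV _ N(1)]) simp
    also have "\<dots> = (\<integral>s. (norm (\<omega> n (s, 1)))\<^sup>2 * \<kappa> 1 \<partial>lebesgue_restr ?I)" by (simp add: \<kappa>(3) power2_eq_square)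
    also have "\<dots> = \<kappa> 1 * (L2_norm ?I (\<lambda>s. \<omega> n (s, 1)))\<^sup>2" by (simp add: L2_norm_power2[OF Ib])
    finally show ?thesis by (simp only: g)
  qed
  have "(\<lambda>n. \<kappa> 1 * (L2_norm ?I (\<lambda>s. \<omega> n (s, 1)))\<^sup>2) \<longlonglongrightarrow> \<kappa> 1 * (L2_norm ?I (\<lambda>_. 0 :: real))\<^sup>2"
    by (intro tendsto_mult_left tendsto_L2_norm[OF Ib top])
  also have "L2_norm ?I (\<lambda>_. 0 :: real) = 0" by (simp add: L2_norm_def set_lebesgue_integral_def)
  finally have "(\<integral>x. w x * ((\<kappa> (snd x) *\<^sub>R snd (h x) + \<kappa> (snd x) *\<^sub>R snd (h x)) + \<kappa>' (snd x) *\<^sub>R w x) \<partial>lebesgue_restr ?D) = 0"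
    using LIMSEQ_unique[OF lim[unfolded eq]] by simp
  moreover have "2 * a = a + a" for a :: real by simp
  ultimately show ?thesis by (simp only: real_scaleR_def)
qed

context scaled_cell
begin

text \<open>A cut-off removing the two outermost cells, where the periodic corrector violates the Neumann condition.\<close>

definition \<mu> :: "real \<Rightarrow> real" where
  "\<mu> s = (1 - zeta (s / \<epsilon> - 1 / 4)) * (1 - zeta ((1 - s) / \<epsilon> - 1 / 4))"
definition \<mu>' :: "real \<Rightarrow> real" where
  "\<mu>' s = (1 - zeta (s / \<epsilon> - 1 / 4)) * (zeta_deriv ((1 - s) / \<epsilon> - 1 / 4) / \<epsilon>) -
    (zeta_deriv (s / \<epsilon> - 1 / 4) / \<epsilon>) * (1 - zeta ((1 - s) / \<epsilon> - 1 / 4))"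

lemma DERIV_\<mu>: "(\<mu> has_real_derivative \<mu>' s) (at s)"
proof -
  have 1: "((\<lambda>s. s / \<epsilon> - 1 / 4) has_real_derivative 1 / \<epsilon>) (at s)"
    and 2: "((\<lambda>s. (1 - s) / \<epsilon> - 1 / 4) has_real_derivative - (1 / \<epsilon>)) (at s)"
    using \<epsilon> by (auto intro!: derivative_eq_intros)
  note Z = DERIV_diff[OF DERIV_const[of 1] DERIV_chain2[OF DERIV_zeta 1]] DERIV_diff[OF DERIV_const[of 1] DERIV_chain2[OF DERIV_zeta 2]]
  show ?thesis unfolding \<mu>_def[abs_def] \<mu>'_def
    by (rule DERIV_cong[OF DERIV_mult[OF Z]]) (simp add: algebra_simps)
qed

lemma continuous_\<mu>': "continuous_on S \<mu>'"
proof -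
  have z: "continuous_on S (\<lambda>s. zeta (k s))" "continuous_on S (\<lambda>s. zeta_deriv (k s))"
    if "continuous_on S k" for k :: "real \<Rightarrow> real"
    using continuous_on_compose2[OF continuous_at_imp_continuous_on[of UNIV zeta] that] DERIV_isCont[OF DERIV_zeta]
      continuous_on_compose2[OF continuous_zeta_deriv that] by auto
  show ?thesis unfolding \<mu>'_def[abs_def] using \<epsilon> by (intro continuous_intros z) auto
qed

lemma \<mu>_bounds: "0 \<le> \<mu> s" "\<mu> s \<le> 1" "\<bar>\<mu>' s\<bar> \<le> 16 / \<epsilon>"
proof -
  let ?p = "s / \<epsilon> - 1 / 4" and ?q = "(1 - s) / \<epsilon> - 1 / 4"
  show "0 \<le> \<mu> s" unfolding \<mu>_def using zeta_bounds by simp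
  have "(1 - zeta ?p) * (1 - zeta ?q) \<le> 1 * 1" using zeta_bounds by (intro mult_mono) (auto simp: diff_le_eq)
  then show "\<mu> s \<le> 1" by (simp add: \<mu>_def)
  have m: "\<bar>(1 - zeta y) * (zeta_deriv z / \<epsilon>)\<bar> \<le> 8 / \<epsilon>" for y z
  proof -
    have "\<bar>1 - zeta y\<bar> * (\<bar>zeta_deriv z\<bar> / \<epsilon>) \<le> 1 * (8 / \<epsilon>)"
      using zeta_bounds[of y] zeta_deriv_bounds(2)[of z] \<epsilon> by (intro mult_mono divide_right_mono) auto
    then show ?thesis using \<epsilon> by (simp add: abs_mult)
  qed
  have "\<bar>\<mu>' s\<bar> \<le> \<bar>(1 - zeta ?p) * (zeta_deriv ?q / \<epsilon>)\<bar> + \<bar>(1 - zeta ?q) * (zeta_deriv ?p / \<epsilon>)\<bar>"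
    unfolding \<mu>'_def using abs_triangle_ineq4[of "(1 - zeta ?p) * (zeta_deriv ?q / \<epsilon>)" "(1 - zeta ?q) * (zeta_deriv ?p / \<epsilon>)"]
    by (simp only: mult.commute[of "zeta_deriv ?p / \<epsilon>"])
  then show "\<bar>\<mu>' s\<bar> \<le> 16 / \<epsilon>" using m[of ?p ?q] m[of ?q ?p] by simp
qed

lemma \<mu>_inner: "\<epsilon> \<le> s \<Longrightarrow> s \<le> 1 - \<epsilon> \<Longrightarrow> \<mu> s = 1 \<and> \<mu>' s = 0"
proof -
  assume "\<epsilon> \<le> s" "s \<le> 1 - \<epsilon>"
  then have "1 \<le> s / \<epsilon>" "1 \<le> (1 - s) / \<epsilon>" using \<epsilon> by (simp_all add: pos_le_divide_eq)
  then have "1 / 2 \<le> s / \<epsilon> - 1 / 4" "1 / 2 \<le> (1 - s) / \<epsilon> - 1 / 4" by linarith+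
  from zeta_eq_0[OF this(1)] zeta_eq_0[OF this(2)] show ?thesis by (simp add: \<mu>_def \<mu>'_def)
qed

text \<open>The shift by 1/4 in the definition leaves this collar at the sides;
  \<open>test_zero_trace\<close> demands it of its cut-off.\<close>

lemma \<mu>_outer: "s < \<epsilon> / 4 \<or> 1 - \<epsilon> / 4 < s \<Longrightarrow> \<mu> s = 0"
proof -
  assume "s < \<epsilon> / 4 \<or> 1 - \<epsilon> / 4 < s"
  then have "s / \<epsilon> - 1 / 4 \<le> 0 \<or> (1 - s) / \<epsilon> - 1 / 4 \<le> 0" using \<epsilon> by (auto simp: pos_divide_le_eq field_simps)
  then show ?thesis by (auto simp: \<mu>_def zeta_eq_1)
qed

text \<open>A Hardy inequality whose weight varies on the scale \<epsilon>: the moment of the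
  inverse fourth power of \<open>wt\<close> is of order \<epsilon>^2, which is the source of the
  factor \<epsilon>.\<close>

lemma weighted_value:
  assumes \<phi>: "C1_approx (channel b) \<phi> v h" "tendsto_L2 {0<..<1} (\<lambda>n s. \<phi> n (s, b s)) (\<lambda>_. 0)"
  shows "L2 (channel b) (\<lambda>x. v x / (wt x)\<^sup>2)" and "L2_norm (channel b) (\<lambda>x. v x / (wt x)\<^sup>2) \<le> \<epsilon> * L2_norm (channel b) h"
proof -
  let ?a = "\<lambda>x. 1 / (wt x)\<^sup>2"
  have "wt \<in> borel_measurable borel" by (rule borel_measurable_continuous_onI[OF wt_continuous])
  then have am: "?a \<in> borel_measurable borel" by simp
  have ab: "\<bar>?a x\<bar> \<le> 1" if "x \<in> channel b" for x
  proof -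
    have "1 \<le> (wt x)\<^sup>2" using wt_ge[of x] that channel_above by (intro one_le_power) auto
    moreover from this have "0 < (wt x)\<^sup>2" by linarith
    ultimately show ?thesis by (simp add: pos_divide_le_eq)
  qed
  have Lv: "L2 (channel b) v" by (rule tendsto_L2D(2)[OF C1_approxD(2)[OF \<phi>(1)]])
  from L2_mult(1)[OF D.channel_borel Lv borel_measurable_restr[OF am] ab]
  show "L2 (channel b) (\<lambda>x. v x / (wt x)\<^sup>2)" by simp
  have K: "(\<integral>\<^sup>+t. ennreal ((t - b s) * (?a (s, t))\<^sup>2) * indicator {b s<..<min 1 (b s + 3)} t \<partial>lborel) \<le> ennreal (\<epsilon>\<^sup>2 / 2)" for s
  proof -
    \<comment> \<open>As the graph lies above -\<epsilon>, \<open>t - b s\<close> is at most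
      \<epsilon> times the weight and lowers its power from 4 to 3. The primitive \<open>?F\<close>
      vanishes at infinity, and the weight is 1 at -\<epsilon>, so the bound does not depend on
      \<open>s\<close>.\<close>
    let ?f = "\<lambda>t. \<epsilon> * (1 / (t / \<epsilon> + 2) ^ 3)" and ?F = "\<lambda>t. - (\<epsilon>\<^sup>2 / 2) * (1 / (t / \<epsilon> + 2)\<^sup>2)"
    have pos: "1 \<le> t / \<epsilon> + 2" if "- \<epsilon> \<le> t" for t using that \<epsilon> by (simp add: field_simps)
    have "(\<integral>\<^sup>+t. ennreal ((t - b s) * (?a (s, t))\<^sup>2) * indicator {b s<..<min 1 (b s + 3)} t \<partial>lborel)
        \<le> (\<integral>\<^sup>+t. ennreal (?f t) * indicator {- \<epsilon>..} t \<partial>lborel)"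
    proof (rule nn_integral_mono)
      fix t
      show "ennreal ((t - b s) * (?a (s, t))\<^sup>2) * indicator {b s<..<min 1 (b s + 3)} t \<le> ennreal (?f t) * indicator {- \<epsilon>..} t"
      proof (cases "t \<in> {b s<..<min 1 (b s + 3)}")
        case True
        then have t: "- \<epsilon> \<le> t" using b_lt(2)[of s] by simp
        let ?y = "t / \<epsilon> + 2"
        have y: "1 \<le> ?y" "\<epsilon> * ?y = t + 2 * \<epsilon>" using pos[OF t] \<epsilon> by (simp_all add: field_simps)
        have "t - b s \<le> \<epsilon> * ?y" using b_lt(2)[of s] \<epsilon> unfolding y(2) by simp
        then have "(t - b s) * (1 / ?y ^ 4) \<le> \<epsilon> * ?y * (1 / ?y ^ 4)" using y(1) by (intro mult_right_mono) auto
        also have "?y ^ 4 = ?y * ?y ^ 3" by (simp add: power_numeral_reduce)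
        also have "\<epsilon> * ?y * (1 / (?y * ?y ^ 3)) = ?f t" using y(1) by simp
        finally have "(t - b s) * (1 / ?y ^ 4) \<le> ?f t" by (simp add: power_numeral_reduce)
        moreover have "(?a (s, t))\<^sup>2 = 1 / ?y ^ 4" by (simp add: wt_def power_divide power_mult[symmetric])
        ultimately show ?thesis using True t by (simp only: indicator_simps atLeast_iff mult_1_right) (simp add: ennreal_leI)
      qed simp
    qed
    also have "\<dots> = ennreal (0 - ?F (- \<epsilon>))"
    proof (rule nn_integral_FTC_atLeast)
      show "?f \<in> borel_measurable borel" by simp
      show "0 \<le> ?f t" if "- \<epsilon> \<le> t" for t using pos[OF that] \<epsilon> by simp
      show "(?F has_real_derivative ?f t) (at t)" if "- \<epsilon> \<le> t" for t
      proof -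
        let ?y = "\<lambda>t. t / \<epsilon> + 2"
        have y0: "?y t \<noteq> 0" using pos[OF that] by simp
        have d: "(?y has_real_derivative 1 / \<epsilon>) (at t)" using \<epsilon> by (auto intro!: derivative_eq_intros)
        have p: "((\<lambda>t. (?y t)\<^sup>2) has_real_derivative 2 * ?y t * (1 / \<epsilon>)) (at t)"
          using DERIV_power[OF d, of 2] by simp
        have "((\<lambda>t. inverse ((?y t)\<^sup>2)) has_real_derivative - (inverse ((?y t)\<^sup>2) * (2 * ?y t * (1 / \<epsilon>)) * inverse ((?y t)\<^sup>2))) (at t)"
          by (rule DERIV_inverse'[OF p]) (use y0 in simp)
        from DERIV_cmult[OF this, of "- (\<epsilon>\<^sup>2 / 2)"] have dF:
          "((\<lambda>t. - (\<epsilon>\<^sup>2 / 2) * (1 / (?y t)\<^sup>2)) has_real_derivative - (\<epsilon>\<^sup>2 / 2) * - (inverse ((?y t)\<^sup>2) * (2 * ?y t * (1 / \<epsilon>)) * inverse ((?y t)\<^sup>2))) (at t)"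
          by (simp only: inverse_eq_divide)
        have alg: "- (\<epsilon>\<^sup>2 / 2) * - (inverse (Y\<^sup>2) * (2 * Y * (1 / \<epsilon>)) * inverse (Y\<^sup>2)) = \<epsilon> * (1 / Y ^ 3)"
          if "Y \<noteq> 0" for Y using that \<epsilon> by (simp add: field_simps power2_eq_square power3_eq_cube)
        show ?thesis by (rule DERIV_cong[OF dF alg[OF y0]])
      qed
      have "filterlim (\<lambda>t. t / \<epsilon> + 2) at_top at_top"
        using filterlim_tendsto_add_at_top[OF tendsto_const[of 2]
            filterlim_tendsto_pos_mult_at_top[OF tendsto_const[of "1 / \<epsilon>"] _ filterlim_ident]] \<epsilon>
        by (simp add: add.commute)
      then have "filterlim (\<lambda>t. (t / \<epsilon> + 2)\<^sup>2) at_infinity at_top"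
        by (intro filterlim_at_top_imp_at_infinity filterlim_pow_at_top) auto
      from tendsto_mult_right_zero[OF tendsto_divide_0[OF tendsto_const[of 1] this], of "- (\<epsilon>\<^sup>2 / 2)"]
      show "(?F \<longlongrightarrow> 0) at_top" .
    qed
    also have "0 - ?F (- \<epsilon>) = \<epsilon>\<^sup>2 / 2" using \<epsilon> by simp
    finally show ?thesis .
  qed
  have "(L2_norm (layer b 3) (\<lambda>x. ?a x * v x))\<^sup>2 \<le> 2 * (\<epsilon>\<^sup>2 / 2) * (L2_norm (layer b 3) h)\<^sup>2"
    by (rule D.layer_bound[OF \<phi> am ab _ _ K]) auto
  then have "(L2_norm (channel b) (\<lambda>x. v x / (wt x)\<^sup>2))\<^sup>2 \<le> (\<epsilon> * L2_norm (channel b) h)\<^sup>2"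
    by (simp add: D.channel_eq_layer power_mult_distrib)
  then show "L2_norm (channel b) (\<lambda>x. v x / (wt x)\<^sup>2) \<le> \<epsilon> * L2_norm (channel b) h"
    by (rule power2_le_imp_le) (use \<epsilon> in simp)
qed

end

section \<open>Consistency: how far the corrected profile is from being weakly harmonic\<close>

context scaled_cell
begin

text \<open>The gradient of the affine profile corrected by the cut-off corrector, before
  multiplication by the constant \<open>c\<close>. The last term stems from the cut-off.\<close>

definition G :: "real \<times> real \<Rightarrow> real \<times> real" where
  "G x = (0, 1) + zeta (snd x) *\<^sub>R grad B x + (zeta_deriv (snd x) * (B x - \<epsilon> * B\<^sub>0)) *\<^sub>R (0, 1)"

lemma continuous_cutoffs:
  fixes S :: "(real \<times> real) set"
  shows "continuous_on S (\<lambda>x. zeta (snd x))" "continuous_on S (\<lambda>x. zeta_deriv (snd x))"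
    "continuous_on S (\<lambda>x. \<mu> (fst x))" "continuous_on S (\<lambda>x. \<mu>' (fst x))"
proof -
  have z: "continuous_on UNIV zeta" "continuous_on UNIV \<mu>"
    by (intro continuous_at_imp_continuous_on ballI DERIV_isCont[OF DERIV_zeta] DERIV_isCont[OF DERIV_\<mu>])+
  show "continuous_on S (\<lambda>x. zeta (snd x))" "continuous_on S (\<lambda>x. zeta_deriv (snd x))"
    by (auto intro!: continuous_intros continuous_on_compose2[OF z(1)] continuous_on_compose2[OF continuous_zeta_deriv])
  show "continuous_on S (\<lambda>x. \<mu> (fst x))" "continuous_on S (\<lambda>x. \<mu>' (fst x))"
    by (auto intro!: continuous_intros continuous_on_compose2[OF z(2)] continuous_on_compose2[OF continuous_\<mu>'[of UNIV]])
qed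

text \<open>The constant field contributes nothing, since \<open>v\<close> vanishes at the bottom
  and at the top; the harmonic part contributes nothing away from the sides. What remains involves
  the decaying corrector, which is paired in L2 after moving a factor \<open>wt ^ 3\<close> onto it.
  Hence \<open>v\<close> and \<open>h\<close> are measured by \<open>a\<close> and \<open>m\<close>,
  that is with this weight divided out.\<close>

lemma test_bound:
  assumes \<phi>: "C1_approx (channel b) \<phi> v h" and bot: "tendsto_L2 {0<..<1} (\<lambda>n s. \<phi> n (s, b s)) (\<lambda>_. 0)"
    and top: "tendsto_L2 {0<..<1} (\<lambda>n s. \<phi> n (s, 1)) (\<lambda>_. 0)"
    and a: "L2 (channel b) a" and m: "L2 (channel b) m"
    and v_le: "\<And>x. x \<in> channel b \<Longrightarrow> \<bar>v x\<bar> \<le> wt x ^ 3 * a x"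
    and h_le: "\<And>x. x \<in> channel b \<Longrightarrow> norm (h x) \<le> wt x ^ 3 * m x"
  shows "\<bar>\<integral>x. G x \<bullet> h x \<partial>lebesgue_restr (channel b)\<bar> \<le>
      sqrt decay_const * (18 * \<epsilon> * L2_norm (channel b) m + 64 * L2_norm (channel b) a)"
proof -
  let ?C = "channel b" and ?Q = "channel (\<lambda>_. 0 :: real)"
  let ?M = "lebesgue_restr ?C"
  have Cb: "?C \<in> sets borel" by (rule D.channel_borel)
  have w1: "1 \<le> wt x ^ 3" "0 \<le> wt x ^ 3" if "x \<in> ?C" for x
  proof -
    show "1 \<le> wt x ^ 3" using wt_ge[of x] that channel_above by (intro one_le_power) auto
    then show "0 \<le> wt x ^ 3" by linarith
  qed
  have a0: "0 \<le> a x" if "x \<in> ?C" for x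
    using v_le[OF that] w1(1)[OF that] zero_le_mult_iff[of "wt x ^ 3" "a x"] by linarith
  have m0: "0 \<le> m x" if "x \<in> ?C" for x
    using h_le[OF that] w1(1)[OF that] norm_ge_zero[of "h x"] zero_le_mult_iff[of "wt x ^ 3" "m x"] by linarith
  have nw: "norm (wt x ^ 3 *\<^sub>R y) = wt x ^ 3 * norm y" if "x \<in> ?C" for x and y :: "'z::real_normed_vector"
    using w1(2)[OF that] by simp
  have Lv: "L2 ?C v" and Lh: "L2 ?C h" using tendsto_L2D(2) C1_approxD(2,3)[OF \<phi>] by blast+
  note mv [measurable] = L2_measurable[OF Cb Lv] and mh [measurable] = L2_measurable[OF Cb Lh]
  note mB [measurable] = L2_measurable[OF Cb B_L2] and mg [measurable] = L2_measurable[OF Cb grad_B_L2]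
  note mc [measurable] = continuous_cutoffs[THEN borel_measurable_restr_continuous[OF Cb]]
  have [measurable]: "(\<lambda>x. snd (h x)) \<in> borel_measurable ?M" "(\<lambda>x. fst (grad B x)) \<in> borel_measurable ?M"
    "(\<lambda>x. snd (grad B x)) \<in> borel_measurable ?M"
    using borel_measurable_continuous_on[OF continuous_on_snd[OF continuous_on_id] mh]
      borel_measurable_continuous_on[OF continuous_on_fst[OF continuous_on_id] mg]
      borel_measurable_continuous_on[OF continuous_on_snd[OF continuous_on_id] mg] by simp_all
  define \<Psi> where "\<Psi> x = \<mu> (fst x) * zeta (snd x)" for x
  note X = C1_compose_real[OF open_UNIV C1_fst DERIV_\<mu> continuous_\<mu>'[of UNIV]]
  note XZ = C1_on_mult[OF open_UNIV X(1) C1_zeta_affine(3)]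
  have \<Psi>: "C1_on UNIV \<Psi>" "grad \<Psi> x = (zeta (snd x) * \<mu>' (fst x), \<mu> (fst x) * zeta_deriv (snd x))" for x
    using XZ(1) XZ(2)[of x] X(2)[of x] C1_zeta_affine(4)[of x] by (simp_all add: \<Psi>_def[abs_def])
  \<comment> \<open>T0 is the pairing of the gradient of \<open>B\<close> with the gradient of
    \<Psi> v and integrates to 0. T1 is the cut-off term of \<open>G\<close>. T2 restores what \<mu>
    removed and lives in the outermost cells; T3 removes the term in which the derivative fell on
    the vertical cut-off.\<close>
  define T0 where "T0 x = grad B x \<bullet> (\<Psi> x *\<^sub>R h x + v x *\<^sub>R grad \<Psi> x)" for x
  define T1 where "T1 x = zeta_deriv (snd x) * (B x - \<epsilon> * B\<^sub>0) * snd (h x)" for x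
  define T2 where "T2 x = (1 - \<mu> (fst x)) * (zeta (snd x) * (grad B x \<bullet> h x) + zeta_deriv (snd x) * v x * snd (grad B x))
      - \<mu>' (fst x) * zeta (snd x) * v x * fst (grad B x)" for x
  define T3 where "T3 x = zeta_deriv (snd x) * v x * snd (grad B x)" for x
  have split: "G x \<bullet> h x = snd (h x) + T0 x + T1 x + T2 x - T3 x" for x
    unfolding G_def T0_def T1_def T2_def T3_def \<Psi>(2) \<Psi>_def
    by (cases "h x"; cases "grad B x") (simp add: algebra_simps)
  have D0: "0 \<le> decay_const" by (rule decay_const_nonneg)
  have ns: "\<bar>fst y\<bar> \<le> norm y" "\<bar>snd y\<bar> \<le> norm y" for y :: "real \<times> real"
    using norm_fst_le[of "fst y" "snd y"] norm_snd_le[of "snd y" "fst y"] by simp_all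
  have I0: "integrable ?M T0" "(\<integral>x. T0 x \<partial>?M) = 0"
  proof -
    note P = C1_approx_mult[OF D.open_channel D.compact_closed_region D.channel_subset_closed_region \<Psi>(1) \<phi>]
    have L: "L2 ?C (\<lambda>x. \<Psi> x *\<^sub>R h x + v x *\<^sub>R grad \<Psi> x)" by (rule tendsto_L2D(2)[OF C1_approxD(3)[OF P]])
    have "T0 \<in> borel_measurable ?M"
      unfolding T0_def[abs_def] by (intro borel_measurable_inner mg L2_measurable[OF Cb L])
    then show "integrable ?M T0"
      by (rule L2_product(1)[OF Cb grad_B_L2 L, where C = 1]) (auto simp: T0_def Cauchy_Schwarz_ineq2)
    have "\<Psi> x = 0" if "fst x < \<epsilon> / 4 \<or> 1 - \<epsilon> / 4 < fst x \<or> 1 - \<epsilon> / 4 < snd x" for x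
      using that \<mu>_outer[of "fst x"] zeta_eq_0(1)[of "snd x"] \<epsilon> by (auto simp: \<Psi>_def)
    from test_zero_trace_B[where \<alpha> = "\<epsilon> / 4", OF \<phi> bot \<Psi>(1) _ this] show "(\<integral>x. T0 x \<partial>?M) = 0" using \<epsilon> by (simp add: T0_def)
  qed
  have Ih: "integrable ?M (\<lambda>x. snd (h x))" "(\<integral>x. snd (h x) \<partial>?M) = 0"
  proof -
    have "L2 ?C (\<lambda>_. 1 :: real)" by (rule L2_const[OF Cb D.emeasure_channel, where C = 1]) auto
    then show "integrable ?M (\<lambda>x. snd (h x))"
      by (rule L2_product(1)[OF Cb _ Lh, where C = 1]) (use ns in auto)
    show "(\<integral>x. snd (h x) \<partial>?M) = 0" using D.tendsto_traces_integral[OF \<phi> bot top] by simp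
  qed
  have L8: "L2 ?C (\<lambda>x. 8 *\<^sub>R m x)" "L2_norm ?C (\<lambda>x. 8 *\<^sub>R m x) = 8 * L2_norm ?C m"
    "L2 ?C (\<lambda>x. 8 *\<^sub>R a x)" "L2_norm ?C (\<lambda>x. 8 *\<^sub>R a x) = 8 * L2_norm ?C a"
    using L2_cmult[OF Cb m, of 8] L2_cmult[OF Cb a, of 8] by simp_all
  let ?d = "sqrt decay_const"
  have d2: "?d\<^sup>2 = decay_const" using D0 by simp
  have I1: "integrable ?M T1" "\<bar>\<integral>x. T1 x \<partial>?M\<bar> \<le> 2 * \<epsilon> * ?d * (8 * L2_norm ?C m)"
  proof -
    note sub = L2_subset[OF Cb D0.channel_borel smooth_subset L8(1)]
    have z: "T1 x = 0" if "x \<in> ?C - ?Q" for x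
    proof -
      have "snd x \<le> 0" using that by (auto simp: channel_def)
      then show ?thesis by (simp add: T1_def zeta_eq_1)
    qed
    have le: "norm (T1 x) \<le> norm (wt x ^ 3 *\<^sub>R (B x - \<epsilon> * B\<^sub>0)) * norm (8 *\<^sub>R m x)" if x: "x \<in> ?Q" for x
    proof -
      have x': "x \<in> ?C" using x smooth_subset by blast
      have "\<bar>zeta_deriv (snd x)\<bar> * \<bar>B x - \<epsilon> * B\<^sub>0\<bar> * \<bar>snd (h x)\<bar> \<le> 8 * \<bar>B x - \<epsilon> * B\<^sub>0\<bar> * (wt x ^ 3 * m x)"
        using ns(2)[of "h x"] h_le[OF x'] by (intro mult_mono zeta_deriv_bounds(2)) auto
      then show ?thesis unfolding nw[OF x'] T1_def using m0[OF x'] by (simp add: abs_mult mult_ac)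
    qed
    have mT: "T1 \<in> borel_measurable ?M" unfolding T1_def[abs_def] by measurable
    note P = L2_product_on[OF Cb D0.channel_borel smooth_subset weighted_B(1) sub(1) mT z le]
    show "integrable ?M T1" by (rule P(1))
    \<comment> \<open>Half a power of \<epsilon> is given away: the lateral cells limit the total to
      this order anyway.\<close>
    have "\<epsilon> ^ 3 \<le> \<epsilon>\<^sup>2" using \<epsilon> by (intro power_decreasing) auto
    then have "2 * \<epsilon> ^ 3 \<le> 4 * \<epsilon>\<^sup>2" using zero_le_power2[of \<epsilon>] by linarith
    then have "2 * \<epsilon> ^ 3 * decay_const \<le> 4 * \<epsilon>\<^sup>2 * decay_const" by (rule mult_right_mono[OF _ D0])
    also have "4 * \<epsilon>\<^sup>2 * decay_const = (2 * \<epsilon> * ?d)\<^sup>2" by (simp add: power_mult_distrib d2)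
    finally have "(L2_norm ?Q (\<lambda>x. wt x ^ 3 *\<^sub>R (B x - \<epsilon> * B\<^sub>0)))\<^sup>2 \<le> (2 * \<epsilon> * ?d)\<^sup>2"
      by (rule order_trans[OF weighted_B(2)])
    then have "L2_norm ?Q (\<lambda>x. wt x ^ 3 *\<^sub>R (B x - \<epsilon> * B\<^sub>0)) \<le> 2 * \<epsilon> * ?d"
      by (rule power2_le_imp_le) (use \<epsilon> D0 in simp)
    then have "L2_norm ?Q (\<lambda>x. wt x ^ 3 *\<^sub>R (B x - \<epsilon> * B\<^sub>0)) * L2_norm ?Q (\<lambda>x. 8 *\<^sub>R m x) \<le> 2 * \<epsilon> * ?d * (8 * L2_norm ?C m)"
      using sub(2) \<epsilon> D0 unfolding L8(2) by (intro mult_mono) auto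
    with P(2) show "\<bar>\<integral>x. T1 x \<partial>?M\<bar> \<le> 2 * \<epsilon> * ?d * (8 * L2_norm ?C m)" by simp
  qed
  have I3: "integrable ?M T3" "\<bar>\<integral>x. T3 x \<partial>?M\<bar> \<le> 2 * ?d * (8 * L2_norm ?C a)"
  proof -
    have le: "norm (T3 x) \<le> norm (wt x ^ 3 *\<^sub>R grad B x) * norm (8 *\<^sub>R a x)" if x: "x \<in> ?C" for x
    proof -
      have "\<bar>zeta_deriv (snd x)\<bar> * \<bar>v x\<bar> * \<bar>snd (grad B x)\<bar> \<le> 8 * (wt x ^ 3 * a x) * norm (grad B x)"
        using w1(2)[OF x] a0[OF x] by (intro mult_mono zeta_deriv_bounds(2) v_le[OF x] ns) auto
      then show ?thesis unfolding nw[OF x] T3_def using a0[OF x] by (simp add: abs_mult mult_ac)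
    qed
    have mT: "T3 \<in> borel_measurable ?M" unfolding T3_def[abs_def] by measurable
    note P = L2_product_on[OF Cb Cb subset_refl weighted_grad_B(1) L8(3) mT _ le]
    show "integrable ?M T3" by (rule P(1)) auto
    have "2 * \<epsilon> * decay_const \<le> 4 * decay_const" using D0 \<epsilon> by (intro mult_right_mono) auto
    also have "4 * decay_const = (2 * ?d)\<^sup>2" by (simp add: power_mult_distrib d2)
    finally have "(L2_norm ?C (\<lambda>x. wt x ^ 3 *\<^sub>R grad B x))\<^sup>2 \<le> (2 * ?d)\<^sup>2"
      by (rule order_trans[OF weighted_grad_B(2)])
    then have "L2_norm ?C (\<lambda>x. wt x ^ 3 *\<^sub>R grad B x) \<le> 2 * ?d"
      by (rule power2_le_imp_le) (use D0 in simp)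
    then have "L2_norm ?C (\<lambda>x. wt x ^ 3 *\<^sub>R grad B x) * L2_norm ?C (\<lambda>x. 8 *\<^sub>R a x) \<le> 2 * ?d * (8 * L2_norm ?C a)"
      using D0 unfolding L8(4) by (intro mult_mono) auto
    moreover have "\<bar>\<integral>x. T3 x \<partial>?M\<bar> \<le> L2_norm ?C (\<lambda>x. wt x ^ 3 *\<^sub>R grad B x) * L2_norm ?C (\<lambda>x. 8 *\<^sub>R a x)"
      using P(2) by simp
    ultimately show "\<bar>\<integral>x. T3 x \<partial>?M\<bar> \<le> 2 * ?d * (8 * L2_norm ?C a)" by linarith
  qed
  have I2: "integrable ?M T2" "\<bar>\<integral>x. T2 x \<partial>?M\<bar> \<le> 2 * \<epsilon> * ?d * (L2_norm ?C m + 24 / \<epsilon> * L2_norm ?C a)"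
  proof -
    let ?m = "\<lambda>x. m x + (24 / \<epsilon>) *\<^sub>R a x"
    have Lm: "L2 ?C ?m" "L2_norm ?C ?m \<le> L2_norm ?C m + 24 / \<epsilon> * L2_norm ?C a"
      using L2_add[OF Cb m L2_cmult(1)[OF Cb a, of "24 / \<epsilon>"]] L2_cmult(2)[OF Cb a, of "24 / \<epsilon>"] \<epsilon> by simp_all
    note sub = L2_subset[OF Cb ends_borel ends_subset Lm(1)] L2_subset(1)[OF Cb ends_borel ends_subset weighted_grad_B(1)]
    have z: "T2 x = 0" if "x \<in> ?C - ends" for x
    proof -
      have "\<epsilon> \<le> fst x" "fst x \<le> 1 - \<epsilon>" using that by (auto simp: ends_def)
      then show ?thesis using \<mu>_inner[of "fst x"] by (simp add: T2_def)
    qed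
    have le: "norm (T2 x) \<le> norm (wt x ^ 3 *\<^sub>R grad B x) * norm (?m x)" if xe: "x \<in> ends" for x
    proof -
      have x: "x \<in> ?C" using xe ends_subset by blast
      let ?W = "wt x ^ 3" and ?g = "norm (grad B x)"
      have 1: "\<bar>zeta (snd x) * (grad B x \<bullet> h x)\<bar> \<le> ?g * (?W * m x)"
      proof -
        have "\<bar>zeta (snd x)\<bar> * \<bar>grad B x \<bullet> h x\<bar> \<le> 1 * (?g * norm (h x))"
          using zeta_bounds[of "snd x"] by (intro mult_mono Cauchy_Schwarz_ineq2) auto
        also have "\<dots> \<le> 1 * (?g * (?W * m x))" by (intro mult_left_mono h_le[OF x]) auto
        finally show ?thesis by (simp add: abs_mult)
      qed
      have 2: "\<bar>zeta_deriv (snd x) * v x * snd (grad B x)\<bar> \<le> 8 * (?W * a x) * ?g"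
        unfolding abs_mult using w1(2)[OF x] a0[OF x] by (intro mult_mono zeta_deriv_bounds(2) v_le[OF x] ns) auto
      have 3: "\<bar>\<mu>' (fst x) * zeta (snd x) * v x * fst (grad B x)\<bar> \<le> 16 / \<epsilon> * 1 * (?W * a x) * ?g"
        unfolding abs_mult using w1(2)[OF x] a0[OF x] zeta_bounds[of "snd x"] \<epsilon>
        by (intro mult_mono \<mu>_bounds(3) v_le[OF x] ns) auto
      have 4: "\<bar>(1 - \<mu> (fst x)) * (zeta (snd x) * (grad B x \<bullet> h x) + zeta_deriv (snd x) * v x * snd (grad B x))\<bar>
          \<le> 1 * (?g * (?W * m x) + 8 * (?W * a x) * ?g)"
        unfolding abs_mult using \<mu>_bounds[of "fst x"] 1 2 abs_triangle_ineq order_trans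
        by (intro mult_mono) (auto intro!: order_trans[OF abs_triangle_ineq] add_mono simp: abs_mult)
      \<comment> \<open>Enlarged so as to merge with the term from \<mu>', giving the coefficient 24
        / \<epsilon> of \<open>?m\<close>.\<close>
      have e8: "8 * (?W * a x) * ?g \<le> 8 / \<epsilon> * (?W * a x) * ?g"
        using \<epsilon> w1(2)[OF x] a0[OF x] by (intro mult_right_mono) (auto simp: pos_le_divide_eq)
      have "\<bar>T2 x\<bar> \<le> 1 * (?g * (?W * m x) + 8 * (?W * a x) * ?g) + 16 / \<epsilon> * 1 * (?W * a x) * ?g"
        unfolding T2_def using 3 4 by (intro order_trans[OF abs_triangle_ineq4] add_mono) auto
      also have "\<dots> \<le> 1 * (?g * (?W * m x) + 8 / \<epsilon> * (?W * a x) * ?g) + 16 / \<epsilon> * 1 * (?W * a x) * ?g"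
        by (intro add_mono mult_left_mono order_refl e8) auto
      also have "\<dots> = ?W * ?g * ?m x" using \<epsilon> by (simp add: field_simps)
      also have "\<dots> = norm (wt x ^ 3 *\<^sub>R grad B x) * norm (?m x)"
        unfolding nw[OF x] using m0[OF x] a0[OF x] \<epsilon> by simp
      finally show ?thesis by simp
    qed
    have mT: "T2 \<in> borel_measurable ?M" unfolding T2_def[abs_def] by measurable
    note P = L2_product_on[OF Cb ends_borel ends_subset sub(3) sub(1) mT z le]
    show "integrable ?M T2" by (rule P(1))
    have "(L2_norm ends (\<lambda>x. wt x ^ 3 *\<^sub>R grad B x))\<^sup>2 \<le> (2 * \<epsilon> * ?d)\<^sup>2"
      using weighted_grad_B(3) by (simp add: power_mult_distrib d2)
    then have "L2_norm ends (\<lambda>x. wt x ^ 3 *\<^sub>R grad B x) \<le> 2 * \<epsilon> * ?d"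
      by (rule power2_le_imp_le) (use \<epsilon> D0 in simp)
    then have "L2_norm ends (\<lambda>x. wt x ^ 3 *\<^sub>R grad B x) * L2_norm ends ?m \<le> 2 * \<epsilon> * ?d * (L2_norm ?C m + 24 / \<epsilon> * L2_norm ?C a)"
      using order_trans[OF sub(2) Lm(2)] \<epsilon> D0 by (intro mult_mono) auto
    with P(2) show "\<bar>\<integral>x. T2 x \<partial>?M\<bar> \<le> 2 * \<epsilon> * ?d * (L2_norm ?C m + 24 / \<epsilon> * L2_norm ?C a)" by simp
  qed
  have "(\<integral>x. G x \<bullet> h x \<partial>?M) = (\<integral>x. snd (h x) \<partial>?M) + (\<integral>x. T0 x \<partial>?M) + (\<integral>x. T1 x \<partial>?M) + (\<integral>x. T2 x \<partial>?M) - (\<integral>x. T3 x \<partial>?M)"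
    unfolding split using Ih(1) I0(1) I1(1) I2(1) I3(1) by simp
  then have "\<bar>\<integral>x. G x \<bullet> h x \<partial>?M\<bar> \<le> 2 * \<epsilon> * ?d * (8 * L2_norm ?C m) + 2 * \<epsilon> * ?d * (L2_norm ?C m + 24 / \<epsilon> * L2_norm ?C a)
     + 2 * ?d * (8 * L2_norm ?C a)"
    using Ih(2) I0(2) I1(2) I2(2) I3(2) by linarith
  also have "\<dots> = ?d * (18 * \<epsilon> * L2_norm ?C m + 64 * L2_norm ?C a)" using \<epsilon> by (simp add: field_simps)
  finally show ?thesis .
qed

end

section \<open>Energy estimate and L2 estimate of the error\<close>

context scaled_cell
begin

definition corrected :: "real \<times> real \<Rightarrow> real" where
  "corrected x = snd x + \<epsilon> * B\<^sub>0 + zeta (snd x) * (B x - \<epsilon> * B\<^sub>0)"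

text \<open>The profile is \<eta> minus (1 - \<zeta>)(B - \<epsilon> B0). The second term vanishes
  below height 0 and therefore is C1 on the whole plane, so the approximants of \<eta> keep their
  exact zeros on the rough bottom, and at the top the oscillating part cancels.\<close>

lemma corrected_approx:
  obtains \<phi> where "C1_approx (channel b) \<phi> corrected G" "\<And>n s. \<phi> n (s, b s) = 0" "\<And>n s. \<phi> n (s, 1) = 1 + \<epsilon> * B\<^sub>0"
proof -
  obtain \<phi> where \<phi>: "C1_approx (channel b) \<phi> \<eta> (grad \<eta>)" "\<And>n s. \<phi> n (s, b s) = 0" "\<And>n s. \<phi> n (s, 1) = \<eta> (s, 1)"
    by (rule \<eta>_approx) blast
  let ?k = "\<lambda>x :: real \<times> real. 1 - zeta (snd x)" and ?u = "\<lambda>x. B x - \<epsilon> * B\<^sub>0"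
  let ?r = "\<lambda>x. ?k x * ?u x"
  note K = C1_on_diff[OF open_UNIV C1_const[of 1] C1_zeta_affine(3)]
  note u = C1_on_diff[OF open_above' B_C1(1) C1_on_subset[OF C1_const[of "\<epsilon> * B\<^sub>0"] subset_UNIV]]
  have V: "open {x :: real \<times> real. snd x < 0}" by (intro open_Collect_less continuous_intros)
  have UV: "above \<union> {x. snd x < 0} = UNIV"
  proof -
    have "x \<in> above \<or> snd x < 0" for x using b_lt(1)[of "fst x"] by auto
    then show ?thesis by blast
  qed
  note r = C1_mult_extend[OF open_above' V UV K(1) _ u(1)]
  have rC: "C1_on UNIV ?r" by (rule r(1)) (simp add: zeta_eq_1)
  have rg: "grad ?r x = ?k x *\<^sub>R grad ?u x + ?u x *\<^sub>R grad ?k x" for x by (rule r(2)) (simp add: zeta_eq_1)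
  have kg: "grad ?k x = (0, - zeta_deriv (snd x))" for x
    using K(2)[of x] C1_zeta_affine(4)[of x] by simp
  have P: "C1_approx (channel b) (\<lambda>n x. \<phi> n x - ?r x) (\<lambda>x. \<eta> x - ?r x) (\<lambda>x. grad \<eta> x - grad ?r x)"
    by (rule C1_approx_lincomb[OF D.open_channel \<phi>(1) D.C1_approx_C1[OF rC]])
  have "C1_approx (channel b) (\<lambda>n x. \<phi> n x - ?r x) corrected G"
  proof (rule C1_approx_cong[OF D.open_channel P])
    fix x assume "x \<in> channel b"
    then have x: "x \<in> above" using channel_above by blast
    show "\<eta> x - ?r x = corrected x" by (simp add: corrected_def \<eta>_def algebra_simps)
    show "grad \<eta> x - grad ?r x = G x"
      unfolding rg kg using \<eta>_C1(2)[OF x] u(2)[OF x] by (simp add: G_def prod_eq_iff algebra_simps)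
  next
    have c: "continuous_on (channel b) B" "continuous_on (channel b) (grad B)"
      using C1_on_continuous[OF B_C1(1)] continuous_on_subset channel_above by blast+
    show "corrected \<in> borel_measurable (lebesgue_restr (channel b))" "G \<in> borel_measurable (lebesgue_restr (channel b))"
      unfolding corrected_def[abs_def] G_def[abs_def]
      by (intro borel_measurable_restr_continuous[OF D.channel_borel] continuous_intros c continuous_cutoffs)+
  qed
  moreover have "\<phi> n (s, b s) - ?r (s, b s) = 0" for n s
    using \<phi>(2)[of n s] b_lt(1)[of s] by (simp add: zeta_eq_1)
  moreover have "\<phi> n (s, 1) - ?r (s, 1) = 1 + \<epsilon> * B\<^sub>0" for n s
    using \<phi>(3)[of n s] by (simp add: \<eta>_def zeta_eq_0)
  ultimately show thesis by (rule that)
qed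

sublocale M: multiplier \<epsilon> by unfold_locales (rule \<epsilon>)+

text \<open>The energy estimate is only of order \<open>\<epsilon>\<close>. Testing with \<open>\<theta>(x\<^sub>2) w\<close>, where \<open>\<theta>\<close> vanishes on the rough part and
  \<open>\<theta>'' \<approx> -1\<close> away from it, gains the missing half power.\<close>

lemma error_bound:
  assumes \<omega>: "C1_approx (channel b) \<omega> w h" and bot: "tendsto_L2 {0<..<1} (\<lambda>n s. \<omega> n (s, b s)) (\<lambda>_. 0)"
    and top: "tendsto_L2 {0<..<1} (\<lambda>n s. \<omega> n (s, 1)) (\<lambda>_. 0)"
    and green: "\<And>\<phi> v g. C1_approx (channel b) \<phi> v g \<Longrightarrow> tendsto_L2 {0<..<1} (\<lambda>n s. \<phi> n (s, b s)) (\<lambda>_. 0) \<Longrightarrow>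
        tendsto_L2 {0<..<1} (\<lambda>n s. \<phi> n (s, 1)) (\<lambda>_. 0) \<Longrightarrow>
        (\<integral>x. h x \<bullet> g x \<partial>lebesgue_restr (channel b)) = - c * (\<integral>x. G x \<bullet> g x \<partial>lebesgue_restr (channel b))"
  shows "L2_norm smooth_domain w \<le> 1053 * (\<bar>c\<bar> * sqrt decay_const) * sqrt (\<epsilon> ^ 3)"
proof -
  let ?C = "channel b" and ?Q = "channel (\<lambda>_. 0 :: real)" and ?I = "{0<..<1::real}"
  let ?M = "lebesgue_restr ?C" and ?N = "lebesgue_restr ?Q"
  let ?H = "L2_norm ?C h"
  define q where "q = \<bar>c\<bar> * sqrt decay_const"
  have q0: "0 \<le> q" using decay_const_nonneg by (simp add: q_def)
  have Cb: "?C \<in> sets borel" and Qb: "?Q \<in> sets borel" and Ib: "?I \<in> sets borel"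
    using D.channel_borel D0.channel_borel by simp_all
  have Lw: "L2 ?C w" and Lh: "L2 ?C h" using tendsto_L2D(2) C1_approxD(2,3)[OF \<omega>] by blast+
  note mw [measurable] = L2_measurable[OF Cb Lw] and mh [measurable] = L2_measurable[OF Cb Lh]
  define a where "a x = w x / (wt x)\<^sup>2" for x
  have La: "L2 ?C a" "L2_norm ?C a \<le> \<epsilon> * ?H" unfolding a_def[abs_def] by (rule weighted_value[OF \<omega> bot])+
  note ma [measurable] = L2_measurable[OF Cb La(1)]
  have Lna: "L2 ?C (\<lambda>x. \<bar>a x\<bar>)" "L2_norm ?C (\<lambda>x. \<bar>a x\<bar>) \<le> L2_norm ?C a"
    using L2_bound[OF Cb, where v = a and u = "\<lambda>x. \<bar>a x\<bar>" and C = 1] La(1) by simp_all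
  have Lnh: "L2 ?C (\<lambda>x. norm (h x))" "L2_norm ?C (\<lambda>x. norm (h x)) \<le> ?H"
    using L2_bound[OF Cb, where v = h and u = "\<lambda>x. norm (h x)" and C = 1] Lh by simp_all
  have wt1: "1 \<le> wt x" "wt x \<noteq> 0" if "x \<in> ?C" for x using wt_ge[of x] that channel_above by auto
  have wa: "\<bar>w x\<bar> = (wt x)\<^sup>2 * \<bar>a x\<bar>" if "x \<in> ?C" for x
    using wt1[OF that] by (simp add: a_def abs_mult)
  have wt23: "(wt x)\<^sup>2 \<le> wt x ^ 3" "1 \<le> wt x ^ 3" "wt x \<le> wt x ^ 3" if "x \<in> ?C" for x
    using wt1(1)[OF that] power_increasing[of 2 3 "wt x"] power_increasing[of 1 3 "wt x"] one_le_power[of "wt x" 3] by simp_all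
  have bound: "\<bar>\<integral>x. h x \<bullet> g x \<partial>?M\<bar> \<le> q * (18 * \<epsilon> * L2_norm ?C m + 64 * L2_norm ?C a')"
    if "C1_approx ?C \<phi> v g" "tendsto_L2 ?I (\<lambda>n s. \<phi> n (s, b s)) (\<lambda>_. 0)" "tendsto_L2 ?I (\<lambda>n s. \<phi> n (s, 1)) (\<lambda>_. 0)"
      "L2 ?C a'" "L2 ?C m" "\<And>x. x \<in> ?C \<Longrightarrow> \<bar>v x\<bar> \<le> wt x ^ 3 * a' x" "\<And>x. x \<in> ?C \<Longrightarrow> norm (g x) \<le> wt x ^ 3 * m x"
    for \<phi> v g a' m
    using mult_left_mono[OF test_bound[OF that] abs_ge_zero[of c]] unfolding green[OF that(1-3)]
    by (simp add: q_def abs_mult mult_ac)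
  \<comment> \<open>The energy estimate: the error is tested with itself, and the Hardy inequality
    bounds the norm of \<open>a\<close> by \<epsilon> times \<open>?H\<close>. The constant is 82 =
    18 + 64.\<close>
  have H: "?H \<le> 82 * q * \<epsilon>"
  proof -
    have "?H\<^sup>2 = \<bar>\<integral>x. h x \<bullet> h x \<partial>?M\<bar>" by (simp add: L2_norm_power2[OF Cb] power2_norm_eq_inner)
    also have "\<dots> \<le> q * (18 * \<epsilon> * L2_norm ?C (\<lambda>x. norm (h x)) + 64 * L2_norm ?C (\<lambda>x. \<bar>a x\<bar>))"
    proof (rule bound[OF \<omega> bot top Lna(1) Lnh(1)])
      fix x assume x: "x \<in> ?C"
      show "\<bar>w x\<bar> \<le> wt x ^ 3 * \<bar>a x\<bar>" unfolding wa[OF x] by (intro mult_right_mono wt23[OF x]) auto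
      show "norm (h x) \<le> wt x ^ 3 * norm (h x)"
        using mult_right_mono[OF wt23(2)[OF x] norm_ge_zero[of "h x"]] by simp
    qed
    also have "\<dots> \<le> q * (18 * \<epsilon> * ?H + 64 * (\<epsilon> * ?H))"
      using Lnh(2) Lna(2) La(2) \<epsilon> q0 by (intro mult_left_mono add_mono order_trans[OF Lna(2)]) auto
    also have "\<dots> = 82 * q * \<epsilon> * ?H" by (simp add: algebra_simps)
    finally have "?H * ?H \<le> 82 * q * \<epsilon> * ?H" by (simp add: power2_eq_square)
    then show ?thesis using L2_norm_nonneg[of ?C h] q0 \<epsilon> by (cases "?H = 0") (auto simp: mult_le_cancel_right)
  qed
  let ?k = "\<lambda>x :: real \<times> real. M.\<theta> (snd x)"
  note k = C1_compose_real[OF open_UNIV C1_snd M.DERIV_\<theta> M.continuous_\<theta>'[of UNIV]]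
  have kg: "grad ?k x = (0, M.\<theta>' (snd x))" for x using k(2)[of x] by simp
  define g where "g x = M.\<theta> (snd x) *\<^sub>R h x + (w x * M.\<theta>' (snd x)) *\<^sub>R (0, 1)" for x
  have P: "C1_approx ?C (\<lambda>n x. ?k x * \<omega> n x) (\<lambda>x. ?k x * w x) g"
    using C1_approx_mult[OF D.open_channel D.compact_closed_region D.channel_subset_closed_region k(1) \<omega>]
    unfolding kg by (simp add: g_def[abs_def])
  have c\<theta>: "continuous_on S M.\<theta>" for S by (intro continuous_at_imp_continuous_on ballI DERIV_isCont[OF M.DERIV_\<theta>])
  have mk [measurable]: "(\<lambda>x. M.\<theta> (snd x)) \<in> borel_measurable ?M" "(\<lambda>x. M.\<theta>' (snd x)) \<in> borel_measurable ?M"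
    by (auto intro!: borel_measurable_restr_continuous[OF Cb] continuous_on_compose2[OF c\<theta>[of UNIV]]
        continuous_on_compose2[OF M.continuous_\<theta>'[of UNIV]] continuous_intros)
  have below: "M.\<theta> (snd x) = 0" "M.\<theta>' (snd x) = 0" if "x \<in> ?C - ?Q" for x
  proof -
    have "snd x \<le> 0" using that by (auto simp: channel_def)
    then show "M.\<theta> (snd x) = 0" "M.\<theta>' (snd x) = 0" by (rule M.\<theta>'_eq)+
  qed
  have \<theta>1: "0 \<le> M.\<theta> (snd x)" "M.\<theta> (snd x) \<le> \<epsilon> * wt x" "\<bar>M.\<theta>' (snd x)\<bar> \<le> 2" if "x \<in> ?C" for x
  proof -
    have "0 \<le> M.\<theta> (snd x) \<and> M.\<theta> (snd x) \<le> \<epsilon> * wt x \<and> \<bar>M.\<theta>' (snd x)\<bar> \<le> 2"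
    proof (cases "x \<in> ?Q")
      case True
      then have s: "0 \<le> snd x" "snd x \<le> 1" by (auto simp: channel_def)
      have "snd x \<le> \<epsilon> * wt x" using \<epsilon> by (simp add: wt_def algebra_simps)
      then show ?thesis using M.\<theta>_bounds[OF s] by auto
    next
      case False
      then show ?thesis using below[of x] that wt1(1)[OF that] \<epsilon> by simp
    qed
    then show "0 \<le> M.\<theta> (snd x)" "M.\<theta> (snd x) \<le> \<epsilon> * wt x" "\<bar>M.\<theta>' (snd x)\<bar> \<le> 2" by blast+
  qed
  \<comment> \<open>The bound \<theta> \<le> \<epsilon> wt uses up the third power of the weight, of
    which \<open>w = (wt)^2 a\<close> takes two. Compared with the energy estimate, a further factor
    \<epsilon> is gained.\<close>
  define a' where "a' x = \<epsilon> *\<^sub>R \<bar>a x\<bar>" for x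
  define m where "m x = \<epsilon> *\<^sub>R norm (h x) + 2 *\<^sub>R \<bar>a x\<bar>" for x
  have La': "L2 ?C a'" "L2_norm ?C a' \<le> \<epsilon> * (\<epsilon> * ?H)"
    unfolding a'_def[abs_def] using L2_cmult[OF Cb Lna(1), of \<epsilon>] order_trans[OF Lna(2) La(2)] \<epsilon> by simp_all
  have Lm: "L2 ?C m" "L2_norm ?C m \<le> \<epsilon> * ?H + 2 * (\<epsilon> * ?H)"
  proof -
    note A = L2_add[OF Cb L2_cmult(1)[OF Cb Lnh(1), of \<epsilon>] L2_cmult(1)[OF Cb Lna(1), of 2]]
    show "L2 ?C m" unfolding m_def[abs_def] by (rule A(1))
    have "L2_norm ?C m \<le> \<epsilon> * L2_norm ?C (\<lambda>x. norm (h x)) + 2 * L2_norm ?C (\<lambda>x. \<bar>a x\<bar>)"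
      using A(2) L2_cmult(2)[OF Cb Lnh(1), of \<epsilon>] L2_cmult(2)[OF Cb Lna(1), of 2] \<epsilon> by (simp add: m_def[abs_def])
    also have "\<dots> \<le> \<epsilon> * ?H + 2 * (\<epsilon> * ?H)"
      using Lnh(2) order_trans[OF Lna(2) La(2)] \<epsilon> by (intro add_mono mult_left_mono) auto
    finally show "L2_norm ?C m \<le> \<epsilon> * ?H + 2 * (\<epsilon> * ?H)" .
  qed
  have R: "\<bar>\<integral>x. h x \<bullet> g x \<partial>?M\<bar> \<le> 118 * q * \<epsilon>\<^sup>2 * ?H"
  proof -
    have "\<bar>\<integral>x. h x \<bullet> g x \<partial>?M\<bar> \<le> q * (18 * \<epsilon> * L2_norm ?C m + 64 * L2_norm ?C a')"
    proof (rule bound[OF P _ _ La'(1) Lm(1)])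
      have "M.\<theta> (b s) = 0" for s using M.\<theta>'_eq(3)[of "b s"] b_lt(1)[of s] by simp
      moreover have "L2 ?I (\<lambda>_. 0 :: real)" by (rule L2_const[where C = 0]) auto
      ultimately show "tendsto_L2 ?I (\<lambda>n s. ?k (s, b s) * \<omega> n (s, b s)) (\<lambda>_. 0)"
        using tendsto_L2_const[of ?I "\<lambda>_. 0 :: real"] by simp
      show "tendsto_L2 ?I (\<lambda>n s. ?k (s, 1) * \<omega> n (s, 1)) (\<lambda>_. 0)"
        using tendsto_L2_mult[OF Ib top, of "\<lambda>_. M.\<theta> 1" "\<bar>M.\<theta> 1\<bar>"] by simp
      fix x assume x: "x \<in> ?C"
      have "\<bar>?k x * w x\<bar> \<le> \<epsilon> * wt x * ((wt x)\<^sup>2 * \<bar>a x\<bar>)"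
        unfolding abs_mult wa[OF x] using \<theta>1[OF x] by (intro mult_right_mono) auto
      also have "\<dots> = wt x ^ 3 * a' x" by (simp add: a'_def power2_eq_square power3_eq_cube)
      finally show "\<bar>?k x * w x\<bar> \<le> wt x ^ 3 * a' x" .
      have "norm (g x) \<le> M.\<theta> (snd x) * norm (h x) + \<bar>w x\<bar> * \<bar>M.\<theta>' (snd x)\<bar>"
        unfolding g_def using \<theta>1(1)[OF x] norm_triangle_ineq[of "M.\<theta> (snd x) *\<^sub>R h x" "(w x * M.\<theta>' (snd x)) *\<^sub>R (0, 1 :: real)"]
        by (simp add: abs_mult)
      also have "\<dots> \<le> (\<epsilon> * wt x ^ 3) * norm (h x) + (wt x ^ 3 * \<bar>a x\<bar>) * 2"
      proof (intro add_mono mult_mono)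
        show "M.\<theta> (snd x) \<le> \<epsilon> * wt x ^ 3" using \<theta>1(2)[OF x] wt23(3)[OF x] \<epsilon> mult_left_mono[of "wt x" "wt x ^ 3" \<epsilon>] by linarith
        show "\<bar>w x\<bar> \<le> wt x ^ 3 * \<bar>a x\<bar>" unfolding wa[OF x] by (intro mult_right_mono wt23[OF x]) auto
      qed (use \<theta>1[OF x] order_trans[OF zero_le_one wt23(2)[OF x]] \<epsilon> in auto)
      also have "\<dots> = wt x ^ 3 * m x" by (simp add: m_def algebra_simps)
      finally show "norm (g x) \<le> wt x ^ 3 * m x" .
    qed
    also have "\<dots> \<le> q * (18 * \<epsilon> * (\<epsilon> * ?H + 2 * (\<epsilon> * ?H)) + 64 * (\<epsilon> * (\<epsilon> * ?H)))"
      using Lm(2) La'(2) \<epsilon> q0 by (intro mult_left_mono add_mono) auto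
    also have "\<dots> = 118 * q * \<epsilon>\<^sup>2 * ?H" by (simp add: power2_eq_square algebra_simps)
    finally show ?thesis .
  qed
  note sub = tendsto_L2_subset[OF Cb Qb smooth_subset]
  have \<omega>': "C1_approx ?Q \<omega> w h" unfolding C1_approx_def
    using C1_approxD(1)[OF \<omega>] sub[OF C1_approxD(2)[OF \<omega>]] sub[OF C1_approxD(3)[OF \<omega>]] by blast
  have Lw': "L2 ?Q w" and Lh': "L2 ?Q h" using tendsto_L2D(2) C1_approxD(2,3)[OF \<omega>'] by blast+
  note mw' [measurable] = L2_measurable[OF Qb Lw'] and mh' [measurable] = L2_measurable[OF Qb Lh']
  have snd_meas [measurable]: "(\<lambda>x. snd (h x)) \<in> borel_measurable ?M" "(\<lambda>x. snd (h x)) \<in> borel_measurable ?N"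
    using borel_measurable_continuous_on[OF continuous_on_snd[OF continuous_on_id] mh]
      borel_measurable_continuous_on[OF continuous_on_snd[OF continuous_on_id] mh'] by simp_all
  have mk' [measurable]: "(\<lambda>x. M.\<kappa> (snd x)) \<in> borel_measurable ?N" "(\<lambda>x. M.\<kappa>' (snd x)) \<in> borel_measurable ?N"
    by (auto intro!: borel_measurable_restr_continuous[OF Qb] continuous_on_compose2[OF M.continuous_\<kappa>[of UNIV]]
        continuous_on_compose2[OF M.continuous_\<kappa>'[of UNIV]] continuous_intros)
  have Z: "(\<integral>x. w x * (2 * (M.\<kappa> (snd x) * snd (h x)) + M.\<kappa>' (snd x) * w x) \<partial>?N) = 0"
    by (rule weighted_trace_identity[OF \<omega>' top M.DERIV_\<kappa> M.continuous_\<kappa>']) (simp add: M.\<kappa>_def)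
  have QD: "x \<in> ?C" "0 \<le> snd x" "snd x \<le> 1" if "x \<in> ?Q" for x
    using that smooth_subset by (auto simp: channel_def)
  have \<kappa>2: "\<bar>M.\<kappa> (snd x)\<bar> \<le> 2" if "x \<in> ?Q" for x
    using M.\<theta>_bounds(3)[OF QD(2,3)[OF that]] M.\<theta>'_eq(1)[OF QD(2)[OF that]] by simp
  have sn: "\<bar>snd y\<bar> \<le> norm y" for y :: "real \<times> real" using norm_snd_le[of "snd y" "fst y"] by simp
  define I1 where "I1 x = w x * (M.\<kappa> (snd x) * snd (h x))" for x
  define I2 where "I2 x = M.\<kappa>' (snd x) * (w x)\<^sup>2" for x
  have i1: "integrable ?N I1"
  proof (rule L2_product(1)[OF Qb Lw' Lh', where C = 2])
    show "I1 \<in> borel_measurable ?N" unfolding I1_def[abs_def] by measurable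
    fix x assume x: "x \<in> ?Q"
    have "\<bar>M.\<kappa> (snd x)\<bar> * \<bar>snd (h x)\<bar> \<le> 2 * norm (h x)" by (intro mult_mono \<kappa>2[OF x] sn) auto
    from mult_left_mono[OF this abs_ge_zero[of "w x"]] show "norm (I1 x) \<le> 2 * (norm (w x) * norm (h x))"
      by (simp add: I1_def abs_mult mult_ac)
  qed simp
  have iw: "integrable ?N (\<lambda>x. (w x)\<^sup>2)" using Lw' Qb by (simp add: L2_iff)
  have La0: "L2 ?Q a" "L2_norm ?Q a \<le> \<epsilon> * ?H"
    using L2_subset[OF Cb Qb smooth_subset La(1)] La(2) by simp_all
  have ia: "integrable ?N (\<lambda>x. (a x)\<^sup>2)" using La0(1) Qb by (simp add: L2_iff)
  obtain K where K: "\<And>x. x \<in> ?Q \<Longrightarrow> \<bar>M.\<kappa>' (snd x)\<bar> \<le> K"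
  proof -
    have "bounded (M.\<kappa>' ` {0..1})" by (intro compact_imp_bounded compact_continuous_image M.continuous_\<kappa>') auto
    then obtain K where K: "\<forall>t\<in>{0..1}. norm (M.\<kappa>' t) \<le> K" by (auto simp: bounded_iff)
    show thesis by (rule that[of K]) (use K QD in auto)
  qed
  have i2: "integrable ?N I2"
  proof (rule Bochner_Integration.integrable_bound[OF integrable_mult_right[OF iw, of K]])
    show "I2 \<in> borel_measurable ?N" unfolding I2_def[abs_def] by measurable
    have "norm (I2 x) \<le> norm (K * (w x)\<^sup>2)" if "x \<in> ?Q" for x
      using K[OF that] by (auto simp: I2_def abs_mult intro!: mult_right_mono)
    then show "AE x in ?N. norm (I2 x) \<le> norm (K * (w x)\<^sup>2)" by (intro AE_I2) (simp add: space_restrict_space)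
  qed
  have zI: "2 * (\<integral>x. I1 x \<partial>?N) + (\<integral>x. I2 x \<partial>?N) = 0"
  proof -
    have "w x * (2 * (M.\<kappa> (snd x) * snd (h x)) + M.\<kappa>' (snd x) * w x) = 2 * I1 x + I2 x" for x
      by (simp add: I1_def I2_def power2_eq_square algebra_simps)
    with Z have "(\<integral>x. 2 * I1 x + I2 x \<partial>?N) = 0" by simp
    then show ?thesis using i1 i2 by simp
  qed
  have hg: "(\<integral>x. I1 x \<partial>?N) \<le> (\<integral>x. h x \<bullet> g x \<partial>?M)"
  proof -
    define J where "J x = (w x * M.\<theta>' (snd x)) * snd (h x)" for x
    have J0: "J x = 0" if "x \<in> ?C - ?Q" for x using below[OF that] by (simp add: J_def)
    have JQ: "J x = I1 x" if "x \<in> ?Q" for x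
      using M.\<theta>'_eq(1)[OF QD(2)[OF that]] by (simp add: J_def I1_def mult_ac)
    note RS = restr_subset[where F = J, OF Cb Qb smooth_subset J0]
    have e: "(\<integral>x. J x \<partial>?N) = (\<integral>x. I1 x \<partial>?N)"
      by (rule Bochner_Integration.integral_cong) (auto simp: space_restrict_space JQ)
    have "integrable ?N J \<longleftrightarrow> integrable ?N I1"
      by (rule Bochner_Integration.integrable_cong) (auto simp: space_restrict_space JQ)
    then have iJ: "integrable ?M J" using RS(2) i1 by blast
    have Lg: "L2 ?C g" by (rule tendsto_L2D(2)[OF C1_approxD(3)[OF P]])
    have ihg: "integrable ?M (\<lambda>x. h x \<bullet> g x)"
      using L2_product(1)[OF Cb Lh Lg, of "\<lambda>x. h x \<bullet> g x" 1] borel_measurable_inner[OF mh L2_measurable[OF Cb Lg]]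
      by (simp add: Cauchy_Schwarz_ineq2)
    have "(\<integral>x. J x \<partial>?M) \<le> (\<integral>x. h x \<bullet> g x \<partial>?M)"
    proof (rule Bochner_Integration.integral_mono[OF iJ ihg])
      fix x assume "x \<in> space ?M"
      then have x: "x \<in> ?C" by (simp add: space_restrict_space)
      \<comment> \<open>The first summand is nonnegative as \<theta> is, so it may be
        dropped.\<close>
      have "h x \<bullet> g x = M.\<theta> (snd x) * (h x \<bullet> h x) + J x"
        unfolding g_def J_def by (cases "h x") (simp add: algebra_simps)
      then show "J x \<le> h x \<bullet> g x" using \<theta>1(1)[OF x] by simp
    qed
    then show ?thesis using RS(3) e by simp
  qed
  \<comment> \<open>The square of \<open>w\<close> is split as -\<kappa>' w^2 + (1 + \<kappa>') w^2.
    The first part is known from \<open>zI\<close>; the second is concentrated near the bottom and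
    absorbed by the Hardy inequality.\<close>
  have wI: "(\<integral>x. (w x)\<^sup>2 \<partial>?N) \<le> - (\<integral>x. I2 x \<partial>?N) + 162 / \<epsilon> * (\<integral>x. (a x)\<^sup>2 \<partial>?N)"
  proof -
    have "(\<integral>x. (w x)\<^sup>2 \<partial>?N) \<le> (\<integral>x. - I2 x + 162 / \<epsilon> * (a x)\<^sup>2 \<partial>?N)"
    proof (rule Bochner_Integration.integral_mono[OF iw])
      show "integrable ?N (\<lambda>x. - I2 x + 162 / \<epsilon> * (a x)\<^sup>2)" using i2 ia by simp
      fix x assume "x \<in> space ?N"
      then have x: "x \<in> ?Q" by (simp add: space_restrict_space)
      have "\<epsilon> * (1 + M.\<kappa>' (snd x)) \<le> 162 * (1 / (wt x)\<^sup>2)\<^sup>2" using M.\<kappa>'_bound[OF QD(2)[OF x]] by (simp add: wt_def)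
      then have "1 + M.\<kappa>' (snd x) \<le> 162 * (1 / (wt x)\<^sup>2)\<^sup>2 / \<epsilon>"
        using \<epsilon> by (simp only: pos_le_divide_eq mult.commute)
      from mult_right_mono[OF this zero_le_power2[of "w x"]]
      show "(w x)\<^sup>2 \<le> - I2 x + 162 / \<epsilon> * (a x)\<^sup>2" by (simp add: I2_def a_def power_divide algebra_simps)
    qed
    then show ?thesis using i2 ia by simp
  qed
  have "(L2_norm ?Q w)\<^sup>2 = (\<integral>x. (w x)\<^sup>2 \<partial>?N)" by (simp add: L2_norm_power2[OF Qb])
  also have "\<dots> \<le> 2 * (118 * q * \<epsilon>\<^sup>2 * ?H) + 162 / \<epsilon> * (\<epsilon> * ?H)\<^sup>2"
  proof -
    have "(\<integral>x. (a x)\<^sup>2 \<partial>?N) = (L2_norm ?Q a)\<^sup>2" by (simp add: L2_norm_power2[OF Qb])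
    also have "\<dots> \<le> (\<epsilon> * ?H)\<^sup>2" using La0(2) by (intro power_mono) auto
    finally have "162 / \<epsilon> * (\<integral>x. (a x)\<^sup>2 \<partial>?N) \<le> 162 / \<epsilon> * (\<epsilon> * ?H)\<^sup>2" using \<epsilon> by (intro mult_left_mono) auto
    then show ?thesis using wI zI hg R by linarith
  qed
  also have "\<dots> = 236 * q * \<epsilon>\<^sup>2 * ?H + 162 * \<epsilon> * (?H * ?H)" using \<epsilon> by (simp add: power2_eq_square)
  also have "\<dots> \<le> 236 * q * \<epsilon>\<^sup>2 * (82 * q * \<epsilon>) + 162 * \<epsilon> * ((82 * q * \<epsilon>) * (82 * q * \<epsilon>))"
    using H q0 \<epsilon> by (intro add_mono mult_left_mono mult_mono) auto
  also have "\<dots> = 1108640 * (q\<^sup>2 * \<epsilon> ^ 3)" by (simp add: power2_eq_square power3_eq_cube)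
  \<comment> \<open>Rounded up to 1053^2.\<close>
  also have "\<dots> \<le> 1108809 * (q\<^sup>2 * \<epsilon> ^ 3)" using \<epsilon> by (intro mult_right_mono) auto
  also have "\<dots> = (1053 * q * sqrt (\<epsilon> ^ 3))\<^sup>2" using \<epsilon> by (simp add: power_mult_distrib)
  finally have "L2_norm ?Q w \<le> 1053 * q * sqrt (\<epsilon> ^ 3)" by (rule power2_le_imp_le) (use q0 \<epsilon> in simp)
  then show ?thesis by (simp add: smooth_domain_eq q_def)
qed

text \<open>The difference splits into the error of the corrected profile, the cut-off corrector,
  and the deviation of \<open>u1\<close> from the affine solution. The last is 0 and the corrector
  alone is already of order \<epsilon>^(3/2) in L2, which accounts for 1055 = 1053 + 2.\<close>

lemma wall_law_error:
  assumes u: "rough_solution f U \<epsilon> u" and u1: "wall_law_solution B\<^sub>0 U \<epsilon> u1" and B0: "0 \<le> B\<^sub>0"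
  shows "L2_norm smooth_domain (\<lambda>x. u x - u1 x) \<le> 1055 * \<bar>U\<bar> * sqrt decay_const * sqrt (\<epsilon> ^ 3)"
proof -
  let ?C = "channel b" and ?Q = "channel (\<lambda>_. 0 :: real)" and ?I = "{0<..<1::real}"
  let ?M = "lebesgue_restr ?C"
  define c where "c = U / (1 + \<epsilon> * B\<^sub>0)"
  have pos: "1 \<le> 1 + \<epsilon> * B\<^sub>0" using B0 \<epsilon> by simp
  have cU: "c * (1 + \<epsilon> * B\<^sub>0) = U" using pos by (simp add: c_def)
  \<comment> \<open>This removes the dependence of the constant on \<epsilon> through
    \<open>c\<close>; it rests on the sign of the mean.\<close>
  have cle: "\<bar>c\<bar> \<le> \<bar>U\<bar>"
  proof -
    have "\<bar>c\<bar> * 1 \<le> \<bar>c\<bar> * (1 + \<epsilon> * B\<^sub>0)" by (rule mult_left_mono[OF pos]) simp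
    also have "\<dots> = \<bar>U\<bar>" using pos unfolding cU[symmetric] by (simp add: abs_mult)
    finally show ?thesis by simp
  qed
  have Cb: "?C \<in> sets borel" and Qb: "?Q \<in> sets borel" and Ib: "?I \<in> sets borel"
    using D.channel_borel D0.channel_borel by simp_all
  from u obtain g where top: "has_trace ?C (\<lambda>_. 1) u (\<lambda>_. U)" and bot: "has_trace ?C b u (\<lambda>_. 0)"
    and g: "H1_grad ?C u g"
    and green: "\<And>v h. H1_grad ?C v h \<Longrightarrow> has_trace ?C (\<lambda>_. 1) v (\<lambda>_. 0) \<Longrightarrow> has_trace ?C b v (\<lambda>_. 0) \<Longrightarrow>
        (\<integral>x. g x \<bullet> h x \<partial>?M) = 0"
    unfolding rough_solution_def rough_domain_eq by (auto simp: set_lint_restr[OF D.channel_borel])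
  obtain \<phi> where \<phi>: "C1_approx ?C \<phi> u g" "tendsto_L2 ?I (\<lambda>n s. \<phi> n (s, b s)) (\<lambda>_. 0)"
    by (rule has_traceD[OF D.open_channel bot g])
  obtain \<psi> where \<psi>: "C1_approx ?C \<psi> u g" "tendsto_L2 ?I (\<lambda>n s. \<psi> n (s, 1)) (\<lambda>_. U)"
    by (rule has_traceD[OF D.open_channel top g])
  obtain \<omega> where \<omega>: "C1_approx ?C \<omega> u g" "tendsto_L2 ?I (\<lambda>n s. \<omega> n (s, b s)) (\<lambda>_. 0)"
    "tendsto_L2 ?I (\<lambda>n s. \<omega> n (s, 1)) (\<lambda>_. U)"
    by (rule D.joint_approx[OF \<phi> \<psi>])
  obtain \<rho> where \<rho>: "C1_approx ?C \<rho> corrected G" "\<And>n s. \<rho> n (s, b s) = 0" "\<And>n s. \<rho> n (s, 1) = 1 + \<epsilon> * B\<^sub>0"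
    by (rule corrected_approx) blast
  have Lu: "L2 ?C u" and Lg: "L2 ?C g" using g by (simp_all add: H1_grad_def)
  have LT: "L2 ?C corrected" and LG: "L2 ?C G" using tendsto_L2D(2) C1_approxD(2,3)[OF \<rho>(1)] by blast+
  have c\<rho>: "C1_approx ?C (\<lambda>n x. c * \<rho> n x) (\<lambda>x. c * corrected x) (\<lambda>x. c *\<^sub>R G x)"
    using C1_approx_mult[OF D.open_channel D.compact_closed_region D.channel_subset_closed_region C1_const[of c] \<rho>(1)]
    by (simp add: grad_const)
  let ?w = "\<lambda>x. u x - c * corrected x" and ?h = "\<lambda>x. g x - c *\<^sub>R G x"
  have W: "C1_approx ?C (\<lambda>n x. \<omega> n x - c * \<rho> n x) ?w ?h"
    by (rule C1_approx_lincomb[OF D.open_channel \<omega>(1) c\<rho>])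
  have err: "L2_norm smooth_domain ?w \<le> 1053 * (\<bar>c\<bar> * sqrt decay_const) * sqrt (\<epsilon> ^ 3)"
  proof (rule error_bound[OF W])
    show "tendsto_L2 ?I (\<lambda>n s. \<omega> n (s, b s) - c * \<rho> n (s, b s)) (\<lambda>_. 0)" using \<omega>(2) by (simp add: \<rho>(2))
    have "L2 ?I (\<lambda>_. U)" by (rule L2_const[OF Ib, where C = "\<bar>U\<bar>"]) auto
    from tendsto_L2_diff[OF Ib \<omega>(3) tendsto_L2_const[OF this]]
    show "tendsto_L2 ?I (\<lambda>n s. \<omega> n (s, 1) - c * \<rho> n (s, 1)) (\<lambda>_. 0)" by (simp add: \<rho>(3) cU)
    fix \<phi> v k assume A: "C1_approx ?C \<phi> v k" "tendsto_L2 ?I (\<lambda>n s. \<phi> n (s, b s)) (\<lambda>_. 0)" "tendsto_L2 ?I (\<lambda>n s. \<phi> n (s, 1)) (\<lambda>_. 0)"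
    have Lk: "L2 ?C k" by (rule tendsto_L2D(2)[OF C1_approxD(3)[OF A(1)]])
    have i: "integrable ?M (\<lambda>x. F x \<bullet> k x)" if "L2 ?C F" for F
      using L2_product(1)[OF Cb that Lk, of "\<lambda>x. F x \<bullet> k x" 1]
        borel_measurable_inner[OF L2_measurable[OF Cb that] L2_measurable[OF Cb Lk]] by (simp add: Cauchy_Schwarz_ineq2)
    have "(\<integral>x. g x \<bullet> k x \<partial>?M) = 0"
      by (rule green[OF C1_approx_H1[OF D.open_channel A(1)] has_traceI[OF D.open_channel A(1,3)] has_traceI[OF D.open_channel A(1,2)]])
    then show "(\<integral>x. ?h x \<bullet> k x \<partial>?M) = - c * (\<integral>x. G x \<bullet> k x \<partial>?M)"
      using i[OF Lg] i[OF LG] by (simp add: inner_diff_left)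
  qed
  note W1 = wall_law_unique[OF u1 B0 \<epsilon>(1)]
  let ?l = "\<lambda>x. c * (snd x + \<epsilon> * B\<^sub>0)" and ?B = "\<lambda>x. zeta (snd x) *\<^sub>R (B x - \<epsilon> * B\<^sub>0)"
  have Lw: "L2 ?Q ?w"
    using L2_diff(1)[OF Cb Lu L2_cmult(1)[OF Cb LT, of c]] L2_subset(1)[OF Cb Qb smooth_subset] by simp
  have Lu1: "L2 ?Q u1" using W1(1) by (simp add: smooth_domain_eq)
  have cB: "continuous_on ?Q B"
    using C1_on_continuous(1)[OF B_C1(1)] continuous_on_subset channel_above smooth_subset by blast
  have mB: "?B \<in> borel_measurable (lebesgue_restr ?Q)"
    by (intro borel_measurable_restr_continuous[OF Qb] continuous_intros cB continuous_cutoffs)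
  have Ble: "norm (?B x) \<le> 1 * norm (wt x ^ 3 *\<^sub>R (B x - \<epsilon> * B\<^sub>0))" if "x \<in> ?Q" for x
  proof -
    have "1 \<le> wt x ^ 3" using wt_ge[of x] that smooth_subset channel_above by (intro one_le_power) blast
    then have "\<bar>zeta (snd x)\<bar> * \<bar>B x - \<epsilon> * B\<^sub>0\<bar> \<le> \<bar>wt x ^ 3\<bar> * \<bar>B x - \<epsilon> * B\<^sub>0\<bar>"
      using zeta_bounds[of "snd x"] by (intro mult_right_mono) auto
    then show ?thesis by (simp add: abs_mult)
  qed
  note LB = L2_bound[OF Qb mB weighted_B(1) Ble, simplified]
  have Bn: "L2_norm ?Q ?B \<le> 2 * sqrt decay_const * sqrt (\<epsilon> ^ 3)"
  proof -
    have "(L2_norm ?Q (\<lambda>x. wt x ^ 3 *\<^sub>R (B x - \<epsilon> * B\<^sub>0)))\<^sup>2 \<le> 4 * (\<epsilon> ^ 3 * decay_const)"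
    proof (rule order_trans[OF weighted_B(2)])
      have "0 \<le> \<epsilon> ^ 3 * decay_const" using decay_const_nonneg \<epsilon> by simp
      then show "2 * \<epsilon> ^ 3 * decay_const \<le> 4 * (\<epsilon> ^ 3 * decay_const)" by (simp add: mult.commute)
    qed
    also have "\<dots> = (2 * sqrt decay_const * sqrt (\<epsilon> ^ 3))\<^sup>2" using decay_const_nonneg \<epsilon> by (simp add: power_mult_distrib)
    finally have "L2_norm ?Q (\<lambda>x. wt x ^ 3 *\<^sub>R (B x - \<epsilon> * B\<^sub>0)) \<le> 2 * sqrt decay_const * sqrt (\<epsilon> ^ 3)"
      by (rule power2_le_imp_le) (use decay_const_nonneg \<epsilon> in simp)
    then show ?thesis using LB(2) by simp
  qed
  have cl: "continuous_on UNIV ?l" by (intro continuous_intros)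
  have Ll: "L2 ?Q ?l" by (rule D0.L2_continuous(1)[OF cl open_UNIV]) simp
  have LcB: "L2 ?Q (\<lambda>x. c *\<^sub>R ?B x)" "L2_norm ?Q (\<lambda>x. c *\<^sub>R ?B x) = \<bar>c\<bar> * L2_norm ?Q ?B"
    using L2_cmult[OF Qb LB(1), of c] by simp_all
  have eq: "(\<lambda>x. u x - u1 x) = (\<lambda>x. (?w x + c *\<^sub>R ?B x) - (u1 x - ?l x))"
    by (simp add: corrected_def algebra_simps)
  have "L2_norm ?Q (\<lambda>x. u x - u1 x) \<le> L2_norm ?Q (\<lambda>x. ?w x + c *\<^sub>R ?B x) + L2_norm ?Q (\<lambda>x. u1 x - ?l x)"
    unfolding eq by (rule L2_diff(2)[OF Qb L2_add(1)[OF Qb Lw LcB(1)] L2_diff(1)[OF Qb Lu1 Ll]])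
  also have "L2_norm ?Q (\<lambda>x. u1 x - ?l x) = 0" using W1(2) by (simp add: c_def smooth_domain_eq)
  also have "L2_norm ?Q (\<lambda>x. ?w x + c *\<^sub>R ?B x) + 0 \<le> L2_norm ?Q ?w + \<bar>c\<bar> * L2_norm ?Q ?B"
    using L2_add(2)[OF Qb Lw LcB(1)] LcB(2) by simp
  also have "\<dots> \<le> 1053 * (\<bar>c\<bar> * sqrt decay_const) * sqrt (\<epsilon> ^ 3) + \<bar>c\<bar> * (2 * sqrt decay_const * sqrt (\<epsilon> ^ 3))"
    using err Bn by (intro add_mono mult_left_mono) (auto simp: smooth_domain_eq)
  also have "\<dots> = \<bar>c\<bar> * (1055 * sqrt decay_const * sqrt (\<epsilon> ^ 3))" by (simp add: algebra_simps)
  also have "\<dots> \<le> \<bar>U\<bar> * (1055 * sqrt decay_const * sqrt (\<epsilon> ^ 3))"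
    using cle decay_const_nonneg \<epsilon> by (intro mult_right_mono) auto
  finally show ?thesis by (simp add: smooth_domain_eq mult_ac)
qed

end

theorem theorem5p2:
  fixes f :: "real \<Rightarrow> real" and \<delta> U :: real and \<beta> :: "real \<times> real \<Rightarrow> real"
  assumes "\<exists>L. L-lipschitz_on UNIV f"
    and "\<And>y1. f (y1 + 1) = f y1"
    and "\<delta> > 0"
    and "\<And>y1. -1 + \<delta> < f y1 \<and> f y1 < - \<delta>"
    and "cell_solution f \<beta>"
  shows "\<exists>k. \<forall>\<epsilon> u_eps u1. 0 < \<epsilon> \<and> \<epsilon> \<le> 1 \<and>
           rough_solution f U \<epsilon> u_eps \<and> wall_law_solution (beta_bar \<beta>) U \<epsilon> u1 \<longrightarrow>
           L2_norm smooth_domain (\<lambda>x. u_eps x - u1 x) \<le> k * \<epsilon> powr (3 / 2)"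
proof -
  from assms(1) obtain L where L: "L-lipschitz_on UNIV f" by blast
  interpret cell_problem f L \<delta> \<beta>
    using assms(2-5) lipschitz_onD[OF L] by unfold_locales (auto simp: dist_real_def)
  show ?thesis
  \<comment> \<open>The constant is left open until the last step, which can only fill in a term
    free of \<epsilon>; \<open>decay_const\<close> qualifies, as it belongs to the cell problem
    fixed before \<epsilon>.\<close>
  proof (intro exI allI impI)
    fix \<epsilon> u_eps u1
    assume A: "0 < \<epsilon> \<and> \<epsilon> \<le> 1 \<and> rough_solution f U \<epsilon> u_eps \<and> wall_law_solution (beta_bar \<beta>) U \<epsilon> u1"
    interpret scaled_cell f L \<delta> \<beta> \<epsilon> using A by unfold_locales auto
    have "\<epsilon> powr (3 / 2) = (\<epsilon> powr 3) powr (1 / 2)" by (simp add: powr_powr)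
    also have "\<dots> = sqrt (\<epsilon> ^ 3)" using A by (simp add: powr_half_sqrt)
    finally have "sqrt (\<epsilon> ^ 3) = \<epsilon> powr (3 / 2)" ..
    then show "L2_norm smooth_domain (\<lambda>x. u_eps x - u1 x) \<le> (1055 * \<bar>U\<bar> * sqrt decay_const) * \<epsilon> powr (3 / 2)"
      using wall_law_error[of U u_eps u1] A beta_bar_nonneg by simp
  qed
qed

end
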